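(* Let $T$ be a complete first-order NIP theory with monster model $\mathfrak{C}$, and let $M \models T$. Suppose that $\phi(x,y)$ is a formula over $M$ and $b\in \mathfrak{C}^y$ is such that $\phi(x,b)$ does not fork over $M$. Then there is a formula $\psi(y)\in \mathrm{tp}(b/M)$ such that the set of formulas $\{\phi(x,c) \mid c\in\mathfrak{C}^y,\ \mathfrak{C}\models \psi(c)\}$ is consistent.
   Context: $\mathfrak{C}$ is a monster model of $T$ (a sufficiently saturated and strongly homogeneous model); $M$ is a small elementary submodel of $\mathfrak{C}$. Variables $x,y$ denote finite tuples; $\mathfrak{C}^y$ is the set of tuples of the sort of $y$. "Over $M$" means with parameters from $M$. A set of formulas with parameters in $\mathfrak{C}$ is consistent if it is finitely satisfiable in $\mathfrak{C}$. NIP: a formula $\phi(x,y)$ is NIP if there is $n<\omega$ such that no subset of $M^x$ of size $n$ is shattered by the family $\{\phi(M,a)\mid a\in M^y\}$ (a set $A$ is shattered by $\mathcal F$ if every subset of $A$ is of the form $F\cap A$ with $F\in\mathcal F$). $T$ is NIP if all formulas are NIP. Forking: a formula $\phi(x,b)$ divides over a set $A$ if for some $k<\omega$ there is a sequence $(b_i)_{i<\omega}$ with $b_i\equiv_A b$ for all $i$ such that $\{\phi(x,b_i)\mid i<\omega\}$ is $k$-inconsistent (every $k$ of its members are jointly inconsistent). A formula forks over $A$ if it implies a finite disjunction of formulas each of which divides over $A$. *)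

theory Defs
  imports Main
begin

unbundle cardinal_syntax

section \<open>First-order syntax\<close>

record ('f, 'r) lang =
  funs :: "'f set"
  rels :: "'r set"
  farity :: "'f \<Rightarrow> nat"
  rarity :: "'r \<Rightarrow> nat"

datatype 'f tm = Var nat | Fn 'f "'f tm list"

datatype ('f, 'r) fm =
    Eq "'f tm" "'f tm"
  | Rel 'r "'f tm list"
  | Neg "('f, 'r) fm"
  | And "('f, 'r) fm" "('f, 'r) fm"
  | Ex nat "('f, 'r) fm"

fun wf_tm :: "('f, 'r) lang \<Rightarrow> 'f tm \<Rightarrow> bool" where
  "wf_tm L (Var v) = True"
| "wf_tm L (Fn f ts) = (f \<in> funs L \<and> length ts = farity L f \<and> (\<forall>t\<in>set ts. wf_tm L t))"

fun wf_fm :: "('f, 'r) lang \<Rightarrow> ('f, 'r) fm \<Rightarrow> bool" where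
  "wf_fm L (Eq s t) = (wf_tm L s \<and> wf_tm L t)"
| "wf_fm L (Rel r ts) = (r \<in> rels L \<and> length ts = rarity L r \<and> (\<forall>t\<in>set ts. wf_tm L t))"
| "wf_fm L (Neg \<phi>) = wf_fm L \<phi>"
| "wf_fm L (And \<phi> \<psi>) = (wf_fm L \<phi> \<and> wf_fm L \<psi>)"
| "wf_fm L (Ex v \<phi>) = wf_fm L \<phi>"

fun fv_tm :: "'f tm \<Rightarrow> nat set" where
  "fv_tm (Var v) = {v}"
| "fv_tm (Fn f ts) = (\<Union>t\<in>set ts. fv_tm t)"

fun fv :: "('f, 'r) fm \<Rightarrow> nat set" where
  "fv (Eq s t) = fv_tm s \<union> fv_tm t"
| "fv (Rel r ts) = (\<Union>t\<in>set ts. fv_tm t)"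
| "fv (Neg \<phi>) = fv \<phi>"
| "fv (And \<phi> \<psi>) = fv \<phi> \<union> fv \<psi>"
| "fv (Ex v \<phi>) = fv \<phi> - {v}"

text \<open>The formulas \<open>\<phi>(x)\<close> whose free variables are among those of the tuple \<open>x\<close>.\<close>

definition formulas :: "('f, 'r) lang \<Rightarrow> nat list \<Rightarrow> ('f, 'r) fm set" where
  "formulas L xs = {\<phi>. wf_fm L \<phi> \<and> fv \<phi> \<subseteq> set xs}"

definition sentences :: "('f, 'r) lang \<Rightarrow> ('f, 'r) fm set" where
  "sentences L = formulas L []"

section \<open>Structures and satisfaction\<close>

record ('a, 'f, 'r) struct =
  carrier :: "'a set"
  fint :: "'f \<Rightarrow> 'a list \<Rightarrow> 'a"
  rint :: "'r \<Rightarrow> 'a list \<Rightarrow> bool"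

definition is_struct :: "('f, 'r) lang \<Rightarrow> ('a, 'f, 'r) struct \<Rightarrow> bool" where
  "is_struct L N \<longleftrightarrow> carrier N \<noteq> {} \<and>
     (\<forall>f\<in>funs L. \<forall>as. set as \<subseteq> carrier N \<and> length as = farity L f \<longrightarrow> fint N f as \<in> carrier N)"

fun eval :: "('a, 'f, 'r) struct \<Rightarrow> (nat \<Rightarrow> 'a) \<Rightarrow> 'f tm \<Rightarrow> 'a" where
  "eval N e (Var v) = e v"
| "eval N e (Fn f ts) = fint N f (map (eval N e) ts)"

fun sat :: "('a, 'f, 'r) struct \<Rightarrow> (nat \<Rightarrow> 'a) \<Rightarrow> ('f, 'r) fm \<Rightarrow> bool" where
  "sat N e (Eq s t) = (eval N e s = eval N e t)"
| "sat N e (Rel r ts) = rint N r (map (eval N e) ts)"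
| "sat N e (Neg \<phi>) = (\<not> sat N e \<phi>)"
| "sat N e (And \<phi> \<psi>) = (sat N e \<phi> \<and> sat N e \<psi>)"
| "sat N e (Ex v \<phi>) = (\<exists>a\<in>carrier N. sat N (e(v := a)) \<phi>)"

text \<open>The set \<open>N\<^sup>x\<close>. Throughout, a tuple of variables is a list of pairwise distinct variables.\<close>

definition tuples :: "('a, 'f, 'r) struct \<Rightarrow> nat list \<Rightarrow> 'a list set" where
  "tuples N xs = {as. set as \<subseteq> carrier N \<and> length as = length xs}"

text \<open>\<open>N \<Turnstile> \<phi>(a)\<close> for \<open>\<phi>(x)\<close> and \<open>a \<in> N\<^sup>x\<close>. Variables outside \<open>x\<close> get an unspecified value; this
  is only used when the free variables of \<open>\<phi>\<close> are among \<open>x\<close>.\<close>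

definition holds :: "('a, 'f, 'r) struct \<Rightarrow> ('f, 'r) fm \<Rightarrow> nat list \<Rightarrow> 'a list \<Rightarrow> bool" where
  "holds N \<phi> xs as = sat N (\<lambda>v. the (map_of (zip xs as) v)) \<phi>"

definition models :: "('f, 'r) lang \<Rightarrow> ('a, 'f, 'r) struct \<Rightarrow> ('f, 'r) fm set \<Rightarrow> bool" where
  "models L N T \<longleftrightarrow> is_struct L N \<and> (\<forall>\<sigma>\<in>T. holds N \<sigma> [] [])"

text \<open>HOL cannot quantify over structures on all types. By the downward Loewenheim--Skolem theorem
  the structures on subsets of the type of formulas (which is infinite and has at least as many
  elements as there are formulas of the language) suffice to determine satisfiability and semantic
  consequence.\<close>

definition satisfiable :: "('f, 'r) lang \<Rightarrow> ('f, 'r) fm set \<Rightarrow> bool" where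
  "satisfiable L T \<longleftrightarrow> (\<exists>N :: (('f, 'r) fm, 'f, 'r) struct. models L N T)"

definition entails :: "('f, 'r) lang \<Rightarrow> ('f, 'r) fm set \<Rightarrow> ('f, 'r) fm \<Rightarrow> bool" where
  "entails L T \<sigma> \<longleftrightarrow> (\<forall>N :: (('f, 'r) fm, 'f, 'r) struct. models L N T \<longrightarrow> holds N \<sigma> [] [])"

definition complete_theory :: "('f, 'r) lang \<Rightarrow> ('f, 'r) fm set \<Rightarrow> bool" where
  "complete_theory L T \<longleftrightarrow> T \<subseteq> sentences L \<and> satisfiable L T \<and>
     (\<forall>\<sigma>\<in>sentences L. entails L T \<sigma> \<or> entails L T (Neg \<sigma>))"

definition elementary_substructure ::
    "('f, 'r) lang \<Rightarrow> ('a, 'f, 'r) struct \<Rightarrow> ('a, 'f, 'r) struct \<Rightarrow> bool" where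
  "elementary_substructure L M N \<longleftrightarrow>
     is_struct L M \<and> is_struct L N \<and> carrier M \<subseteq> carrier N \<and>
     (\<forall>f\<in>funs L. \<forall>as. set as \<subseteq> carrier M \<and> length as = farity L f \<longrightarrow> fint M f as = fint N f as) \<and>
     (\<forall>r\<in>rels L. \<forall>as. set as \<subseteq> carrier M \<and> length as = rarity L r \<longrightarrow> rint M r as = rint N r as) \<and>
     (\<forall>xs. distinct xs \<longrightarrow> (\<forall>\<phi>\<in>formulas L xs. \<forall>as\<in>tuples M xs. holds M \<phi> xs as \<longleftrightarrow> holds N \<phi> xs as))"

section \<open>Parameters\<close>

text \<open>Formulas over \<open>A\<close> are formulas of the language \<open>L(A)\<close>, which has a new constant (nullary
  function symbol) \<open>Inr a\<close> for each \<open>a \<in> A\<close>; the symbols of \<open>L\<close> appear as \<open>Inl f\<close>.\<close>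

definition lang_over :: "('f, 'r) lang \<Rightarrow> 'a set \<Rightarrow> ('f + 'a, 'r) lang" where
  "lang_over L A = \<lparr>funs = Inl ` funs L \<union> Inr ` A, rels = rels L,
     farity = case_sum (farity L) (\<lambda>_. 0), rarity = rarity L\<rparr>"

definition expand :: "('a, 'f, 'r) struct \<Rightarrow> ('a, 'f + 'a, 'r) struct" where
  "expand N = \<lparr>carrier = carrier N, fint = case_sum (fint N) (\<lambda>a _. a), rint = rint N\<rparr>"

fun subst_tm :: "(nat \<Rightarrow> 'a option) \<Rightarrow> ('f + 'a) tm \<Rightarrow> ('f + 'a) tm" where
  "subst_tm \<sigma> (Var v) = (case \<sigma> v of None \<Rightarrow> Var v | Some a \<Rightarrow> Fn (Inr a) [])"
| "subst_tm \<sigma> (Fn f ts) = Fn f (map (subst_tm \<sigma>) ts)"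

fun subst :: "(nat \<Rightarrow> 'a option) \<Rightarrow> ('f + 'a, 'r) fm \<Rightarrow> ('f + 'a, 'r) fm" where
  "subst \<sigma> (Eq s t) = Eq (subst_tm \<sigma> s) (subst_tm \<sigma> t)"
| "subst \<sigma> (Rel r ts) = Rel r (map (subst_tm \<sigma>) ts)"
| "subst \<sigma> (Neg \<phi>) = Neg (subst \<sigma> \<phi>)"
| "subst \<sigma> (And \<phi> \<psi>) = And (subst \<sigma> \<phi>) (subst \<sigma> \<psi>)"
| "subst \<sigma> (Ex v \<phi>) = Ex v (subst (\<sigma>(v := None)) \<phi>)"

text \<open>\<open>inst ys b \<phi>\<close> is the formula \<open>\<phi>(x, b)\<close> obtained from \<open>\<phi>(x, y)\<close>.\<close>

definition inst :: "nat list \<Rightarrow> 'a list \<Rightarrow> ('f + 'a, 'r) fm \<Rightarrow> ('f + 'a, 'r) fm" where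
  "inst ys b \<phi> = subst (map_of (zip ys b)) \<phi>"

definition tp :: "('f, 'r) lang \<Rightarrow> ('a, 'f, 'r) struct \<Rightarrow> 'a set \<Rightarrow> nat list \<Rightarrow> 'a list
    \<Rightarrow> ('f + 'a, 'r) fm set" where
  "tp L C A ys b = {\<psi> \<in> formulas (lang_over L A) ys. holds (expand C) \<psi> ys b}"

text \<open>Finite satisfiability in \<open>C\<close> of a set of formulas in the variables \<open>x\<close> with parameters in
  \<open>C\<close>.\<close>

definition consistent :: "('a, 'f, 'r) struct \<Rightarrow> nat list \<Rightarrow> ('f + 'a, 'r) fm set \<Rightarrow> bool" where
  "consistent C xs S \<longleftrightarrow>
     (\<forall>F\<subseteq>S. finite F \<longrightarrow> (\<exists>a\<in>tuples C xs. \<forall>\<theta>\<in>F. holds (expand C) \<theta> xs a))"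

section \<open>Monster models\<close>

definition saturated ::
    "('f, 'r) lang \<Rightarrow> 'k rel \<Rightarrow> ('a, 'f, 'r) struct \<Rightarrow> bool" where
  "saturated L \<kappa> C \<longleftrightarrow>
     (\<forall>A xs p. A \<subseteq> carrier C \<and> |A| <o \<kappa> \<and> distinct xs \<and>
        p \<subseteq> formulas (lang_over L A) xs \<and> consistent C xs p
        \<longrightarrow> (\<exists>a\<in>tuples C xs. \<forall>\<theta>\<in>p. holds (expand C) \<theta> xs a))"

definition partial_elementary ::
    "('f, 'r) lang \<Rightarrow> ('a, 'f, 'r) struct \<Rightarrow> 'a set \<Rightarrow> ('a \<Rightarrow> 'a) \<Rightarrow> bool" where
  "partial_elementary L C A h \<longleftrightarrow> A \<subseteq> carrier C \<and> h ` A \<subseteq> carrier C \<and>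
     (\<forall>xs. distinct xs \<longrightarrow> (\<forall>\<phi>\<in>formulas L xs. \<forall>as. set as \<subseteq> A \<and> length as = length xs
        \<longrightarrow> (holds C \<phi> xs as \<longleftrightarrow> holds C \<phi> xs (map h as))))"

definition automorphism ::
    "('f, 'r) lang \<Rightarrow> ('a, 'f, 'r) struct \<Rightarrow> ('a \<Rightarrow> 'a) \<Rightarrow> bool" where
  "automorphism L C h \<longleftrightarrow> bij_betw h (carrier C) (carrier C) \<and>
     (\<forall>f\<in>funs L. \<forall>as. set as \<subseteq> carrier C \<and> length as = farity L f
        \<longrightarrow> h (fint C f as) = fint C f (map h as)) \<and>
     (\<forall>r\<in>rels L. \<forall>as. set as \<subseteq> carrier C \<and> length as = rarity L r
        \<longrightarrow> (rint C r as \<longleftrightarrow> rint C r (map h as)))"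

definition strongly_homogeneous ::
    "('f, 'r) lang \<Rightarrow> 'k rel \<Rightarrow> ('a, 'f, 'r) struct \<Rightarrow> bool" where
  "strongly_homogeneous L \<kappa> C \<longleftrightarrow>
     (\<forall>A h. |A| <o \<kappa> \<and> partial_elementary L C A h
        \<longrightarrow> (\<exists>g. automorphism L C g \<and> (\<forall>a\<in>A. g a = h a)))"

text \<open>A monster model is \<open>\<kappa>\<close>-saturated and strongly \<open>\<kappa>\<close>-homogeneous for some cardinal \<open>\<kappa>\<close> larger
  than the number \<open>|L| + \<aleph>\<^sub>0\<close> of formulas, and ``small'' means of cardinality less than \<open>\<kappa>\<close>.\<close>

definition monster_model ::
    "('f, 'r) lang \<Rightarrow> ('f, 'r) fm set \<Rightarrow> 'k rel \<Rightarrow> ('a, 'f, 'r) struct \<Rightarrow> bool" where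
  "monster_model L T \<kappa> C \<longleftrightarrow> Card_order \<kappa> \<and> |{\<phi>. wf_fm L \<phi>}| <o \<kappa> \<and>
     models L C T \<and> saturated L \<kappa> C \<and> strongly_homogeneous L \<kappa> C"

definition small :: "'k rel \<Rightarrow> 'a set \<Rightarrow> bool" where
  "small \<kappa> A \<longleftrightarrow> |A| <o \<kappa>"

section \<open>NIP\<close>

definition shattered :: "'b set set \<Rightarrow> 'b set \<Rightarrow> bool" where
  "shattered \<F> A \<longleftrightarrow> (\<forall>B\<subseteq>A. \<exists>F\<in>\<F>. B = F \<inter> A)"

definition NIP_formula ::
    "('a, 'f, 'r) struct \<Rightarrow> nat list \<Rightarrow> nat list \<Rightarrow> ('f, 'r) fm \<Rightarrow> bool" where
  "NIP_formula N xs ys \<phi> \<longleftrightarrow>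
     (\<exists>n. \<forall>A\<subseteq>tuples N xs. finite A \<and> card A = n
        \<longrightarrow> \<not> shattered ((\<lambda>a. {c\<in>tuples N xs. holds N \<phi> (xs @ ys) (c @ a)}) ` tuples N ys) A)"

text \<open>All formulas are NIP in all models of \<open>T\<close> on the given type. For complete \<open>T\<close>, whether a formula
  is NIP does not depend on the model.\<close>

definition NIP_theory :: "'a itself \<Rightarrow> ('f, 'r) lang \<Rightarrow> ('f, 'r) fm set \<Rightarrow> bool" where
  "NIP_theory _ L T \<longleftrightarrow>
     (\<forall>N :: ('a, 'f, 'r) struct. models L N T \<longrightarrow>
        (\<forall>xs ys. distinct (xs @ ys) \<longrightarrow> (\<forall>\<phi>\<in>formulas L (xs @ ys). NIP_formula N xs ys \<phi>)))"

section \<open>Dividing and forking\<close>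

text \<open>\<open>k\<close>-inconsistency of an indexed family: with the set of its members instead, a constant
  sequence would be vacuously 2-inconsistent.\<close>

definition k_inconsistent ::
    "('a, 'f, 'r) struct \<Rightarrow> nat list \<Rightarrow> nat \<Rightarrow> (nat \<Rightarrow> ('f + 'a, 'r) fm) \<Rightarrow> bool" where
  "k_inconsistent C xs k \<theta> \<longleftrightarrow>
     (\<forall>I. finite I \<and> card I = k \<longrightarrow> \<not> consistent C xs (\<theta> ` I))"

text \<open>\<open>\<chi>(x)\<close> divides over \<open>A\<close> if it can be written as \<open>\<phi>(x, b)\<close> with a sequence \<open>b\<^sub>i\<close> as usual.
  The formula \<open>\<phi>(x, y)\<close> may itself have parameters from \<open>A\<close>; moving these into \<open>b\<close> makes no
  difference, since \<open>b\<^sub>i\<close> and \<open>b\<close> have the same type over \<open>A\<close>.\<close>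

definition divides :: "('f, 'r) lang \<Rightarrow> ('a, 'f, 'r) struct \<Rightarrow> 'a set \<Rightarrow> nat list
    \<Rightarrow> ('f + 'a, 'r) fm \<Rightarrow> bool" where
  "divides L C A xs \<chi> \<longleftrightarrow>
     (\<exists>ys \<phi> b. distinct (xs @ ys) \<and> \<phi> \<in> formulas (lang_over L A) (xs @ ys) \<and>
        b \<in> tuples C ys \<and> \<chi> = inst ys b \<phi> \<and>
        (\<exists>k. \<exists>bs :: nat \<Rightarrow> 'a list.
           (\<forall>i. bs i \<in> tuples C ys \<and> tp L C A ys (bs i) = tp L C A ys b) \<and>
           k_inconsistent C xs k (\<lambda>i. inst ys (bs i) \<phi>)))"

definition forks :: "('f, 'r) lang \<Rightarrow> ('a, 'f, 'r) struct \<Rightarrow> 'a set \<Rightarrow> nat list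
    \<Rightarrow> ('f + 'a, 'r) fm \<Rightarrow> bool" where
  "forks L C A xs \<chi> \<longleftrightarrow>
     (\<exists>\<Theta>. finite \<Theta> \<and> (\<forall>\<theta>\<in>\<Theta>. divides L C A xs \<theta>) \<and>
        (\<forall>a\<in>tuples C xs. holds (expand C) \<chi> xs a \<longrightarrow> (\<exists>\<theta>\<in>\<Theta>. holds (expand C) \<theta> xs a)))"

end

theory Submission
  imports Complex_Main "HOL-Library.FuncSet" "HOL-Real_Asymp.Real_Asymp" Defs
begin

text \<open>Suppose that no \<open>\<psi> \<in> tp(b/M)\<close> works. Since \<open>\<phi>(x, b)\<close> does not fork, the formulas \<open>\<phi>(x, b')\<close> with
  \<open>b' \<equiv>\<^sub>M b\<close> are jointly consistent: if \<open>\<phi>(x, c\<^sub>1), \<dots>, \<phi>(x, c\<^sub>r)\<close> were inconsistent, then \<open>\<phi>(x, b)\<close> would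
  imply the disjunction of the formulas \<open>\<phi>(x, c) \<noteq> \<phi>(x, d)\<close> for \<open>c = b, c\<^sub>1, \<dots>, c\<^sub>r\<close>, where \<open>d\<close> realizes a
  coheir of \<open>tp(b/M)\<close> over all of them, and these divide, because NIP bounds the number of alternations
  along a Morley sequence.

  Call a definable set \<open>\<beta>(y, f)\<close> robustly consistent if \<open>{\<phi>(x, c) | c \<in> \<beta>(y, f')}\<close> is consistent for all
  \<open>f'\<close> in some \<open>M\<close>-definable set containing \<open>f\<close>. The type of \<open>b\<close> and the complements of the robustly
  consistent sets generate a proper \<open>M\<close>-invariant filter, which extends to an \<open>M\<close>-invariant ultrafilter \<open>U\<close>
  by Adler's vacuum cleaner argument. Then one builds a Morley sequence \<open>c\<^sub>0, d\<^sub>0, c\<^sub>1, d\<^sub>1, \<dots>\<close> of \<open>U\<close> with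
  \<open>\<phi>(x, c\<^sub>i) \<and> \<not> \<phi>(x, d\<^sub>i)\<close> for all \<open>i\<close> consistent, against NIP. The induction keeps \<open>\<eta>(x)\<close>, the conjunction
  so far, consistent with \<open>\<phi>(x, e)\<close> for all realizations \<open>e\<close> of \<open>U\<close> over the parameters, so only the choice of
  \<open>d\<^sub>i\<close> is difficult. If it failed, a covering lemma (a finite \<open>(p, q)\<close>-theorem) applied to \<open>\<phi>\<close> would yield an
  invariant filter on tuples \<open>x\<^sub>1, \<dots>, x\<^sub>n\<close> that contradicts the vacuum cleaner lemma; its hypothesis, that
  \<open>n\<close> realizations of \<open>U\<close> never suffice to imply all others on \<open>\<eta>\<close>, holds because otherwise the same covering
  lemma, applied to that implication, would make some set in \<open>U\<close> robustly consistent.\<close>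

section \<open>A covering lemma for finite VC dimension\<close>

text \<open>There is no reason why the type of b should have an extension that is finitely
  satisfiable in M and also avoids the robustly consistent sets; so \<open>U\<close> is merely
  invariant, whereas pairs that start a Morley sequence are at first only under control for coheirs.
  The vacuum cleaner lemma bridges this gap in the form of \<open>invariant_filter_no_split\<close>:
  a proper invariant filter cannot force that one of finitely many relations changes its value on
  such a pair. It is used twice, to complete the filter to an invariant ultrafilter and to choose
  the negative terms. Robustness refers to an M-definable set of parameters because finite
  consistency at f is not a first-order condition on f. With it, a finite cover by robust sets can
  be moved to parameters in M, where it would contradict the failure for b. To produce such a set of
  parameters, the covering number must depend on the VC bound alone: only then is "any N points are
  implied by some n points" a first-order condition that persists around the given
  parameters.\<close>

definition vc_free :: "nat \<Rightarrow> ('p \<Rightarrow> 'q \<Rightarrow> bool) \<Rightarrow> 'p set \<Rightarrow> 'q set \<Rightarrow> bool" where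
  "vc_free d R U A \<longleftrightarrow>
     \<not> (\<exists>u. (\<forall>j<d. u j \<in> U) \<and> (\<forall>S. \<exists>a\<in>A. \<forall>j<d. R (u j) a \<longleftrightarrow> j \<in> S))"

lemma vc_free_mono:
  assumes "vc_free d R U A" "d \<le> d'" "U' \<subseteq> U" "A' \<subseteq> A"
  shows "vc_free d' R U' A'"
  unfolding vc_free_def
proof
  assume "\<exists>u. (\<forall>j<d'. u j \<in> U') \<and> (\<forall>S. \<exists>a\<in>A'. \<forall>j<d'. R (u j) a \<longleftrightarrow> j \<in> S)"
  then obtain u where u: "\<forall>j<d'. u j \<in> U'" "\<forall>S. \<exists>a\<in>A'. \<forall>j<d'. R (u j) a \<longleftrightarrow> j \<in> S"
    by blast
  have "(\<forall>j<d. u j \<in> U) \<and> (\<forall>S. \<exists>a\<in>A. \<forall>j<d. R (u j) a \<longleftrightarrow> j \<in> S)"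
    using u assms(2-4) by (meson order_less_le_trans subsetD)
  with assms(1) show False unfolding vc_free_def by blast
qed

section \<open>Traces on finite sets: Pajor's lemma and a polynomial bound\<close>

definition shattered_by :: "'p set set \<Rightarrow> 'p set \<Rightarrow> bool" where
  "shattered_by F A \<longleftrightarrow> (\<forall>S\<subseteq>A. \<exists>T\<in>F. T \<inter> A = S)"

text \<open>Remove a point x. The members without x, and the members with x after x is deleted from
  them, are two families on the smaller set, to which the induction hypothesis applies. A set
  shattered by both families is counted twice in the sum, but it also yields two sets shattered by
  F: itself, and itself with x added.\<close>

lemma pajor:
  fixes F :: "'p set set"
  assumes "finite J" "F \<subseteq> Pow J"
  shows "card F \<le> card {A. A \<subseteq> J \<and> shattered_by F A}"
  using assms
proof (induction J arbitrary: F rule: finite_induct)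
  case empty
  show ?case
  proof (cases "F = {}")
    case False
    with empty have F: "F = {{}}" by auto
    have "{A. A \<subseteq> ({}::'p set) \<and> shattered_by F A} = {{}}"
      unfolding F shattered_by_def by auto
    then show ?thesis by (simp add: F)
  qed simp
next
  case (insert x J)
  define F0 where "F0 = {T\<in>F. x \<notin> T}"
  define F1 where "F1 = (\<lambda>T. T - {x}) ` {T\<in>F. x \<in> T}"
  have finF: "finite F" using insert.prems insert.hyps(1) by (meson finite_Pow_iff finite_insert finite_subset)
  have sub: "F0 \<subseteq> Pow J" "F1 \<subseteq> Pow J" using insert.prems unfolding F0_def F1_def by auto
  have inj: "inj_on (\<lambda>T. T - {x}) {T\<in>F. x \<in> T}"
    by (intro inj_onI) (metis (mono_tags, lifting) insert_Diff mem_Collect_eq)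
  have F_split: "F = F0 \<union> {T\<in>F. x \<in> T}" unfolding F0_def by auto
  have cardF: "card F = card F0 + card F1"
  proof -
    have "card F = card F0 + card {T\<in>F. x \<in> T}"
      by (subst F_split, rule card_Un_disjoint) (use finF in \<open>auto simp: F0_def\<close>)
    then show ?thesis unfolding F1_def card_image[OF inj] .
  qed
  define S0 where "S0 = {A. A \<subseteq> J \<and> shattered_by F0 A}"
  define S1 where "S1 = {A. A \<subseteq> J \<and> shattered_by F1 A}"
  have finS: "finite S0" "finite S1" unfolding S0_def S1_def using insert.hyps(1) by auto
  have a: "S0 \<union> S1 \<subseteq> {A. A \<subseteq> insert x J \<and> shattered_by F A}"
  proof
    fix A assume A: "A \<in> S0 \<union> S1"
    then have AJ: "A \<subseteq> J" unfolding S0_def S1_def by auto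
    then have xA: "x \<notin> A" using insert.hyps(2) by auto
    from A consider "shattered_by F0 A" | "shattered_by F1 A" unfolding S0_def S1_def by auto
    then have "shattered_by F A"
    proof cases
      case 1
      have "F0 \<subseteq> F" unfolding F0_def by blast
      with 1 show ?thesis unfolding shattered_by_def by (meson subsetD)
    next
      case 2
      show ?thesis unfolding shattered_by_def
      proof (intro allI impI)
        fix S assume "S \<subseteq> A"
        with 2 obtain T where T: "T \<in> F1" "T \<inter> A = S" unfolding shattered_by_def by blast
        then obtain T' where "T' \<in> F" "T = T' - {x}" unfolding F1_def by blast
        moreover from this xA have "T' \<inter> A = T \<inter> A" by blast
        ultimately show "\<exists>T\<in>F. T \<inter> A = S" using T(2) by metis
      qed
    qed
    then show "A \<in> {A. A \<subseteq> insert x J \<and> shattered_by F A}" using AJ by auto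
  qed
  have b: "insert x ` (S0 \<inter> S1) \<subseteq> {A. A \<subseteq> insert x J \<and> shattered_by F A}"
  proof
    fix B assume "B \<in> insert x ` (S0 \<inter> S1)"
    then obtain A where A: "B = insert x A" "A \<in> S0" "A \<in> S1" by auto
    have AJ: "A \<subseteq> J" using A unfolding S0_def by auto
    have "shattered_by F B" unfolding shattered_by_def
    proof (intro allI impI)
      fix S assume S: "S \<subseteq> B"
      show "\<exists>T\<in>F. T \<inter> B = S"
      proof (cases "x \<in> S")
        case True
        obtain T where T: "T \<in> F1" "T \<inter> A = S - {x}"
        proof -
          have "shattered_by F1 A" "S - {x} \<subseteq> A" using A(1,3) S unfolding S1_def by blast+
          then show ?thesis using that unfolding shattered_by_def by blast
        qed
        then obtain T' where T': "T' \<in> F" "x \<in> T'" "T = T' - {x}" unfolding F1_def by blast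
        have "x \<notin> A" using AJ insert.hyps(2) by blast
        then have "T' \<inter> B = insert x (T \<inter> A)" unfolding T'(3) A(1) using T'(2) by fastforce
        then have "T' \<inter> B = S" unfolding T(2) using True by (simp add: insert_absorb)
        then show ?thesis using T'(1) by blast
      next
        case False
        then have "shattered_by F0 A" "S \<subseteq> A" using A(1,2) S unfolding S0_def by blast+
        then obtain T where T: "T \<in> F0" "T \<inter> A = S" unfolding shattered_by_def by blast
        then have "T \<in> F" "T \<inter> B = S" unfolding F0_def A(1) by blast+
        then show ?thesis by blast
      qed
    qed
    then show "B \<in> {A. A \<subseteq> insert x J \<and> shattered_by F A}" using A AJ by auto
  qed
  have inj2: "inj_on (insert x) (S0 \<inter> S1)"
  proof (rule inj_onI)
    fix A B assume "A \<in> S0 \<inter> S1" "B \<in> S0 \<inter> S1" "insert x A = insert x B"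
    moreover from this have "x \<notin> A" "x \<notin> B" using insert.hyps(2) unfolding S0_def by auto
    ultimately show "A = B" by (metis insert_ident)
  qed
  have disj: "(S0 \<union> S1) \<inter> insert x ` (S0 \<inter> S1) = {}"
    using insert.hyps(2) unfolding S0_def S1_def by auto
  have "card F0 + card F1 \<le> card S0 + card S1"
    using insert.IH[OF sub(1)] insert.IH[OF sub(2)] unfolding S0_def S1_def by linarith
  also have "\<dots> = card (S0 \<union> S1) + card (insert x ` (S0 \<inter> S1))"
    using card_Un_Int[OF finS] card_image[OF inj2] by simp
  also have "\<dots> = card ((S0 \<union> S1) \<union> insert x ` (S0 \<inter> S1))"
    by (rule card_Un_disjoint[symmetric]) (use finS disj in auto)
  also have "\<dots> \<le> card {A. A \<subseteq> insert x J \<and> shattered_by F A}"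
    by (rule card_mono) (use a b insert.hyps(1) in auto)
  finally show ?case using cardF by simp
qed

lemma card_filter_split:
  assumes "finite A"
  shows "card {x\<in>A. P x} + card {x\<in>A. \<not> P x} = card A"
proof -
  have "A = {x\<in>A. P x} \<union> {x\<in>A. \<not> P x}" by blast
  then show ?thesis using assms by (metis (no_types, lifting) card_Un_disjoint disjoint_iff finite_Un mem_Collect_eq)
qed

lemma card_filter_eq_sum:
  assumes "finite A"
  shows "card {x\<in>A. P x} = (\<Sum>x\<in>A. if P x then 1 else 0)"
  using assms by (simp add: sum.inter_filter[symmetric])

lemma card_less_split: "card {j. j < n \<and> P j} + card {j. j < n \<and> \<not> P j} = (n::nat)"
  using card_filter_split[of "{..<n}" P] by simp

lemma card_less_eq_sum: "card {j. j < n \<and> P j} = (\<Sum>j<n::nat. if P j then 1 else 0)"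
  using card_filter_eq_sum[of "{..<n}" P] by simp

lemma card_small_subsets: "card {A. A \<subseteq> {..<m::nat} \<and> card A < d} \<le> (m + 1) ^ d"
proof -
  let ?P = "PiE {..<d} (\<lambda>_. {..m})"
  have "{A. A \<subseteq> {..<m} \<and> card A < d} \<subseteq> (\<lambda>f. f ` {..<d} \<inter> {..<m}) ` ?P"
  proof
    fix A assume "A \<in> {A. A \<subseteq> {..<m} \<and> card A < d}"
    then have A: "A \<subseteq> {..<m}" "card A < d" by auto
    then have "finite A" using finite_subset by blast
    then obtain h where h: "bij_betw h {..<card A} A"
      using ex_bij_betw_nat_finite[of A] by (auto simp: atLeast0LessThan)
    let ?f = "restrict (\<lambda>i. if i < card A then h i else m) {..<d}"
    have "h i \<le> m" if "i < card A" for i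
      using h A(1) that unfolding bij_betw_def by (metis imageI lessThan_iff less_imp_le subsetD)
    then have "?f \<in> ?P" by auto
    moreover have "?f ` {..<d} \<inter> {..<m} = A"
    proof -
      have "?f ` {..<d} \<inter> {..<m} = h ` {..<card A} \<inter> {..<m}"
        using A(2) by (auto simp: image_iff intro: less_trans)
      then show ?thesis using h A(1) by (auto simp: bij_betw_def)
    qed
    ultimately show "A \<in> (\<lambda>f. f ` {..<d} \<inter> {..<m}) ` ?P"
      by (intro image_eqI[where x="?f"]) auto
  qed
  then have "card {A. A \<subseteq> {..<m} \<and> card A < d} \<le> card ?P"
    by (rule surj_card_le[rotated]) (simp add: finite_PiE)
  also have "\<dots> = (m + 1) ^ d" by (simp add: card_PiE)
  finally show ?thesis .
qed

text \<open>Traces are recorded as sets of indices, since a sample may repeat points; two indices of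
  the same point never lie in a common shattered set. A shattered set of d indices would contradict
  \<open>vc_free\<close>, so Pajor's lemma reduces the count to index sets with fewer than d
  elements.\<close>

lemma card_traces:
  assumes "vc_free d R I A" "\<forall>j<m. z j \<in> I"
  shows "card ((\<lambda>a. {j. j < m \<and> R (z j) a}) ` A) \<le> (m + 1) ^ d"
proof -
  let ?F = "(\<lambda>a. {j. j < m \<and> R (z j) a}) ` A"
  have "card B < d" if B: "B \<subseteq> {..<m}" "shattered_by ?F B" for B
  proof (rule ccontr)
    assume "\<not> card B < d"
    then obtain C where C: "C \<subseteq> B" "card C = d" by (metis not_less obtain_subset_with_card_n)
    have "finite C" using C B finite_subset finite_lessThan by metis
    then obtain h where h: "bij_betw h {..<d} C"
      using ex_bij_betw_nat_finite[of C] C(2) by (auto simp: atLeast0LessThan)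
    have hm: "h j < m" if "j < d" for j using h that C B by (auto simp: bij_betw_def)
    have "(\<forall>j<d. (z \<circ> h) j \<in> I) \<and> (\<forall>S. \<exists>a\<in>A. \<forall>j<d. R ((z \<circ> h) j) a \<longleftrightarrow> j \<in> S)"
    proof (intro conjI allI impI)
      fix j assume "j < d" then show "(z \<circ> h) j \<in> I" using hm assms(2) by simp
    next
      fix S
      have hS: "h ` (S \<inter> {..<d}) \<subseteq> B"
        using C(1) image_mono[of "S \<inter> {..<d}" "{..<d}" h] bij_betw_imp_surj_on[OF h] by simp
      obtain T where T: "T \<in> ?F" "T \<inter> B = h ` (S \<inter> {..<d})"
        using B(2)[unfolded shattered_by_def, rule_format, OF hS] by (rule bexE)
      from T(1) obtain a where a: "a \<in> A" "T = {j. j < m \<and> R (z j) a}" by (rule imageE)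
      have "R (z (h j)) a \<longleftrightarrow> j \<in> S" if j: "j < d" for j
      proof -
        have "h j \<in> B" using h C j by (auto simp: bij_betw_def)
        then have "R (z (h j)) a \<longleftrightarrow> h j \<in> T \<inter> B" using a hm[OF j] by auto
        also have "\<dots> \<longleftrightarrow> j \<in> S"
          unfolding T(2) using inj_on_image_mem_iff[of h "{..<d}" j "S \<inter> {..<d}"] h j
          by (simp add: bij_betw_def)
        finally show ?thesis .
      qed
      then show "\<exists>a\<in>A. \<forall>j<d. R ((z \<circ> h) j) a \<longleftrightarrow> j \<in> S" using a by auto
    qed
    then show False using assms(1) unfolding vc_free_def by blast
  qed
  then have "{B. B \<subseteq> {..<m} \<and> shattered_by ?F B} \<subseteq> {B. B \<subseteq> {..<m} \<and> card B < d}" by auto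
  moreover have "finite {B. B \<subseteq> {..<m} \<and> card B < d}" by simp
  ultimately have "card {B. B \<subseteq> {..<m} \<and> shattered_by ?F B} \<le> card {B. B \<subseteq> {..<m} \<and> card B < d}"
    by (rule card_mono[rotated])
  moreover have "card ?F \<le> card {B. B \<subseteq> {..<m} \<and> shattered_by ?F B}"
    by (rule pajor) auto
  ultimately show ?thesis using card_small_subsets[of m d] by linarith
qed

text \<open>Double sampling (Vapnik and Chervonenkis, Haussler and Welzl): if every sample \<open>X\<close> misses some member,
  then many pairs \<open>(X, Y)\<close> are such that a member missed by \<open>X\<close> is hit often by \<open>Y\<close>; swapping
  coordinates of \<open>X\<close> and \<open>Y\<close> shows that there are few such pairs.\<close>

lemma eps_net:
  assumes fin: "finite I" and ne: "I \<noteq> {}" and vc: "vc_free d R I A"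
    and large: "\<forall>a\<in>A. card I \<le> 4 * card {i\<in>I. R i a}"
    and k: "7 * (16 * k + 1) ^ d < 2 ^ k"
  shows "\<exists>z. (\<forall>j<8 * k. z j \<in> I) \<and> (\<forall>a\<in>A. \<exists>j<8 * k. R (z j) a)"
proof (rule ccontr)
  assume neg: "\<not> ?thesis"
  \<comment> \<open>A sample of 8k points hits a member of density 1/4 at least 2k times on average,
    so the threshold k used below is half the guaranteed mean.\<close>
  define n where "n = 8 * k"
  define m where "m = card I"
  have m: "m > 0" using fin ne by (simp add: m_def card_gt_0_iff)
  define P where "P = PiE {..<n} (\<lambda>_. I)"
  have finP: "finite P" unfolding P_def using fin by (simp add: finite_PiE)
  have cardP: "card P = m ^ n" unfolding P_def m_def by (simp add: card_PiE)
  have kpos: "k > 0" using k by (cases k) auto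
  have "\<forall>X\<in>P. \<exists>a\<in>A. \<forall>j<n. \<not> R (X j) a"
  proof
    fix X assume "X \<in> P"
    then have "\<forall>j<8 * k. X j \<in> I" unfolding P_def n_def by auto
    with neg show "\<exists>a\<in>A. \<forall>j<n. \<not> R (X j) a" unfolding n_def by blast
  qed
  then obtain f where f: "\<And>X. X \<in> P \<Longrightarrow> f X \<in> A" "\<And>X j. X \<in> P \<Longrightarrow> j < n \<Longrightarrow> \<not> R (X j) (f X)"
    by metis
  define hits where "hits Y a = card {j. j < n \<and> R (Y j) a}" for Y :: "nat \<Rightarrow> 'a" and a
  define Bd where "Bd = {(X, Y). X \<in> P \<and> Y \<in> P \<and> (\<exists>a\<in>A. (\<forall>j<n. \<not> R (X j) a) \<and> k \<le> hits Y a)}"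
  have finBd: "finite Bd" by (rule finite_subset[of _ "P \<times> P"]) (use finP in \<open>auto simp: Bd_def\<close>)
  \<comment> \<open>Markov's inequality for misses: on average at most 6k of the 8k points miss
    \<open>a\<close>, whereas fewer than k hits means more than 7k misses. Hence at most 6/7 of all
    samples hit \<open>a\<close> too rarely.\<close>
  have lower: "m ^ n \<le> 7 * card {Y\<in>P. k \<le> hits Y a}" if a: "a \<in> A" for a
  proof -
    let ?L = "{Y\<in>P. \<not> k \<le> hits Y a}"
    let ?N = "{i\<in>I. \<not> R i a}"
    have cN: "4 * card ?N \<le> 3 * m"
    proof -
      have "card {i\<in>I. R i a} + card ?N = m"
        unfolding m_def by (rule card_filter_split[OF fin])
      then show ?thesis using large a unfolding m_def by fastforce
    qed
    have miss: "card {Y\<in>P. \<not> R (Y j) a} = card ?N * m ^ (n - 1)" if j: "j < n" for j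
    proof -
      have "{Y\<in>P. \<not> R (Y j) a} = PiE {..<n} (\<lambda>i. if i = j then ?N else I)"
        (is "?l = ?r")
      proof (intro set_eqI iffI)
        fix Y assume "Y \<in> ?l"
        then have "Y \<in> P" "\<not> R (Y j) a" by simp_all
        then show "Y \<in> ?r" unfolding P_def PiE_iff by simp
      next
        fix Y assume Y: "Y \<in> ?r"
        have Yi: "Y i \<in> (if i = j then ?N else I)" if "i < n" for i
          using PiE_mem[OF Y, of i] that by simp
        have "\<not> R (Y j) a" using Yi[OF j] by simp
        moreover have "Y i \<in> I" if "i < n" for i
          using Yi[OF that] by (cases "i = j") simp_all
        moreover have "Y \<in> extensional {..<n}" using Y unfolding PiE_def by simp
        ultimately show "Y \<in> ?l" unfolding P_def PiE_iff by simp
      qed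
      then have "card {Y\<in>P. \<not> R (Y j) a} = (\<Prod>i<n. card (if i = j then ?N else I))"
        by (simp add: card_PiE)
      also have "\<dots> = card ?N * (\<Prod>i\<in>{..<n} - {j}. card (if i = j then ?N else I))"
        using j by (subst prod.remove[of _ j]) auto
      also have "(\<Prod>i\<in>{..<n} - {j}. card (if i = j then ?N else I)) = (\<Prod>i\<in>{..<n} - {j}. m)"
        by (rule prod.cong) (auto simp: m_def)
      finally show ?thesis using j by simp
    qed
    have "card ?L * (7 * k) \<le> (\<Sum>Y\<in>?L. card {j. j < n \<and> \<not> R (Y j) a})"
    proof -
      have "7 * k \<le> card {j. j < n \<and> \<not> R (Y j) a}" if "Y \<in> ?L" for Y
      proof -
        have "hits Y a + card {j. j < n \<and> \<not> R (Y j) a} = n"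
          unfolding hits_def by (rule card_less_split)
        then show ?thesis using that unfolding n_def by simp
      qed
      then have "of_nat (card ?L) * (7 * k) \<le> (\<Sum>Y\<in>?L. card {j. j < n \<and> \<not> R (Y j) a})"
        by (rule sum_bounded_below)
      then show ?thesis by (simp only: of_nat_id)
    qed
    also have "\<dots> \<le> (\<Sum>Y\<in>P. card {j. j < n \<and> \<not> R (Y j) a})"
      by (rule sum_mono2) (use finP in auto)
    also have "\<dots> = (\<Sum>Y\<in>P. \<Sum>j<n. if \<not> R (Y j) a then 1 else 0)"
      by (simp only: card_less_eq_sum)
    also have "\<dots> = (\<Sum>j<n. \<Sum>Y\<in>P. if \<not> R (Y j) a then 1 else 0)"
      by (rule sum.swap)
    also have "\<dots> = (\<Sum>j<n. card {Y\<in>P. \<not> R (Y j) a})"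
      by (simp only: card_filter_eq_sum[OF finP])
    also have "\<dots> = n * (card ?N * m ^ (n - 1))" using miss by simp
    finally have h1: "card ?L * (7 * k) \<le> n * (card ?N * m ^ (n - 1))" .
    define c q L where "c = card ?N" and "q = m ^ (n - 1)" and "L = card ?L"
    have mq: "m * q = m ^ n" unfolding q_def n_def using kpos by (simp add: power_eq_if)
    have "4 * (L * (7 * k)) \<le> 4 * (n * (c * q))"
      using h1 unfolding c_def q_def L_def by (rule mult_le_mono2)
    also have "\<dots> = n * q * (4 * c)" by (simp only: ac_simps)
    also have "\<dots> \<le> n * q * (3 * m)" using cN unfolding c_def by (rule mult_le_mono2)
    also have "\<dots> = 24 * k * (m * q)" unfolding n_def by (simp add: algebra_simps)
    finally have "k * (28 * L) \<le> k * (24 * m ^ n)"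
      unfolding mq by (simp add: algebra_simps)
    then have "7 * card ?L \<le> 6 * m ^ n" using kpos unfolding L_def by simp
    moreover have "card {Y\<in>P. k \<le> hits Y a} + card ?L = m ^ n"
      unfolding cardP[symmetric] by (rule card_filter_split[OF finP])
    ultimately show ?thesis by linarith
  qed
  have "card P * m ^ n \<le> 7 * card Bd"
  proof -
    have "Sigma P (\<lambda>X. {Y\<in>P. k \<le> hits Y (f X)}) \<subseteq> Bd"
      using f unfolding Bd_def by auto
    then have "card (Sigma P (\<lambda>X. {Y\<in>P. k \<le> hits Y (f X)})) \<le> card Bd"
      by (rule card_mono[OF finBd])
    also have "card (Sigma P (\<lambda>X. {Y\<in>P. k \<le> hits Y (f X)})) = (\<Sum>X\<in>P. card {Y\<in>P. k \<le> hits Y (f X)})"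
      using finP by (subst card_SigmaI) auto
    finally have "(\<Sum>X\<in>P. 7 * card {Y\<in>P. k \<le> hits Y (f X)}) \<le> 7 * card Bd"
      by (simp add: sum_distrib_left[symmetric])
    moreover have "(\<Sum>X\<in>P. m ^ n) \<le> (\<Sum>X\<in>P. 7 * card {Y\<in>P. k \<le> hits Y (f X)})"
      by (rule sum_mono) (use lower f in auto)
    ultimately show ?thesis by simp
  qed
  then have low: "m ^ n * m ^ n \<le> 7 * card Bd" by (simp add: cardP)
  \<comment> \<open>\<open>sw s\<close> exchanges the two samples at the coordinates in s. It is an
    involution of \<open>P \<times> P\<close>, so every s turns equally many pairs into bad ones,
    and the count can be bounded by fixing the pair and varying s.\<close>
  define sw where "sw s = (\<lambda>p :: (nat \<Rightarrow> 'a) \<times> (nat \<Rightarrow> 'a).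
      (restrict (\<lambda>j. if j \<in> s then snd p j else fst p j) {..<n},
       restrict (\<lambda>j. if j \<in> s then fst p j else snd p j) {..<n}))" for s :: "nat set"
  have swP: "sw s p \<in> P \<times> P" if "p \<in> P \<times> P" for s p
  proof -
    obtain X Y where p: "p = (X, Y)" by (cases p)
    with that have "\<forall>j<n. X j \<in> I" "\<forall>j<n. Y j \<in> I" unfolding P_def by (simp_all add: PiE_iff)
    then show ?thesis unfolding sw_def p P_def PiE_iff by simp
  qed
  have swsw: "sw s (sw s p) = p" if "p \<in> P \<times> P" for s p
  proof -
    obtain X Y where p: "p = (X, Y)" by (cases p)
    with that have ext: "X \<in> extensional {..<n}" "Y \<in> extensional {..<n}"
      unfolding P_def by (simp_all add: PiE_iff)
    have "fst (sw s (sw s p)) = X" "snd (sw s (sw s p)) = Y"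
      using ext unfolding sw_def p by (auto intro!: HOL.ext simp: extensional_def)
    then show ?thesis unfolding p by (simp add: prod_eq_iff)
  qed
  have card_sw: "card {p\<in>P \<times> P. sw s p \<in> Bd} = card Bd" for s
  proof (rule bij_betw_same_card[of "sw s"])
    show "bij_betw (sw s) {p\<in>P \<times> P. sw s p \<in> Bd} Bd"
    proof (rule bij_betwI[where g="sw s"])
      show "sw s \<in> {p \<in> P \<times> P. sw s p \<in> Bd} \<rightarrow> Bd" by auto
      have "Bd \<subseteq> P \<times> P" unfolding Bd_def by auto
      then show "sw s \<in> Bd \<rightarrow> {p \<in> P \<times> P. sw s p \<in> Bd}" using swP swsw by auto
      show "sw s (sw s x) = x" if "x \<in> {p \<in> P \<times> P. sw s p \<in> Bd}" for x using that swsw by auto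
      show "sw s (sw s y) = y" if "y \<in> Bd" for y using that swsw \<open>Bd \<subseteq> P \<times> P\<close> by auto
    qed
  qed
  have few: "card {s\<in>Pow {..<n}. sw s p \<in> Bd} \<le> (16 * k + 1) ^ d * 2 ^ (n - k)" if p: "p \<in> P \<times> P" for p
  proof -
    obtain X Y where XY: "p = (X, Y)" "X \<in> P" "Y \<in> P" using p by auto
    define z where "z j = (if j < n then X j else Y (j - n))" for j
    have XYI: "\<forall>j<n. X j \<in> I" "\<forall>j<n. Y j \<in> I" using XY(2,3) unfolding P_def by (simp_all add: PiE_iff)
    have zI: "\<forall>j<2 * n. z j \<in> I" using XYI unfolding z_def by simp
    define tr where "tr a = {j. j < 2 * n \<and> R (z j) a}" for a
    have ctr: "card (tr ` A) \<le> (16 * k + 1) ^ d"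
      using card_traces[OF vc zI] unfolding tr_def n_def by simp
    have fintr: "finite (tr ` A)" by (rule finite_subset[of _ "Pow {..<2 * n}"]) (auto simp: tr_def)
    define TX where "TX T = T \<inter> {..<n}" for T :: "nat set"
    define TY where "TY T = {j. j < n \<and> j + n \<in> T}" for T :: "nat set"
    \<comment> \<open>For a given trace T the swap must move every hit out of the first sample: the
      coordinates in \<open>TX T\<close> have to be swapped and those in \<open>TY T\<close> must
      not be. This determines s on at least k coordinates and leaves at most 2^(n-k)
      choices.\<close>
    define G where "G T = {s\<in>Pow {..<n}. TX T \<subseteq> s \<and> TY T \<inter> s = {} \<and> k \<le> card (TX T \<union> TY T)}" for T
    have cG: "card (G T) \<le> 2 ^ (n - k)" for T
    proof (cases "k \<le> card (TX T \<union> TY T)")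
      case True
      let ?W = "{..<n} - (TX T \<union> TY T)"
      have sub: "TX T \<union> TY T \<subseteq> {..<n}" unfolding TX_def TY_def by auto
      have "G T \<subseteq> (\<lambda>s. TX T \<union> s) ` Pow ?W"
      proof
        fix s assume "s \<in> G T"
        then have "s = TX T \<union> (s - TX T)" "s - TX T \<in> Pow ?W" unfolding G_def by auto
        then show "s \<in> (\<lambda>s. TX T \<union> s) ` Pow ?W" by blast
      qed
      then have "card (G T) \<le> card (Pow ?W)"
        by (rule surj_card_le[rotated]) simp
      also have "\<dots> = 2 ^ card ?W" by (rule card_Pow) simp
      also have "card ?W = n - card (TX T \<union> TY T)"
        using card_Diff_subset[OF finite_subset[OF sub] sub] by simp
      also have "2 ^ (n - card (TX T \<union> TY T)) \<le> (2::nat) ^ (n - k)"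
        using True by (intro power_increasing) auto
      finally show ?thesis .
    qed (simp add: G_def)
    have "{s\<in>Pow {..<n}. sw s p \<in> Bd} \<subseteq> (\<Union>T\<in>tr ` A. G T)"
    proof
      fix s assume s: "s \<in> {s\<in>Pow {..<n}. sw s p \<in> Bd}"
      then obtain a where a: "a \<in> A" "\<forall>j<n. \<not> R (fst (sw s p) j) a" "k \<le> hits (snd (sw s p)) a"
        unfolding Bd_def by auto
      have x: "j \<in> TX (tr a) \<longleftrightarrow> j < n \<and> R (X j) a" for j unfolding TX_def tr_def z_def by auto
      have y: "j \<in> TY (tr a) \<longleftrightarrow> j < n \<and> R (Y j) a" for j unfolding TY_def tr_def z_def by auto
      have 1: "TX (tr a) \<subseteq> s"
        using a(2) unfolding sw_def XY by (auto simp: x split: if_splits)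
      have 2: "TY (tr a) \<inter> s = {}"
        using a(2) unfolding sw_def XY by (auto simp: y split: if_splits)
      have "{j. j < n \<and> R (snd (sw s p) j) a} \<subseteq> TX (tr a) \<union> TY (tr a)"
        unfolding sw_def XY by (auto simp: x y split: if_splits)
      moreover have "finite (TX (tr a) \<union> TY (tr a))" unfolding TX_def TY_def by auto
      ultimately have "hits (snd (sw s p)) a \<le> card (TX (tr a) \<union> TY (tr a))"
        unfolding hits_def by (rule card_mono[rotated])
      then have "s \<in> G (tr a)" using 1 2 a(3) s unfolding G_def by auto
      then show "s \<in> (\<Union>T\<in>tr ` A. G T)" using a(1) by auto
    qed
    then have "card {s\<in>Pow {..<n}. sw s p \<in> Bd} \<le> card (\<Union>T\<in>tr ` A. G T)"
      by (rule card_mono[rotated], intro finite_UN_I[OF fintr]) (simp add: G_def)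
    also have "\<dots> \<le> (\<Sum>T\<in>tr ` A. card (G T))" by (rule card_UN_le[OF fintr])
    also have "\<dots> \<le> (\<Sum>T\<in>tr ` A. 2 ^ (n - k))" by (rule sum_mono) (use cG in auto)
    also have "\<dots> = card (tr ` A) * 2 ^ (n - k)" by simp
    also have "\<dots> \<le> (16 * k + 1) ^ d * 2 ^ (n - k)" using ctr by simp
    finally show ?thesis .
  qed
  have finPP: "finite (P \<times> P)" and finPow: "finite (Pow {..<n})" using finP by simp_all
  have "2 ^ n * card Bd = (\<Sum>s\<in>Pow {..<n}. card {p\<in>P \<times> P. sw s p \<in> Bd})"
    by (simp only: card_sw sum_constant card_Pow[OF finite_lessThan] card_lessThan of_nat_id)
  also have "\<dots> = (\<Sum>s\<in>Pow {..<n}. \<Sum>p\<in>P \<times> P. if sw s p \<in> Bd then 1 else 0)"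
    by (simp only: card_filter_eq_sum[OF finPP])
  also have "\<dots> = (\<Sum>p\<in>P \<times> P. \<Sum>s\<in>Pow {..<n}. if sw s p \<in> Bd then 1 else 0)"
    by (rule sum.swap)
  also have "\<dots> = (\<Sum>p\<in>P \<times> P. card {s\<in>Pow {..<n}. sw s p \<in> Bd})"
    by (simp only: card_filter_eq_sum[OF finPow])
  also have "\<dots> \<le> (\<Sum>p\<in>P \<times> P. (16 * k + 1) ^ d * 2 ^ (n - k))"
    by (rule sum_mono) (rule few)
  also have "\<dots> = (m ^ n * m ^ n) * ((16 * k + 1) ^ d * 2 ^ (n - k))"
    by (simp only: sum_constant card_cartesian_product cardP of_nat_id)
  finally have up: "2 ^ n * card Bd \<le> (m ^ n * m ^ n) * ((16 * k + 1) ^ d * 2 ^ (n - k))" .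
  define q e B v where "q = m ^ n * m ^ n" and "e = (16 * k + 1) ^ d" and "B = card Bd"
    and "v = (2::nat) ^ (n - k)"
  have v: "v > 0" unfolding v_def by simp
  have "(2::nat) ^ n = 2 ^ k * v" unfolding v_def n_def by (simp add: power_add[symmetric])
  with up have "v * (2 ^ k * B) \<le> v * (q * e)"
    unfolding q_def[symmetric] e_def[symmetric] B_def[symmetric] v_def[symmetric]
    by (simp only: ac_simps)
  then have "2 ^ k * B \<le> q * e" using v by simp
  also have "\<dots> \<le> (7 * B) * e" using low unfolding q_def B_def by (rule mult_le_mono1)
  finally have "B * 2 ^ k \<le> B * (7 * e)" by (simp only: ac_simps)
  moreover have "B > 0" using low m unfolding B_def by (cases "card Bd") auto
  ultimately show False using k unfolding e_def by simp
qed

lemma eps_net_size: "\<exists>k. 7 * (16 * k + 1) ^ d < (2::nat) ^ k"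
proof -
  have "eventually (\<lambda>k. 7 * (16 * real k + 1) ^ d < 2 ^ k) sequentially"
    by real_asymp
  then obtain k where "7 * (16 * real k + 1) ^ d < 2 ^ k"
    unfolding eventually_sequentially by blast
  then have "real (7 * (16 * k + 1) ^ d) < real (2 ^ k)" by (simp add: add.commute)
  then show ?thesis using of_nat_less_iff by blast
qed

text \<open>Multiplicative weights: an uncovered point doubles its weight, so the total weight grows by a
  factor of at most 5/4 in each round.\<close>

lemma multiplicative_weights:
  fixes R :: "'p \<Rightarrow> 'q \<Rightarrow> bool"
  assumes fin: "finite E" and ne: "E \<noteq> {}"
    and cov: "\<And>w :: 'p \<Rightarrow> nat. \<forall>e\<in>E. w e > 0 \<Longrightarrow>
      \<exists>a\<in>A. 4 * (\<Sum>e\<in>{e\<in>E. \<not> R e a}. w e) \<le> (\<Sum>e\<in>E. w e)"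
  shows "\<exists>T>0. \<exists>s. (\<forall>t<T. s t \<in> A) \<and> (\<forall>e\<in>E. T \<le> 4 * card {t. t < T \<and> R e (s t)})"
proof -
  obtain pick where pick: "\<And>w :: 'p \<Rightarrow> nat. \<forall>e\<in>E. w e > 0 \<Longrightarrow> pick w \<in> A \<and>
      4 * (\<Sum>e\<in>{e\<in>E. \<not> R e (pick w)}. w e) \<le> (\<Sum>e\<in>E. w e)"
    using cov by metis
  define W :: "nat \<Rightarrow> 'p \<Rightarrow> nat" where
    "W = rec_nat (\<lambda>_. 1) (\<lambda>_ w e. if R e (pick w) then w e else 2 * w e)"
  have W0: "W 0 e = 1" for e unfolding W_def by simp
  have WS: "W (Suc t) e = (if R e (pick (W t)) then W t e else 2 * W t e)" for t e
    unfolding W_def by simp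
  define s where "s t = pick (W t)" for t
  have Wpos: "W t e > 0" for t e by (induction t) (auto simp: W0 WS)
  have s: "s t \<in> A" "4 * (\<Sum>e\<in>{e\<in>E. \<not> R e (s t)}. W t e) \<le> (\<Sum>e\<in>E. W t e)" for t
    using pick[of "W t"] Wpos unfolding s_def by auto
  have tot: "4 ^ t * (\<Sum>e\<in>E. W t e) \<le> card E * 5 ^ t" for t
  proof (induction t)
    case 0 then show ?case by (simp add: W0)
  next
    case (Suc t)
    have "(\<Sum>e\<in>E. W (Suc t) e) = (\<Sum>e\<in>E. W t e + (if \<not> R e (s t) then W t e else 0))"
      by (rule sum.cong) (auto simp: WS s_def)
    also have "\<dots> = (\<Sum>e\<in>E. W t e) + (\<Sum>e\<in>{e\<in>E. \<not> R e (s t)}. W t e)"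
      using fin by (simp only: sum.distrib sum.inter_filter)
    finally have "4 * (\<Sum>e\<in>E. W (Suc t) e) \<le> 5 * (\<Sum>e\<in>E. W t e)" using s(2)[of t] by linarith
    then have "4 ^ t * (4 * (\<Sum>e\<in>E. W (Suc t) e)) \<le> 4 ^ t * (5 * (\<Sum>e\<in>E. W t e))"
      by (rule mult_le_mono2)
    also have "\<dots> = 5 * (4 ^ t * (\<Sum>e\<in>E. W t e))" by (simp only: ac_simps)
    also have "\<dots> \<le> 5 * (card E * 5 ^ t)" using Suc by (rule mult_le_mono2)
    finally show ?case by (simp add: ac_simps)
  qed
  define k where "k t e = card {i. i < t \<and> R e (s i)}" for t e
  have kS: "k (Suc t) e = (if R e (s t) then Suc (k t e) else k t e)" for t e
  proof -
    have "{i. i < Suc t \<and> R e (s i)} = (if R e (s t) then insert t {i. i < t \<and> R e (s i)} else {i. i < t \<and> R e (s i)})"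
      by (auto simp: less_Suc_eq)
    then show ?thesis unfolding k_def by simp
  qed
  have k0: "k 0 e = 0" for e unfolding k_def by simp
  have k_le: "k t e \<le> t" for t e
    by (induction t) (auto simp: kS k0)
  have W_eq: "W t e = 2 ^ (t - k t e)" for t e
  proof (induction t)
    case 0 then show ?case by (simp add: W0)
  next
    case (Suc t)
    then show ?case using k_le[of t e] by (simp add: WS kS s_def[symmetric] Suc_diff_le)
  qed
  \<comment> \<open>After T = 4c rounds, a point covered in less than a quarter of them has doubled
    its weight at least 3c times. Its weight is then at least 8^c, while the total weight is at most
    c (5/4)^(4c) = c (625/256)^c, and this is smaller because c < 2^c.\<close>
  define c T where "c = card E" and "T = 4 * card E"
  have c: "c > 0" using fin ne unfolding c_def by (simp add: card_gt_0_iff)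
  have "T \<le> 4 * k T e" if e: "e \<in> E" for e
  proof (rule ccontr)
    assume "\<not> T \<le> 4 * k T e"
    then have "3 * c \<le> T - k T e" unfolding T_def c_def by linarith
    then have "(2::nat) ^ (3 * c) \<le> W T e" unfolding W_eq by (intro power_increasing) auto
    also have "\<dots> \<le> (\<Sum>e\<in>E. W T e)" using e fin by (intro member_le_sum) auto
    finally have "4 ^ T * 2 ^ (3 * c) \<le> 4 ^ T * (\<Sum>e\<in>E. W T e)" by (rule mult_le_mono2)
    also have "\<dots> \<le> c * 5 ^ T" using tot[of T] unfolding c_def .
    finally have 1: "4 ^ T * 2 ^ (3 * c) \<le> c * (5::nat) ^ T" .
    have "(4::nat) ^ T * 2 ^ (3 * c) = (4 ^ 4 * 2 ^ 3) ^ c"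
      unfolding T_def c_def[symmetric] by (simp only: power_mult power_mult_distrib)
    moreover have "(5::nat) ^ T = (5 ^ 4) ^ c" unfolding T_def c_def[symmetric] by (simp only: power_mult)
    ultimately have "(2048::nat) ^ c \<le> c * 625 ^ c" using 1 by simp
    also have "\<dots> < 2 ^ c * 625 ^ c" by (rule mult_strict_right_mono) simp_all
    also have "\<dots> = 1250 ^ c" by (simp flip: power_mult_distrib)
    also have "\<dots> \<le> 2048 ^ c" by (rule power_mono) simp_all
    finally show False by simp
  qed
  moreover have "T > 0" using c unfolding T_def c_def by simp
  ultimately show ?thesis using s(1) unfolding k_def by blast
qed

text \<open>Sampling with respect to any weight yields a member of large weight, hence by minimax a fractional
  cover, which is then sampled again in the dual system.\<close>

lemma finite_cover_by_few:
  "\<exists>n::nat. n > 0 \<and> (\<forall>(R :: 'p \<Rightarrow> 'q \<Rightarrow> bool) E A.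
     finite E \<and> E \<noteq> {} \<and> vc_free d R E A \<and> vc_free d (\<lambda>a e. R e a) A E \<and>
     (\<forall>e. (\<forall>j<n. e j \<in> E) \<longrightarrow> (\<exists>a\<in>A. \<forall>j<n. R (e j) a)) \<longrightarrow>
     (\<exists>a. (\<forall>i<n. a i \<in> A) \<and> (\<forall>e\<in>E. \<exists>i<n. R e (a i))))"
proof -
  obtain k where k: "7 * (16 * k + 1) ^ d < (2::nat) ^ k" using eps_net_size by blast
  have kpos: "k > 0" using k by (cases k) auto
  show ?thesis
  proof (intro exI[of _ "8 * k"] conjI allI impI)
    show "8 * k > 0" using kpos by simp
    fix R :: "'p \<Rightarrow> 'q \<Rightarrow> bool" and E A
    assume "finite E \<and> E \<noteq> {} \<and> vc_free d R E A \<and> vc_free d (\<lambda>a e. R e a) A E \<and>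
     (\<forall>e. (\<forall>j<8 * k. e j \<in> E) \<longrightarrow> (\<exists>a\<in>A. \<forall>j<8 * k. R (e j) a))"
    then have E: "finite E" "E \<noteq> {}" and vc: "vc_free d R E A" "vc_free d (\<lambda>a e. R e a) A E"
      and hyp: "\<And>e. (\<forall>j<8 * k. e j \<in> E) \<Longrightarrow> (\<exists>a\<in>A. \<forall>j<8 * k. R (e j) a)" by blast+
    have "\<exists>a\<in>A. 4 * (\<Sum>e\<in>{e\<in>E. \<not> R e a}. w e) \<le> (\<Sum>e\<in>E. w e)"
      if w: "\<forall>e\<in>E. w e > 0" for w :: "'p \<Rightarrow> nat"
    proof (rule ccontr)
      assume "\<not> ?thesis"
      then have big: "\<And>a. a \<in> A \<Longrightarrow> (\<Sum>e\<in>E. w e) \<le> 4 * (\<Sum>e\<in>{e\<in>E. \<not> R e a}. w e)" by force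
      \<comment> \<open>Weights become multiplicities: with \<open>w e\<close> copies of
        \<open>e\<close>, the uniform sampling in \<open>eps_net\<close> respects the weights. It is
        applied to the negated relation, so the sample it yields would contradict the joint
        satisfiability of any 8k points.\<close>
      define I where "I = Sigma E (\<lambda>e. {..<w e})"
      have fI: "finite I" unfolding I_def using E by auto
      have nI: "I \<noteq> {}" using E w unfolding I_def by auto
      have vI: "vc_free d (\<lambda>i a. \<not> R (fst i) a) I A"
        unfolding vc_free_def
      proof
        assume "\<exists>u. (\<forall>j<d. u j \<in> I) \<and> (\<forall>S. \<exists>a\<in>A. \<forall>j<d. (\<not> R (fst (u j)) a) = (j \<in> S))"
        then obtain u where u: "\<forall>j<d. u j \<in> I" "\<forall>S. \<exists>a\<in>A. \<forall>j<d. (\<not> R (fst (u j)) a) = (j \<in> S)"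
          by blast
        have "\<exists>a\<in>A. \<forall>j<d. R (fst (u j)) a = (j \<in> S)" for S
        proof -
          obtain a where "a \<in> A" "\<forall>j<d. (\<not> R (fst (u j)) a) = (j \<in> - S)" using u(2) by blast
          then show ?thesis by (intro bexI[of _ a]) auto
        qed
        moreover have "\<forall>j<d. fst (u j) \<in> E" using u(1) unfolding I_def by auto
        ultimately have "(\<forall>j<d. (fst \<circ> u) j \<in> E) \<and> (\<forall>S. \<exists>a\<in>A. \<forall>j<d. R ((fst \<circ> u) j) a = (j \<in> S))"
          by simp
        then show False using vc(1) unfolding vc_free_def by blast
      qed
      have lI: "\<forall>a\<in>A. card I \<le> 4 * card {i\<in>I. \<not> R (fst i) a}"
      proof
        fix a assume a: "a \<in> A"
        have "card I = (\<Sum>e\<in>E. w e)" unfolding I_def using E by simp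
        moreover have "{i\<in>I. \<not> R (fst i) a} = Sigma {e\<in>E. \<not> R e a} (\<lambda>e. {..<w e})"
          unfolding I_def by auto
        moreover have "card (Sigma {e\<in>E. \<not> R e a} (\<lambda>e. {..<w e})) = (\<Sum>e\<in>{e\<in>E. \<not> R e a}. w e)"
          using E by simp
        ultimately show "card I \<le> 4 * card {i\<in>I. \<not> R (fst i) a}" using big[OF a] by simp
      qed
      obtain z where z: "\<forall>j<8 * k. z j \<in> I" "\<forall>a\<in>A. \<exists>j<8 * k. \<not> R (fst (z j)) a"
        using eps_net[OF fI nI vI lI k] by blast
      have "\<forall>j<8 * k. fst (z j) \<in> E" using z(1) unfolding I_def by auto
      then obtain a where "a \<in> A" "\<forall>j<8 * k. R (fst (z j)) a" using hyp[of "fst \<circ> z"] by auto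
      then show False using z(2) by blast
    qed
    then obtain T s where T: "T > 0" "\<forall>t<T. s t \<in> A" "\<forall>e\<in>E. T \<le> 4 * card {t. t < T \<and> R e (s t)}"
      using multiplicative_weights[OF E, of A R] by blast
    \<comment> \<open>The dual system: the rounds are now the points, and each \<open>e\<close> is a
      set of density at least 1/4 among them.\<close>
    have vT: "vc_free d (\<lambda>t e. R e (s t)) {..<T} E"
      unfolding vc_free_def
    proof
      assume "\<exists>u. (\<forall>j<d. u j \<in> {..<T}) \<and> (\<forall>S. \<exists>a\<in>E. \<forall>j<d. R a (s (u j)) = (j \<in> S))"
      then obtain u where "\<forall>j<d. u j \<in> {..<T}" "\<forall>S. \<exists>a\<in>E. \<forall>j<d. R a (s (u j)) = (j \<in> S)" by blast
      with T(2) have "(\<forall>j<d. (s \<circ> u) j \<in> A) \<and> (\<forall>S. \<exists>a\<in>E. \<forall>j<d. R a ((s \<circ> u) j) = (j \<in> S))"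
        by simp
      then show False using vc(2) unfolding vc_free_def by blast
    qed
    have lT: "\<forall>e\<in>E. card {..<T} \<le> 4 * card {t\<in>{..<T}. R e (s t)}"
      using T(3) by simp
    have nT: "{..<T} \<noteq> {}" using T(1) by auto
    obtain z where "\<forall>j<8 * k. z j \<in> {..<T}" "\<forall>e\<in>E. \<exists>j<8 * k. R e (s (z j))"
      using eps_net[OF finite_lessThan nT vT lT k] by blast
    then show "\<exists>a. (\<forall>i<8 * k. a i \<in> A) \<and> (\<forall>e\<in>E. \<exists>i<8 * k. R e (a i))"
      using T(2) by (intro exI[of _ "s \<circ> z"]) auto
  qed
qed

section \<open>Ultrafilters\<close>

definition ultra :: "'p filter \<Rightarrow> bool" where
  "ultra U \<longleftrightarrow> U \<noteq> bot \<and> (\<forall>P. eventually P U \<or> eventually (\<lambda>x. \<not> P x) U)"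

lemma ultra_not_iff:
  assumes "ultra U"
  shows "eventually (\<lambda>x. \<not> P x) U \<longleftrightarrow> \<not> eventually P U"
proof
  assume n: "eventually (\<lambda>x. \<not> P x) U"
  show "\<not> eventually P U"
  proof
    assume "eventually P U"
    with n have "eventually (\<lambda>x. False) U" by eventually_elim simp
    then show False using assms unfolding ultra_def trivial_limit_def by simp
  qed
qed (use assms in \<open>auto simp: ultra_def\<close>)

lemma ex_ultra_le:
  assumes "F \<noteq> (bot :: 'p filter)"
  shows "\<exists>U\<le>F. ultra U"
proof -
  define \<A> where "\<A> = {H :: 'p filter. H \<le> F \<and> H \<noteq> bot}"
  have po: "partial_order_on \<A> (relation_of (\<lambda>x y. y \<le> x) \<A>)"
    by (rule partial_order_on_relation_ofI) auto
  have "\<exists>u\<in>\<A>. \<forall>H\<in>C. u \<le> H" if C: "C \<in> Chains (relation_of (\<lambda>x y. y \<le> x) \<A>)" for C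
  proof (cases "C = {}")
    case True
    then show ?thesis using assms unfolding \<A>_def by auto
  next
    case False
    have CA: "C \<subseteq> \<A>" and lin: "\<And>H K. H \<in> C \<Longrightarrow> K \<in> C \<Longrightarrow> H \<le> K \<or> K \<le> H"
      using C unfolding Chains_def relation_of_def by auto
    have ev: "eventually P (Inf C) \<longleftrightarrow> (\<exists>H\<in>C. eventually P H)" for P
      using lin by (intro eventually_Inf_base False) (meson inf.absorb_iff1 inf.absorb_iff2 order_refl le_inf_iff)
    have nb: "Inf C \<noteq> bot"
    proof
      assume "Inf C = bot"
      then have "eventually (\<lambda>_. False) (Inf C)" by simp
      then obtain H where "H \<in> C" "eventually (\<lambda>_. False) H" unfolding ev by blast
      then show False using CA unfolding \<A>_def trivial_limit_def by blast
    qed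
    obtain H where H: "H \<in> C" using False by blast
    then have "H \<le> F" using CA unfolding \<A>_def by blast
    then have "Inf C \<le> F" using H by (rule Inf_lower2[rotated])
    then have "Inf C \<in> \<A>" using nb unfolding \<A>_def by simp
    then show ?thesis by (rule bexI[rotated]) (simp add: Inf_lower)
  qed
  then obtain U where U: "U \<in> \<A>" "\<And>H. H \<in> \<A> \<Longrightarrow> H \<le> U \<Longrightarrow> H = U"
    using predicate_Zorn[OF po] by metis
  have "eventually P U \<or> eventually (\<lambda>x. \<not> P x) U" for P
  proof (rule ccontr)
    assume neg: "\<not> ?thesis"
    have "inf U (principal {x. P x}) \<noteq> bot"
      unfolding trivial_limit_def eventually_inf_principal using neg by auto
    then have "inf U (principal {x. P x}) \<in> \<A>" using U(1) unfolding \<A>_def by (auto intro: le_infI1)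
    then have "inf U (principal {x. P x}) = U" by (intro U(2)) auto
    then have "U \<le> principal {x. P x}" by (metis inf.cobounded2)
    then show False using neg unfolding le_principal by simp
  qed
  then show ?thesis using U(1) unfolding ultra_def \<A>_def by blast
qed

text \<open>The product of global types in the order in which the right factor is realized first and
  \<open>V\<close> is then realized over it; a later realization thus stands in front.\<close>

definition prod_filter_app :: "'a list filter \<Rightarrow> 'a list filter \<Rightarrow> 'a list filter" where
  "prod_filter_app V U = Abs_filter (\<lambda>P. eventually (\<lambda>v. eventually (\<lambda>u. P (v @ u)) U) V)"

lemma eventually_prod_filter_app:
  "eventually P (prod_filter_app V U) \<longleftrightarrow> eventually (\<lambda>v. eventually (\<lambda>u. P (v @ u)) U) V"
  unfolding prod_filter_app_def
proof (rule eventually_Abs_filter, rule is_filter.intro)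
  fix P Q :: "'a list \<Rightarrow> bool"
  assume "\<forall>\<^sub>F v in V. \<forall>\<^sub>F u in U. P (v @ u)"
  then show "\<forall>\<^sub>F v in V. \<forall>\<^sub>F u in U. P (v @ u) \<and> Q (v @ u)" if "\<forall>\<^sub>F v in V. \<forall>\<^sub>F u in U. Q (v @ u)"
    using that by (simp add: eventually_conj_iff)
  show "\<forall>\<^sub>F v in V. \<forall>\<^sub>F u in U. Q (v @ u)" if "\<forall>x. P x \<longrightarrow> Q x"
    using \<open>\<forall>\<^sub>F v in V. \<forall>\<^sub>F u in U. P (v @ u)\<close> that by (auto elim!: eventually_mono)
qed simp

lemma ultra_prod_filter_app:
  assumes "ultra V" "ultra U"
  shows "ultra (prod_filter_app V U)"
proof -
  have "eventually P (prod_filter_app V U) \<or> eventually (\<lambda>x. \<not> P x) (prod_filter_app V U)" for P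
    unfolding eventually_prod_filter_app ultra_not_iff[OF assms(2)] ultra_not_iff[OF assms(1)] by blast
  moreover have "prod_filter_app V U \<noteq> bot"
    using assms unfolding trivial_limit_def eventually_prod_filter_app ultra_def by simp
  ultimately show ?thesis unfolding ultra_def by blast
qed

section \<open>Definable sets of tuples in a monster model\<close>

definition tpl :: "'a set \<Rightarrow> nat \<Rightarrow> 'a list set" where
  "tpl X n = {g. set g \<subseteq> X \<and> length g = n}"

definition sub :: "'a list \<Rightarrow> nat list \<Rightarrow> 'a list" where
  "sub g I = map (\<lambda>i. g ! i) I"

lemma tpl_append: "g \<in> tpl X n \<Longrightarrow> h \<in> tpl X k \<Longrightarrow> g @ h \<in> tpl X (n + k)"
  unfolding tpl_def by simp

lemma tpl_mono: "X \<subseteq> Y \<Longrightarrow> tpl X n \<subseteq> tpl Y n"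
  unfolding tpl_def by auto

lemma sub_tpl: "g \<in> tpl X n \<Longrightarrow> set I \<subseteq> {..<n} \<Longrightarrow> length I = k \<Longrightarrow> sub g I \<in> tpl X k"
  unfolding tpl_def sub_def by (auto simp: subset_iff)

lemma sub_append: "sub g (I @ J) = sub g I @ sub g J"
  unfolding sub_def by simp

lemma length_sub [simp]: "length (sub g I) = length I"
  unfolding sub_def by simp

lemma sub_id: "length g = n \<Longrightarrow> sub g [0..<n] = g"
  unfolding sub_def using map_nth by blast

lemma sub_append_left: "length g = n \<Longrightarrow> sub (g @ h) [0..<n] = g"
  unfolding sub_def by (intro nth_equalityI) (auto simp: nth_append)

lemma sub_append_right: "length g = n \<Longrightarrow> length h = k \<Longrightarrow> sub (g @ h) [n..<n+k] = h"
  unfolding sub_def by (intro nth_equalityI) (auto simp: nth_append)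

lemma map_sub: "set I \<subseteq> {..<length g} \<Longrightarrow> map h (sub g I) = sub (map h g) I"
  unfolding sub_def by (auto simp: subset_iff)

lemma ex_sub:
  assumes "set c \<subseteq> set g"
  shows "\<exists>I. set I \<subseteq> {..<length g} \<and> length I = length c \<and> sub g I = c"
proof -
  have "\<forall>x\<in>set c. \<exists>i<length g. g ! i = x" using assms by (metis in_set_conv_nth subsetD)
  then obtain p where p: "\<And>x. x \<in> set c \<Longrightarrow> p x < length g \<and> g ! p x = x" by metis
  show ?thesis
    by (rule exI[of _ "map p c"]) (use p in \<open>auto simp: sub_def map_idI\<close>)
qed

text \<open>\<open>D B n\<close> consists of the \<open>B\<close>-definable subsets of \<open>\<Omega>\<^sup>n\<close>, \<open>G\<close> of the automorphisms, and \<open>sm\<close> singles out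
  the small sets. Global types are represented by ultrafilters on tuples: \<open>iu\<close> stands for invariant types,
  \<open>coh\<close> for coheirs, and \<open>rz U B n\<close> is the set of realizations of \<open>U\<close> over \<open>B\<close>.\<close>

locale monster_structure =
  fixes \<Omega> :: "'a set" and D :: "'a set \<Rightarrow> nat \<Rightarrow> 'a list set set"
    and G :: "('a \<Rightarrow> 'a) set" and sm :: "'a set \<Rightarrow> bool"
  assumes D_sub: "R \<in> D B n \<Longrightarrow> R \<subseteq> tpl \<Omega> n"
    and D_full: "tpl \<Omega> n \<in> D B n"
    and D_compl: "R \<in> D B n \<Longrightarrow> tpl \<Omega> n - R \<in> D B n"
    and D_Int: "R \<in> D B n \<Longrightarrow> S \<in> D B n \<Longrightarrow> R \<inter> S \<in> D B n"
    and D_reindex: "R \<in> D B k \<Longrightarrow> length I = k \<Longrightarrow> set I \<subseteq> {..<n} \<Longrightarrow>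
          {g \<in> tpl \<Omega> n. sub g I \<in> R} \<in> D B n"
    and D_eq: "i < n \<Longrightarrow> j < n \<Longrightarrow> {g \<in> tpl \<Omega> n. g ! i = g ! j} \<in> D B n"
    and D_proj: "R \<in> D B (n + k) \<Longrightarrow> {g \<in> tpl \<Omega> n. \<exists>h\<in>tpl \<Omega> k. g @ h \<in> R} \<in> D B n"
    and D_mono: "B \<subseteq> B' \<Longrightarrow> R \<in> D B n \<Longrightarrow> R \<in> D B' n"
    and D_param: "R \<in> D B (n + k) \<Longrightarrow> m \<in> tpl B k \<Longrightarrow> m \<in> tpl \<Omega> k \<Longrightarrow>
          {g \<in> tpl \<Omega> n. g @ m \<in> R} \<in> D B n"
    and D_paramE: "R \<in> D (B \<union> A) n \<Longrightarrow>
          \<exists>k m R'. m \<in> tpl A k \<and> m \<in> tpl \<Omega> k \<and> R' \<in> D B (n + k) \<and> R = {g \<in> tpl \<Omega> n. g @ m \<in> R'}"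
    and sm_sub: "sm B \<Longrightarrow> B \<subseteq> \<Omega>"
    and sm_Un: "sm B \<Longrightarrow> finite A \<Longrightarrow> A \<subseteq> \<Omega> \<Longrightarrow> sm (B \<union> A)"
    and sm_closed: "sm B \<Longrightarrow> \<exists>B'. B \<subseteq> B' \<and> sm B' \<and> (\<forall>n. \<forall>R\<in>D B' n. R \<noteq> {} \<longrightarrow> R \<inter> tpl B' n \<noteq> {})"
    and sat: "sm B \<Longrightarrow> F \<subseteq> D B n \<Longrightarrow>
          (\<And>F0. finite F0 \<Longrightarrow> F0 \<subseteq> F \<Longrightarrow> \<exists>g\<in>tpl \<Omega> n. \<forall>R\<in>F0. g \<in> R) \<Longrightarrow>
          \<exists>g\<in>tpl \<Omega> n. \<forall>R\<in>F. g \<in> R"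
    and hom: "sm B \<Longrightarrow> g \<in> tpl \<Omega> n \<Longrightarrow> g' \<in> tpl \<Omega> n \<Longrightarrow> (\<forall>R\<in>D B n. g \<in> R \<longrightarrow> g' \<in> R) \<Longrightarrow>
          \<exists>h\<in>G. (\<forall>a\<in>B. h a = a) \<and> map h g = g'"
    and G_into: "h \<in> G \<Longrightarrow> a \<in> \<Omega> \<Longrightarrow> h a \<in> \<Omega>"
    and G_inv: "h \<in> G \<Longrightarrow> \<exists>k\<in>G. \<forall>a\<in>\<Omega>. k (h a) = a \<and> h (k a) = a"
    and G_D: "h \<in> G \<Longrightarrow> (\<forall>a\<in>B. h a = a) \<Longrightarrow> R \<in> D B n \<Longrightarrow> g \<in> tpl \<Omega> n \<Longrightarrow> map h g \<in> R \<longleftrightarrow> g \<in> R"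
    and nip: "R \<in> D \<Omega> (n + k) \<Longrightarrow> \<exists>d. vc_free d (\<lambda>u a. u @ a \<in> R) (tpl \<Omega> n) (tpl \<Omega> k)"
begin

text \<open>The Tarski-Vaught criterion, for tuples in place of single elements.\<close>

definition closed :: "'a set \<Rightarrow> bool" where
  "closed B \<longleftrightarrow> (\<forall>n. \<forall>R\<in>D B n. R \<noteq> {} \<longrightarrow> R \<inter> tpl B n \<noteq> {})"

definition GB :: "'a set \<Rightarrow> ('a \<Rightarrow> 'a) set" where
  "GB B = {h \<in> G. \<forall>a\<in>B. h a = a}"

definition teq :: "'a set \<Rightarrow> nat \<Rightarrow> 'a list \<Rightarrow> 'a list \<Rightarrow> bool" where
  "teq B n g g' \<longleftrightarrow> g \<in> tpl \<Omega> n \<and> g' \<in> tpl \<Omega> n \<and> (\<forall>R\<in>D B n. g \<in> R \<longleftrightarrow> g' \<in> R)"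

text \<open>An ultrafilter decides every definable set and so determines a global type. The last
  clause says that this type does not split over B: whether R(m, g) belongs to it depends only on
  the type of g over B.\<close>

definition iu :: "'a set \<Rightarrow> nat \<Rightarrow> 'a list filter \<Rightarrow> bool" where
  "iu B n U \<longleftrightarrow> ultra U \<and> eventually (\<lambda>m. m \<in> tpl \<Omega> n) U \<and>
     (\<forall>k g g' R. teq B k g g' \<longrightarrow> R \<in> D B (n + k) \<longrightarrow>
        eventually (\<lambda>m. m @ g \<in> R) U \<longrightarrow> eventually (\<lambda>m. m @ g' \<in> R) U)"

definition coh :: "'a set \<Rightarrow> nat \<Rightarrow> 'a list filter \<Rightarrow> bool" where
  "coh B n U \<longleftrightarrow> ultra U \<and> eventually (\<lambda>m. m \<in> tpl B n) U"

definition rz :: "'a list filter \<Rightarrow> 'a set \<Rightarrow> nat \<Rightarrow> 'a list set" where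
  "rz U B n = {c \<in> tpl \<Omega> n. \<forall>R\<in>D B n. eventually (\<lambda>m. m \<in> R) U \<longrightarrow> c \<in> R}"

section \<open>Automorphisms over B and types over B\<close>

lemma GB_inv:
  assumes "h \<in> GB B" "B \<subseteq> \<Omega>"
  obtains k where "k \<in> GB B" "\<And>a. a \<in> \<Omega> \<Longrightarrow> k (h a) = a" "\<And>a. a \<in> \<Omega> \<Longrightarrow> h (k a) = a"
proof -
  have h: "h \<in> G" "\<And>a. a \<in> B \<Longrightarrow> h a = a" using assms(1) unfolding GB_def by auto
  then obtain k where k: "k \<in> G" "\<And>a. a \<in> \<Omega> \<Longrightarrow> k (h a) = a" "\<And>a. a \<in> \<Omega> \<Longrightarrow> h (k a) = a"
    using G_inv by blast
  have "k a = a" if "a \<in> B" for a using k(2)[of a] h(2)[OF that] that assms(2) by auto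
  then show ?thesis using that k unfolding GB_def by blast
qed

lemma GB_into: "h \<in> GB B \<Longrightarrow> set x \<subseteq> \<Omega> \<Longrightarrow> set (map h x) \<subseteq> \<Omega>"
  using G_into unfolding GB_def by auto

lemma GB_tpl: "h \<in> GB B \<Longrightarrow> x \<in> tpl \<Omega> n \<Longrightarrow> map h x \<in> tpl \<Omega> n"
  using GB_into unfolding tpl_def by simp

lemma GB_D: "h \<in> GB B \<Longrightarrow> R \<in> D B n \<Longrightarrow> g \<in> tpl \<Omega> n \<Longrightarrow> map h g \<in> R \<longleftrightarrow> g \<in> R"
  unfolding GB_def by (rule G_D) auto

lemma teq_sym: "teq B n g g' \<Longrightarrow> teq B n g' g"
  unfolding teq_def by auto

lemma teq_trans: "teq B n g g' \<Longrightarrow> teq B n g' g'' \<Longrightarrow> teq B n g g''"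
  unfolding teq_def by auto

lemma teq_refl: "g \<in> tpl \<Omega> n \<Longrightarrow> teq B n g g"
  unfolding teq_def by auto

lemma teq_Nil: "teq B 0 [] []"
  by (rule teq_refl) (simp add: tpl_def)

lemma teq_GB: "h \<in> GB B \<Longrightarrow> g \<in> tpl \<Omega> n \<Longrightarrow> teq B n g (map h g)"
  unfolding teq_def using GB_D GB_tpl by blast

lemma ex_GB:
  assumes "sm B" "teq B n g g'"
  obtains h where "h \<in> GB B" "map h g = g'"
proof -
  have "g \<in> tpl \<Omega> n" "g' \<in> tpl \<Omega> n" "\<forall>R\<in>D B n. g \<in> R \<longrightarrow> g' \<in> R"
    using assms(2) unfolding teq_def by auto
  from hom[OF assms(1) this] show ?thesis using that unfolding GB_def by blast
qed

section \<open>Further closure properties of definable sets\<close>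

lemma D_Inter:
  assumes "finite F" "F \<subseteq> D B n"
  shows "{g \<in> tpl \<Omega> n. \<forall>R\<in>F. g \<in> R} \<in> D B n"
  using assms
proof (induction F)
  case empty
  then show ?case using D_full by simp
next
  case (insert R F)
  have "{g \<in> tpl \<Omega> n. \<forall>S\<in>insert R F. g \<in> S} = R \<inter> {g \<in> tpl \<Omega> n. \<forall>S\<in>F. g \<in> S}"
    using insert.prems D_sub[of R B n] by auto
  then show ?case using insert D_Int by auto
qed

lemma D_param_front:
  assumes "R \<in> D B (n + k)" "m \<in> tpl B n" "B \<subseteq> \<Omega>"
  shows "{z \<in> tpl \<Omega> k. m @ z \<in> R} \<in> D B k"
proof -
  have mO: "m \<in> tpl \<Omega> n" using assms(2,3) tpl_mono by blast
  let ?I = "[k..<k+n] @ [0..<k]"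
  have "{z \<in> tpl \<Omega> (k + n). sub z ?I \<in> R} \<in> D B (k + n)"
    by (rule D_reindex[OF assms(1)]) auto
  from D_param[OF this assms(2) mO]
  have "{g \<in> tpl \<Omega> k. g @ m \<in> {z \<in> tpl \<Omega> (k + n). sub z ?I \<in> R}} \<in> D B k" .
  moreover have "g @ m \<in> {z \<in> tpl \<Omega> (k + n). sub z ?I \<in> R} \<longleftrightarrow> m @ g \<in> R" if "g \<in> tpl \<Omega> k" for g
  proof -
    have "length g = k" "length m = n" using that mO unfolding tpl_def by auto
    then have "sub (g @ m) ?I = m @ g"
      by (simp only: sub_append sub_append_left sub_append_right)
    then show ?thesis using tpl_append[OF that mO] by simp
  qed
  ultimately show ?thesis by (smt (verit) Collect_cong mem_Collect_eq)
qed

lemma D_proj_front: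
  assumes "R \<in> D B (k + n)"
  shows "{g \<in> tpl \<Omega> n. \<exists>h\<in>tpl \<Omega> k. h @ g \<in> R} \<in> D B n"
proof -
  let ?I = "[n..<n+k] @ [0..<n]"
  have sub: "sub (g @ h) ?I = h @ g" if "g \<in> tpl \<Omega> n" "h \<in> tpl \<Omega> k" for g h
  proof -
    have "length g = n" "length h = k" using that unfolding tpl_def by auto
    then show ?thesis by (simp only: sub_append sub_append_left sub_append_right)
  qed
  have "{g \<in> tpl \<Omega> n. \<exists>h\<in>tpl \<Omega> k. g @ h \<in> {z \<in> tpl \<Omega> (n + k). sub z ?I \<in> R}} \<in> D B n"
    by (rule D_proj, rule D_reindex[OF assms]) auto
  moreover have "{g \<in> tpl \<Omega> n. \<exists>h\<in>tpl \<Omega> k. g @ h \<in> {z \<in> tpl \<Omega> (n + k). sub z ?I \<in> R}}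
      = {g \<in> tpl \<Omega> n. \<exists>h\<in>tpl \<Omega> k. h @ g \<in> R}"
    by (intro Collect_cong conj_cong refl bex_cong) (simp add: sub tpl_append)
  ultimately show ?thesis by simp
qed

lemma D_sub_eq:
  assumes "set I \<subseteq> {..<n}" "set J \<subseteq> {..<n}" "length I = length J"
  shows "{g \<in> tpl \<Omega> n. sub g I = sub g J} \<in> D B n"
proof -
  let ?F = "(\<lambda>i. {g \<in> tpl \<Omega> n. g ! (I ! i) = g ! (J ! i)}) ` {..<length I}"
  have "?F \<subseteq> D B n"
    using assms by (auto intro!: D_eq simp: subset_iff)
  then have "{g \<in> tpl \<Omega> n. \<forall>R\<in>?F. g \<in> R} \<in> D B n" by (intro D_Inter) auto
  moreover have "{g \<in> tpl \<Omega> n. \<forall>R\<in>?F. g \<in> R} = {g \<in> tpl \<Omega> n. sub g I = sub g J}"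
    unfolding sub_def list_eq_iff_nth_eq using assms(3) by auto
  ultimately show ?thesis by simp
qed

section \<open>Realizations of ultrafilters\<close>

lemma rz_tpl: "c \<in> rz U B n \<Longrightarrow> c \<in> tpl \<Omega> n"
  unfolding rz_def by blast

lemma rz_mono: "B \<subseteq> B' \<Longrightarrow> rz U B' n \<subseteq> rz U B n"
  unfolding rz_def using D_mono by blast

lemma rz_iff:
  assumes "ultra U" "eventually (\<lambda>m. m \<in> tpl \<Omega> n) U" "c \<in> rz U B n" "R \<in> D B n"
  shows "c \<in> R \<longleftrightarrow> eventually (\<lambda>m. m \<in> R) U"
proof
  assume c: "c \<in> R"
  show "eventually (\<lambda>m. m \<in> R) U"
  proof (rule ccontr)
    assume "\<not> ?thesis"
    then have "eventually (\<lambda>m. m \<notin> R) U" using ultra_not_iff[OF assms(1)] by simp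
    then have "eventually (\<lambda>m. m \<in> tpl \<Omega> n - R) U" using assms(2) by eventually_elim simp
    then have "c \<in> tpl \<Omega> n - R" using assms(3) D_compl[OF assms(4)] unfolding rz_def by blast
    then show False using c by simp
  qed
qed (use assms in \<open>auto simp: rz_def\<close>)

lemma rz_ex:
  assumes "sm B" "ultra U" "eventually (\<lambda>m. m \<in> tpl \<Omega> n) U"
  shows "\<exists>c. c \<in> rz U B n"
proof -
  let ?F = "{R \<in> D B n. eventually (\<lambda>m. m \<in> R) U}"
  have "\<exists>g\<in>tpl \<Omega> n. \<forall>R\<in>F0. g \<in> R" if F0: "finite F0" "F0 \<subseteq> ?F" for F0
  proof -
    have "eventually (\<lambda>m. \<forall>R\<in>F0. m \<in> R) U"
      using F0 by (intro eventually_ball_finite) auto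
    then have "eventually (\<lambda>m. m \<in> tpl \<Omega> n \<and> (\<forall>R\<in>F0. m \<in> R)) U"
      using assms(3) by eventually_elim simp
    moreover have "U \<noteq> bot" using assms(2) unfolding ultra_def by simp
    ultimately obtain m where "m \<in> tpl \<Omega> n" "\<forall>R\<in>F0. m \<in> R"
      using eventually_happens'[of U] by blast
    then show ?thesis by blast
  qed
  then obtain g where "g \<in> tpl \<Omega> n" "\<forall>R\<in>?F. g \<in> R"
    using sat[OF assms(1), of ?F n] by blast
  then show ?thesis unfolding rz_def by blast
qed

lemma rz_append:
  assumes "ultra U" "eventually (\<lambda>m. m \<in> tpl \<Omega> n) U" "c \<in> rz U (B \<union> set g) n"
    and "R \<in> D B (n + k)" "g \<in> tpl \<Omega> k"
  shows "c @ g \<in> R \<longleftrightarrow> eventually (\<lambda>m. m @ g \<in> R) U"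
proof -
  have "g \<in> tpl (B \<union> set g) k" using assms(5) unfolding tpl_def by auto
  moreover have "R \<in> D (B \<union> set g) (n + k)" using assms(4) D_mono by blast
  ultimately have *: "{m \<in> tpl \<Omega> n. m @ g \<in> R} \<in> D (B \<union> set g) n" using assms(5) D_param by blast
  have "c @ g \<in> R \<longleftrightarrow> c \<in> {m \<in> tpl \<Omega> n. m @ g \<in> R}" using rz_tpl[OF assms(3)] by simp
  also have "\<dots> \<longleftrightarrow> eventually (\<lambda>m. m \<in> {m \<in> tpl \<Omega> n. m @ g \<in> R}) U"
    by (rule rz_iff[OF assms(1,2,3) *])
  also have "\<dots> \<longleftrightarrow> eventually (\<lambda>m. m @ g \<in> R) U"
    using assms(2) by (simp add: eventually_conj_iff)
  finally show ?thesis .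
qed

text \<open>A set definable over B and g uses finitely many entries of g in some order and with
  repetitions. By reindexing it becomes a relation over B whose last arguments are the whole tuple
  g, so these are the only ones to be tested.\<close>

lemma rz_UnI:
  assumes "c \<in> tpl \<Omega> n" "g \<in> tpl \<Omega> k" "eventually (\<lambda>m. m \<in> tpl \<Omega> n) U"
    and *: "\<And>R. R \<in> D B (n + k) \<Longrightarrow> eventually (\<lambda>m. m @ g \<in> R) U \<Longrightarrow> c @ g \<in> R"
  shows "c \<in> rz U (B \<union> set g) n"
  unfolding rz_def
proof (intro CollectI conjI ballI impI assms(1))
  fix R assume R: "R \<in> D (B \<union> set g) n" "eventually (\<lambda>m. m \<in> R) U"
  obtain p m R' where m: "m \<in> tpl (set g) p" "m \<in> tpl \<Omega> p" "R' \<in> D B (n + p)" "R = {g \<in> tpl \<Omega> n. g @ m \<in> R'}"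
    using D_paramE[OF R(1)] by blast
  obtain I where I: "set I \<subseteq> {..<length g}" "length I = p" "sub g I = m"
    using ex_sub[of m g] m(1) unfolding tpl_def by auto
  have lg: "length g = k" using assms(2) unfolding tpl_def by simp
  let ?J = "[0..<n] @ map (\<lambda>i. n + i) I"
  have sub: "sub (y @ g) ?J = y @ m" if "length y = n" for y
  proof -
    have "sub (y @ g) (map (\<lambda>i. n + i) I) = m"
      unfolding I(3)[symmetric] sub_def using that by (simp add: nth_append)
    then show ?thesis using that by (simp only: sub_append sub_append_left)
  qed
  let ?S = "{z \<in> tpl \<Omega> (n + k). sub z ?J \<in> R'}"
  have S: "?S \<in> D B (n + k)"
    by (rule D_reindex[OF m(3)]) (use I lg in auto)
  have "eventually (\<lambda>y. y @ g \<in> ?S) U"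
    using R(2) by eventually_elim (use sub m(4) assms(2) tpl_append in \<open>auto simp: tpl_def\<close>)
  from *[OF S this] show "c \<in> R" using sub[of c] assms(1) m(4) by (auto simp: tpl_def)
qed

lemma rz_teq:
  assumes "ultra U" "eventually (\<lambda>m. m \<in> tpl \<Omega> n) U" "c \<in> rz U B n" "c' \<in> rz U B n"
  shows "teq B n c c'"
  unfolding teq_def using rz_iff[OF assms(1,2)] assms(3,4) rz_tpl by blast

text \<open>Whether the tuple extended by a realization lies in R is decided by U
  (\<open>rz_append\<close>), and by invariance this decision depends only on the type of the
  parameters.\<close>

lemma rz_teq_append:
  assumes "iu B n U" "c \<in> rz U (B \<union> set g) n" "c' \<in> rz U (B \<union> set g') n" "teq B k g g'"
  shows "teq B (n + k) (c @ g) (c' @ g')"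
proof -
  have U: "ultra U" "eventually (\<lambda>m. m \<in> tpl \<Omega> n) U" using assms(1) unfolding iu_def by auto
  have g: "g \<in> tpl \<Omega> k" "g' \<in> tpl \<Omega> k" using assms(4) unfolding teq_def by auto
  have "c @ g \<in> R \<longleftrightarrow> c' @ g' \<in> R" if R: "R \<in> D B (n + k)" for R
    unfolding rz_append[OF U assms(2) R g(1)] rz_append[OF U assms(3) R g(2)]
    using assms(1,4) teq_sym[OF assms(4)] R unfolding iu_def by blast
  then show ?thesis unfolding teq_def using g rz_tpl[OF assms(2)] rz_tpl[OF assms(3)] tpl_append by blast
qed

lemma rz_of_teq:
  assumes "c \<in> rz U B n" "teq B n c c'"
  shows "c' \<in> rz U B n"
  using assms unfolding rz_def teq_def by blast

lemma coh_tpl: "coh B n U \<Longrightarrow> B \<subseteq> \<Omega> \<Longrightarrow> eventually (\<lambda>m. m \<in> tpl \<Omega> n) U"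
  unfolding coh_def using tpl_mono by (blast intro: eventually_mono)

text \<open>For m in B, the condition R(m, g) on g is definable over B and so depends only on the
  type of g; and U concentrates on such m.\<close>

lemma coh_iu:
  assumes "coh B n U" "B \<subseteq> \<Omega>"
  shows "iu B n U"
proof -
  have "eventually (\<lambda>m. m @ g' \<in> R) U"
    if g: "teq B k g g'" and R: "R \<in> D B (n + k)" and ev: "eventually (\<lambda>m. m @ g \<in> R) U" for k g g' R
  proof -
    have "eventually (\<lambda>m. m \<in> tpl B n) U" using assms(1) unfolding coh_def by simp
    with ev show ?thesis
    proof eventually_elim
      case (elim m)
      have S: "{z \<in> tpl \<Omega> k. m @ z \<in> R} \<in> D B k" by (rule D_param_front[OF R elim(2) assms(2)])
      have "g \<in> tpl \<Omega> k" "\<And>S. S \<in> D B k \<Longrightarrow> g \<in> S \<longleftrightarrow> g' \<in> S" using g unfolding teq_def by auto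
      with this(2)[OF S] elim(1) show ?case by simp
    qed
  qed
  moreover have "ultra U" using assms(1) unfolding coh_def by simp
  ultimately show ?thesis using coh_tpl[OF assms] unfolding iu_def by simp
qed

text \<open>A Morley sequence is listed in the order of construction, whereas the tuple \<open>g\<close> of parameters collected
  so far grows at the front, matching products of ultrafilters.\<close>

fun morl :: "'a set \<Rightarrow> 'a list \<Rightarrow> (nat \<times> 'a list filter) list \<Rightarrow> 'a list list \<Rightarrow> bool" where
  "morl B g [] [] = True"
| "morl B g ((n, U) # us) (s # ss) = (s \<in> rz U (B \<union> set g) n \<and> morl B (s @ g) us ss)"
| "morl B g _ _ = False"

definition iul :: "'a set \<Rightarrow> (nat \<times> 'a list filter) list \<Rightarrow> bool" where
  "iul B us \<longleftrightarrow> (\<forall>(n, U)\<in>set us. iu B n U)"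

lemma iul_simps [simp]:
  "iul B []" "iul B ((n, U) # us) \<longleftrightarrow> iu B n U \<and> iul B us" "iul B (us @ vs) \<longleftrightarrow> iul B us \<and> iul B vs"
  unfolding iul_def by auto

lemma iul_replicate: "iu B n U \<Longrightarrow> iul B (replicate k (n, U))"
  unfolding iul_def by auto

lemma morl_length: "morl B g us ss \<Longrightarrow> length ss = length us"
  by (induction B g us ss rule: morl.induct) auto

lemma morl_mono: "morl B g us ss \<Longrightarrow> set g' \<subseteq> set g \<Longrightarrow> morl B g' us ss"
proof (induction B g us ss arbitrary: g' rule: morl.induct)
  case (2 B g n U us s ss)
  have "rz U (B \<union> set g) n \<subseteq> rz U (B \<union> set g') n" by (rule rz_mono) (use 2(3) in auto)
  moreover have "morl B (s @ g') us ss" by (rule 2(1)) (use 2(2,3) in auto)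
  ultimately show ?case using 2(2) by (simp add: subset_iff)
qed auto

lemma morl_sub: "morl B g us ss \<Longrightarrow> s \<in> set ss \<Longrightarrow> set s \<subseteq> \<Omega>"
  by (induction B g us ss rule: morl.induct) (auto dest!: rz_tpl simp: tpl_def)

lemma morl_append:
  "length us1 = length ss1 \<Longrightarrow>
   morl B g (us1 @ us2) (ss1 @ ss2) \<longleftrightarrow> morl B g us1 ss1 \<and> morl B (concat (rev ss1) @ g) us2 ss2"
proof (induction us1 ss1 arbitrary: g rule: list_induct2)
  case (Cons x xs y ys)
  then show ?case by (cases x) auto
qed simp

lemma morl_ex:
  assumes "sm B" "set g \<subseteq> \<Omega>" "iul B us"
  shows "\<exists>ss. morl B g us ss"
  using assms(2,3)
proof (induction us arbitrary: g)
  case Nil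
  then show ?case by (intro exI[of _ "[]"]) simp
next
  case (Cons u us)
  obtain n U where u: "u = (n, U)" by (cases u)
  have iu: "iu B n U" "iul B us" using Cons.prems u by auto
  have "sm (B \<union> set g)" using sm_Un[OF assms(1)] Cons.prems by simp
  then obtain s where s: "s \<in> rz U (B \<union> set g) n"
    using rz_ex iu(1) unfolding iu_def by blast
  then have "set (s @ g) \<subseteq> \<Omega>" using rz_tpl Cons.prems(1) unfolding tpl_def by fastforce
  then obtain ss where "morl B (s @ g) us ss" using Cons.IH iu(2) by blast
  then show ?case using s u by (intro exI[of _ "s # ss"]) simp
qed

text \<open>Morley sequences are unique up to conjugacy. By \<open>rz_teq_append\<close> the
  accumulated tuples keep the same type over B at each step, and a single automorphism chosen at the
  end matches all terms at once.\<close>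

lemma morl_conj:
  assumes "sm B" "iul B us" "teq B k g g'" "morl B g us ss" "morl B g' us ss'"
  shows "\<exists>h\<in>GB B. map h g = g' \<and> map (map h) ss = ss'"
  using assms(2-5)
proof (induction us arbitrary: k g g' ss ss')
  case Nil
  have "ss = []" "ss' = []" using Nil.prems(3,4) by (auto dest: morl_length)
  moreover obtain h where "h \<in> GB B" "map h g = g'" using ex_GB[OF assms(1) Nil.prems(2)] by blast
  ultimately show ?case by auto
next
  case (Cons u us)
  obtain n U where u: "u = (n, U)" by (cases u)
  obtain s r where ss: "ss = s # r" using Cons.prems(3) u by (cases ss) auto
  obtain s' r' where ss': "ss' = s' # r'" using Cons.prems(4) u by (cases ss') auto
  have s: "s \<in> rz U (B \<union> set g) n" "morl B (s @ g) us r" using Cons.prems(3) u ss by auto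
  have s': "s' \<in> rz U (B \<union> set g') n" "morl B (s' @ g') us r'" using Cons.prems(4) u ss' by auto
  have iu: "iu B n U" "iul B us" using Cons.prems(1) u by auto
  have "teq B (n + k) (s @ g) (s' @ g')" by (rule rz_teq_append[OF iu(1) s(1) s'(1) Cons.prems(2)])
  from Cons.IH[OF iu(2) this s(2) s'(2)]
  obtain h where h: "h \<in> GB B" "map h (s @ g) = s' @ g'" "map (map h) r = r'" by blast
  have "length s = length s'" using rz_tpl[OF s(1)] rz_tpl[OF s'(1)] unfolding tpl_def by simp
  with h(2) have "map h s = s'" "map h g = g'" by auto
  then show ?case using h ss ss' by (intro bexI[of _ h]) auto
qed

text \<open>For a constant list of types, the condition on a term involves the earlier terms only as
  a set of parameters; in this form it visibly passes to subsequences.\<close>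

lemma morl_replicate_iff:
  "morl B g (replicate k (n, U)) ss \<longleftrightarrow>
     length ss = k \<and> (\<forall>i<k. ss ! i \<in> rz U (B \<union> set g \<union> \<Union> (set ` set (take i ss))) n)"
proof (induction k arbitrary: g ss)
  case 0
  then show ?case by (cases ss) auto
next
  case (Suc k)
  show ?case
  proof (cases ss)
    case (Cons s r)
    have *: "B \<union> set (s @ g) \<union> \<Union> (set ` set (take i r)) = B \<union> set g \<union> \<Union> (set ` set (take (Suc i) ss))" for i
      unfolding Cons by auto
    have "morl B g (replicate (Suc k) (n, U)) ss \<longleftrightarrow> s \<in> rz U (B \<union> set g) n \<and> morl B (s @ g) (replicate k (n, U)) r"
      unfolding Cons by simp
    also have "\<dots> \<longleftrightarrow> s \<in> rz U (B \<union> set g) n \<and> length r = k \<and>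
       (\<forall>i<k. ss ! Suc i \<in> rz U (B \<union> set g \<union> \<Union> (set ` set (take (Suc i) ss))) n)"
      unfolding Suc.IH * by (simp add: Cons)
    also have "\<dots> \<longleftrightarrow> length ss = Suc k \<and> (\<forall>i<Suc k. ss ! i \<in> rz U (B \<union> set g \<union> \<Union> (set ` set (take i ss))) n)"
      by (auto simp: Cons All_less_Suc2)
    finally show ?thesis .
  qed simp
qed

end

section \<open>Invariant filters and Morley sequences\<close>

context monster_structure
begin

definition equi :: "'a set \<Rightarrow> 'a list set \<Rightarrow> ('a list \<Rightarrow> 'a list \<Rightarrow> bool) \<Rightarrow> bool" where
  "equi B X \<delta> \<longleftrightarrow> (\<forall>h\<in>GB B. \<forall>x\<in>X. \<forall>u. set u \<subseteq> \<Omega> \<longrightarrow> \<delta> x u \<longrightarrow> \<delta> (map h x) (map h u))"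

definition points :: "'a set \<Rightarrow> 'a list set \<Rightarrow> bool" where
  "points B X \<longleftrightarrow> (\<forall>x\<in>X. set x \<subseteq> \<Omega>) \<and> (\<forall>h\<in>GB B. \<forall>x\<in>X. map h x \<in> X)"

definition finv :: "'a set \<Rightarrow> 'a list set \<Rightarrow> 'a list filter \<Rightarrow> bool" where
  "finv B X \<Xi> \<longleftrightarrow> points B X \<and> eventually (\<lambda>x. x \<in> X) \<Xi> \<and>
     (\<forall>h\<in>GB B. \<forall>P. eventually P \<Xi> \<longrightarrow> eventually (\<lambda>x. P (map h x)) \<Xi>)"

lemma map_inverse: "(\<And>a. a \<in> \<Omega> \<Longrightarrow> k (h a) = a) \<Longrightarrow> set x \<subseteq> \<Omega> \<Longrightarrow> map k (map h x) = x"
  by (induction x) auto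

lemma points_tpl: "points B (tpl \<Omega> n)"
  unfolding points_def using GB_tpl unfolding tpl_def by auto

lemma equi_iff:
  assumes "equi B X \<delta>" "points B X" "B \<subseteq> \<Omega>" "h \<in> GB B" "x \<in> X" "set u \<subseteq> \<Omega>"
  shows "\<delta> (map h x) (map h u) \<longleftrightarrow> \<delta> x u"
proof
  obtain k where k: "k \<in> GB B" "\<And>a. a \<in> \<Omega> \<Longrightarrow> k (h a) = a" using GB_inv[OF assms(4,3)] by metis
  assume "\<delta> (map h x) (map h u)"
  moreover have "map h x \<in> X" "set (map h u) \<subseteq> \<Omega>"
    using assms GB_into[OF assms(4,6)] unfolding points_def by auto
  ultimately have "\<delta> (map k (map h x)) (map k (map h u))"
    using assms(1) k(1) unfolding equi_def by blast
  moreover have "set x \<subseteq> \<Omega>" using assms(2,5) unfolding points_def by blast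
  ultimately show "\<delta> x u" using map_inverse[of k h, OF k(2)] assms(6) by simp
next
  assume "\<delta> x u"
  then show "\<delta> (map h x) (map h u)" using assms(1,4,5,6) unfolding equi_def by blast
qed

lemma finv_transport:
  assumes "finv B X \<Xi>" "B \<subseteq> \<Omega>" "h \<in> GB B" "eventually Q \<Xi>"
    and Q: "\<And>x. x \<in> X \<Longrightarrow> Q x \<Longrightarrow> Q' (map h x)"
  shows "eventually Q' \<Xi>"
proof -
  obtain k where k: "k \<in> GB B" "\<And>a. a \<in> \<Omega> \<Longrightarrow> h (k a) = a" using GB_inv[OF assms(3,2)] by metis
  have pts: "\<And>x. x \<in> X \<Longrightarrow> set x \<subseteq> \<Omega>" "\<And>x. x \<in> X \<Longrightarrow> map k x \<in> X"
    using assms(1) k(1) unfolding finv_def points_def by auto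
  have "eventually (\<lambda>x. x \<in> X) \<Xi>" "eventually (\<lambda>x. Q (map k x)) \<Xi>"
    using assms(1,4) k(1) unfolding finv_def by blast+
  then show ?thesis
  proof eventually_elim
    case (elim x)
    have "Q' (map h (map k x))" by (rule Q) (use elim pts in auto)
    then show ?case using map_inverse[of h k, OF k(2)] pts(1)[OF elim(1)] by simp
  qed
qed

text \<open>Choosing one point from each of \<open>K\<close> consecutive pairs of a Morley sequence always yields the
  same type, so a \<open>\<delta>\<close> that separates each pair would shatter \<open>K\<close> points.\<close>

lemma alternation:
  assumes "sm B" "iu B n U" "morl B [] (replicate (2 * K) (n, U)) us"
    and "equi B X \<delta>" "points B X" "vc_free K (\<lambda>u x. \<delta> x u) (tpl \<Omega> n) X" "x \<in> X"
  shows "\<exists>j<K. \<delta> x (us ! (2 * j)) = \<delta> x (us ! (2 * j + 1))"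
proof (rule ccontr)
  assume "\<not> ?thesis"
  then have alt: "\<And>j. j < K \<Longrightarrow> \<delta> x (us ! (2 * j)) \<noteq> \<delta> x (us ! (2 * j + 1))" by auto
  have len: "length us = 2 * K"
    and us: "\<And>i. i < 2 * K \<Longrightarrow> us ! i \<in> rz U (B \<union> set [] \<union> \<Union> (set ` set (take i us))) n"
    using assms(3) unfolding morl_replicate_iff by auto
  \<comment> \<open>From each pair take the term at which x has the value prescribed by S; there is
    one because the two values differ. Indices from later pairs are larger, so the chosen terms
    again form a Morley sequence.\<close>
  define f where "f S j = (if \<delta> x (us ! (2 * j)) = (j \<in> S) then 2 * j else 2 * j + 1)" for S j
  define v where "v S = map (\<lambda>j. us ! f S j) [0..<K]" for S
  have v_len: "length (v S) = K" for S unfolding v_def by simp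
  have v_nth: "v S ! j = us ! f S j" if "j < K" for S j unfolding v_def using that by simp
  have f_bounds: "2 * j \<le> f S j" "f S j \<le> 2 * j + 1" for S j unfolding f_def by auto
  have v_val: "\<delta> x (v S ! j) \<longleftrightarrow> j \<in> S" if "j < K" for S j
    using alt[OF that] v_nth[OF that] unfolding f_def by auto
  have v_morl: "morl B [] (replicate K (n, U)) (v S)" for S
    unfolding morl_replicate_iff
  proof (intro conjI allI impI v_len)
    fix i assume i: "i < K"
    have "set (take i (v S)) \<subseteq> set (take (f S i) us)"
    proof
      fix c assume "c \<in> set (take i (v S))"
      then obtain j where j: "j < i" "c = us ! f S j"
        using i v_nth by (auto simp: in_set_conv_nth v_len)
      have "f S j < f S i" "f S i < 2 * K" using f_bounds[where j=j and S=S] f_bounds[where j=i and S=S] j(1) i by linarith+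
      then show "c \<in> set (take (f S i) us)" using j len by (auto simp: in_set_conv_nth)
    qed
    then have "B \<union> set [] \<union> \<Union> (set ` set (take i (v S))) \<subseteq> B \<union> set [] \<union> \<Union> (set ` set (take (f S i) us))"
      by auto
    moreover have "f S i < 2 * K" using f_bounds[where j=i and S=S] i by linarith
    ultimately show "v S ! i \<in> rz U (B \<union> set [] \<union> \<Union> (set ` set (take i (v S)))) n"
      using us[of "f S i"] rz_mono unfolding v_nth[OF i] by blast
  qed
  have sub: "set (v S ! j) \<subseteq> \<Omega>" "v S ! j \<in> tpl \<Omega> n" if "j < K" for S j
  proof -
    have "v S ! j \<in> rz U (B \<union> set [] \<union> \<Union> (set ` set (take j (v S)))) n"
      using v_morl[of S] that unfolding morl_replicate_iff by blast
    then show "v S ! j \<in> tpl \<Omega> n" by (rule rz_tpl)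
    then show "set (v S ! j) \<subseteq> \<Omega>" unfolding tpl_def by simp
  qed
  \<comment> \<open>All the sequences \<open>v S\<close> are conjugate over B. The automorphism
    taking \<open>v S\<close> to \<open>v {}\<close> takes x to a point that realizes the pattern S
    on the fixed sequence \<open>v {}\<close>.\<close>
  have "\<exists>y\<in>X. \<forall>j<K. \<delta> y (v {} ! j) \<longleftrightarrow> j \<in> S" for S
  proof -
    obtain h where h: "h \<in> GB B" "map (map h) (v S) = v {}"
      using morl_conj[OF assms(1) iul_replicate[OF assms(2)] teq_Nil v_morl v_morl] by blast
    have "\<delta> (map h x) (v {} ! j) \<longleftrightarrow> j \<in> S" if j: "j < K" for j
    proof -
      have "v {} ! j = map h (v S ! j)" unfolding h(2)[symmetric] using j v_len by simp
      then show ?thesis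
        using equi_iff[OF assms(4,5) sm_sub[OF assms(1)] h(1) assms(7) sub(1)[OF j]] v_val[OF j] by simp
    qed
    moreover have "map h x \<in> X" using assms(5,7) h(1) unfolding points_def by blast
    ultimately show ?thesis by blast
  qed
  moreover have "\<forall>j<K. v {} ! j \<in> tpl \<Omega> n" using sub(2) by blast
  ultimately show False using assms(6) unfolding vc_free_def by blast
qed

definition equi_list :: "'a set \<Rightarrow> 'a list set \<Rightarrow> ('a list \<Rightarrow> 'a list list \<Rightarrow> bool) \<Rightarrow> bool" where
  "equi_list B X \<psi> \<longleftrightarrow> (\<forall>h\<in>GB B. \<forall>x\<in>X. \<forall>ss. (\<forall>s\<in>set ss. set s \<subseteq> \<Omega>) \<longrightarrow> \<psi> x ss \<longrightarrow> \<psi> (map h x) (map (map h) ss))"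

text \<open>Dividing along a Morley sequence of an invariant type of g over B. The type
  \<open>W\<close> and the length \<open>K\<close> may vary with \<delta>, but g is common to all
  relations to be removed; therefore the pairs treated later are first collected in one
  tuple.\<close>

definition inconsistent_along :: "'a set \<Rightarrow> 'a list set \<Rightarrow> nat \<Rightarrow> 'a list \<Rightarrow> ('a list \<Rightarrow> 'a list \<Rightarrow> bool) \<Rightarrow> bool" where
  "inconsistent_along B X k g \<delta> \<longleftrightarrow> (\<exists>W K. K > 0 \<and> iu B k W \<and> g \<in> rz W B k \<and>
     (\<forall>ss. morl B [] (replicate K (k, W)) ss \<longrightarrow> \<not> (\<exists>x\<in>X. \<forall>s\<in>set ss. \<delta> x s)))"

text \<open>Adler's vacuum cleaner lemma. The copies \<open>c\<^sub>1, \<dots>, c\<^sub>K\<^sub>-\<^sub>1\<close> of \<open>c\<close> needed to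
  remove one formula are independent from \<open>c\<close>, hence may be absorbed into the part \<open>\<psi>\<close> that is kept.\<close>

lemma vacuum:
  assumes "sm B" "finv B X \<Xi>" "g \<in> tpl \<Omega> k"
    and "\<forall>\<delta>\<in>set Ds. equi B X \<delta> \<and> inconsistent_along B X k g \<delta>"
    and "teq B k g c" "iul B us" "morl B c us ss" "equi_list B X \<psi>"
    and "eventually (\<lambda>x. \<psi> x ss \<or> (\<exists>\<delta>\<in>set Ds. \<delta> x c)) \<Xi>"
  shows "eventually (\<lambda>x. \<psi> x ss) \<Xi>"
  using assms(4-9)
proof (induction Ds arbitrary: c us ss \<psi>)
  case Nil
  then show ?case by simp
next
  case (Cons \<delta>0 Ds)
  have BO: "B \<subseteq> \<Omega>" by (rule sm_sub[OF assms(1)])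
  obtain W K where K: "K > 0" and W: "iu B k W" "g \<in> rz W B k"
    and inc: "\<And>ss. morl B [] (replicate K (k, W)) ss \<Longrightarrow> \<not> (\<exists>x\<in>X. \<forall>s\<in>set ss. \<delta>0 x s)"
    using Cons.prems(1) unfolding inconsistent_along_def by auto
  have W': "ultra W" "eventually (\<lambda>m. m \<in> tpl \<Omega> k) W" using W(1) unfolding iu_def by auto
  have cO: "set c \<subseteq> \<Omega>" using Cons.prems(2) unfolding teq_def tpl_def by auto
  obtain rs where rs: "morl B c (replicate (K - 1) (k, W)) rs"
    using morl_ex[OF assms(1) cO iul_replicate[OF W(1)]] by blast
  have rs_len: "length rs = K - 1" using morl_length[OF rs] by simp
  define cc where "cc = c # rs"
  have cc_len: "length cc = K" unfolding cc_def using rs_len K by simp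
  have "c \<in> rz W B k" using rz_of_teq[OF W(2) Cons.prems(2)] .
  moreover have "replicate K (k, W) = (k, W) # replicate (K - 1) (k, W)" using K by (cases K) auto
  ultimately have cc: "morl B [] (replicate K (k, W)) cc" unfolding cc_def using rs by simp
  have ccO: "set (concat (rev cc)) \<subseteq> \<Omega>" using morl_sub[OF cc] by auto
  \<comment> \<open>The sequence kept in \<psi> is rebuilt over all copies simultaneously, so that
    c' together with ss' is conjugate to c together with ss, for each c' in
    \<open>cc\<close>.\<close>
  obtain ss' where ss': "morl B (concat (rev cc)) us ss'" using morl_ex[OF assms(1) ccO Cons.prems(3)] by blast
  have full: "morl B [] (replicate K (k, W) @ us) (cc @ ss')"
    using cc ss' by (subst morl_append) (simp_all add: cc_len)
  have cc_teq: "teq B k g c'" if c': "c' \<in> set cc" for c'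
  proof -
    obtain i where "i < K" "c' = cc ! i" using c' cc_len by (auto simp: in_set_conv_nth)
    then have "c' \<in> rz W (B \<union> set [] \<union> \<Union> (set ` set (take i cc))) k" using cc unfolding morl_replicate_iff by blast
    then have "c' \<in> rz W B k" by (rule subsetD[OF rz_mono, rotated]) auto
    then show ?thesis by (rule rz_teq[OF W' W(2)])
  qed
  have ev1: "eventually (\<lambda>x. \<psi> x ss' \<or> (\<exists>\<delta>\<in>set (\<delta>0 # Ds). \<delta> x c')) \<Xi>" if c': "c' \<in> set cc" for c'
  proof -
    have "morl B c' us ss'" by (rule morl_mono[OF ss']) (use c' in auto)
    moreover have "teq B k c c'" using teq_trans[OF teq_sym[OF Cons.prems(2)] cc_teq[OF c']] .
    ultimately obtain h where h: "h \<in> GB B" "map h c = c'" "map (map h) ss = ss'"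
      using morl_conj[OF assms(1) Cons.prems(3) _ Cons.prems(4)] by blast
    show ?thesis
    proof (rule finv_transport[OF assms(2) BO h(1) Cons.prems(6)])
      fix x assume x: "x \<in> X" and or: "\<psi> x ss \<or> (\<exists>\<delta>\<in>set (\<delta>0 # Ds). \<delta> x c)"
      have "\<forall>s\<in>set ss. set s \<subseteq> \<Omega>" using morl_sub[OF Cons.prems(4)] by blast
      then have 1: "\<psi> x ss \<longrightarrow> \<psi> (map h x) (map (map h) ss)"
        using Cons.prems(5) h(1) x unfolding equi_list_def by simp
      have 2: "\<delta> (map h x) (map h c)" if "\<delta> \<in> set (\<delta>0 # Ds)" "\<delta> x c" for \<delta>
      proof -
        have "equi B X \<delta>" using Cons.prems(1) that(1) by blast
        then show ?thesis using h(1) x that(2) cO unfolding equi_def by simp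
      qed
      from or show "\<psi> (map h x) ss' \<or> (\<exists>\<delta>\<in>set (\<delta>0 # Ds). \<delta> (map h x) c')"
      proof
        assume "\<psi> x ss" then show ?thesis using 1 h(3) by simp
      next
        assume "\<exists>\<delta>\<in>set (\<delta>0 # Ds). \<delta> x c" then show ?thesis using 2 h(2) by metis
      qed
    qed
  qed
  have "eventually (\<lambda>x. \<forall>c'\<in>set cc. \<psi> x ss' \<or> (\<exists>\<delta>\<in>set (\<delta>0 # Ds). \<delta> x c')) \<Xi>"
    using ev1 by (intro eventually_ball_finite) auto
  moreover have "eventually (\<lambda>x. x \<in> X) \<Xi>" using assms(2) unfolding finv_def by simp
  \<comment> \<open>The K copies form a Morley sequence of W, so \<delta>0 fails at one of them. At
    that copy one of the other alternatives must hold, and \<delta>0 has disappeared at the price of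
    having several copies.\<close>
  ultimately have start: "eventually (\<lambda>x. \<psi> x ss' \<or> (\<exists>c'\<in>set (drop 0 cc). \<exists>\<delta>\<in>set Ds. \<delta> x c')) \<Xi>"
  proof eventually_elim
    case (elim x)
    obtain c' where c': "c' \<in> set cc" "\<not> \<delta>0 x c'" using inc[OF cc] elim(2) by blast
    from elim(1) c'(1) have "\<psi> x ss' \<or> (\<exists>\<delta>\<in>set (\<delta>0 # Ds). \<delta> x c')" by (rule bspec)
    with c'(2) have "\<psi> x ss' \<or> (\<exists>\<delta>\<in>set Ds. \<delta> x c')" by simp
    with c'(1) show ?case by (simp only: drop_0) blast
  qed
  \<comment> \<open>The copies are now removed one at a time. Over \<open>cc ! q\<close>, the later
    copies followed by ss' are still a Morley sequence, so the alternatives at those copies can be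
    counted as part of \<psi>' while the induction hypothesis for \<open>Ds\<close> removes the
    alternatives at \<open>cc ! q\<close>.\<close>
  have peel: "eventually (\<lambda>x. \<psi> x ss' \<or> (\<exists>c'\<in>set (drop q cc). \<exists>\<delta>\<in>set Ds. \<delta> x c')) \<Xi>" if "q \<le> K" for q
    using that
  proof (induction q)
    case 0
    show ?case by (rule start)
  next
    case (Suc q)
    have q: "q < K" using Suc.prems by simp
    define t where "t = K - Suc q"
    define \<psi>' where "\<psi>' = (\<lambda>x zs. \<psi> x (drop t zs) \<or> (\<exists>c'\<in>set (take t zs). \<exists>\<delta>\<in>set Ds. \<delta> x c'))"
    have t_len: "length (drop (Suc q) cc) = t" unfolding t_def using cc_len by simp
    have dq: "drop q cc = cc ! q # drop (Suc q) cc" using q cc_len by (simp add: Cons_nth_drop_Suc)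
    have e1: "cc @ ss' = take (Suc q) cc @ (drop (Suc q) cc @ ss')" by simp
    have e2: "replicate K (k, W) @ us = replicate (Suc q) (k, W) @ (replicate t (k, W) @ us)"
      unfolding t_def using q by (metis Suc_leI append.assoc le_add_diff_inverse replicate_add)
    have "length (replicate (Suc q) (k, W)) = length (take (Suc q) cc)" using q cc_len by simp
    from full[unfolded e1 e2 morl_append[OF this]]
    have "morl B (concat (rev (take (Suc q) cc)) @ []) (replicate t (k, W) @ us) (drop (Suc q) cc @ ss')"
      by (rule conjunct2)
    moreover have "set (cc ! q) \<subseteq> set (concat (rev (take (Suc q) cc)) @ [])"
      using q cc_len by (auto simp: take_Suc_conv_app_nth)
    ultimately have m: "morl B (cc ! q) (replicate t (k, W) @ us) (drop (Suc q) cc @ ss')"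
      by (rule morl_mono)
    have eq': "equi_list B X \<psi>'"
      unfolding equi_list_def
    proof (intro ballI allI impI)
      fix h x zs assume h: "h \<in> GB B" and x: "x \<in> X" and zs: "\<forall>s\<in>set zs. set s \<subseteq> \<Omega>" and "\<psi>' x zs"
      then consider "\<psi> x (drop t zs)" | c' \<delta> where "c' \<in> set (take t zs)" "\<delta> \<in> set Ds" "\<delta> x c'"
        unfolding \<psi>'_def by blast
      then show "\<psi>' (map h x) (map (map h) zs)"
      proof cases
        case 1
        have "\<forall>s\<in>set (drop t zs). set s \<subseteq> \<Omega>" using zs by (auto dest: in_set_dropD)
        then have "\<psi> (map h x) (map (map h) (drop t zs))"
          using Cons.prems(5) h x 1 unfolding equi_list_def by simp
        then show ?thesis unfolding \<psi>'_def by (simp add: drop_map)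
      next
        case 2
        have "set c' \<subseteq> \<Omega>" using zs 2(1) by (auto dest: in_set_takeD)
        moreover have "equi B X \<delta>" using Cons.prems(1) 2(2) by simp
        ultimately have "\<delta> (map h x) (map h c')" using h x 2(3) unfolding equi_def by simp
        moreover have "map h c' \<in> set (take t (map (map h) zs))" using 2(1) by (simp add: take_map)
        ultimately show ?thesis unfolding \<psi>'_def using 2(2) by blast
      qed
    qed
    have dt: "drop t (drop (Suc q) cc @ ss') = ss'" and tt: "take t (drop (Suc q) cc @ ss') = drop (Suc q) cc"
      using t_len by simp_all
    have IH: "eventually (\<lambda>x. \<psi> x ss' \<or> (\<exists>c'\<in>set (drop q cc). \<exists>\<delta>\<in>set Ds. \<delta> x c')) \<Xi>"
      by (rule Suc.IH[OF less_imp_le[OF q]])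
    have ev': "eventually (\<lambda>x. \<psi>' x (drop (Suc q) cc @ ss') \<or> (\<exists>\<delta>\<in>set Ds. \<delta> x (cc ! q))) \<Xi>"
      by (rule eventually_mono[OF IH]) (simp only: \<psi>'_def dt tt dq set_simps bex_simps, blast)
    have "eventually (\<lambda>x. \<psi>' x (drop (Suc q) cc @ ss')) \<Xi>"
    proof (rule Cons.IH[OF _ _ _ m eq' ev'])
      show "\<forall>\<delta>\<in>set Ds. equi B X \<delta> \<and> inconsistent_along B X k g \<delta>" using Cons.prems(1) by simp
      show "teq B k g (cc ! q)" by (rule cc_teq) (use q cc_len in simp)
      show "iul B (replicate t (k, W) @ us)" using Cons.prems(3) iul_replicate[OF W(1)] by simp
    qed
    then show ?case unfolding \<psi>'_def dt tt .
  qed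
  have ev: "eventually (\<lambda>x. \<psi> x ss') \<Xi>" using peel[of K] cc_len by simp
  have "morl B c us ss'" by (rule morl_mono[OF ss']) (simp add: cc_def)
  moreover have "teq B k c c" by (rule teq_trans[OF teq_sym[OF Cons.prems(2)] Cons.prems(2)])
  ultimately obtain h where h: "h \<in> GB B" "map (map h) ss' = ss"
    using morl_conj[OF assms(1) Cons.prems(3) _ _ Cons.prems(4)] by blast
  show ?case
  proof (rule finv_transport[OF assms(2) BO h(1) ev])
    fix x assume "x \<in> X" "\<psi> x ss'"
    moreover have "\<forall>s\<in>set ss'. set s \<subseteq> \<Omega>" using morl_sub[OF ss'] by blast
    ultimately have "\<psi> (map h x) (map (map h) ss')" using Cons.prems(5) h(1) unfolding equi_list_def by simp
    then show "\<psi> (map h x) ss" using h(2) by simp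
  qed
qed

end

section \<open>Coheirs: products, extensions and their Morley sequences\<close>

context monster_structure
begin

lemma coh_prod:
  assumes "coh B n U" "coh B k V"
  shows "coh B (k + n) (prod_filter_app V U)"
proof -
  have "ultra V" "ultra U" and ev: "eventually (\<lambda>v. v \<in> tpl B k) V" "eventually (\<lambda>u. u \<in> tpl B n) U"
    using assms unfolding coh_def by auto
  have "eventually (\<lambda>v. eventually (\<lambda>u. v @ u \<in> tpl B (k + n)) U) V"
    using ev(1)
  proof eventually_elim
    case (elim v)
    show ?case using ev(2) by eventually_elim (rule tpl_append[OF elim])
  qed
  then show ?thesis
    unfolding coh_def eventually_prod_filter_app
    using ultra_prod_filter_app[OF \<open>ultra V\<close> \<open>ultra U\<close>] by simp
qed

text \<open>V concentrates on B, and for w in B the set of all m with R(w, m) is definable over B',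
  so that u belongs to it if it is U-large. Hence R(w, u) holds for V-many w, and v realizes V over
  a set containing u.\<close>

lemma prod_realized:
  assumes "B \<subseteq> \<Omega>" "coh B n U" "coh B k V" "u \<in> rz U B' n" "v \<in> rz V (B' \<union> set u) k" "B \<subseteq> B'" "B' \<subseteq> \<Omega>"
  shows "v @ u \<in> rz (prod_filter_app V U) B' (k + n)"
  unfolding rz_def
proof (intro CollectI conjI ballI impI)
  have U: "ultra U" "eventually (\<lambda>m. m \<in> tpl \<Omega> n) U" and V: "ultra V" "eventually (\<lambda>m. m \<in> tpl \<Omega> k) V"
    using assms(1-3) coh_tpl unfolding coh_def by blast+
  have uv: "u \<in> tpl \<Omega> n" "v \<in> tpl \<Omega> k" using assms(4,5) rz_tpl by blast+
  show "v @ u \<in> tpl \<Omega> (k + n)" using uv tpl_append by blast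
  fix R assume R: "R \<in> D B' (k + n)" and ev: "eventually (\<lambda>m. m \<in> R) (prod_filter_app V U)"
  have evB: "eventually (\<lambda>w. w \<in> tpl B k) V" using assms(3) unfolding coh_def by simp
  have "eventually (\<lambda>w. w @ u \<in> R) V"
    using ev evB unfolding eventually_prod_filter_app
  proof eventually_elim
    case (elim w)
    have wB': "w \<in> tpl B' k" using elim(2) assms(6) tpl_mono by blast
    have S: "{m \<in> tpl \<Omega> n. w @ m \<in> R} \<in> D B' n" by (rule D_param_front[OF R wB' assms(7)])
    have "eventually (\<lambda>m. m \<in> {m \<in> tpl \<Omega> n. w @ m \<in> R}) U"
      using elim(1) U(2) by eventually_elim simp
    then have "u \<in> {m \<in> tpl \<Omega> n. w @ m \<in> R}" using assms(4) S unfolding rz_def by blast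
    then show ?case by simp
  qed
  then show "v @ u \<in> R" using rz_append[OF V assms(5) R uv(1)] by simp
qed

text \<open>Serves to control parameters that sit inside a longer tuple: the coheir of the part is
  prescribed and the coheir of the whole has to project to it. One needs points z of B in a given
  set of the type of g whose J-part lies in a given V-large set. That some z lies above w is a
  definable condition on w, true for V-many w in B; \<open>closed\<close> then provides z in
  B.\<close>

lemma left_extension:
  assumes "closed B" "B \<subseteq> \<Omega>" "coh B m V" "set J \<subseteq> {..<k}" "length J = m" "g \<in> tpl \<Omega> k" "sub g J \<in> rz V B m"
  shows "\<exists>W. coh B k W \<and> g \<in> rz W B k \<and> (\<forall>P. eventually P V \<longrightarrow> eventually (\<lambda>z. P (sub z J)) W)"
proof -
  have V: "ultra V" "eventually (\<lambda>w. w \<in> tpl \<Omega> m) V" "eventually (\<lambda>w. w \<in> tpl B m) V"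
    using assms(2,3) coh_tpl unfolding coh_def by auto
  \<comment> \<open>P ranges over all V-large predicates and not only the definable ones, so that W
    projects to V as an ultrafilter and not merely as a type.\<close>
  define S where "S = (\<lambda>(R, P). {z \<in> tpl B k. z \<in> R \<and> P (sub z J)})"
  define T where "T = {(R, P). R \<in> D B k \<and> g \<in> R \<and> eventually P V}"
  have Tne: "(tpl \<Omega> k, \<lambda>_. True) \<in> T" unfolding T_def using D_full assms(6) by simp
  have dir: "\<exists>x\<in>T. principal (S x) \<le> inf (principal (S a)) (principal (S b))" if "a \<in> T" "b \<in> T" for a b
  proof -
    obtain R P R' P' where ab: "a = (R, P)" "b = (R', P')" by (cases a, cases b)
    have "(R \<inter> R', \<lambda>w. P w \<and> P' w) \<in> T"
      using that unfolding ab T_def by (auto simp: D_Int eventually_conj_iff)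
    moreover have "principal (S (R \<inter> R', \<lambda>w. P w \<and> P' w)) \<le> inf (principal (S a)) (principal (S b))"
      unfolding ab S_def by auto
    ultimately show ?thesis by blast
  qed
  define F where "F = (INF x\<in>T. principal (S x))"
  have evF: "eventually Q F \<longleftrightarrow> (\<exists>x\<in>T. eventually Q (principal (S x)))" for Q
    unfolding F_def by (rule eventually_INF_base) (use Tne dir in auto)
  have "S x \<noteq> {}" if "x \<in> T" for x
  proof -
    obtain R P where x: "x = (R, P)" by (cases x)
    with that have R: "R \<in> D B k" "g \<in> R" and P: "eventually P V" unfolding T_def by auto
    define Y where "Y = {y \<in> tpl \<Omega> (k + m). sub y [0..<k] \<in> R} \<inter> {y \<in> tpl \<Omega> (k + m). sub y J = sub y [k..<k+m]}"
    have Y: "Y \<in> D B (k + m)"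
      unfolding Y_def by (intro D_Int D_reindex[OF R(1)] D_sub_eq) (use assms(4,5) in auto)
    have in_Y: "z @ w \<in> Y \<longleftrightarrow> z \<in> R \<and> sub z J = w" if "z \<in> tpl \<Omega> k" "w \<in> tpl \<Omega> m" for z w
    proof -
      have "length z = k" "length w = m" using that unfolding tpl_def by auto
      moreover have "sub (z @ w) J = sub z J"
        using assms(4) \<open>length z = k\<close> unfolding sub_def by (auto simp: nth_append subset_iff)
      ultimately show ?thesis
        unfolding Y_def using tpl_append[OF that] by (simp add: sub_append_left sub_append_right)
    qed
    have gJ: "sub g J \<in> tpl \<Omega> m" using rz_tpl[OF assms(7)] .
    let ?Q = "{w \<in> tpl \<Omega> m. \<exists>z\<in>tpl \<Omega> k. z @ w \<in> Y}"
    have "sub g J \<in> ?Q" using in_Y[OF assms(6) gJ] R(2) assms(6) gJ by blast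
    then have "eventually (\<lambda>w. w \<in> ?Q) V"
      using rz_iff[OF V(1,2) assms(7) D_proj_front[OF Y]] by simp
    with P V(3) have "eventually (\<lambda>w. P w \<and> w \<in> tpl B m \<and> w \<in> ?Q) V" by eventually_elim simp
    then obtain w where w: "P w" "w \<in> tpl B m" "w \<in> ?Q"
      using V(1) eventually_happens'[of V] unfolding ultra_def by blast
    then obtain z where z: "z \<in> tpl \<Omega> k" "z @ w \<in> Y" and wO: "w \<in> tpl \<Omega> m" by blast
    have "{z \<in> tpl \<Omega> k. z @ w \<in> Y} \<in> D B k" by (rule D_param[OF Y w(2) wO])
    moreover have "{z \<in> tpl \<Omega> k. z @ w \<in> Y} \<noteq> {}" using z by blast
    ultimately have "{z \<in> tpl \<Omega> k. z @ w \<in> Y} \<inter> tpl B k \<noteq> {}"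
      using assms(1) unfolding closed_def by simp
    then obtain z' where z': "z' \<in> tpl B k" "z' \<in> tpl \<Omega> k" "z' @ w \<in> Y" by blast
    then have "z' \<in> R" "P (sub z' J)" using in_Y[OF z'(2) wO] w(1) by auto
    then have "z' \<in> S x" using z'(1) unfolding x S_def by simp
    then show ?thesis by blast
  qed
  then have "F \<noteq> bot" unfolding trivial_limit_def evF by (auto simp: eventually_principal)
  then obtain W where W: "W \<le> F" "ultra W" using ex_ultra_le by blast
  have evW: "eventually (\<lambda>z. z \<in> S x) W" if "x \<in> T" for x
    using that evF[of "\<lambda>z. z \<in> S x"] W(1) unfolding le_filter_def by (auto simp: eventually_principal)
  have "eventually (\<lambda>z. z \<in> tpl B k) W"
    using evW[OF Tne] unfolding S_def by eventually_elim simp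
  then have coh: "coh B k W" using W(2) unfolding coh_def by simp
  have "g \<in> rz W B k"
    unfolding rz_def
  proof (intro CollectI conjI ballI impI assms(6))
    fix R assume R: "R \<in> D B k" "eventually (\<lambda>m. m \<in> R) W"
    show "g \<in> R"
    proof (rule ccontr)
      assume "g \<notin> R"
      then have "(tpl \<Omega> k - R, \<lambda>_. True) \<in> T" unfolding T_def using D_compl[OF R(1)] assms(6) by simp
      from evW[OF this] R(2) have "eventually (\<lambda>_. False) W"
        unfolding S_def by eventually_elim simp
      then show False using W(2) unfolding ultra_def trivial_limit_def by simp
    qed
  qed
  moreover have "eventually (\<lambda>z. P (sub z J)) W" if "eventually P V" for P
  proof -
    have "(tpl \<Omega> k, P) \<in> T" unfolding T_def using D_full assms(6) that by simp
    from evW[OF this] show ?thesis unfolding S_def by eventually_elim simp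
  qed
  ultimately show ?thesis using coh by blast
qed

text \<open>The extension lemma for the empty subtuple, starting from an ultrafilter concentrated on
  \<open>[]\<close>.\<close>

lemma coh_ex:
  assumes "closed B" "B \<subseteq> \<Omega>" "c \<in> tpl \<Omega> n"
  shows "\<exists>U. coh B n U \<and> c \<in> rz U B n"
proof -
  have "principal {[] :: 'a list} \<noteq> bot" by (simp add: principal_eq_bot_iff)
  then obtain V :: "'a list filter" where "V \<le> principal {[]}" and V: "ultra V"
    using ex_ultra_le by blast
  then have e: "eventually (\<lambda>w. w = []) V" unfolding le_principal by simp
  then have coh: "coh B 0 V" using V unfolding coh_def tpl_def by (auto elim!: eventually_mono)
  have "[] \<in> rz V B 0"
    unfolding rz_def
  proof (intro CollectI conjI ballI impI)
    show "[] \<in> tpl \<Omega> 0" unfolding tpl_def by simp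
    fix R assume "eventually (\<lambda>m. m \<in> R) V"
    with e have "eventually (\<lambda>m. [] \<in> R) V" by eventually_elim simp
    then show "[] \<in> R" using V unfolding ultra_def by (simp add: eventually_const_iff)
  qed
  then have "sub c [] \<in> rz V B 0" unfolding sub_def by simp
  from left_extension[OF assms(1,2) coh _ _ assms(3) this] show ?thesis by auto
qed

text \<open>The hypothesis on W concerns the ultrafilter, hence the global type, and so remains
  available over all parameters collected so far. Therefore each term of a sequence in W unfolds
  into two successive terms of a sequence in U, the I-part being the earlier one.\<close>

lemma morley_pairs:
  assumes "sm B" "coh B n U" "coh B k W" "set I \<subseteq> {..<k}" "set J \<subseteq> {..<k}" "length I = n" "length J = n"
    and proj: "\<And>P. eventually P (prod_filter_app U U) \<Longrightarrow> eventually (\<lambda>z. P (sub z (J @ I))) W"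
    and ss: "morl B [] (replicate K (k, W)) ss"
  shows "\<exists>us. morl B [] (replicate (2 * K) (n, U)) us \<and>
           (\<forall>j<K. us ! (2 * j) = sub (ss ! j) I \<and> us ! (2 * j + 1) = sub (ss ! j) J)"
proof -
  have BO: "B \<subseteq> \<Omega>" by (rule sm_sub[OF assms(1)])
  have U: "ultra U" "eventually (\<lambda>m. m \<in> tpl \<Omega> n) U" "eventually (\<lambda>m. m \<in> tpl B n) U"
    and W: "ultra W" "eventually (\<lambda>m. m \<in> tpl \<Omega> k) W"
    using assms(2,3) coh_tpl BO unfolding coh_def by auto
  have len: "length ss = K" and ss_rz: "\<And>j. j < K \<Longrightarrow> ss ! j \<in> rz W (B \<union> set [] \<union> \<Union> (set ` set (take j ss))) k"
    using ss unfolding morl_replicate_iff by auto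
  have step: "sub z I \<in> rz U B' n \<and> sub z J \<in> rz U (B' \<union> set (sub z I)) n"
    if z: "z \<in> rz W B' k" and B': "B \<subseteq> B'" "B' \<subseteq> \<Omega>" for z B'
  proof -
    have zt: "z \<in> tpl \<Omega> k" using rz_tpl[OF z] .
    have subI: "sub z I \<in> tpl \<Omega> n" and subJ: "sub z J \<in> tpl \<Omega> n" using sub_tpl[OF zt] assms(4-7) by auto
    have 1: "sub z I \<in> rz U B' n"
      unfolding rz_def
    proof (intro CollectI conjI ballI impI subI)
      fix R assume R: "R \<in> D B' n" "eventually (\<lambda>m. m \<in> R) U"
      have "eventually (\<lambda>v. eventually (\<lambda>u. drop n (v @ u) \<in> R) U) U"
        using U(2) by eventually_elim (use R(2) in \<open>simp add: tpl_def\<close>)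
      then have "eventually (\<lambda>y. drop n y \<in> R) (prod_filter_app U U)" unfolding eventually_prod_filter_app .
      then have "eventually (\<lambda>z. drop n (sub z (J @ I)) \<in> R) W" by (rule proj)
      then have "eventually (\<lambda>z. z \<in> {z \<in> tpl \<Omega> k. sub z I \<in> R}) W"
        using W(2) by eventually_elim (simp add: sub_append assms(7))
      moreover have "{z \<in> tpl \<Omega> k. sub z I \<in> R} \<in> D B' k" by (rule D_reindex[OF R(1) assms(6,4)])
      ultimately show "sub z I \<in> R" using z unfolding rz_def by blast
    qed
    have 2: "sub z J \<in> rz U (B' \<union> set (sub z I)) n"
    proof (rule rz_UnI[OF subJ subI U(2)])
      fix R assume R: "R \<in> D B' (n + n)" and ev: "eventually (\<lambda>m. m @ sub z I \<in> R) U"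
      show "sub z J @ sub z I \<in> R"
      proof (rule ccontr)
        assume neg: "sub z J @ sub z I \<notin> R"
        have S: "{z \<in> tpl \<Omega> k. sub z (J @ I) \<in> R} \<in> D B' k"
          by (rule D_reindex[OF R]) (use assms(4-7) in auto)
        have "\<not> eventually (\<lambda>y. y \<in> R) (prod_filter_app U U)"
        proof
          assume "eventually (\<lambda>y. y \<in> R) (prod_filter_app U U)"
          then have "eventually (\<lambda>z. sub z (J @ I) \<in> R) W" by (rule proj)
          then have "eventually (\<lambda>z. z \<in> {z \<in> tpl \<Omega> k. sub z (J @ I) \<in> R}) W"
            using W(2) by eventually_elim simp
          then have "z \<in> {z \<in> tpl \<Omega> k. sub z (J @ I) \<in> R}" using z S unfolding rz_def by blast
          then show False using neg by (simp add: sub_append)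
        qed
        then have "eventually (\<lambda>v. eventually (\<lambda>u. v @ u \<notin> R) U) U"
          unfolding eventually_prod_filter_app ultra_not_iff[OF U(1)] by simp
        \<comment> \<open>U concentrates on v in B. For such v the set of all m with R(v, m) is
          definable over B', so its value at \<open>sub z I\<close>, which realizes U over B',
          agrees with its value at U-many m; the two assumptions on v contradict each other.\<close>
        with ev U(3) have "eventually (\<lambda>_. False) U"
        proof eventually_elim
          case (elim v)
          have "v \<in> tpl B' n" using elim(2) tpl_mono[OF B'(1)] by blast
          then have "{m \<in> tpl \<Omega> n. v @ m \<in> R} \<in> D B' n" by (rule D_param_front[OF R _ B'(2)])
          moreover have "sub z I \<in> {m \<in> tpl \<Omega> n. v @ m \<in> R}" using elim(1) subI by simp
          ultimately have "eventually (\<lambda>m. m \<in> {m \<in> tpl \<Omega> n. v @ m \<in> R}) U"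
            using rz_iff[OF U(1,2) 1] by blast
          with elim(3) have "eventually (\<lambda>_. False) U" by eventually_elim simp
          then show ?case using U(1) unfolding ultra_def trivial_limit_def by simp
        qed
        then show False using U(1) unfolding ultra_def trivial_limit_def by simp
      qed
    qed
    show ?thesis using 1 2 by simp
  qed
  define us where "us = map (\<lambda>i. sub (ss ! (i div 2)) (if even i then I else J)) [0..<2 * K]"
  have us_len: "length us = 2 * K" unfolding us_def by simp
  have us_nth: "us ! i = sub (ss ! (i div 2)) (if even i then I else J)" if "i < 2 * K" for i
    unfolding us_def using that by simp
  have ssO: "set s \<subseteq> \<Omega>" if "s \<in> set ss" for s using morl_sub[OF ss that] .
  have ss_tpl: "ss ! j \<in> tpl \<Omega> k" if "j < K" for j using rz_tpl[OF ss_rz[OF that]] .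
  have "us ! i \<in> rz U (B \<union> set [] \<union> \<Union> (set ` set (take i us))) n" if i: "i < 2 * K" for i
  proof -
    define j where "j = i div 2"
    have j: "j < K" unfolding j_def using i by simp
    define P where "P = B \<union> set [] \<union> \<Union> (set ` set (take j ss))"
    have PO: "P \<subseteq> \<Omega>" "B \<subseteq> P" unfolding P_def using BO ssO by (auto dest: in_set_takeD)
    have st: "sub (ss ! j) I \<in> rz U P n" "sub (ss ! j) J \<in> rz U (P \<union> set (sub (ss ! j) I)) n"
      using step[OF _ PO(2,1), of "ss ! j"] ss_rz[OF j] unfolding P_def by auto
    have set_sub: "set (us ! i') \<subseteq> set (ss ! (i' div 2))" if "i' < 2 * K" for i'
    proof -
      have "length (ss ! (i' div 2)) = k" using ss_tpl[of "i' div 2"] that unfolding tpl_def by simp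
      then show ?thesis unfolding us_nth[OF that] sub_def using assms(4,5) by (auto simp: subset_iff)
    qed
    have prev: "\<Union> (set ` set (take i us)) \<subseteq> \<Union> (set ` set (take j ss)) \<union> (if even i then {} else set (sub (ss ! j) I))"
    proof
      fix a assume "a \<in> \<Union> (set ` set (take i us))"
      then obtain c where c: "c \<in> set (take i us)" "a \<in> set c" by blast
      then obtain i' where "i' < i" "c = us ! i'"
        using i us_len unfolding in_set_conv_nth[of c] by auto
      with c have i': "i' < i" "a \<in> set (us ! i')" by auto
      show "a \<in> \<Union> (set ` set (take j ss)) \<union> (if even i then {} else set (sub (ss ! j) I))"
      proof (cases "i' div 2 < j")
        case True
        have "a \<in> set (ss ! (i' div 2))" using set_sub[of i'] i' i by auto
        moreover have "ss ! (i' div 2) \<in> set (take j ss)"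
          using True j len by (auto simp: in_set_conv_nth)
        ultimately show ?thesis by blast
      next
        case False
        then have "i' = 2 * j" "odd i" using i'(1) unfolding j_def by presburger+
        then show ?thesis using i' us_nth[of i'] i by simp
      qed
    qed
    show ?thesis
    proof (cases "even i")
      case True
      then have "B \<union> set [] \<union> \<Union> (set ` set (take i us)) \<subseteq> P" using prev unfolding P_def by auto
      then have "rz U P n \<subseteq> rz U (B \<union> set [] \<union> \<Union> (set ` set (take i us))) n" by (rule rz_mono)
      then show ?thesis using st(1) us_nth[OF i] True unfolding j_def by auto
    next
      case False
      then have "B \<union> set [] \<union> \<Union> (set ` set (take i us)) \<subseteq> P \<union> set (sub (ss ! j) I)"
        using prev unfolding P_def by auto
      then have "rz U (P \<union> set (sub (ss ! j) I)) n \<subseteq> rz U (B \<union> set [] \<union> \<Union> (set ` set (take i us))) n"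
        by (rule rz_mono)
      then show ?thesis using st(2) us_nth[OF i] False unfolding j_def by auto
    qed
  qed
  then have "morl B [] (replicate (2 * K) (n, U)) us"
    unfolding morl_replicate_iff using us_len by simp
  moreover have "us ! (2 * j) = sub (ss ! j) I \<and> us ! (2 * j + 1) = sub (ss ! j) J" if "j < K" for j
    using us_nth[of "2 * j"] us_nth[of "2 * j + 1"] that by simp
  ultimately show ?thesis by blast
qed

text \<open>The difference of \<delta> at u and v is rewritten as a relation to the longer tuple g,
  since \<open>vacuum\<close> works with a single parameter tuple. The product of U with itself
  extends to a coheir W of g, and a Morley sequence of W then contains one of U in its I- and
  J-parts, along which \<delta> cannot change within every pair.\<close>

lemma inconsistent_along_pair:
  assumes "sm B" "closed B" "points B X" "g \<in> tpl \<Omega> k" "set u \<subseteq> set g" "set v \<subseteq> set g"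
    and "coh B n U" "u \<in> rz U B n" "v \<in> rz U (B \<union> set u) n"
    and "equi B X \<delta>" "vc_free K (\<lambda>u x. \<delta> x u) (tpl \<Omega> n) X"
  shows "\<exists>\<epsilon>. equi B X \<epsilon> \<and> inconsistent_along B X k g \<epsilon> \<and> (\<forall>x. \<epsilon> x g \<longleftrightarrow> \<delta> x u \<noteq> \<delta> x v)"
proof -
  have BO: "B \<subseteq> \<Omega>" by (rule sm_sub[OF assms(1)])
  have lg: "length g = k" using assms(4) unfolding tpl_def by simp
  have lu: "length u = n" "length v = n" using rz_tpl[OF assms(8)] rz_tpl[OF assms(9)] unfolding tpl_def by auto
  obtain I where I: "set I \<subseteq> {..<k}" "length I = n" "sub g I = u" using ex_sub[OF assms(5)] lg lu by metis
  obtain J where J: "set J \<subseteq> {..<k}" "length J = n" "sub g J = v" using ex_sub[OF assms(6)] lg lu by metis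
  have JI: "set (J @ I) \<subseteq> {..<k}" "length (J @ I) = n + n" using I J by auto
  have "v @ u \<in> rz (prod_filter_app U U) B (n + n)"
    by (rule prod_realized[OF BO assms(7,7,8,9) order_refl BO])
  then have "sub g (J @ I) \<in> rz (prod_filter_app U U) B (n + n)" unfolding sub_append I(3) J(3) .
  from left_extension[OF assms(2) BO coh_prod[OF assms(7,7)] JI assms(4) this]
  obtain W where W: "coh B k W" "g \<in> rz W B k"
      "\<And>P. eventually P (prod_filter_app U U) \<Longrightarrow> eventually (\<lambda>z. P (sub z (J @ I))) W" by blast
  define \<epsilon> where "\<epsilon> = (\<lambda>x z. length z = k \<and> \<delta> x (sub z I) \<noteq> \<delta> x (sub z J))"
  have "equi B X \<epsilon>"
    unfolding equi_def
  proof (intro ballI allI impI)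
    fix h x z assume h: "h \<in> GB B" and x: "x \<in> X" and z: "set z \<subseteq> \<Omega>" and e: "\<epsilon> x z"
    have lz: "length z = k" using e unfolding \<epsilon>_def by simp
    have "\<delta> (map h x) (sub (map h z) L) \<longleftrightarrow> \<delta> x (sub z L)" if L: "set L \<subseteq> {..<k}" for L
    proof -
      have "set (sub z L) \<subseteq> \<Omega>" unfolding sub_def using L z lz by (auto simp: subset_iff)
      from equi_iff[OF assms(10,3) BO h x this] show ?thesis using map_sub[of L z h] L lz by simp
    qed
    then show "\<epsilon> (map h x) (map h z)" using e I(1) J(1) unfolding \<epsilon>_def by simp
  qed
  moreover have "inconsistent_along B X k g \<epsilon>"
    unfolding inconsistent_along_def
  \<comment> \<open>K may be 0, whereas \<open>inconsistent_along\<close> asks for a positive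
    length.\<close>
  proof (intro exI[of _ W] exI[of _ "Suc K"] conjI allI impI notI)
    show "0 < Suc K" by simp
    show "iu B k W" by (rule coh_iu[OF W(1) BO])
    show "g \<in> rz W B k" by (rule W(2))
    fix ss assume ss: "morl B [] (replicate (Suc K) (k, W)) ss" and "\<exists>x\<in>X. \<forall>s\<in>set ss. \<epsilon> x s"
    then obtain x where x: "x \<in> X" "\<And>s. s \<in> set ss \<Longrightarrow> \<epsilon> x s" by blast
    have len: "length ss = Suc K" using morl_length[OF ss] by simp
    obtain us where us: "morl B [] (replicate (2 * Suc K) (n, U)) us"
        "\<And>j. j < Suc K \<Longrightarrow> us ! (2 * j) = sub (ss ! j) I \<and> us ! (2 * j + 1) = sub (ss ! j) J"
      using morley_pairs[OF assms(1,7) W(1) I(1) J(1) I(2) J(2) W(3) ss] by blast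
    have "vc_free (Suc K) (\<lambda>u x. \<delta> x u) (tpl \<Omega> n) X" by (rule vc_free_mono[OF assms(11)]) auto
    from alternation[OF assms(1) coh_iu[OF assms(7) BO] us(1) assms(10,3) this x(1)]
    obtain j where j: "j < Suc K" "\<delta> x (us ! (2 * j)) = \<delta> x (us ! (2 * j + 1))" by blast
    have "\<epsilon> x (ss ! j)" by (rule x(2)) (use j(1) len in simp)
    then show False using j us(2)[OF j(1)] unfolding \<epsilon>_def by simp
  qed
  moreover have "\<forall>x. \<epsilon> x g \<longleftrightarrow> \<delta> x u \<noteq> \<delta> x v" unfolding \<epsilon>_def using I(3) J(3) lg by simp
  ultimately show ?thesis by blast
qed

text \<open>The pairs in T have different parameters and coheirs. Once all differences are expressed
  over the concatenation g of the parameters, \<open>vacuum\<close> with the false relation as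
  \<psi> would put the empty set into the filter.\<close>

lemma invariant_filter_no_split:
  assumes "sm B" "closed B" "finv B X \<Xi>" "\<Xi> \<noteq> bot" "finite T"
    and T: "\<And>\<delta> u v. (\<delta>, u, v) \<in> T \<Longrightarrow> equi B X \<delta> \<and> (\<exists>n U K. coh B n U \<and> u \<in> rz U B n \<and>
              v \<in> rz U (B \<union> set u) n \<and> vc_free K (\<lambda>u x. \<delta> x u) (tpl \<Omega> n) X)"
  shows "\<not> eventually (\<lambda>x. \<exists>(\<delta>, u, v)\<in>T. \<delta> x u \<noteq> \<delta> x v) \<Xi>"
proof
  assume ev: "eventually (\<lambda>x. \<exists>(\<delta>, u, v)\<in>T. \<delta> x u \<noteq> \<delta> x v) \<Xi>"
  have pts: "points B X" using assms(3) unfolding finv_def by simp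
  obtain ts where ts: "set ts = T" using finite_list[OF assms(5)] by blast
  define g where "g = concat (map (\<lambda>(\<delta>, u, v). u @ v) ts)"
  have sg: "set u \<subseteq> set g" "set v \<subseteq> set g" if "(\<delta>, u, v) \<in> T" for \<delta> u v
    using that unfolding g_def ts[symmetric] by force+
  have uvO: "set u \<subseteq> \<Omega> \<and> set v \<subseteq> \<Omega>" if "(\<delta>, u, v) \<in> T" for \<delta> u v
    using T[OF that] rz_tpl unfolding tpl_def by blast
  have "set g \<subseteq> \<Omega>"
  proof
    fix a assume "a \<in> set g"
    then obtain \<delta> u v where "(\<delta>, u, v) \<in> T" "a \<in> set u \<union> set v" unfolding g_def ts[symmetric] by auto
    then show "a \<in> \<Omega>" using uvO by blast
  qed
  then have g: "g \<in> tpl \<Omega> (length g)" unfolding tpl_def by simp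
  have "\<exists>\<epsilon>. equi B X \<epsilon> \<and> inconsistent_along B X (length g) g \<epsilon> \<and>
      (\<forall>x. \<epsilon> x g \<longleftrightarrow> fst t x (fst (snd t)) \<noteq> fst t x (snd (snd t)))" if tT: "t \<in> T" for t
  proof -
    obtain \<delta> u v where t: "t = (\<delta>, u, v)" by (cases t)
    obtain n U K where "equi B X \<delta>" "coh B n U" "u \<in> rz U B n" "v \<in> rz U (B \<union> set u) n"
        "vc_free K (\<lambda>u x. \<delta> x u) (tpl \<Omega> n) X"
      using T[OF tT[unfolded t]] by blast
    from inconsistent_along_pair[OF assms(1,2) pts g sg[OF tT[unfolded t]] this(2,3,4,1,5)]
    show ?thesis unfolding t by simp
  qed
  then obtain e where e: "\<And>t. t \<in> T \<Longrightarrow> equi B X (e t) \<and> inconsistent_along B X (length g) g (e t) \<and>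
      (\<forall>x. e t x g \<longleftrightarrow> fst t x (fst (snd t)) \<noteq> fst t x (snd (snd t)))" by metis
  have 1: "\<forall>\<delta>\<in>set (map e ts). equi B X \<delta> \<and> inconsistent_along B X (length g) g \<delta>"
    using e ts by auto
  have 2: "eventually (\<lambda>x. False \<or> (\<exists>\<delta>\<in>set (map e ts). \<delta> x g)) \<Xi>"
    using ev
  proof eventually_elim
    case (elim x)
    then obtain t where "t \<in> T" "fst t x (fst (snd t)) \<noteq> fst t x (snd (snd t))" by force
    then have "e t \<in> set (map e ts)" "e t x g" using e ts by auto
    then show ?case by blast
  qed
  have "eventually (\<lambda>x. False) \<Xi>"
    by (rule vacuum[OF assms(1,3) g 1 teq_refl[OF g], where us="[]" and ss="[]" and \<psi>="\<lambda>_ _. False"])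
      (use 2 in \<open>simp_all add: equi_list_def\<close>)
  then show False using assms(4) unfolding trivial_limit_def by simp
qed

end

section \<open>Blocks of tuples, and a calculus of definable predicates\<close>

definition sl :: "nat \<Rightarrow> nat \<Rightarrow> 'a list \<Rightarrow> 'a list" where
  "sl k j x = take k (drop (j * k) x)"

lemma sl_tpl:
  assumes "x \<in> tpl X (m * k)" "j < m"
  shows "sl k j x \<in> tpl X k"
proof -
  have "j * k + k \<le> m * k" using assms(2) by (metis add.commute mult_Suc mult_le_mono1 Suc_leI)
  then have "length (sl k j x) = k" using assms(1) unfolding sl_def tpl_def by simp
  moreover have "set (sl k j x) \<subseteq> X" using assms(1) unfolding sl_def tpl_def by (auto dest!: in_set_takeD in_set_dropD)
  ultimately show ?thesis unfolding tpl_def by simp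
qed

lemma map_sl: "map h (sl k j x) = sl k j (map h x)"
  unfolding sl_def by (simp add: take_map drop_map)

lemma sl_concat:
  assumes "\<And>j. j < m \<Longrightarrow> f j \<in> tpl X k"
  shows "concat (map f [0..<m]) \<in> tpl X (m * k)" "\<And>j. j < m \<Longrightarrow> sl k j (concat (map f [0..<m])) = f j"
proof -
  have *: "concat (map f [0..<m]) \<in> tpl X (m * k) \<and> (\<forall>j<m. sl k j (concat (map f [0..<m])) = f j)"
    using assms
  proof (induction m)
    case 0
    then show ?case by (simp add: tpl_def)
  next
    case (Suc m)
    then have IH: "concat (map f [0..<m]) \<in> tpl X (m * k)" "\<forall>j<m. sl k j (concat (map f [0..<m])) = f j" by simp_all
    have fm: "f m \<in> tpl X k" using Suc.prems by simp
    have len: "length (concat (map f [0..<m])) = m * k" using IH(1) unfolding tpl_def by simp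
    have eq: "concat (map f [0..<Suc m]) = concat (map f [0..<m]) @ f m" by simp
    have "sl k j (concat (map f [0..<m]) @ f m) = f j" if "j < Suc m" for j
    proof (cases "j = m")
      case True
      then show ?thesis using len fm unfolding sl_def tpl_def by simp
    next
      case False
      then have j: "j < m" using that by simp
      then have "j * k + k \<le> m * k" by (metis add.commute mult_Suc mult_le_mono1 Suc_leI)
      then have "sl k j (concat (map f [0..<m]) @ f m) = sl k j (concat (map f [0..<m]))"
        using len unfolding sl_def by simp
      then show ?thesis using IH(2) j by simp
    qed
    then show ?case unfolding eq using tpl_append[OF IH(1) fm] by (simp add: add.commute)
  qed
  then show "concat (map f [0..<m]) \<in> tpl X (m * k)" "\<And>j. j < m \<Longrightarrow> sl k j (concat (map f [0..<m])) = f j"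
    by auto
qed

text \<open>The maps that select entries of a tuple; together with the rules for \<open>dfp\<close> below they make proofs of
  definability follow the syntax of the defining condition.\<close>

definition tm :: "nat \<Rightarrow> nat \<Rightarrow> ('a list \<Rightarrow> 'a list) \<Rightarrow> bool" where
  "tm n k t \<longleftrightarrow> (\<exists>I. set I \<subseteq> {..<n} \<and> length I = k \<and> (\<forall>g. length g = n \<longrightarrow> t g = sub g I))"

lemma tm_id: "tm n n (\<lambda>g. g)"
  unfolding tm_def by (rule exI[of _ "[0..<n]"]) (auto simp: sub_id)

lemma tm_sub: "set I \<subseteq> {..<n} \<Longrightarrow> length I = k \<Longrightarrow> tm n k (\<lambda>g. sub g I)"
  unfolding tm_def by blast

lemma tm_take:
  assumes "tm n (a + b) t"
  shows "tm n a (\<lambda>g. take a (t g))"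
proof -
  obtain I where I: "set I \<subseteq> {..<n}" "length I = a + b" "\<And>g. length g = n \<Longrightarrow> t g = sub g I"
    using assms unfolding tm_def by blast
  show ?thesis
    unfolding tm_def
  proof (intro exI[of _ "take a I"] conjI allI impI)
    show "set (take a I) \<subseteq> {..<n}" using I(1) by (auto dest: in_set_takeD)
  qed (use I in \<open>auto simp: sub_def take_map\<close>)
qed

lemma tm_drop:
  assumes "tm n (a + b) t"
  shows "tm n b (\<lambda>g. drop a (t g))"
proof -
  obtain I where I: "set I \<subseteq> {..<n}" "length I = a + b" "\<And>g. length g = n \<Longrightarrow> t g = sub g I"
    using assms unfolding tm_def by blast
  show ?thesis
    unfolding tm_def
  proof (intro exI[of _ "drop a I"] conjI allI impI)
    show "set (drop a I) \<subseteq> {..<n}" using I(1) by (auto dest: in_set_dropD)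
  qed (use I in \<open>auto simp: sub_def drop_map\<close>)
qed

lemma tm_append:
  assumes "tm n a s" "tm n b t"
  shows "tm n (a + b) (\<lambda>g. s g @ t g)"
proof -
  obtain I where I: "set I \<subseteq> {..<n}" "length I = a" "\<And>g. length g = n \<Longrightarrow> s g = sub g I"
    using assms unfolding tm_def by blast
  obtain J where J: "set J \<subseteq> {..<n}" "length J = b" "\<And>g. length g = n \<Longrightarrow> t g = sub g J"
    using assms unfolding tm_def by blast
  show ?thesis
    unfolding tm_def by (rule exI[of _ "I @ J"]) (use I J in \<open>auto simp: sub_append\<close>)
qed

lemma tm_sl:
  assumes "tm n (m * k) t" "j < m"
  shows "tm n k (\<lambda>g. sl k j (t g))"
proof -
  obtain r where r: "m = Suc (j + r)" using assms(2) less_imp_Suc_add by blast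
  have "m * k = j * k + (k + r * k)" unfolding r by (simp add: algebra_simps)
  then have "tm n (k + r * k) (\<lambda>g. drop (j * k) (t g))" using assms(1) by (simp add: tm_drop)
  then show ?thesis unfolding sl_def by (rule tm_take)
qed

lemma inf_bot_separation:
  assumes "inf A B = (bot :: 'p filter)"
  shows "\<exists>Q. eventually (\<lambda>x. \<not> Q x) A \<and> eventually Q B"
proof -
  have "eventually (\<lambda>_. False) (inf A B)" using assms by simp
  then have "\<exists>P Q. eventually P A \<and> eventually Q B \<and> (\<forall>x. P x \<and> Q x \<longrightarrow> False)"
    unfolding eventually_inf .
  then show ?thesis
  proof (elim exE conjE)
    fix P Q assume PQ: "eventually P A" "eventually Q B" "\<forall>x. P x \<and> Q x \<longrightarrow> False"
    have "eventually (\<lambda>x. \<not> Q x) A" using PQ(1) by (rule eventually_mono) (use PQ(3) in simp)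
    then show ?thesis using PQ(2) by (intro exI[of _ Q]) simp
  qed
qed

context monster_structure
begin

definition dfp :: "'a set \<Rightarrow> nat \<Rightarrow> ('a list \<Rightarrow> bool) \<Rightarrow> bool" where
  "dfp B n P \<longleftrightarrow> {g \<in> tpl \<Omega> n. P g} \<in> D B n"

lemma dfp_conj:
  assumes "dfp B n P" "dfp B n Q"
  shows "dfp B n (\<lambda>g. P g \<and> Q g)"
proof -
  have "{g \<in> tpl \<Omega> n. P g \<and> Q g} = {g \<in> tpl \<Omega> n. P g} \<inter> {g \<in> tpl \<Omega> n. Q g}" by blast
  then show ?thesis using D_Int assms unfolding dfp_def by simp
qed

lemma dfp_not:
  assumes "dfp B n P"
  shows "dfp B n (\<lambda>g. \<not> P g)"
proof -
  have "{g \<in> tpl \<Omega> n. \<not> P g} = tpl \<Omega> n - {g \<in> tpl \<Omega> n. P g}" by blast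
  then show ?thesis using D_compl assms unfolding dfp_def by simp
qed

lemma dfp_imp:
  assumes "dfp B n P" "dfp B n Q"
  shows "dfp B n (\<lambda>g. P g \<longrightarrow> Q g)"
proof -
  have "dfp B n (\<lambda>g. \<not> (P g \<and> \<not> Q g))" using assms by (intro dfp_not dfp_conj)
  then show ?thesis by simp
qed

lemma dfp_ball:
  assumes "finite T" "\<And>s. s \<in> T \<Longrightarrow> dfp B n (P s)"
  shows "dfp B n (\<lambda>g. \<forall>s\<in>T. P s g)"
  using assms
proof (induction T)
  case empty
  then show ?case using D_full unfolding dfp_def by simp
next
  case (insert s T)
  then have "dfp B n (\<lambda>g. P s g \<and> (\<forall>s\<in>T. P s g))" by (intro dfp_conj) auto
  then show ?case by simp
qed

lemma dfp_all_less:
  assumes "\<And>j. j < (k :: nat) \<Longrightarrow> dfp B n (P j)"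
  shows "dfp B n (\<lambda>g. \<forall>j<k. P j g)"
  using dfp_ball[of "{..<k}" B n P] assms by (simp add: Ball_def)

text \<open>A quantified tuple is appended at the end, so under a quantifier the old variables are
  read by \<open>take n\<close> and the new ones by \<open>drop n\<close>. The nested selections in
  later definability proofs come from here.\<close>

lemma dfp_ex:
  assumes "dfp B (n + k) (\<lambda>z. P (take n z) (drop n z))"
  shows "dfp B n (\<lambda>g. \<exists>h\<in>tpl \<Omega> k. P g h)"
proof -
  have "{g \<in> tpl \<Omega> n. \<exists>h\<in>tpl \<Omega> k. g @ h \<in> {z \<in> tpl \<Omega> (n + k). P (take n z) (drop n z)}} \<in> D B n"
    by (rule D_proj) (use assms in \<open>simp add: dfp_def\<close>)
  moreover have "{g \<in> tpl \<Omega> n. \<exists>h\<in>tpl \<Omega> k. g @ h \<in> {z \<in> tpl \<Omega> (n + k). P (take n z) (drop n z)}}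
      = {g \<in> tpl \<Omega> n. \<exists>h\<in>tpl \<Omega> k. P g h}"
  proof (intro Collect_cong conj_cong refl bex_cong)
    fix g h assume "g \<in> tpl \<Omega> n" "h \<in> tpl \<Omega> k"
    then have "g @ h \<in> tpl \<Omega> (n + k)" "length g = n" using tpl_append unfolding tpl_def by auto
    then show "(g @ h \<in> {z \<in> tpl \<Omega> (n + k). P (take n z) (drop n z)}) = P g h" by simp
  qed
  ultimately show ?thesis unfolding dfp_def by simp
qed

lemma dfp_all:
  assumes "dfp B (n + k) (\<lambda>z. P (take n z) (drop n z))"
  shows "dfp B n (\<lambda>g. \<forall>h\<in>tpl \<Omega> k. P g h)"
proof -
  have "dfp B n (\<lambda>g. \<not> (\<exists>h\<in>tpl \<Omega> k. \<not> P g h))" using assms by (intro dfp_not dfp_ex)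
  then show ?thesis by simp
qed

lemma dfp_mem:
  assumes "R \<in> D B k" "tm n k t"
  shows "dfp B n (\<lambda>g. t g \<in> R)"
proof -
  obtain I where I: "set I \<subseteq> {..<n}" "length I = k" "\<And>g. length g = n \<Longrightarrow> t g = sub g I"
    using assms(2) unfolding tm_def by blast
  have "{g \<in> tpl \<Omega> n. t g \<in> R} = {g \<in> tpl \<Omega> n. sub g I \<in> R}"
    using I(3) unfolding tpl_def by auto
  then show ?thesis using D_reindex[OF assms(1) I(2,1)] unfolding dfp_def by simp
qed

text \<open>Finitely many U-large sets over B intersect in a U-large one, so the hypothesis gives
  finite satisfiability and saturation does the rest. Applied contrapositively, it replaces a
  property of all tuples of realizations of U by the same property on a single U-large set.\<close>

lemma rz_compact:
  assumes "sm B" "ultra U" "eventually (\<lambda>m. m \<in> tpl \<Omega> n) U" "S \<in> D B (m * n)"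
    and *: "\<And>\<beta>. \<beta> \<in> D B n \<Longrightarrow> eventually (\<lambda>y. y \<in> \<beta>) U \<Longrightarrow> \<exists>e\<in>S. \<forall>j<m. sl n j e \<in> \<beta>"
  shows "\<exists>e\<in>S. \<forall>j<m. sl n j e \<in> rz U B n"
proof -
  let ?Q = "{\<beta> \<in> D B n. eventually (\<lambda>y. y \<in> \<beta>) U}"
  define f where "f = (\<lambda>(j, \<beta>). {e \<in> tpl \<Omega> (m * n). e \<in> S \<and> (j < m \<longrightarrow> sl n j e \<in> \<beta>)})"
  have fD: "f (j, \<beta>) \<in> D B (m * n)" if "\<beta> \<in> D B n" for j \<beta>
  proof (cases "j < m")
    case True
    have "dfp B (m * n) (\<lambda>e. e \<in> S \<and> sl n j e \<in> \<beta>)"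
      by (intro dfp_conj dfp_mem[OF assms(4)] dfp_mem[OF that] tm_sl[OF tm_id True] tm_id)
    then show ?thesis unfolding f_def dfp_def using True by simp
  next
    case False
    then have "f (j, \<beta>) = S" unfolding f_def using D_sub[OF assms(4)] by auto
    then show ?thesis using assms(4) by simp
  qed
  have "\<exists>e\<in>tpl \<Omega> (m * n). \<forall>R\<in>f ` (UNIV \<times> ?Q). e \<in> R"
  proof (rule sat[OF assms(1)])
    show "f ` (UNIV \<times> ?Q) \<subseteq> D B (m * n)" using fD by auto
    fix F0 assume "finite F0" "F0 \<subseteq> f ` (UNIV \<times> ?Q)"
    then obtain P where P: "P \<subseteq> UNIV \<times> ?Q" "finite P" "F0 = f ` P" by (meson finite_subset_image)
    let ?\<beta> = "{y \<in> tpl \<Omega> n. \<forall>\<beta>\<in>snd ` P. y \<in> \<beta>}"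
    have "?\<beta> \<in> D B n" by (rule D_Inter) (use P in auto)
    moreover have "eventually (\<lambda>y. y \<in> ?\<beta>) U"
    proof -
      have "eventually (\<lambda>y. \<forall>\<beta>\<in>snd ` P. y \<in> \<beta>) U" using P by (intro eventually_ball_finite) auto
      with assms(3) show ?thesis by eventually_elim simp
    qed
    ultimately obtain e where e: "e \<in> S" "\<forall>j<m. sl n j e \<in> ?\<beta>" using * by blast
    have eT: "e \<in> tpl \<Omega> (m * n)" using e(1) D_sub[OF assms(4)] by blast
    have "e \<in> f p" if "p \<in> P" for p
    proof -
      obtain j \<beta> where p: "p = (j, \<beta>)" by (cases p)
      have "\<beta> \<in> snd ` P" using that p by force
      then show ?thesis using e eT unfolding p f_def by auto
    qed
    then have "\<forall>R\<in>F0. e \<in> R" unfolding P(3) by blast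
    with eT show "\<exists>e\<in>tpl \<Omega> (m * n). \<forall>R\<in>F0. e \<in> R" by blast
  qed
  then obtain e where e: "e \<in> tpl \<Omega> (m * n)" "\<And>j \<beta>. \<beta> \<in> ?Q \<Longrightarrow> e \<in> f (j, \<beta>)" by auto
  have full: "tpl \<Omega> n \<in> ?Q" using D_full assms(3) by simp
  have "e \<in> S" using e(2)[OF full, of 0] unfolding f_def by simp
  moreover have "sl n j e \<in> rz U B n" if "j < m" for j
    unfolding rz_def using sl_tpl[OF e(1) that] e(2)[of _ j] that unfolding f_def by auto
  ultimately show ?thesis by blast
qed

text \<open>NIP holds for every definable relation, in particular for R with its two groups of
  variables exchanged.\<close>

lemma nip_right:
  assumes "R \<in> D \<Omega> (n + k)"
  shows "\<exists>d. vc_free d (\<lambda>u x. x @ u \<in> R) (tpl \<Omega> k) (tpl \<Omega> n)"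
proof -
  let ?I = "[k..<k+n] @ [0..<k]"
  let ?R = "{z \<in> tpl \<Omega> (k + n). sub z ?I \<in> R}"
  have "?R \<in> D \<Omega> (k + n)" by (rule D_reindex[OF assms]) auto
  then obtain d where d: "vc_free d (\<lambda>u x. u @ x \<in> ?R) (tpl \<Omega> k) (tpl \<Omega> n)" using nip by blast
  have eq: "u @ x \<in> ?R \<longleftrightarrow> x @ u \<in> R" if "u \<in> tpl \<Omega> k" "x \<in> tpl \<Omega> n" for u x
  proof -
    have "length u = k" "length x = n" using that unfolding tpl_def by auto
    then have "sub (u @ x) ?I = x @ u" by (simp only: sub_append sub_append_left sub_append_right)
    then show ?thesis using tpl_append[OF that] by simp
  qed
  have "vc_free d (\<lambda>u x. x @ u \<in> R) (tpl \<Omega> k) (tpl \<Omega> n)"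
    unfolding vc_free_def
  proof
    assume "\<exists>u. (\<forall>j<d. u j \<in> tpl \<Omega> k) \<and> (\<forall>S. \<exists>a\<in>tpl \<Omega> n. \<forall>j<d. (a @ u j \<in> R) = (j \<in> S))"
    then obtain u where u: "\<forall>j<d. u j \<in> tpl \<Omega> k" "\<forall>S. \<exists>a\<in>tpl \<Omega> n. \<forall>j<d. (a @ u j \<in> R) = (j \<in> S)" by blast
    have "\<exists>a\<in>tpl \<Omega> n. \<forall>j<d. (u j @ a \<in> ?R) = (j \<in> S)" for S
    proof -
      obtain a where "a \<in> tpl \<Omega> n" "\<forall>j<d. (a @ u j \<in> R) = (j \<in> S)" using u(2) by blast
      then show ?thesis using eq u(1) by (intro bexI[of _ a]) simp_all
    qed
    with u(1) show False using d unfolding vc_free_def by blast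
  qed
  then show ?thesis by blast
qed

lemma D_Om: "R \<in> D B n \<Longrightarrow> B \<subseteq> \<Omega> \<Longrightarrow> R \<in> D \<Omega> n"
  using D_mono by blast

lemma equi_mem: "R \<in> D B (n + k) \<Longrightarrow> equi B (tpl \<Omega> n) (\<lambda>x u. x @ u \<in> R)"
  unfolding equi_def
proof (intro ballI allI impI)
  fix h x u assume R: "R \<in> D B (n + k)" and h: "h \<in> GB B" and mem: "x @ u \<in> R"
  then have "map h (x @ u) \<in> R" using GB_D[OF h R] D_sub[OF R] by blast
  then show "map h x @ map h u \<in> R" by simp
qed

text \<open>The invariant completion plays the role of ``forking equals dividing over models''.\<close>

lemma invariant_ultrafilter:
  assumes "sm M" "closed M" "finv M (tpl \<Omega> n) \<pi>" "\<pi> \<noteq> bot"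
  shows "\<exists>U\<le>\<pi>. iu M n U"
proof -
  have MO: "M \<subseteq> \<Omega>" by (rule sm_sub[OF assms(1)])
  define T where "T = {(k, R, c, c'). R \<in> D M (n + k) \<and> teq M k c c'}"
  define S where "S = (\<lambda>(k :: nat, R, c, c'). {y :: 'a list. y @ c \<in> R \<longleftrightarrow> y @ c' \<in> R})"
  define F where "F = inf \<pi> (INF t\<in>T. principal (S t))"
  have "F \<noteq> bot"
  proof
    assume "F = bot"
    from inf_bot_separation[OF this[unfolded F_def]]
    obtain Q where Q0: "eventually (\<lambda>y. \<not> Q y) \<pi> \<and> eventually Q (INF t\<in>T. principal (S t))" ..
    from Q0[THEN conjunct2, THEN iffD1[OF eventually_INF]]
    obtain X where X0: "X \<subseteq> T \<and> finite X \<and> eventually Q (INF t\<in>X. principal (S t))" ..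
    have X: "X \<subseteq> T" "finite X" "eventually Q (INF t\<in>X. principal (S t))" using X0 by simp_all
    have Q: "\<forall>y\<in>(\<Inter>t\<in>X. S t). Q y"
      using X(3) unfolding INF_principal_finite[OF X(2)] eventually_principal .
    have ev: "eventually (\<lambda>y. \<exists>t\<in>X. y \<notin> S t) \<pi>"
      using Q0[THEN conjunct1]
    proof eventually_elim
      case (elim y)
      then show ?case using Q by auto
    qed
    have "\<exists>\<T>. finite \<T> \<and> (\<forall>(\<delta>, u, v)\<in>\<T>. equi M (tpl \<Omega> n) \<delta> \<and> (\<exists>n' U K. coh M n' U \<and> u \<in> rz U M n' \<and>
        v \<in> rz U (M \<union> set u) n' \<and> vc_free K (\<lambda>u x. \<delta> x u) (tpl \<Omega> n') (tpl \<Omega> n))) \<and>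
        (\<forall>y. y \<notin> S t \<longrightarrow> (\<exists>(\<delta>, u, v)\<in>\<T>. \<delta> y u \<noteq> \<delta> y v))" if tX: "t \<in> X" for t
    proof -
      obtain k R c c' where t: "t = (k, R, c, c')" by (cases t)
      have "(k, R, c, c') \<in> T" using subsetD[OF X(1) tX] unfolding t .
      then have R: "R \<in> D M (n + k)" and cc: "teq M k c c'" unfolding T_def by simp_all
      have c: "c \<in> tpl \<Omega> k" "c' \<in> tpl \<Omega> k" using cc unfolding teq_def by auto
      obtain V where V: "coh M k V" "c \<in> rz V M k" using coh_ex[OF assms(2) MO c(1)] by blast
      have c'V: "c' \<in> rz V M k" by (rule rz_of_teq[OF V(2) cc])
      have "sm (M \<union> (set c \<union> set c'))" by (rule sm_Un[OF assms(1)]) (use c in \<open>auto simp: tpl_def\<close>)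
      then obtain d where d: "d \<in> rz V (M \<union> (set c \<union> set c')) k"
        using rz_ex[of "M \<union> (set c \<union> set c')" V k] V(1) coh_tpl[OF V(1) MO] unfolding coh_def by blast
      \<comment> \<open>A tuple y that distinguishes c from c' distinguishes c from d or c' from d.
        Both (c, d) and (c', d) start Morley sequences of the coheir V, so a splitting between
        arbitrary tuples of equal type is reduced to splittings that an invariant filter cannot
        force.\<close>
      have dc: "d \<in> rz V (M \<union> set c) k" "d \<in> rz V (M \<union> set c') k"
        by (rule subsetD[OF rz_mono d], blast)+
      obtain K where K: "vc_free K (\<lambda>u x. x @ u \<in> R) (tpl \<Omega> k) (tpl \<Omega> n)"
        using nip_right[OF D_Om[OF R MO]] by blast
      let ?\<delta> = "\<lambda>x u. x @ u \<in> R"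
      have ex: "\<exists>n' U K. coh M n' U \<and> u \<in> rz U M n' \<and> d \<in> rz U (M \<union> set u) n' \<and>
          vc_free K (\<lambda>u x. ?\<delta> x u) (tpl \<Omega> n') (tpl \<Omega> n)" if "u \<in> {c, c'}" for u
      proof -
        have "u \<in> rz V M k" "d \<in> rz V (M \<union> set u) k" using that V(2) dc c'V by auto
        then show ?thesis using V(1) K by blast
      qed
      show ?thesis
      proof (intro exI[of _ "{(?\<delta>, c, d), (?\<delta>, c', d)}"] conjI)
        show "\<forall>(\<delta>, u, v)\<in>{(?\<delta>, c, d), (?\<delta>, c', d)}. equi M (tpl \<Omega> n) \<delta> \<and> (\<exists>n' U K. coh M n' U \<and> u \<in> rz U M n' \<and>
          v \<in> rz U (M \<union> set u) n' \<and> vc_free K (\<lambda>u x. \<delta> x u) (tpl \<Omega> n') (tpl \<Omega> n))"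
          using equi_mem[OF R] ex by simp
        show "\<forall>y. y \<notin> S t \<longrightarrow> (\<exists>(\<delta>, u, v)\<in>{(?\<delta>, c, d), (?\<delta>, c', d)}. \<delta> y u \<noteq> \<delta> y v)"
          unfolding t S_def by auto
      qed simp
    qed
    from bchoice[OF ballI, OF this]
    obtain \<T> where \<T>: "\<forall>t\<in>X. finite (\<T> t) \<and> (\<forall>(\<delta>, u, v)\<in>\<T> t. equi M (tpl \<Omega> n) \<delta> \<and> (\<exists>n' U K. coh M n' U \<and> u \<in> rz U M n' \<and>
        v \<in> rz U (M \<union> set u) n' \<and> vc_free K (\<lambda>u x. \<delta> x u) (tpl \<Omega> n') (tpl \<Omega> n))) \<and>
        (\<forall>y. y \<notin> S t \<longrightarrow> (\<exists>(\<delta>, u, v)\<in>\<T> t. \<delta> y u \<noteq> \<delta> y v))" ..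
    have "eventually (\<lambda>y. \<exists>(\<delta>, u, v)\<in>(\<Union>t\<in>X. \<T> t). \<delta> y u \<noteq> \<delta> y v) \<pi>"
      using ev
    proof eventually_elim
      case (elim y)
      then obtain t where t: "t \<in> X" "y \<notin> S t" by blast
      with \<T> have "\<exists>(\<delta>, u, v)\<in>\<T> t. \<delta> y u \<noteq> \<delta> y v" by simp
      then show ?case using t(1) by blast
    qed
    moreover have "\<not> eventually (\<lambda>y. \<exists>(\<delta>, u, v)\<in>(\<Union>t\<in>X. \<T> t). \<delta> y u \<noteq> \<delta> y v) \<pi>"
    proof (rule invariant_filter_no_split[OF assms])
      show "finite (\<Union>t\<in>X. \<T> t)" using \<T> X(2) by simp
      fix \<delta> u v assume "(\<delta>, u, v) \<in> (\<Union>t\<in>X. \<T> t)"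
      then obtain t where t: "t \<in> X" "(\<delta>, u, v) \<in> \<T> t" by (rule UN_E)
      from \<T>[rule_format, OF t(1), THEN conjunct2, THEN conjunct1, rule_format, OF t(2)]
      show "equi M (tpl \<Omega> n) \<delta> \<and> (\<exists>n' U K. coh M n' U \<and> u \<in> rz U M n' \<and>
        v \<in> rz U (M \<union> set u) n' \<and> vc_free K (\<lambda>u x. \<delta> x u) (tpl \<Omega> n') (tpl \<Omega> n))" by simp
    qed
    ultimately show False by blast
  qed
  then obtain U where U: "U \<le> F" "ultra U" using ex_ultra_le by blast
  have "U \<le> \<pi>" using U(1) unfolding F_def by simp
  moreover have "eventually (\<lambda>m. m \<in> tpl \<Omega> n) U"
    using assms(3) \<open>U \<le> \<pi>\<close> unfolding finv_def le_filter_def by blast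
  moreover have "eventually (\<lambda>m. m @ g' \<in> R) U"
    if "teq M k g g'" "R \<in> D M (n + k)" "eventually (\<lambda>m. m @ g \<in> R) U" for k g g' R
  proof -
    have "(k, R, g, g') \<in> T" using that unfolding T_def by simp
    then have "U \<le> principal (S (k, R, g, g'))" using U(1) unfolding F_def by (simp add: le_INF_iff)
    then have "eventually (\<lambda>y. y @ g \<in> R \<longleftrightarrow> y @ g' \<in> R) U" unfolding le_principal S_def by simp
    with that(3) show ?thesis by eventually_elim simp
  qed
  ultimately show ?thesis using U(2) unfolding iu_def by blast
qed

end

section \<open>Uniform consistency of conjugates\<close>

lemma (in monster_structure) closedD:
  assumes "closed B" "R \<in> D B n" "g \<in> R"
  shows "\<exists>z\<in>R. z \<in> tpl B n"
proof -
  have "R \<inter> tpl B n \<noteq> {}" using assms unfolding closed_def by (metis empty_iff)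
  then show ?thesis by blast
qed

locale pq_setup = monster_structure +
  fixes M :: "'a set" and nx ny :: nat and \<Phi> :: "'a list set" and b :: "'a list"
  assumes sm_M: "sm M" and closed_M: "closed M"
    and \<Phi>: "\<Phi> \<in> D M (nx + ny)" and b: "b \<in> tpl \<Omega> ny"
begin

definition good :: "'a list set \<Rightarrow> bool" where
  "good \<beta> \<longleftrightarrow> (\<forall>F. finite F \<longrightarrow> F \<subseteq> \<beta> \<longrightarrow> (\<exists>a\<in>tpl \<Omega> nx. \<forall>c\<in>F. a @ c \<in> \<Phi>))"

text \<open>Being \<open>good\<close> imposes infinitely many first-order conditions on the
  parameter f. Requiring it on a whole M-definable set around f lets it be transferred to parameters
  in M.\<close>

definition robust :: "'a list set \<Rightarrow> bool" where
  "robust \<beta> \<longleftrightarrow> (\<exists>k f \<beta>0 \<theta>. \<beta>0 \<in> D M (ny + k) \<and> \<theta> \<in> D M k \<and> f \<in> \<theta> \<and>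
     \<beta> = {y \<in> tpl \<Omega> ny. y @ f \<in> \<beta>0} \<and> (\<forall>f'\<in>\<theta>. good {y \<in> tpl \<Omega> ny. y @ f' \<in> \<beta>0}))"

definition gens :: "'a list set set" where
  "gens = {R \<in> D M ny. b \<in> R} \<union> {tpl \<Omega> ny - \<beta> |\<beta>. robust \<beta>}"

definition bad_filter :: "'a list filter" where
  "bad_filter = (INF S\<in>gens. principal S)"

lemma MO: "M \<subseteq> \<Omega>"
  by (rule sm_sub[OF sm_M])

lemma GB_map_inverse: "(\<And>a. a \<in> \<Omega> \<Longrightarrow> k (h a) = a) \<Longrightarrow> y \<in> tpl \<Omega> n \<Longrightarrow> map k (map h y) = y"
  using map_inverse unfolding tpl_def by blast

lemma GB_shift:
  assumes "h \<in> GB B" "k \<in> GB B" "\<And>a. a \<in> \<Omega> \<Longrightarrow> k (h a) = a" "R \<in> D B (n + m)" "y \<in> tpl \<Omega> n" "f \<in> tpl \<Omega> m"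
  shows "map h y @ f \<in> R \<longleftrightarrow> y @ map k f \<in> R"
proof -
  have "map h y @ f \<in> tpl \<Omega> (n + m)" by (rule tpl_append[OF GB_tpl[OF assms(1,5)] assms(6)])
  from GB_D[OF assms(2,4) this] show ?thesis using GB_map_inverse[of k h, OF assms(3) assms(5)] by simp
qed

lemma bad_filter_finv: "finv M (tpl \<Omega> ny) bad_filter"
  unfolding finv_def
proof (intro conjI ballI allI impI points_tpl)
  have "tpl \<Omega> ny \<in> gens" unfolding gens_def using D_full b by simp
  then have "bad_filter \<le> principal (tpl \<Omega> ny)" unfolding bad_filter_def by (rule INF_lower)
  then show "eventually (\<lambda>x. x \<in> tpl \<Omega> ny) bad_filter" unfolding le_principal .
  fix h P assume h: "h \<in> GB M" and P: "eventually P bad_filter"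
  obtain k where k: "k \<in> GB M" "\<And>a. a \<in> \<Omega> \<Longrightarrow> k (h a) = a" using GB_inv[OF h MO] by metis
  have "filtermap (map h) bad_filter \<le> principal S" if S: "S \<in> gens" for S
  proof -
    have "\<exists>S'\<in>gens. \<forall>y\<in>S'. map h y \<in> S"
    proof (cases "S \<in> D M ny \<and> b \<in> S")
      case True
      then have "S \<in> gens" "\<forall>y\<in>S. map h y \<in> S" using S GB_D[OF h] D_sub by blast+
      then show ?thesis by blast
    next
      case False
      then obtain \<beta> where \<beta>: "S = tpl \<Omega> ny - \<beta>" "robust \<beta>" using S unfolding gens_def by auto
      obtain m f \<beta>0 \<theta> where r: "\<beta>0 \<in> D M (ny + m)" "\<theta> \<in> D M m" "f \<in> \<theta>"
          "\<beta> = {y \<in> tpl \<Omega> ny. y @ f \<in> \<beta>0}" "\<forall>f'\<in>\<theta>. good {y \<in> tpl \<Omega> ny. y @ f' \<in> \<beta>0}"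
        using \<beta>(2) unfolding robust_def by (elim exE conjE)
      have f: "f \<in> tpl \<Omega> m" using r(2,3) D_sub by blast
      \<comment> \<open>Pulling back along h moves the parameter f by the inverse k, and \<theta> is
        defined over M; so the same \<beta>0 and \<theta> witness robustness of the pulled back
        set.\<close>
      have "map k f \<in> \<theta>" using GB_D[OF k(1) r(2) f] r(3) by simp
      then have "robust {y \<in> tpl \<Omega> ny. y @ map k f \<in> \<beta>0}"
        unfolding robust_def using r(1,2,5) by blast
      then have "tpl \<Omega> ny - {y \<in> tpl \<Omega> ny. y @ map k f \<in> \<beta>0} \<in> gens" unfolding gens_def by blast
      moreover have "map h y \<in> S" if y: "y \<in> tpl \<Omega> ny - {y \<in> tpl \<Omega> ny. y @ map k f \<in> \<beta>0}" for y
      proof -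
        have yt: "y \<in> tpl \<Omega> ny" and ny: "y @ map k f \<notin> \<beta>0" using y by auto
        then show ?thesis using GB_shift[OF h k r(1) yt f] GB_tpl[OF h yt] unfolding \<beta>(1) r(4) by simp
      qed
      ultimately show ?thesis by blast
    qed
    then obtain S' where S': "S' \<in> gens" "\<forall>y\<in>S'. map h y \<in> S" by blast
    have "bad_filter \<le> principal S'" unfolding bad_filter_def by (rule INF_lower[OF S'(1)])
    then have "eventually (\<lambda>y. y \<in> S') bad_filter" unfolding le_principal .
    then have "eventually (\<lambda>y. map h y \<in> S) bad_filter" by (rule eventually_mono) (use S'(2) in blast)
    then show ?thesis unfolding le_principal eventually_filtermap .
  qed
  then have "filtermap (map h) bad_filter \<le> bad_filter"
    unfolding bad_filter_def[symmetric] by (subst (2) bad_filter_def, intro INF_greatest)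
  then have "eventually P (filtermap (map h) bad_filter)" using P by (rule filter_leD)
  then show "eventually (\<lambda>x. P (map h x)) bad_filter" unfolding eventually_filtermap .
qed

text \<open>If finitely many robust sets covered a set \<psi> of the type of b, then so would sets
  of the same form with parameters in M: that the parameters lie in their sets \<theta> and that the
  cover exists is an M-definable condition, met inside M because M is closed. One of the new sets
  contains b; it is M-definable and, by robustness, good.\<close>

lemma bad_filter_ne_bot:
  assumes no: "\<And>\<beta>. \<beta> \<in> D M ny \<Longrightarrow> b \<in> \<beta> \<Longrightarrow> \<not> good \<beta>"
  shows "bad_filter \<noteq> bot"
proof
  assume "bad_filter = bot"
  then have "eventually (\<lambda>_. False) (INF S\<in>gens. principal S)" unfolding bad_filter_def by simp
  from this[THEN iffD1[OF eventually_INF]]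
  obtain X where X0: "X \<subseteq> gens \<and> finite X \<and> eventually (\<lambda>_. False) (INF S\<in>X. principal S)" ..
  then have X: "X \<subseteq> gens" "finite X" and ev: "eventually (\<lambda>_. False) (INF S\<in>X. principal S)" by simp_all
  have empty: "\<exists>S\<in>X. y \<notin> S" for y
    using ev unfolding INF_principal_finite[OF X(2)] eventually_principal by auto
  define X1 where "X1 = {S \<in> X. S \<in> D M ny \<and> b \<in> S}"
  define X2 where "X2 = X - X1"
  define \<psi> where "\<psi> = {y \<in> tpl \<Omega> ny. \<forall>S\<in>X1. y \<in> S}"
  have "finite X1" "X1 \<subseteq> D M ny" using X(2) unfolding X1_def by auto
  then have \<psi>1: "\<psi> \<in> D M ny" unfolding \<psi>_def by (rule D_Inter)
  have "b \<in> \<psi>" unfolding \<psi>_def X1_def using b by simp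
  note \<psi> = \<psi>1 this
  have "\<forall>S\<in>X2. \<exists>q. case q of (k, f, \<beta>0, \<theta>) \<Rightarrow> \<beta>0 \<in> D M (ny + k) \<and> \<theta> \<in> D M k \<and> f \<in> \<theta> \<and>
      S = tpl \<Omega> ny - {y \<in> tpl \<Omega> ny. y @ f \<in> \<beta>0} \<and> (\<forall>f'\<in>\<theta>. good {y \<in> tpl \<Omega> ny. y @ f' \<in> \<beta>0})"
  proof
    fix S assume "S \<in> X2"
    then have "S \<in> gens" "\<not> (S \<in> D M ny \<and> b \<in> S)" using X(1) unfolding X2_def X1_def by auto
    then obtain \<beta> where \<beta>: "S = tpl \<Omega> ny - \<beta>" "robust \<beta>" unfolding gens_def by auto
    then show "\<exists>q. case q of (k, f, \<beta>0, \<theta>) \<Rightarrow> \<beta>0 \<in> D M (ny + k) \<and> \<theta> \<in> D M k \<and> f \<in> \<theta> \<and>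
      S = tpl \<Omega> ny - {y \<in> tpl \<Omega> ny. y @ f \<in> \<beta>0} \<and> (\<forall>f'\<in>\<theta>. good {y \<in> tpl \<Omega> ny. y @ f' \<in> \<beta>0})"
      unfolding robust_def by auto
  qed
  from bchoice[OF this] obtain q where q: "\<forall>S\<in>X2. case q S of (k, f, \<beta>0, \<theta>) \<Rightarrow> \<beta>0 \<in> D M (ny + k) \<and> \<theta> \<in> D M k \<and> f \<in> \<theta> \<and>
      S = tpl \<Omega> ny - {y \<in> tpl \<Omega> ny. y @ f \<in> \<beta>0} \<and> (\<forall>f'\<in>\<theta>. good {y \<in> tpl \<Omega> ny. y @ f' \<in> \<beta>0})" ..
  define k where "k S = fst (q S)" for S
  define f where "f S = fst (snd (q S))" for S
  define \<beta>0 where "\<beta>0 S = fst (snd (snd (q S)))" for S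
  define \<theta> where "\<theta> S = snd (snd (snd (q S)))" for S
  have qq: "\<beta>0 S \<in> D M (ny + k S) \<and> \<theta> S \<in> D M (k S) \<and> f S \<in> \<theta> S \<and>
      S = tpl \<Omega> ny - {y \<in> tpl \<Omega> ny. y @ f S \<in> \<beta>0 S} \<and> (\<forall>f'\<in>\<theta> S. good {y \<in> tpl \<Omega> ny. y @ f' \<in> \<beta>0 S})"
    if S: "S \<in> X2" for S
    using bspec[OF q S] unfolding k_def f_def \<beta>0_def \<theta>_def case_prod_beta .
  note q' = qq[THEN conjunct1] qq[THEN conjunct2, THEN conjunct1]
    qq[THEN conjunct2, THEN conjunct2, THEN conjunct1]
    qq[THEN conjunct2, THEN conjunct2, THEN conjunct2, THEN conjunct1]
    qq[THEN conjunct2, THEN conjunct2, THEN conjunct2, THEN conjunct2]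
  have finX2: "finite X2" using X(2) unfolding X2_def by simp
  obtain xs where xs: "set xs = X2" using finite_list[OF finX2] by blast
  \<comment> \<open>The parameters of all robust sets are collected in one tuple, from which
    \<open>I S\<close> selects those of S, because they must be moved into M simultaneously.\<close>
  define g where "g = concat (map f xs)"
  define n where "n = length g"
  have fO: "f S \<in> tpl \<Omega> (k S)" if "S \<in> X2" for S using q'(2,3)[OF that] D_sub by blast
  have g: "g \<in> tpl \<Omega> n" unfolding g_def n_def tpl_def using fO xs unfolding tpl_def by auto
  have "\<forall>S\<in>X2. \<exists>I. set I \<subseteq> {..<n} \<and> length I = k S \<and> sub g I = f S"
  proof
    fix S assume S: "S \<in> X2"
    have "set (f S) \<subseteq> set g" unfolding g_def using S xs by auto
    then show "\<exists>I. set I \<subseteq> {..<n} \<and> length I = k S \<and> sub g I = f S"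
      using ex_sub[of "f S" g] fO[OF S] unfolding n_def tpl_def by auto
  qed
  from bchoice[OF this] obtain I where I: "\<forall>S\<in>X2. set (I S) \<subseteq> {..<n} \<and> length (I S) = k S \<and> sub g (I S) = f S" ..
  let ?P = "\<lambda>z. (\<forall>S\<in>X2. sub z (I S) \<in> \<theta> S) \<and>
      (\<forall>y\<in>tpl \<Omega> ny. y \<in> \<psi> \<longrightarrow> \<not> (\<forall>S\<in>X2. \<not> (y @ sub z (I S) \<in> \<beta>0 S)))"
  have "dfp M n ?P"
  proof (intro dfp_all dfp_conj dfp_ball finX2 dfp_imp dfp_not)
    fix S assume S: "S \<in> X2"
    show "dfp M n (\<lambda>z. sub z (I S) \<in> \<theta> S)"
      by (rule dfp_mem[OF q'(2)[OF S] tm_sub]) (use I S in auto)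
    have "tm (n + ny) (ny + k S) (\<lambda>z. drop n z @ sub (take n z) (I S))"
    proof (rule tm_append[OF tm_drop[OF tm_id]])
      show "tm (n + ny) (k S) (\<lambda>z. sub (take n z) (I S))"
        unfolding tm_def
        by (rule exI[of _ "I S"]) (use I S in \<open>force simp: sub_def subset_iff\<close>)
    qed
    then show "dfp M (n + ny) (\<lambda>z. drop n z @ sub (take n z) (I S) \<in> \<beta>0 S)"
      by (rule dfp_mem[OF q'(1)[OF S]])
  next
    show "dfp M (n + ny) (\<lambda>z. drop n z \<in> \<psi>)" by (rule dfp_mem[OF \<psi>(1) tm_drop[OF tm_id]])
  qed
  then have "{z \<in> tpl \<Omega> n. ?P z} \<in> D M n" unfolding dfp_def .
  moreover have "g \<in> {z \<in> tpl \<Omega> n. ?P z}"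
  proof -
    have "\<forall>S\<in>X2. sub g (I S) \<in> \<theta> S" using I q'(3) by simp
    moreover have "\<not> (\<forall>S\<in>X2. \<not> (y @ sub g (I S) \<in> \<beta>0 S))" if y: "y \<in> tpl \<Omega> ny" "y \<in> \<psi>" for y
    proof -
      obtain S where S: "S \<in> X" "y \<notin> S" using empty by blast
      then have S2: "S \<in> X2" using y(2) unfolding X2_def \<psi>_def by auto
      from q'(4)[OF S2] have "y \<in> S \<longleftrightarrow> y \<in> tpl \<Omega> ny - {y \<in> tpl \<Omega> ny. y @ f S \<in> \<beta>0 S}"
        by (rule arg_cong[where f="\<lambda>s. y \<in> s"])
      then have "y @ f S \<in> \<beta>0 S" using S(2) y(1) by simp
      then have "y @ sub g (I S) \<in> \<beta>0 S" using bspec[OF I S2] by simp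
      then show ?thesis using S2 by (meson)
    qed
    ultimately show ?thesis using g by simp
  qed
  ultimately have "\<exists>z\<in>{z \<in> tpl \<Omega> n. ?P z}. z \<in> tpl M n" by (rule closedD[OF closed_M])
  then obtain z where z: "z \<in> tpl M n" "\<forall>S\<in>X2. sub z (I S) \<in> \<theta> S"
      "\<forall>y\<in>tpl \<Omega> ny. y \<in> \<psi> \<longrightarrow> \<not> (\<forall>S\<in>X2. \<not> (y @ sub z (I S) \<in> \<beta>0 S))" by auto
  have "\<not> (\<forall>S\<in>X2. \<not> (b @ sub z (I S) \<in> \<beta>0 S))" using z(3) b \<psi>(2) by simp
  then obtain S where S: "S \<in> X2" "b @ sub z (I S) \<in> \<beta>0 S" by blast
  have zI: "sub z (I S) \<in> tpl M (k S)" by (rule sub_tpl[OF z(1)]) (use I S in auto)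
  have "{y \<in> tpl \<Omega> ny. y @ sub z (I S) \<in> \<beta>0 S} \<in> D M ny"
    by (rule D_param[OF q'(1)[OF S(1)] zI subsetD[OF tpl_mono[OF MO] zI]])
  moreover have "b \<in> {y \<in> tpl \<Omega> ny. y @ sub z (I S) \<in> \<beta>0 S}" using S(2) b by simp
  moreover have "good {y \<in> tpl \<Omega> ny. y @ sub z (I S) \<in> \<beta>0 S}" by (rule bspec[OF q'(5)[OF S(1)] bspec[OF z(2) S(1)]])
  ultimately show False using no by simp
qed

end

text \<open>\<open>U\<close> is a global invariant extension of the type of \<open>b\<close> that contains no robustly consistent set.\<close>

locale pq_bad = pq_setup +
  fixes U :: "'a list filter"
  assumes U: "iu M ny U" and U_bad: "U \<le> bad_filter"
begin

abbreviation Y :: "'a set \<Rightarrow> 'a list set" where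
  "Y B \<equiv> rz U B ny"

definition ok :: "'a list set \<Rightarrow> 'a set \<Rightarrow> bool" where
  "ok \<eta> B \<longleftrightarrow> (\<forall>E. finite E \<longrightarrow> E \<subseteq> Y B \<longrightarrow> (\<exists>a\<in>\<eta>. \<forall>e\<in>E. a @ e \<in> \<Phi>))"

lemma U_ultra: "ultra U" and U_tpl: "eventually (\<lambda>m. m \<in> tpl \<Omega> ny) U"
  using U unfolding iu_def by auto

lemma not_robust: "robust \<beta> \<Longrightarrow> eventually (\<lambda>y. y \<in> \<beta>) U \<Longrightarrow> False"
proof -
  assume \<beta>: "robust \<beta>" "eventually (\<lambda>y. y \<in> \<beta>) U"
  have "tpl \<Omega> ny - \<beta> \<in> gens" using \<beta>(1) unfolding gens_def by blast
  then have "U \<le> principal (tpl \<Omega> ny - \<beta>)"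
    using U_bad INF_lower[of _ gens principal] unfolding bad_filter_def by (meson order_trans)
  then have "eventually (\<lambda>y. y \<in> tpl \<Omega> ny - \<beta>) U" unfolding le_principal .
  with \<beta>(2) have "eventually (\<lambda>_. False) U" by eventually_elim simp
  then show False using U_ultra unfolding ultra_def trivial_limit_def by simp
qed

lemma Y_ex: "sm B \<Longrightarrow> \<exists>c. c \<in> Y B"
  by (rule rz_ex[OF _ U_ultra U_tpl])

lemma Y_M: "c \<in> Y M \<Longrightarrow> teq M ny b c"
proof -
  assume c: "c \<in> Y M"
  have "c \<in> R" if "R \<in> D M ny" "b \<in> R" for R
  proof -
    have "R \<in> gens" using that unfolding gens_def by blast
    then have "U \<le> principal R"
      using U_bad INF_lower[of _ gens principal] unfolding bad_filter_def by (meson order_trans)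
    then have "eventually (\<lambda>y. y \<in> R) U" unfolding le_principal .
    then show ?thesis using c that(1) unfolding rz_def by blast
  qed
  note sub = this
  have "b \<in> R" if R: "R \<in> D M ny" "c \<in> R" for R
    using sub[OF D_compl[OF R(1)]] R(2) b by blast
  then show ?thesis using sub b rz_tpl[OF c] unfolding teq_def by blast
qed

text \<open>A failure for every U-large set would, by compactness, give q realizations of U that are
  jointly inconsistent with \<eta>. Since q is fixed, the property obtained for \<beta> is
  first-order in its parameters.\<close>

lemma ok_consistent_nbhd:
  assumes "sm B" "M \<subseteq> B" "\<eta> \<in> D B nx" "ok \<eta> B"
  shows "\<exists>\<beta>\<in>D B ny. eventually (\<lambda>y. y \<in> \<beta>) U \<and>
     (\<forall>e\<in>tpl \<Omega> (q * ny). (\<forall>j<q. sl ny j e \<in> \<beta>) \<longrightarrow> (\<exists>a\<in>tpl \<Omega> nx. a \<in> \<eta> \<and> (\<forall>j<q. a @ sl ny j e \<in> \<Phi>)))"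
proof (rule ccontr)
  assume neg: "\<not> ?thesis"
  let ?P = "\<lambda>e. \<exists>a\<in>tpl \<Omega> nx. a \<in> \<eta> \<and> (\<forall>j<q. a @ sl ny j e \<in> \<Phi>)"
  let ?S = "{e \<in> tpl \<Omega> (q * ny). \<not> ?P e}"
  have \<Phi>B: "\<Phi> \<in> D B (nx + ny)" by (rule D_mono[OF assms(2) \<Phi>])
  have "dfp B (q * ny) (\<lambda>e. \<not> ?P e)"
    by (intro dfp_not dfp_ex dfp_conj dfp_all_less dfp_mem[OF assms(3)] dfp_mem[OF \<Phi>B] tm_append
        tm_drop[OF tm_id] tm_sl[where m=q] tm_take[OF tm_id])
  then have S: "?S \<in> D B (q * ny)" unfolding dfp_def .
  have "\<exists>e\<in>?S. \<forall>j<q. sl ny j e \<in> Y B"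
    by (rule rz_compact[OF assms(1) U_ultra U_tpl S]) (use neg in blast)
  then obtain e where e: "e \<in> tpl \<Omega> (q * ny)" "\<not> ?P e" "\<forall>j<q. sl ny j e \<in> Y B" by blast
  have "finite ((\<lambda>j. sl ny j e) ` {..<q})" "(\<lambda>j. sl ny j e) ` {..<q} \<subseteq> Y B" using e(3) by auto
  then obtain a where a: "a \<in> \<eta>" "\<forall>c\<in>(\<lambda>j. sl ny j e) ` {..<q}. a @ c \<in> \<Phi>"
    using assms(4) unfolding ok_def by blast
  have "a \<in> tpl \<Omega> nx" using a(1) D_sub[OF assms(3)] by blast
  then show False using a e(2) by auto
qed

definition implies :: "nat \<Rightarrow> 'a list set \<Rightarrow> 'a list \<Rightarrow> 'a list \<Rightarrow> 'a list \<Rightarrow> bool" where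
  "implies n \<eta>0 z c e \<longleftrightarrow> (\<forall>a\<in>tpl \<Omega> nx. a @ z \<in> \<eta>0 \<and> (\<forall>j<n. a @ sl ny j e \<in> \<Phi>) \<longrightarrow> a @ c \<in> \<Phi>)"

lemma dfp_implies:
  assumes "\<eta>0 \<in> D M (nx + k)" "tm m k z" "tm m ny c" "tm m (n * ny) e"
  shows "dfp M m (\<lambda>g. implies n \<eta>0 (z g) (c g) (e g))"
proof -
  let ?X = "{w \<in> tpl \<Omega> (k + (ny + n * ny)). implies n \<eta>0 (take k w) (take ny (drop k w)) (drop ny (drop k w))}"
  have "dfp M (k + (ny + n * ny)) (\<lambda>w. implies n \<eta>0 (take k w) (take ny (drop k w)) (drop ny (drop k w)))"
    unfolding implies_def
    by (intro dfp_all dfp_imp dfp_conj dfp_all_less dfp_mem[OF assms(1)] dfp_mem[OF \<Phi>] tm_append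
        tm_sl[where m=n] tm_drop[OF tm_id] tm_take[OF tm_take[OF tm_id]] tm_take[OF tm_drop[OF tm_take[OF tm_id]]]
        tm_drop[OF tm_drop[OF tm_take[OF tm_id]]])
  then have "?X \<in> D M (k + (ny + n * ny))" unfolding dfp_def .
  from dfp_mem[OF this tm_append[OF assms(2) tm_append[OF assms(3,4)]]]
  have "dfp M m (\<lambda>g. z g @ c g @ e g \<in> ?X)" .
  moreover have "{g \<in> tpl \<Omega> m. z g @ c g @ e g \<in> ?X} = {g \<in> tpl \<Omega> m. implies n \<eta>0 (z g) (c g) (e g)}"
  proof -
    have "z g @ c g @ e g \<in> ?X \<longleftrightarrow> implies n \<eta>0 (z g) (c g) (e g)" if g: "g \<in> tpl \<Omega> m" for g
    proof -
      have t: "t g \<in> tpl \<Omega> l" if "tm m l t" for l t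
        using that g sub_tpl[OF g] unfolding tm_def tpl_def by (metis (mono_tags, lifting) mem_Collect_eq)
      have "z g \<in> tpl \<Omega> k" "c g \<in> tpl \<Omega> ny" "e g \<in> tpl \<Omega> (n * ny)" using assms(2-4) t by auto
      then show ?thesis using tpl_append unfolding tpl_def by simp
    qed
    then show ?thesis by blast
  qed
  ultimately show ?thesis unfolding dfp_def by simp
qed

text \<open>The bound must be the same for all z, because the covering number is fixed before z is
  varied. To achieve this, z is put into the group of variables on the right; for each z the
  relation in question is then a restriction of one NIP relation.\<close>

lemma vc_implies:
  assumes "\<eta>0 \<in> D M (nx + k)"
  shows "\<exists>d. \<forall>z\<in>tpl \<Omega> k. vc_free d (implies n \<eta>0 z) (tpl \<Omega> ny) (tpl \<Omega> (n * ny)) \<and>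
    vc_free d (\<lambda>e c. implies n \<eta>0 z c e) (tpl \<Omega> (n * ny)) (tpl \<Omega> ny)"
proof -
  let ?m = "n * ny"
  let ?R1 = "{w \<in> tpl \<Omega> (ny + (?m + k)). implies n \<eta>0 (drop ?m (drop ny w)) (take ny w) (take ?m (drop ny w))}"
  let ?R2 = "{w \<in> tpl \<Omega> (?m + (ny + k)). implies n \<eta>0 (drop ny (drop ?m w)) (take ny (drop ?m w)) (take ?m w)}"
  have "dfp M (ny + (?m + k)) (\<lambda>w. implies n \<eta>0 (drop ?m (drop ny w)) (take ny w) (take ?m (drop ny w)))"
    by (intro dfp_implies[OF assms] tm_drop[OF tm_drop[OF tm_id]] tm_take[OF tm_id] tm_take[OF tm_drop[OF tm_id]])
  then have "?R1 \<in> D \<Omega> (ny + (?m + k))" unfolding dfp_def by (rule D_mono[OF MO])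
  from nip[OF this] obtain d1 where d1: "vc_free d1 (\<lambda>u a. u @ a \<in> ?R1) (tpl \<Omega> ny) (tpl \<Omega> (?m + k))" ..
  have "dfp M (?m + (ny + k)) (\<lambda>w. implies n \<eta>0 (drop ny (drop ?m w)) (take ny (drop ?m w)) (take ?m w))"
    by (intro dfp_implies[OF assms] tm_drop[OF tm_drop[OF tm_id]] tm_take[OF tm_id] tm_take[OF tm_drop[OF tm_id]])
  then have "?R2 \<in> D \<Omega> (?m + (ny + k))" unfolding dfp_def by (rule D_mono[OF MO])
  from nip[OF this] obtain d2 where d2: "vc_free d2 (\<lambda>u a. u @ a \<in> ?R2) (tpl \<Omega> ?m) (tpl \<Omega> (ny + k))" ..
  have vc_ext: "vc_free d R P Q" if vc: "vc_free d R' P Q'" and ext: "\<And>q. q \<in> Q \<Longrightarrow> \<exists>q'\<in>Q'. \<forall>p\<in>P. R p q \<longleftrightarrow> R' p q'"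
    for d :: nat and R R' :: "'a list \<Rightarrow> 'a list \<Rightarrow> bool" and P Q Q'
    unfolding vc_free_def
  proof
    assume "\<exists>u. (\<forall>j<d. u j \<in> P) \<and> (\<forall>S. \<exists>a\<in>Q. \<forall>j<d. R (u j) a = (j \<in> S))"
    then obtain u where u: "\<forall>j<d. u j \<in> P" "\<forall>S. \<exists>a\<in>Q. \<forall>j<d. R (u j) a = (j \<in> S)" by (elim exE conjE)
    have "\<exists>a\<in>Q'. \<forall>j<d. R' (u j) a = (j \<in> S)" for S
    proof -
      obtain a where a: "a \<in> Q" "\<forall>j<d. R (u j) a = (j \<in> S)" using u(2) by blast
      obtain a' where "a' \<in> Q'" "\<forall>p\<in>P. R p a \<longleftrightarrow> R' p a'" using ext[OF a(1)] by blast
      then show ?thesis using a(2) u(1) by (intro bexI[of _ a']) auto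
    qed
    then show False using vc u(1) unfolding vc_free_def by blast
  qed
  have "vc_free (max d1 d2) (implies n \<eta>0 z) (tpl \<Omega> ny) (tpl \<Omega> ?m) \<and>
    vc_free (max d1 d2) (\<lambda>e c. implies n \<eta>0 z c e) (tpl \<Omega> ?m) (tpl \<Omega> ny)" if z: "z \<in> tpl \<Omega> k" for z
  proof
    have "vc_free d1 (implies n \<eta>0 z) (tpl \<Omega> ny) (tpl \<Omega> ?m)"
    proof (rule vc_ext[OF d1])
      fix e assume e: "e \<in> tpl \<Omega> ?m"
      show "\<exists>q'\<in>tpl \<Omega> (?m + k). \<forall>c\<in>tpl \<Omega> ny. implies n \<eta>0 z c e \<longleftrightarrow> c @ q' \<in> ?R1"
      proof (intro bexI[of _ "e @ z"] ballI)
        show "e @ z \<in> tpl \<Omega> (?m + k)" using tpl_append e z by blast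
        fix c assume c: "c \<in> tpl \<Omega> ny"
        have "c @ e @ z \<in> tpl \<Omega> (ny + (?m + k))" using tpl_append c e z by blast
        moreover have "length c = ny" "length e = ?m" using c e unfolding tpl_def by auto
        ultimately show "implies n \<eta>0 z c e \<longleftrightarrow> c @ e @ z \<in> ?R1" by simp
      qed
    qed
    then show "vc_free (max d1 d2) (implies n \<eta>0 z) (tpl \<Omega> ny) (tpl \<Omega> ?m)" by (rule vc_free_mono) auto
    have "vc_free d2 (\<lambda>e c. implies n \<eta>0 z c e) (tpl \<Omega> ?m) (tpl \<Omega> ny)"
    proof (rule vc_ext[OF d2])
      fix c assume c: "c \<in> tpl \<Omega> ny"
      show "\<exists>q'\<in>tpl \<Omega> (ny + k). \<forall>e\<in>tpl \<Omega> ?m. implies n \<eta>0 z c e \<longleftrightarrow> e @ q' \<in> ?R2"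
      proof (intro bexI[of _ "c @ z"] ballI)
        show "c @ z \<in> tpl \<Omega> (ny + k)" using tpl_append c z by blast
        fix e assume e: "e \<in> tpl \<Omega> ?m"
        have "e @ c @ z \<in> tpl \<Omega> (?m + (ny + k))" using tpl_append c e z by blast
        moreover have "length c = ny" "length e = ?m" using c e unfolding tpl_def by auto
        ultimately show "implies n \<eta>0 z c e \<longleftrightarrow> e @ c @ z \<in> ?R2" by simp
      qed
    qed
    then show "vc_free (max d1 d2) (\<lambda>e c. implies n \<eta>0 z c e) (tpl \<Omega> ?m) (tpl \<Omega> ny)" by (rule vc_free_mono) auto
  qed
  then show ?thesis by blast
qed

end

context monster_structure
begin

lemma dfp_mono: "B \<subseteq> B' \<Longrightarrow> dfp B n P \<Longrightarrow> dfp B' n P"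
  unfolding dfp_def by (rule D_mono)

lemma dfp_param:
  assumes "dfp B (n + k) (\<lambda>w. P (take n w) (drop n w))" "f \<in> tpl B k" "f \<in> tpl \<Omega> k"
  shows "dfp B n (\<lambda>g. P g f)"
proof -
  have "{g \<in> tpl \<Omega> n. g @ f \<in> {w \<in> tpl \<Omega> (n + k). P (take n w) (drop n w)}} \<in> D B n"
    by (rule D_param[OF assms(1)[unfolded dfp_def] assms(2,3)])
  moreover have "{g \<in> tpl \<Omega> n. g @ f \<in> {w \<in> tpl \<Omega> (n + k). P (take n w) (drop n w)}} = {g \<in> tpl \<Omega> n. P g f}"
  proof (intro Collect_cong conj_cong refl)
    fix g assume "g \<in> tpl \<Omega> n"
    then have "g @ f \<in> tpl \<Omega> (n + k)" "length g = n" using tpl_append assms(3) unfolding tpl_def by auto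
    then show "(g @ f \<in> {w \<in> tpl \<Omega> (n + k). P (take n w) (drop n w)}) = P g f" by simp
  qed
  ultimately show ?thesis unfolding dfp_def by simp
qed

end

section \<open>When a few realizations imply all others\<close>

context pq_bad
begin

text \<open>A finite F in \<beta> is covered by N tuples of n points from \<beta>1, in the sense
  that each c in F is implied by one of these tuples on the set given by \<open>\<eta>0\<close> and
  \<open>z1\<close>. The N n points have a common solution in that set by \<open>1\<close>, and it
  solves all of F. Since \<open>1\<close> and \<open>2\<close> involve boundedly many points, they
  can be expressed as conditions on the parameters.\<close>

lemma good_of_cover:
  assumes ne: "tpl \<Omega> nx \<noteq> {}" and n: "n > 0" and N: "N > 0"
    and cover: "\<And>E A. finite E \<and> E \<noteq> {} \<and> vc_free d (implies n \<eta>0 z1) E A \<and>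
       vc_free d (\<lambda>e c. implies n \<eta>0 z1 c e) A E \<and>
       (\<forall>c. (\<forall>j<N. c j \<in> E) \<longrightarrow> (\<exists>e\<in>A. \<forall>j<N. implies n \<eta>0 z1 (c j) e)) \<longrightarrow>
       (\<exists>e. (\<forall>i<N. e i \<in> A) \<and> (\<forall>c\<in>E. \<exists>i<N. implies n \<eta>0 z1 c (e i)))"
    and vc: "vc_free d (implies n \<eta>0 z1) (tpl \<Omega> ny) (tpl \<Omega> (n * ny))"
      "vc_free d (\<lambda>e c. implies n \<eta>0 z1 c e) (tpl \<Omega> (n * ny)) (tpl \<Omega> ny)"
    and \<beta>: "\<beta> \<subseteq> tpl \<Omega> ny" "\<beta>1 \<subseteq> tpl \<Omega> ny"
    and 1: "\<forall>e\<in>tpl \<Omega> ((N * n) * ny). (\<forall>j<N * n. sl ny j e \<in> \<beta>1) \<longrightarrow>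
        (\<exists>a\<in>tpl \<Omega> nx. a @ z1 \<in> \<eta>0 \<and> (\<forall>j<N * n. a @ sl ny j e \<in> \<Phi>))"
    and 2: "\<forall>c\<in>tpl \<Omega> (N * ny). (\<forall>i<N. sl ny i c \<in> \<beta>) \<longrightarrow>
        (\<exists>e\<in>tpl \<Omega> (n * ny). (\<forall>j<n. sl ny j e \<in> \<beta>1) \<and> (\<forall>i<N. implies n \<eta>0 z1 (sl ny i c) e))"
  shows "good \<beta>"
  unfolding good_def
proof (intro allI impI)
  fix F assume F: "finite F" "F \<subseteq> \<beta>"
  show "\<exists>a\<in>tpl \<Omega> nx. \<forall>c\<in>F. a @ c \<in> \<Phi>"
  proof (cases "F = {}")
    case True
    then show ?thesis using ne by blast
  next
    case False
    let ?A = "{e \<in> tpl \<Omega> (n * ny). \<forall>j<n. sl ny j e \<in> \<beta>1}"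
    have "vc_free d (implies n \<eta>0 z1) F ?A"
      by (rule vc_free_mono[OF vc(1) order_refl]) (use F \<beta> in auto)
    moreover have "vc_free d (\<lambda>e c. implies n \<eta>0 z1 c e) ?A F"
      by (rule vc_free_mono[OF vc(2) order_refl]) (use F \<beta> in auto)
    moreover have "\<exists>e\<in>?A. \<forall>j<N. implies n \<eta>0 z1 (c j) e" if c: "\<forall>j<N. c j \<in> F" for c
    proof -
      have ct: "c j \<in> tpl \<Omega> ny" "c j \<in> \<beta>" if "j < N" for j using c F(2) \<beta>(1) that by auto
      from sl_concat[of N c, OF ct(1)]
      have cc: "concat (map c [0..<N]) \<in> tpl \<Omega> (N * ny)" "\<And>j. j < N \<Longrightarrow> sl ny j (concat (map c [0..<N])) = c j" by auto
      then have "\<forall>i<N. sl ny i (concat (map c [0..<N])) \<in> \<beta>" using ct(2) by simp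
      from mp[OF bspec[OF 2 cc(1)] this] obtain e where e: "e \<in> tpl \<Omega> (n * ny)" "\<forall>j<n. sl ny j e \<in> \<beta>1"
          "\<forall>i<N. implies n \<eta>0 z1 (sl ny i (concat (map c [0..<N]))) e" by (elim bexE conjE)
      then show ?thesis using cc(2) by (intro bexI[of _ e]) simp_all
    qed
    ultimately obtain es where es: "\<forall>i<N. es i \<in> ?A" "\<forall>c\<in>F. \<exists>i<N. implies n \<eta>0 z1 c (es i)"
      using cover[of F ?A] F(1) False by auto
    \<comment> \<open>The N tuples are strung together into one sequence of N n blocks: block l is
      entry l mod n of tuple l div n.\<close>
    define w where "w l = sl ny (l mod n) (es (l div n))" for l
    have w: "w l \<in> tpl \<Omega> ny" "w l \<in> \<beta>1" if "l < N * n" for l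
    proof -
      have "l div n < N" using that by (simp add: less_mult_imp_div_less)
      then have "es (l div n) \<in> ?A" using es(1) by blast
      moreover have "l mod n < n" using n by simp
      ultimately show "w l \<in> \<beta>1" unfolding w_def by blast
      then show "w l \<in> tpl \<Omega> ny" using \<beta>(2) by blast
    qed
    from sl_concat[of "N * n" w, OF w(1)]
    have ww: "concat (map w [0..<N * n]) \<in> tpl \<Omega> ((N * n) * ny)"
        "\<And>l. l < N * n \<Longrightarrow> sl ny l (concat (map w [0..<N * n])) = w l" by auto
    then have "\<forall>l<N * n. sl ny l (concat (map w [0..<N * n])) \<in> \<beta>1" using w(2) by simp
    from mp[OF bspec[OF 1 ww(1)] this] obtain a where a: "a \<in> tpl \<Omega> nx" "a @ z1 \<in> \<eta>0"
        "\<forall>j<N * n. a @ sl ny j (concat (map w [0..<N * n])) \<in> \<Phi>" by (elim bexE conjE)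
    have "a @ c \<in> \<Phi>" if c: "c \<in> F" for c
    proof -
      obtain i where i: "i < N" "implies n \<eta>0 z1 c (es i)" using es(2) c by blast
      have "a @ sl ny j (es i) \<in> \<Phi>" if j: "j < n" for j
      proof -
        have l: "i * n + j < N * n"
        proof -
          have "i * n + j < Suc i * n" using j by simp
          also have "\<dots> \<le> N * n" using i(1) by (intro mult_le_mono1) simp
          finally show ?thesis .
        qed
        have "w (i * n + j) = sl ny j (es i)" unfolding w_def using j by simp
        then show ?thesis using a(3) ww(2)[OF l] l by metis
      qed
      then show ?thesis using i(2) a unfolding implies_def by blast
    qed
    then show ?thesis using a(1) by blast
  qed
qed

text \<open>Otherwise the covering lemma, applied to the relation that \<open>e\<close> implies \<open>\<phi>(x, c)\<close>, would make some set
  in \<open>U\<close> robustly consistent.\<close>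

lemma unimplied:
  fixes n :: nat
  assumes "sm B" "M \<subseteq> B" "\<eta> \<in> D B nx" "ok \<eta> B" "n > 0"
  shows "\<exists>A. finite A \<and> A \<subseteq> Y B \<and>
    (\<forall>e. (\<forall>j<n. e j \<in> Y B) \<longrightarrow> (\<exists>c\<in>A. \<exists>a\<in>\<eta>. (\<forall>j<n. a @ e j \<in> \<Phi>) \<and> a @ c \<notin> \<Phi>))"
proof (rule ccontr)
  assume no_A: "\<not> ?thesis"
  have neg: "\<exists>e. (\<forall>j<n. e j \<in> Y B) \<and> (\<forall>c\<in>A. \<forall>a\<in>\<eta>. (\<forall>j<n. a @ e j \<in> \<Phi>) \<longrightarrow> a @ c \<in> \<Phi>)"
    if A: "finite A" "A \<subseteq> Y B" for A
  proof (rule ccontr)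
    assume no_e: "\<not> ?thesis"
    have "\<exists>c\<in>A. \<exists>a\<in>\<eta>. (\<forall>j<n. a @ e j \<in> \<Phi>) \<and> a @ c \<notin> \<Phi>" if "\<forall>j<n. e j \<in> Y B" for e
      using no_e that by (metis (no_types, lifting))
    then show False using no_A A by blast
  qed
  have BO: "B \<subseteq> \<Omega>" by (rule sm_sub[OF assms(1)])
  have MB: "M \<union> B = B" using assms(2) by blast
  have \<eta>sub: "\<eta> \<subseteq> tpl \<Omega> nx" by (rule D_sub[OF assms(3)])
  have ne: "tpl \<Omega> nx \<noteq> {}" using assms(4) \<eta>sub unfolding ok_def by (metis empty_subsetI ex_in_conv finite.emptyI subsetD)
  obtain k1 f1 \<eta>0 where f1: "f1 \<in> tpl B k1" "f1 \<in> tpl \<Omega> k1" and \<eta>0: "\<eta>0 \<in> D M (nx + k1)"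
      and \<eta>: "\<eta> = {a \<in> tpl \<Omega> nx. a @ f1 \<in> \<eta>0}"
    using D_paramE[of \<eta> M B nx] assms(3) unfolding MB by blast
  obtain d where d: "\<forall>z\<in>tpl \<Omega> k1. vc_free d (implies n \<eta>0 z) (tpl \<Omega> ny) (tpl \<Omega> (n * ny)) \<and>
    vc_free d (\<lambda>e c. implies n \<eta>0 z c e) (tpl \<Omega> (n * ny)) (tpl \<Omega> ny)"
    using vc_implies[OF \<eta>0, of n] by blast
  obtain N :: nat where N: "N > 0" and cover: "\<forall>(R :: 'a list \<Rightarrow> 'a list \<Rightarrow> bool) E A.
     finite E \<and> E \<noteq> {} \<and> vc_free d R E A \<and> vc_free d (\<lambda>a e. R e a) A E \<and>
     (\<forall>e. (\<forall>j<N. e j \<in> E) \<longrightarrow> (\<exists>a\<in>A. \<forall>j<N. R (e j) a)) \<longrightarrow>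
     (\<exists>a. (\<forall>i<N. a i \<in> A) \<and> (\<forall>e\<in>E. \<exists>i<N. R e (a i)))"
    using finite_cover_by_few[of d] by (elim exE conjE)
  \<comment> \<open>N comes from d alone, and d from \<open>\<eta>0\<close> and n; so q is known
    before \<beta>1 has to be chosen.\<close>
  define q where "q = N * n"
  obtain \<beta>1 where \<beta>1: "\<beta>1 \<in> D B ny" "eventually (\<lambda>y. y \<in> \<beta>1) U"
      "\<forall>e\<in>tpl \<Omega> (q * ny). (\<forall>j<q. sl ny j e \<in> \<beta>1) \<longrightarrow> (\<exists>a\<in>tpl \<Omega> nx. a \<in> \<eta> \<and> (\<forall>j<q. a @ sl ny j e \<in> \<Phi>))"
    using ok_consistent_nbhd[OF assms(1-4), of q] by (elim bexE conjE)
  \<comment> \<open>\<open>?Q c z\<close> says that one n-tuple from \<beta>1 implies all N blocks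
    of c on the set given by z. When the blocks realize U, \<open>neg\<close> supplies such a tuple,
    made of realizations of U; compactness then extends the statement to the blocks of a whole
    U-large set \<beta>.\<close>
  let ?Q = "\<lambda>c z. \<exists>e\<in>tpl \<Omega> (n * ny). (\<forall>j<n. sl ny j e \<in> \<beta>1) \<and> (\<forall>i<N. implies n \<eta>0 z (sl ny i c) e)"
  have "dfp B (N * ny + k1) (\<lambda>w. ?Q (take (N * ny) w) (drop (N * ny) w))"
  proof (intro dfp_ex dfp_conj dfp_all_less)
    fix j assume "j < n"
    then show "dfp B (N * ny + k1 + n * ny) (\<lambda>w. sl ny j (drop (N * ny + k1) w) \<in> \<beta>1)"
      by (intro dfp_mem[OF \<beta>1(1)] tm_sl[where m=n] tm_drop[OF tm_id])
  next
    fix i assume i: "i < N"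
    show "dfp B (N * ny + k1 + n * ny) (\<lambda>w. implies n \<eta>0 (drop (N * ny) (take (N * ny + k1) w))
        (sl ny i (take (N * ny) (take (N * ny + k1) w))) (drop (N * ny + k1) w))"
      by (rule dfp_mono[OF assms(2)], rule dfp_implies[OF \<eta>0])
        (intro tm_drop[OF tm_take[OF tm_id]] tm_sl[where m=N] tm_take[OF tm_take[OF tm_id]] i tm_drop[OF tm_id])+
  qed
  then have "dfp B (N * ny) (\<lambda>c. \<not> ?Q c f1)" by (intro dfp_not) (rule dfp_param[where P="?Q", OF _ f1])
  then have S2: "{c \<in> tpl \<Omega> (N * ny). \<not> ?Q c f1} \<in> D B (N * ny)" unfolding dfp_def .
  have "\<exists>\<beta>\<in>D B ny. eventually (\<lambda>y. y \<in> \<beta>) U \<and> (\<forall>c\<in>tpl \<Omega> (N * ny). (\<forall>i<N. sl ny i c \<in> \<beta>) \<longrightarrow> ?Q c f1)"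
  proof (rule ccontr)
    assume no: "\<not> ?thesis"
    have "\<exists>c\<in>{c \<in> tpl \<Omega> (N * ny). \<not> ?Q c f1}. \<forall>j<N. sl ny j c \<in> Y B"
    proof (rule rz_compact[OF assms(1) U_ultra U_tpl S2], rule ccontr)
      fix \<beta> assume \<beta>: "\<beta> \<in> D B ny" "eventually (\<lambda>y. y \<in> \<beta>) U"
        and none: "\<not> (\<exists>c\<in>{c \<in> tpl \<Omega> (N * ny). \<not> ?Q c f1}. \<forall>j<N. sl ny j c \<in> \<beta>)"
      have "\<forall>c\<in>tpl \<Omega> (N * ny). (\<forall>i<N. sl ny i c \<in> \<beta>) \<longrightarrow> ?Q c f1"
      proof (intro ballI impI, rule ccontr)
        fix c assume "c \<in> tpl \<Omega> (N * ny)" and c\<beta>: "\<forall>i<N. sl ny i c \<in> \<beta>" and "\<not> ?Q c f1"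
        then have "c \<in> {c \<in> tpl \<Omega> (N * ny). \<not> ?Q c f1}" by (intro CollectI conjI)
        with c\<beta> have "\<exists>c\<in>{c \<in> tpl \<Omega> (N * ny). \<not> ?Q c f1}. \<forall>j<N. sl ny j c \<in> \<beta>" by (rule bexI[where x=c])
        then show False by (rule notE[OF none])
      qed
      with \<beta>(2) have "eventually (\<lambda>y. y \<in> \<beta>) U \<and> (\<forall>c\<in>tpl \<Omega> (N * ny). (\<forall>i<N. sl ny i c \<in> \<beta>) \<longrightarrow> ?Q c f1)" ..
      from this \<beta>(1) have "\<exists>\<beta>\<in>D B ny. eventually (\<lambda>y. y \<in> \<beta>) U \<and>
          (\<forall>c\<in>tpl \<Omega> (N * ny). (\<forall>i<N. sl ny i c \<in> \<beta>) \<longrightarrow> ?Q c f1)" by (rule bexI[where x=\<beta>])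
      then show False by (rule notE[OF no])
    qed
    then obtain c where c: "c \<in> tpl \<Omega> (N * ny)" "\<not> ?Q c f1" "\<forall>j<N. sl ny j c \<in> Y B" by blast
    have "finite ((\<lambda>j. sl ny j c) ` {..<N})" "(\<lambda>j. sl ny j c) ` {..<N} \<subseteq> Y B" using c(3) by auto
    from neg[OF this] obtain e where e: "\<forall>j<n. e j \<in> Y B"
        "\<forall>c'\<in>(\<lambda>j. sl ny j c) ` {..<N}. \<forall>a\<in>\<eta>. (\<forall>j<n. a @ e j \<in> \<Phi>) \<longrightarrow> a @ c' \<in> \<Phi>" by (elim exE conjE)
    have et: "e j \<in> tpl \<Omega> ny" if "j < n" for j using e(1) that rz_tpl by blast
    define ee where "ee = concat (map e [0..<n])"
    have ee: "ee \<in> tpl \<Omega> (n * ny)" "\<And>j. j < n \<Longrightarrow> sl ny j ee = e j"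
      unfolding ee_def using sl_concat[of n e, OF et] by auto
    have "sl ny j ee \<in> \<beta>1" if "j < n" for j
      using e(1) that ee(2)[OF that] \<beta>1(1,2) unfolding rz_def by simp
    moreover have "implies n \<eta>0 f1 (sl ny i c) ee" if i: "i < N" for i
      unfolding implies_def
    proof (intro ballI impI)
      fix a assume a: "a \<in> tpl \<Omega> nx" "a @ f1 \<in> \<eta>0 \<and> (\<forall>j<n. a @ sl ny j ee \<in> \<Phi>)"
      then have "a \<in> \<eta>" "\<forall>j<n. a @ e j \<in> \<Phi>" unfolding \<eta> using ee(2) by simp_all
      then show "a @ sl ny i c \<in> \<Phi>" using e(2) i by simp
    qed
    ultimately show False using c(2) ee(1) by blast
  qed
  then obtain \<beta> where \<beta>: "\<beta> \<in> D B ny" "eventually (\<lambda>y. y \<in> \<beta>) U"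
      "\<forall>c\<in>tpl \<Omega> (N * ny). (\<forall>i<N. sl ny i c \<in> \<beta>) \<longrightarrow> ?Q c f1" by (elim bexE conjE)
  obtain k2 f2 \<beta>10 where f2: "f2 \<in> tpl \<Omega> k2" and \<beta>10: "\<beta>10 \<in> D M (ny + k2)"
      and \<beta>1e: "\<beta>1 = {y \<in> tpl \<Omega> ny. y @ f2 \<in> \<beta>10}"
    using D_paramE[of \<beta>1 M B ny] \<beta>1(1) unfolding MB by blast
  obtain k3 f3 \<beta>0 where f3: "f3 \<in> tpl \<Omega> k3" and \<beta>0: "\<beta>0 \<in> D M (ny + k3)"
      and \<beta>e: "\<beta> = {y \<in> tpl \<Omega> ny. y @ f3 \<in> \<beta>0}"
    using D_paramE[of \<beta> M B ny] \<beta>(1) unfolding MB by blast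
  define k where "k = k1 + (k2 + k3)"
  define z1 where "z1 z = take k1 z" for z :: "'a list"
  define z2 where "z2 z = take k2 (drop k1 z)" for z :: "'a list"
  define z3 where "z3 z = drop k2 (drop k1 z)" for z :: "'a list"
  have tz1: "tm m k1 (\<lambda>g. z1 (t g))" and tz2: "tm m k2 (\<lambda>g. z2 (t g))" and tz3: "tm m k3 (\<lambda>g. z3 (t g))"
    if t: "tm m k t" for m and t :: "'a list \<Rightarrow> 'a list"
    using t unfolding z1_def z2_def z3_def k_def
    by (rule tm_take, rule tm_take[OF tm_drop], rule tm_drop[OF tm_drop])
  \<comment> \<open>The two hypotheses of \<open>good_of_cover\<close> become conditions on a tuple
    z of all parameters, with \<open>z1\<close> belonging to \<eta>, \<open>z2\<close> to \<beta>1
    and \<open>z3\<close> to \<beta>. They hold at the actual parameters f, and the M-definable set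
    of z satisfying them witnesses that \<beta> is robust.\<close>
  let ?P1 = "\<lambda>z. \<forall>e\<in>tpl \<Omega> (q * ny). (\<forall>j<q. sl ny j e @ z2 z \<in> \<beta>10) \<longrightarrow>
      (\<exists>a\<in>tpl \<Omega> nx. a @ z1 z \<in> \<eta>0 \<and> (\<forall>j<q. a @ sl ny j e \<in> \<Phi>))"
  let ?P2 = "\<lambda>z. \<forall>c\<in>tpl \<Omega> (N * ny). (\<forall>i<N. sl ny i c @ z3 z \<in> \<beta>0) \<longrightarrow>
      (\<exists>e\<in>tpl \<Omega> (n * ny). (\<forall>j<n. sl ny j e @ z2 z \<in> \<beta>10) \<and> (\<forall>i<N. implies n \<eta>0 (z1 z) (sl ny i c) e))"
  have "dfp M k ?P1"
    by (intro dfp_all dfp_imp dfp_all_less dfp_ex dfp_conj dfp_mem[OF \<beta>10] dfp_mem[OF \<eta>0] dfp_mem[OF \<Phi>]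
        tm_append tz1 tz2 tm_sl[where m=q] tm_drop[OF tm_id] tm_take[OF tm_id]
        tm_take[OF tm_take[OF tm_id]] tm_drop[OF tm_take[OF tm_id]])
  moreover have "dfp M k ?P2"
    by (intro dfp_all dfp_imp dfp_all_less dfp_ex dfp_conj dfp_mem[OF \<beta>0] dfp_mem[OF \<beta>10] dfp_implies[OF \<eta>0]
        tm_append tz1 tz2 tz3 tm_sl[where m=N] tm_sl[where m=n] tm_drop[OF tm_id] tm_take[OF tm_id]
        tm_take[OF tm_take[OF tm_id]] tm_drop[OF tm_take[OF tm_id]])
  ultimately have "dfp M k (\<lambda>z. ?P1 z \<and> ?P2 z)" by (rule dfp_conj)
  then have \<theta>: "{z \<in> tpl \<Omega> k. ?P1 z \<and> ?P2 z} \<in> D M k" unfolding dfp_def .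
  define f where "f = f1 @ (f2 @ f3)"
  have f: "f \<in> tpl \<Omega> k" unfolding f_def k_def using f1(2) f2 f3 tpl_append by blast
  have fz: "z1 f = f1" "z2 f = f2" "z3 f = f3"
    using f1(2) f2 f3 unfolding f_def z1_def z2_def z3_def tpl_def by auto
  have "?P1 f"
  proof (intro ballI impI)
    fix e assume e: "e \<in> tpl \<Omega> (q * ny)" "\<forall>j<q. sl ny j e @ z2 f \<in> \<beta>10"
    have "\<forall>j<q. sl ny j e \<in> \<beta>1" using e sl_tpl[OF e(1)] unfolding \<beta>1e fz by simp
    from mp[OF bspec[OF \<beta>1(3) e(1)] this]
    show "\<exists>a\<in>tpl \<Omega> nx. a @ z1 f \<in> \<eta>0 \<and> (\<forall>j<q. a @ sl ny j e \<in> \<Phi>)" unfolding fz \<eta> by simp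
  qed
  moreover have "?P2 f"
  proof (intro ballI impI)
    fix c assume c: "c \<in> tpl \<Omega> (N * ny)" "\<forall>i<N. sl ny i c @ z3 f \<in> \<beta>0"
    have "\<forall>i<N. sl ny i c \<in> \<beta>" using c sl_tpl[OF c(1)] unfolding \<beta>e fz by simp
    from mp[OF bspec[OF \<beta>(3) c(1)] this]
    show "\<exists>e\<in>tpl \<Omega> (n * ny). (\<forall>j<n. sl ny j e @ z2 f \<in> \<beta>10) \<and> (\<forall>i<N. implies n \<eta>0 (z1 f) (sl ny i c) e)"
      unfolding fz \<beta>1e by auto
  qed
  ultimately have f\<theta>: "f \<in> {z \<in> tpl \<Omega> k. ?P1 z \<and> ?P2 z}" using f by blast
  let ?\<beta>0 = "{w \<in> tpl \<Omega> (ny + k). take ny w @ z3 (drop ny w) \<in> \<beta>0}"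
  have "dfp M (ny + k) (\<lambda>w. take ny w @ z3 (drop ny w) \<in> \<beta>0)"
    by (intro dfp_mem[OF \<beta>0] tm_append tm_take[OF tm_id] tz3 tm_drop[OF tm_id])
  then have \<beta>0': "?\<beta>0 \<in> D M (ny + k)" unfolding dfp_def .
  have eq: "{y \<in> tpl \<Omega> ny. y @ z \<in> ?\<beta>0} = {y \<in> tpl \<Omega> ny. y @ z3 z \<in> \<beta>0}" if z: "z \<in> tpl \<Omega> k" for z
  proof (intro Collect_cong conj_cong refl)
    fix y assume y: "y \<in> tpl \<Omega> ny"
    have "y @ z \<in> tpl \<Omega> (ny + k)" "length y = ny" using tpl_append[OF y z] y unfolding tpl_def by auto
    then show "(y @ z \<in> ?\<beta>0) = (y @ z3 z \<in> \<beta>0)" by simp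
  qed
  have "good {y \<in> tpl \<Omega> ny. y @ z \<in> ?\<beta>0}" if z: "z \<in> {z \<in> tpl \<Omega> k. ?P1 z \<and> ?P2 z}" for z
    unfolding eq[OF CollectD[OF z, THEN conjunct1]]
  proof (rule good_of_cover[OF ne assms(5) N, where ?\<beta>1.0="{y \<in> tpl \<Omega> ny. y @ z2 z \<in> \<beta>10}"])
    have zt: "z \<in> tpl \<Omega> k" and P: "?P1 z" "?P2 z" using z by blast+
    have z1t: "z1 z \<in> tpl \<Omega> k1" using zt unfolding z1_def tpl_def k_def by (auto dest: in_set_takeD)
    show "vc_free d (implies n \<eta>0 (z1 z)) (tpl \<Omega> ny) (tpl \<Omega> (n * ny))"
      "vc_free d (\<lambda>e c. implies n \<eta>0 (z1 z) c e) (tpl \<Omega> (n * ny)) (tpl \<Omega> ny)"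
      using d z1t by blast+
    show "{y \<in> tpl \<Omega> ny. y @ z3 z \<in> \<beta>0} \<subseteq> tpl \<Omega> ny" "{y \<in> tpl \<Omega> ny. y @ z2 z \<in> \<beta>10} \<subseteq> tpl \<Omega> ny" by blast+
    show "\<forall>e\<in>tpl \<Omega> (N * n * ny). (\<forall>j<N * n. sl ny j e \<in> {y \<in> tpl \<Omega> ny. y @ z2 z \<in> \<beta>10}) \<longrightarrow>
        (\<exists>a\<in>tpl \<Omega> nx. a @ z1 z \<in> \<eta>0 \<and> (\<forall>j<N * n. a @ sl ny j e \<in> \<Phi>))"
      using P(1) unfolding q_def by simp
    show "\<forall>c\<in>tpl \<Omega> (N * ny). (\<forall>i<N. sl ny i c \<in> {y \<in> tpl \<Omega> ny. y @ z3 z \<in> \<beta>0}) \<longrightarrow>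
        (\<exists>e\<in>tpl \<Omega> (n * ny). (\<forall>j<n. sl ny j e \<in> {y \<in> tpl \<Omega> ny. y @ z2 z \<in> \<beta>10}) \<and>
          (\<forall>i<N. implies n \<eta>0 (z1 z) (sl ny i c) e))"
    proof (intro ballI impI)
      fix c assume c: "c \<in> tpl \<Omega> (N * ny)" "\<forall>i<N. sl ny i c \<in> {y \<in> tpl \<Omega> ny. y @ z3 z \<in> \<beta>0}"
      then have "\<forall>i<N. sl ny i c @ z3 z \<in> \<beta>0" by simp
      from mp[OF bspec[OF P(2) c(1)] this]
      obtain e where e: "e \<in> tpl \<Omega> (n * ny)" "\<forall>j<n. sl ny j e @ z2 z \<in> \<beta>10" "\<forall>i<N. implies n \<eta>0 (z1 z) (sl ny i c) e"
        by (elim bexE conjE)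
      have "\<forall>j<n. sl ny j e \<in> {y \<in> tpl \<Omega> ny. y @ z2 z \<in> \<beta>10}" using e(2) sl_tpl[OF e(1)] by simp
      then show "\<exists>e\<in>tpl \<Omega> (n * ny). (\<forall>j<n. sl ny j e \<in> {y \<in> tpl \<Omega> ny. y @ z2 z \<in> \<beta>10}) \<and>
          (\<forall>i<N. implies n \<eta>0 (z1 z) (sl ny i c) e)" using e(1,3) by blast
    qed
    show "finite E \<and> E \<noteq> {} \<and> vc_free d (implies n \<eta>0 (z1 z)) E A \<and>
       vc_free d (\<lambda>e c. implies n \<eta>0 (z1 z) c e) A E \<and>
       (\<forall>c. (\<forall>j<N. c j \<in> E) \<longrightarrow> (\<exists>e\<in>A. \<forall>j<N. implies n \<eta>0 (z1 z) (c j) e)) \<longrightarrow>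
       (\<exists>e. (\<forall>i<N. e i \<in> A) \<and> (\<forall>c\<in>E. \<exists>i<N. implies n \<eta>0 (z1 z) c (e i)))" for E A
      by (rule cover[THEN spec, of "implies n \<eta>0 (z1 z)", THEN spec, of E, THEN spec, of A])
  qed
  then have "robust \<beta>"
    unfolding robust_def using \<beta>0' \<theta> f\<theta> eq[OF f] \<beta>e fz(3)
    by (intro exI[of _ k] exI[of _ f] exI[of _ ?\<beta>0] exI[of _ "{z \<in> tpl \<Omega> k. ?P1 z \<and> ?P2 z}"]) simp
  then show False using not_robust \<beta>(2) by blast
qed

end

section \<open>Prolonging the alternating Morley sequence\<close>

context pq_bad
begin

lemma vc_free_slice:
  assumes "vc_free K (\<lambda>u x. x @ u \<in> \<Phi>) (tpl \<Omega> ny) (tpl \<Omega> nx)" "i < n"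
  shows "vc_free K (\<lambda>u x. sl nx i x @ u \<in> \<Phi>) (tpl \<Omega> ny) (tpl \<Omega> (n * nx))"
  unfolding vc_free_def
proof
  assume "\<exists>u. (\<forall>j<K. u j \<in> tpl \<Omega> ny) \<and> (\<forall>S. \<exists>x\<in>tpl \<Omega> (n * nx). \<forall>j<K. (sl nx i x @ u j \<in> \<Phi>) = (j \<in> S))"
  then obtain u where u: "\<forall>j<K. u j \<in> tpl \<Omega> ny"
      "\<forall>S. \<exists>x\<in>tpl \<Omega> (n * nx). \<forall>j<K. (sl nx i x @ u j \<in> \<Phi>) = (j \<in> S)" by (elim exE conjE)
  have "\<exists>x\<in>tpl \<Omega> nx. \<forall>j<K. (x @ u j \<in> \<Phi>) = (j \<in> S)" for S
  proof -
    obtain x where "x \<in> tpl \<Omega> (n * nx)" "\<forall>j<K. (sl nx i x @ u j \<in> \<Phi>) = (j \<in> S)" using u(2) by blast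
    then show ?thesis using sl_tpl[OF _ assms(2)] by (intro bexI[of _ "sl nx i x"])
  qed
  then show False using assms(1) u(1) unfolding vc_free_def by blast
qed

text \<open>If every c in A fails, finitely many realizations E over B' show this: each point of
  \<open>\<eta>1\<close>, the part of \<eta> where \<phi> fails at some c in A, violates \<phi> at
  some e in E. By the choice of A, however, any n realizations are satisfied together by a point of
  \<open>\<eta>1\<close>, so the covering lemma finds, for every finite set of realizations over B',
  n points of \<open>\<eta>1\<close> that cover it. Such n-tuples generate an invariant filter. For
  a realization that is generic over E, one of the n points satisfies \<phi> there but violates it
  at some e in E, a change of value that no invariant filter can force.\<close>

lemma refute_step:
  fixes n :: nat
  assumes B: "sm B" "M \<subseteq> B" "\<eta> \<in> D B nx" "ok \<eta> B" and n: "n > 0"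
    and cover: "\<And>E A. finite E \<and> E \<noteq> {} \<and> vc_free d (\<lambda>e a. a @ e \<in> \<Phi>) E A \<and> vc_free d (\<lambda>a e. a @ e \<in> \<Phi>) A E \<and>
       (\<forall>e. (\<forall>j<n. e j \<in> E) \<longrightarrow> (\<exists>a\<in>A. \<forall>j<n. a @ e j \<in> \<Phi>)) \<longrightarrow>
       (\<exists>a. (\<forall>i<n. a i \<in> A) \<and> (\<forall>e\<in>E. \<exists>i<n. a i @ e \<in> \<Phi>))"
    and vc: "vc_free d (\<lambda>e a. a @ e \<in> \<Phi>) (tpl \<Omega> ny) (tpl \<Omega> nx)" "vc_free d (\<lambda>a e. a @ e \<in> \<Phi>) (tpl \<Omega> nx) (tpl \<Omega> ny)"
    and A: "finite A" "A \<subseteq> Y B"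
      "\<And>e. \<forall>j<n. e j \<in> Y B \<Longrightarrow> \<exists>c\<in>A. \<exists>a\<in>\<eta>. (\<forall>j<n. a @ e j \<in> \<Phi>) \<and> a @ c \<notin> \<Phi>"
    and B': "sm B'" "closed B'" "B \<subseteq> B'" "\<And>c. c \<in> A \<Longrightarrow> set c \<subseteq> B'"
  shows "\<exists>c\<in>A. ok {a \<in> \<eta>. a @ c \<notin> \<Phi>} B'"
proof (rule ccontr)
  assume none: "\<not> ?thesis"
  have BO: "B' \<subseteq> \<Omega>" by (rule sm_sub[OF B'(1)])
  have \<eta>sub: "\<eta> \<subseteq> tpl \<Omega> nx" by (rule D_sub[OF B(3)])
  have YB: "Y B' \<subseteq> Y B" by (rule rz_mono[OF B'(3)])
  have \<Phi>B': "\<Phi> \<in> D B' (nx + ny)" using D_mono[OF _ \<Phi>] B(2) B'(3) by blast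
  have \<eta>B': "\<eta> \<in> D B' nx" by (rule D_mono[OF B'(3) B(3)])
  have At: "c \<in> tpl \<Omega> ny" if "c \<in> A" for c using A(2) that rz_tpl by blast
  have "\<forall>c\<in>A. \<exists>E. finite E \<and> E \<subseteq> Y B' \<and> (\<forall>a\<in>\<eta>. a @ c \<notin> \<Phi> \<longrightarrow> (\<exists>e\<in>E. a @ e \<notin> \<Phi>))"
  proof
    fix c assume "c \<in> A"
    then have "\<not> ok {a \<in> \<eta>. a @ c \<notin> \<Phi>} B'" using none by blast
    then obtain E where "finite E" "E \<subseteq> Y B'" "\<not> (\<exists>a\<in>{a \<in> \<eta>. a @ c \<notin> \<Phi>}. \<forall>e\<in>E. a @ e \<in> \<Phi>)"
      unfolding ok_def by blast
    then show "\<exists>E. finite E \<and> E \<subseteq> Y B' \<and> (\<forall>a\<in>\<eta>. a @ c \<notin> \<Phi> \<longrightarrow> (\<exists>e\<in>E. a @ e \<notin> \<Phi>))"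
      by (intro exI[of _ E]) blast
  qed
  from bchoice[OF this] obtain Ec where Ec: "\<forall>c\<in>A. finite (Ec c) \<and> Ec c \<subseteq> Y B' \<and>
      (\<forall>a\<in>\<eta>. a @ c \<notin> \<Phi> \<longrightarrow> (\<exists>e\<in>Ec c. a @ e \<notin> \<Phi>))" ..
  define E where "E = (\<Union>c\<in>A. Ec c)"
  define \<eta>1 where "\<eta>1 = {a \<in> \<eta>. \<exists>c\<in>A. a @ c \<notin> \<Phi>}"
  have E: "finite E" "E \<subseteq> Y B'" unfolding E_def using Ec A(1) by auto
  have kill: "\<exists>e\<in>E. a @ e \<notin> \<Phi>" if a: "a \<in> \<eta>1" for a
  proof -
    obtain c where c: "a \<in> \<eta>" "c \<in> A" "a @ c \<notin> \<Phi>" using a unfolding \<eta>1_def by blast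
    then obtain e where "e \<in> Ec c" "a @ e \<notin> \<Phi>" using Ec by blast
    then show ?thesis using c(2) unfolding E_def by blast
  qed
  have \<eta>1t: "\<eta>1 \<subseteq> tpl \<Omega> nx" unfolding \<eta>1_def using \<eta>sub by blast
  \<comment> \<open>This is the reason for putting the entries of A into B': automorphisms over B'
    then fix every c in A.\<close>
  have \<eta>1_inv: "map h a \<in> \<eta>1" if h: "h \<in> GB B'" and a: "a \<in> \<eta>1" for h a
  proof -
    obtain c where c: "a \<in> \<eta>" "c \<in> A" "a @ c \<notin> \<Phi>" using a unfolding \<eta>1_def by blast
    have at: "a \<in> tpl \<Omega> nx" using c(1) \<eta>sub by blast
    have "map h c = c" using h B'(4)[OF c(2)] unfolding GB_def by (intro map_idI) blast
    moreover have "map h (a @ c) \<in> \<Phi> \<longleftrightarrow> a @ c \<in> \<Phi>" by (rule GB_D[OF h \<Phi>B' tpl_append[OF at At[OF c(2)]]])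
    moreover have "map h a \<in> \<eta>" using GB_D[OF h \<eta>B' at] c(1) by simp
    ultimately show ?thesis unfolding \<eta>1_def using c by auto
  qed
  let ?X = "tpl \<Omega> (n * nx)"
  define S where "S E' = {x \<in> ?X. (\<forall>i<n. sl nx i x \<in> \<eta>1) \<and> (\<forall>e\<in>E'. \<exists>i<n. sl nx i x @ e \<in> \<Phi>)}" for E'
  define Q where "Q = {E'. finite E' \<and> E' \<subseteq> Y B'}"
  have SI: "\<exists>x. x \<in> S E'" if E': "E' \<in> Q" for E'
  proof -
    \<comment> \<open>The extra realization makes the set to be covered nonempty, as the covering
      lemma requires.\<close>
    obtain e0 where e0: "e0 \<in> Y B'" using Y_ex[OF B'(1)] by blast
    let ?E = "insert e0 E'"
    have E1: "finite ?E" "?E \<subseteq> Y B" "?E \<subseteq> tpl \<Omega> ny"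
      using E' e0 YB rz_tpl unfolding Q_def by blast+
    have "vc_free d (\<lambda>e a. a @ e \<in> \<Phi>) ?E \<eta>1" "vc_free d (\<lambda>a e. a @ e \<in> \<Phi>) \<eta>1 ?E"
      by (rule vc_free_mono[OF vc(1) order_refl E1(3) \<eta>1t], rule vc_free_mono[OF vc(2) order_refl \<eta>1t E1(3)])
    moreover have "\<exists>a\<in>\<eta>1. \<forall>j<n. a @ e j \<in> \<Phi>" if e: "\<forall>j<n. e j \<in> ?E" for e
    proof -
      have "\<forall>j<n. e j \<in> Y B" using e E1(2) by blast
      from A(3)[OF this] obtain c a where "c \<in> A" "a \<in> \<eta>" "\<forall>j<n. a @ e j \<in> \<Phi>" "a @ c \<notin> \<Phi>" by (elim bexE conjE)
      then show ?thesis unfolding \<eta>1_def by (intro bexI[of _ a]) blast+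
    qed
    ultimately obtain a where a: "\<forall>i<n. a i \<in> \<eta>1" "\<forall>e\<in>?E. \<exists>i<n. a i @ e \<in> \<Phi>"
      using cover[of ?E \<eta>1] E1(1) by auto
    have "a i \<in> tpl \<Omega> nx" if "i < n" for i using a(1) \<eta>1t that by blast
    from sl_concat[of n a, OF this]
    have x: "concat (map a [0..<n]) \<in> ?X" "\<And>j. j < n \<Longrightarrow> sl nx j (concat (map a [0..<n])) = a j" by auto
    have "concat (map a [0..<n]) \<in> S E'"
      unfolding S_def
    proof (intro CollectI conjI ballI allI impI x(1))
      show "sl nx i (concat (map a [0..<n])) \<in> \<eta>1" if "i < n" for i using a(1) x(2)[OF that] that by simp
      fix e assume "e \<in> E'"
      then obtain i where i: "i < n" "a i @ e \<in> \<Phi>" using a(2) by blast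
      then show "\<exists>i<n. sl nx i (concat (map a [0..<n])) @ e \<in> \<Phi>" using x(2)[OF i(1)] by (intro exI[of _ i]) simp
    qed
    then show ?thesis by blast
  qed
  define \<Xi> where "\<Xi> = (INF E'\<in>Q. principal (S E'))"
  have ev: "eventually P \<Xi> \<longleftrightarrow> (\<exists>E'\<in>Q. \<forall>x\<in>S E'. P x)" for P
    unfolding \<Xi>_def
  proof (subst eventually_INF_base)
    show "Q \<noteq> {}" unfolding Q_def by auto
    show "\<exists>x\<in>Q. principal (S x) \<le> inf (principal (S a)) (principal (S b))" if "a \<in> Q" "b \<in> Q" for a b
      using that by (intro bexI[of _ "a \<union> b"]) (auto simp: S_def Q_def)
  qed (simp add: eventually_principal)
  have ne: "\<Xi> \<noteq> bot"
    unfolding trivial_limit_def ev using SI by blast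
  have fin: "finv B' ?X \<Xi>"
    unfolding finv_def
  proof (intro conjI ballI allI impI points_tpl)
    show "eventually (\<lambda>x. x \<in> ?X) \<Xi>"
      unfolding ev by (rule bexI[of _ "{}"]) (auto simp: S_def Q_def)
    fix h P assume h: "h \<in> GB B'" and "eventually P \<Xi>"
    then obtain E' where E': "E' \<in> Q" "\<forall>x\<in>S E'. P x" unfolding ev by blast
    obtain k where k: "k \<in> GB B'" "\<And>a. a \<in> \<Omega> \<Longrightarrow> k (h a) = a" using GB_inv[OF h BO] by metis
    have E't: "e \<in> tpl \<Omega> ny" "e \<in> Y B'" if "e \<in> E'" for e using E'(1) that rz_tpl unfolding Q_def by blast+
    have "map k ` E' \<in> Q"
      using E'(1) rz_of_teq[OF E't(2) teq_GB[OF k(1) E't(1)]] unfolding Q_def by auto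
    moreover have "P (map h x)" if x: "x \<in> S (map k ` E')" for x
    proof -
      have xt: "x \<in> ?X" and x1: "\<forall>i<n. sl nx i x \<in> \<eta>1" and x2: "\<forall>e\<in>E'. \<exists>i<n. sl nx i x @ map k e \<in> \<Phi>"
        using x unfolding S_def by auto
      have "sl nx i (map h x) \<in> \<eta>1" if "i < n" for i
        unfolding map_sl[symmetric] using \<eta>1_inv[OF h] x1 that by blast
      moreover have "\<exists>i<n. sl nx i (map h x) @ e \<in> \<Phi>" if e: "e \<in> E'" for e
      proof -
        obtain i where i: "i < n" "sl nx i x @ map k e \<in> \<Phi>" using x2 e by blast
        then have "map h (sl nx i x) @ e \<in> \<Phi>"
          using GB_shift[OF h k \<Phi>B' sl_tpl[OF xt i(1)] E't(1)[OF e]] by simp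
        then show ?thesis using i(1) unfolding map_sl by blast
      qed
      ultimately have "map h x \<in> S E'" unfolding S_def using GB_tpl[OF h xt] by blast
      then show ?thesis using E'(2) by blast
    qed
    ultimately show "eventually (\<lambda>x. P (map h x)) \<Xi>" unfolding ev by blast
  qed
  obtain e0 where e0: "e0 \<in> Y B'" using Y_ex[OF B'(1)] by blast
  \<comment> \<open>U may fail to be a coheir. But all its realizations over B' have one type, and
    this type has a coheir V because B' is closed. An element realizing V over E and B' still
    realizes U over B', while it forms with each e in E the start of a Morley sequence of V.\<close>
  obtain V where V: "coh B' ny V" "e0 \<in> rz V B' ny" using coh_ex[OF B'(2) BO rz_tpl[OF e0]] by blast
  have Vu: "ultra V" "eventually (\<lambda>m. m \<in> tpl \<Omega> ny) V" using V(1) coh_tpl[OF V(1) BO] unfolding coh_def by auto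
  have YV: "e \<in> rz V B' ny" if e: "e \<in> Y B'" for e
    by (rule rz_of_teq[OF V(2) rz_teq[OF U_ultra U_tpl e0 e]])
  let ?BE = "B' \<union> \<Union> (set ` E)"
  have "finite (\<Union> (set ` E))" "\<Union> (set ` E) \<subseteq> \<Omega>" using E rz_tpl unfolding tpl_def by fastforce+
  then have "sm ?BE" by (rule sm_Un[OF B'(1)])
  from rz_ex[OF this Vu] obtain dd where dd: "dd \<in> rz V ?BE ny" ..
  have "dd \<in> rz V B' ny" using dd rz_mono[of B' ?BE] by blast
  then have dY: "dd \<in> Y B'" by (rule rz_of_teq[OF e0 rz_teq[OF Vu V(2)]])
  define T where "T = (\<lambda>(i, e). ((\<lambda>x u. sl nx i x @ u \<in> \<Phi>), e, dd)) ` ({..<n} \<times> E)"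
  have "\<not> eventually (\<lambda>x. \<exists>(\<delta>, u, v)\<in>T. \<delta> x u \<noteq> \<delta> x v) \<Xi>"
  proof (rule invariant_filter_no_split[OF B'(1,2) fin ne])
    show "finite T" unfolding T_def using E(1) by simp
    fix \<delta> u v assume "(\<delta>, u, v) \<in> T"
    then obtain i where \<delta>: "\<delta> = (\<lambda>x u. sl nx i x @ u \<in> \<Phi>)" "v = dd" "i < n" "u \<in> E" unfolding T_def by auto
    have "equi B' ?X \<delta>"
      unfolding equi_def \<delta>(1)
    proof (intro ballI allI impI)
      fix h x u assume h: "h \<in> GB B'" and x: "x \<in> ?X" and u: "set u \<subseteq> \<Omega>" and xu: "sl nx i x @ u \<in> \<Phi>"
      have "sl nx i x @ u \<in> tpl \<Omega> (nx + ny)" using xu D_sub[OF \<Phi>] by blast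
      from GB_D[OF h \<Phi>B' this] xu show "sl nx i (map h x) @ map h u \<in> \<Phi>" unfolding map_sl[symmetric] by simp
    qed
    moreover have "vc_free d (\<lambda>u x. \<delta> x u) (tpl \<Omega> ny) ?X"
      unfolding \<delta>(1) by (rule vc_free_slice[OF vc(1) \<delta>(3)])
    moreover have "u \<in> rz V B' ny" by (rule YV) (use E(2) \<delta>(4) in blast)
    moreover have "v \<in> rz V (B' \<union> set u) ny"
      unfolding \<delta>(2) by (rule subsetD[OF rz_mono dd]) (use \<delta>(4) in blast)
    ultimately show "equi B' ?X \<delta> \<and> (\<exists>n U K. coh B' n U \<and> u \<in> rz U B' n \<and>
              v \<in> rz U (B' \<union> set u) n \<and> vc_free K (\<lambda>u x. \<delta> x u) (tpl \<Omega> n) ?X)" using V(1) by blast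
  qed
  moreover have "eventually (\<lambda>x. \<exists>(\<delta>, u, v)\<in>T. \<delta> x u \<noteq> \<delta> x v) \<Xi>"
    unfolding ev
  proof (intro bexI[of _ "{dd}"] ballI)
    show "{dd} \<in> Q" unfolding Q_def using dY by simp
    fix x assume "x \<in> S {dd}"
    then obtain i where i: "i < n" "sl nx i x @ dd \<in> \<Phi>" "sl nx i x \<in> \<eta>1" unfolding S_def by auto
    obtain e where e: "e \<in> E" "sl nx i x @ e \<notin> \<Phi>" using kill[OF i(3)] by blast
    have "((\<lambda>x u. sl nx i x @ u \<in> \<Phi>), e, dd) \<in> T" unfolding T_def using i(1) e(1) by force
    then show "\<exists>(\<delta>, u, v)\<in>T. \<delta> x u \<noteq> \<delta> x v" by (rule bexI[rotated]) (use i(2) e(2) in simp)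
  qed
  ultimately show False by contradiction
qed

text \<open>The positive term c' can be any realization over B, because \<open>ok\<close> tolerates
  one more instance of \<phi>. The negative term comes from the finite set A of
  \<open>unimplied\<close>, built over a base that already contains c', so it continues the Morley
  sequence. After each pair the base is enlarged to a small closed set, while the sequence remains
  one over M.\<close>

lemma alternating_chain:
  fixes n :: nat
  assumes n: "n > 0"
    and cover: "\<And>E A. finite E \<and> E \<noteq> {} \<and> vc_free d (\<lambda>e a. a @ e \<in> \<Phi>) E A \<and> vc_free d (\<lambda>a e. a @ e \<in> \<Phi>) A E \<and>
       (\<forall>e. (\<forall>j<n. e j \<in> E) \<longrightarrow> (\<exists>a\<in>A. \<forall>j<n. a @ e j \<in> \<Phi>)) \<longrightarrow>
       (\<exists>a. (\<forall>i<n. a i \<in> A) \<and> (\<forall>e\<in>E. \<exists>i<n. a i @ e \<in> \<Phi>))"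
    and vc: "vc_free d (\<lambda>e a. a @ e \<in> \<Phi>) (tpl \<Omega> ny) (tpl \<Omega> nx)" "vc_free d (\<lambda>a e. a @ e \<in> \<Phi>) (tpl \<Omega> nx) (tpl \<Omega> ny)"
    and ok0: "ok (tpl \<Omega> nx) M"
  shows "\<exists>B \<eta> us. sm B \<and> M \<subseteq> B \<and> \<eta> \<in> D B nx \<and> ok \<eta> B \<and> (\<forall>u\<in>set us. set u \<subseteq> B) \<and>
     morl M [] (replicate (2 * j) (ny, U)) us \<and> (\<forall>a\<in>\<eta>. \<forall>i<j. a @ us ! (2 * i) \<in> \<Phi> \<and> a @ us ! (2 * i + 1) \<notin> \<Phi>)"
proof (induction j)
  case 0
  show ?case
    by (intro exI[of _ M] exI[of _ "tpl \<Omega> nx"] exI[of _ "[]"] conjI sm_M order_refl D_full ok0) simp_all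
next
  case (Suc j)
  then obtain B \<eta> us where B: "sm B" "M \<subseteq> B" "\<eta> \<in> D B nx" "ok \<eta> B" "\<forall>u\<in>set us. set u \<subseteq> B"
     "morl M [] (replicate (2 * j) (ny, U)) us" "\<forall>a\<in>\<eta>. \<forall>i<j. a @ us ! (2 * i) \<in> \<Phi> \<and> a @ us ! (2 * i + 1) \<notin> \<Phi>"
    by (elim exE conjE)
  obtain c' where c': "c' \<in> Y B" using Y_ex[OF B(1)] by blast
  have c't: "c' \<in> tpl \<Omega> ny" by (rule rz_tpl[OF c'])
  have B1: "sm (B \<union> set c')" using sm_Un[OF B(1)] c't unfolding tpl_def by simp
  let ?B1 = "B \<union> set c'" and ?\<eta>1 = "{a \<in> \<eta>. a @ c' \<in> \<Phi>}"
  have \<Phi>B1: "\<Phi> \<in> D ?B1 (nx + ny)" using D_mono[OF _ \<Phi>] B(2) by blast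
  have "{a \<in> tpl \<Omega> nx. a @ c' \<in> \<Phi>} \<in> D ?B1 nx"
    by (rule D_param[OF \<Phi>B1 _ c't]) (use c't in \<open>auto simp: tpl_def\<close>)
  then have "\<eta> \<inter> {a \<in> tpl \<Omega> nx. a @ c' \<in> \<Phi>} \<in> D ?B1 nx"
    using D_Int D_mono[OF _ B(3)] by blast
  moreover have "\<eta> \<inter> {a \<in> tpl \<Omega> nx. a @ c' \<in> \<Phi>} = ?\<eta>1" using D_sub[OF B(3)] by blast
  ultimately have \<eta>1: "?\<eta>1 \<in> D ?B1 nx" by simp
  have ok1: "ok ?\<eta>1 ?B1"
    unfolding ok_def
  proof (intro allI impI)
    fix E assume E: "finite E" "E \<subseteq> Y ?B1"
    have "finite (insert c' E)" "insert c' E \<subseteq> Y B" using E c' rz_mono[of B ?B1] by auto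
    then obtain a where "a \<in> \<eta>" "\<forall>e\<in>insert c' E. a @ e \<in> \<Phi>" using B(4) unfolding ok_def by blast
    then show "\<exists>a\<in>?\<eta>1. \<forall>e\<in>E. a @ e \<in> \<Phi>" by (intro bexI[of _ a]) auto
  qed
  have MB1: "M \<subseteq> ?B1" using B(2) by blast
  from unimplied[OF B1 MB1 \<eta>1 ok1 n] obtain A where A: "finite A" "A \<subseteq> Y ?B1"
    "\<forall>e. (\<forall>j<n. e j \<in> Y ?B1) \<longrightarrow> (\<exists>c\<in>A. \<exists>a\<in>?\<eta>1. (\<forall>j<n. a @ e j \<in> \<Phi>) \<and> a @ c \<notin> \<Phi>)" by (elim exE conjE)
  have At: "c \<in> tpl \<Omega> ny" if "c \<in> A" for c using A(2) that rz_tpl by blast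
  have "sm (?B1 \<union> \<Union> (set ` A))"
    by (rule sm_Un[OF B1]) (use A(1) At in \<open>auto simp: tpl_def\<close>)
  from sm_closed[OF this] obtain B2 where B2: "?B1 \<union> \<Union> (set ` A) \<subseteq> B2" "sm B2" "closed B2"
    unfolding closed_def by (elim exE conjE)
  have B12: "?B1 \<subseteq> B2" and A2: "\<And>c. c \<in> A \<Longrightarrow> set c \<subseteq> B2" using B2(1) by blast+
  have "\<exists>c\<in>A. ok {a \<in> ?\<eta>1. a @ c \<notin> \<Phi>} B2"
    by (rule refute_step[OF B1 MB1 \<eta>1 ok1 n cover vc A(1,2) A(3)[THEN spec, THEN mp] B2(2,3) B12 A2])
  then obtain c where c: "c \<in> A" "ok {a \<in> ?\<eta>1. a @ c \<notin> \<Phi>} B2" by (elim bexE)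
  let ?\<eta>2 = "{a \<in> ?\<eta>1. a @ c \<notin> \<Phi>}" and ?us = "us @ [c', c]"
  have ct: "c \<in> tpl \<Omega> ny" by (rule At[OF c(1)])
  have \<Phi>B2: "\<Phi> \<in> D B2 (nx + ny)" using D_mono[OF _ \<Phi>] MB1 B12 by blast
  have "{a \<in> tpl \<Omega> nx. a @ c \<in> \<Phi>} \<in> D B2 nx"
    by (rule D_param[OF \<Phi>B2 _ ct]) (use ct A2[OF c(1)] in \<open>auto simp: tpl_def\<close>)
  from D_Int[OF D_mono[OF B12 \<eta>1] D_compl[OF this]]
  have "?\<eta>1 \<inter> (tpl \<Omega> nx - {a \<in> tpl \<Omega> nx. a @ c \<in> \<Phi>}) \<in> D B2 nx" .
  moreover have "?\<eta>1 \<inter> (tpl \<Omega> nx - {a \<in> tpl \<Omega> nx. a @ c \<in> \<Phi>}) = ?\<eta>2" using D_sub[OF \<eta>1] by blast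
  ultimately have \<eta>2: "?\<eta>2 \<in> D B2 nx" by simp
  have lus: "length us = 2 * j" using morl_length[OF B(6)] by simp
  have rep: "replicate (2 * Suc j) (ny, U) = replicate (2 * j) (ny, U) @ [(ny, U), (ny, U)]"
    by (simp add: replicate_append_same[symmetric])
  have "c' \<in> rz U (M \<union> set (concat (rev us) @ [])) ny"
    by (rule subsetD[OF rz_mono c']) (use B(2,5) in auto)
  moreover have "c \<in> rz U (M \<union> set (c' @ concat (rev us) @ [])) ny"
    by (rule subsetD[OF rz_mono subsetD[OF A(2) c(1)]]) (use B(2,5) in auto)
  ultimately have mor: "morl M [] (replicate (2 * Suc j) (ny, U)) ?us"
    unfolding rep using B(6) lus by (simp add: morl_append)
  have alt: "a @ ?us ! (2 * i) \<in> \<Phi> \<and> a @ ?us ! (2 * i + 1) \<notin> \<Phi>" if a: "a \<in> ?\<eta>2" and i: "i < Suc j" for a i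
  proof (cases "i = j")
    case True
    then show ?thesis using a lus by (simp add: nth_append)
  next
    case False
    then have "i < j" using i by simp
    moreover have "?us ! (2 * i) = us ! (2 * i)" "?us ! (2 * i + 1) = us ! (2 * i + 1)"
      using \<open>i < j\<close> lus by (simp_all add: nth_append)
    moreover have "a \<in> \<eta>" using a by simp
    ultimately show ?thesis using B(7) by simp
  qed
  have "\<forall>u\<in>set ?us. set u \<subseteq> B2" using B(5) B12 A2[OF c(1)] by auto
  then show ?case
    using B2(2) B12 MB1 \<eta>2 c(2) mor alt
    by (intro exI[of _ B2] exI[of _ ?\<eta>2] exI[of _ ?us] conjI ballI allI impI) blast+
qed

lemma ok_contradiction:
  assumes "ok (tpl \<Omega> nx) M"
  shows False
proof -
  have \<Phi>O: "\<Phi> \<in> D \<Omega> (nx + ny)" by (rule D_mono[OF MO \<Phi>])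
  obtain d1 where d1: "vc_free d1 (\<lambda>e a. a @ e \<in> \<Phi>) (tpl \<Omega> ny) (tpl \<Omega> nx)" using nip_right[OF \<Phi>O] ..
  obtain d2 where d2: "vc_free d2 (\<lambda>a e. a @ e \<in> \<Phi>) (tpl \<Omega> nx) (tpl \<Omega> ny)" using nip[OF \<Phi>O] ..
  define d where "d = max d1 d2"
  have vc: "vc_free d (\<lambda>e a. a @ e \<in> \<Phi>) (tpl \<Omega> ny) (tpl \<Omega> nx)" "vc_free d (\<lambda>a e. a @ e \<in> \<Phi>) (tpl \<Omega> nx) (tpl \<Omega> ny)"
    by (rule vc_free_mono[OF d1], simp_all add: d_def) (rule vc_free_mono[OF d2], simp_all)
  obtain n :: nat where n: "n > 0" and cover: "\<forall>(R :: 'a list \<Rightarrow> 'a list \<Rightarrow> bool) E A.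
     finite E \<and> E \<noteq> {} \<and> vc_free d R E A \<and> vc_free d (\<lambda>a e. R e a) A E \<and>
     (\<forall>e. (\<forall>j<n. e j \<in> E) \<longrightarrow> (\<exists>a\<in>A. \<forall>j<n. R (e j) a)) \<longrightarrow>
     (\<exists>a. (\<forall>i<n. a i \<in> A) \<and> (\<forall>e\<in>E. \<exists>i<n. R e (a i)))"
    using finite_cover_by_few[of d] by (elim exE conjE)
  from alternating_chain[OF n cover[THEN spec, of "\<lambda>e a. a @ e \<in> \<Phi>", THEN spec, THEN spec] vc assms, of d]
  obtain B \<eta> us where B: "sm B" "M \<subseteq> B" "\<eta> \<in> D B nx" "ok \<eta> B" "\<forall>u\<in>set us. set u \<subseteq> B"
     "morl M [] (replicate (2 * d) (ny, U)) us" "\<forall>a\<in>\<eta>. \<forall>i<d. a @ us ! (2 * i) \<in> \<Phi> \<and> a @ us ! (2 * i + 1) \<notin> \<Phi>"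
    by (elim exE conjE)
  obtain a where a: "a \<in> \<eta>" using B(4) unfolding ok_def by blast
  then have "a \<in> tpl \<Omega> nx" using D_sub[OF B(3)] by blast
  from alternation[OF sm_M U B(6) equi_mem[OF \<Phi>] points_tpl vc(1) this] obtain i where
    "i < d" "(a @ us ! (2 * i) \<in> \<Phi>) = (a @ us ! (2 * i + 1) \<in> \<Phi>)" by (elim exE conjE)
  then show False using B(7) a by blast
qed

end

section \<open>The criterion for uniform consistency, and dividing of differences\<close>

context pq_setup
begin

theorem good_if_conjugates_consistent:
  assumes "\<And>E. finite E \<Longrightarrow> E \<subseteq> {c. teq M ny b c} \<Longrightarrow> \<exists>a\<in>tpl \<Omega> nx. \<forall>e\<in>E. a @ e \<in> \<Phi>"
  shows "\<exists>\<beta>\<in>D M ny. b \<in> \<beta> \<and> good \<beta>"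
proof (rule ccontr)
  assume "\<not> ?thesis"
  then have "bad_filter \<noteq> bot" by (intro bad_filter_ne_bot) blast
  from invariant_ultrafilter[OF sm_M closed_M bad_filter_finv this]
  obtain U where "U \<le> bad_filter" "iu M ny U" by blast
  then interpret pq_bad \<Omega> D G sm M nx ny \<Phi> b U by unfold_locales
  have "ok (tpl \<Omega> nx) M" unfolding ok_def using assms Y_M by blast
  then show False by (rule ok_contradiction)
qed

lemma morley_sequence:
  assumes "iu M n V"
  shows "\<exists>s. \<forall>i::nat. s i \<in> rz V (M \<union> \<Union> (set ` s ` {..<i})) n"
proof -
  have V: "ultra V" "eventually (\<lambda>m. m \<in> tpl \<Omega> n) V" using assms unfolding iu_def by auto
  define L where "L = rec_nat [] (\<lambda>k l. l @ [SOME s. s \<in> rz V (M \<union> \<Union> (set ` set l)) n])"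
  define s where "s k = (SOME s. s \<in> rz V (M \<union> \<Union> (set ` set (L k))) n)" for k
  have L: "L k = map s [0..<k]" for k
    by (induction k) (simp_all add: L_def s_def)
  have "s i \<in> rz V (M \<union> \<Union> (set ` s ` {..<i})) n" for i
  proof (induction i rule: less_induct)
    case (less i)
    have "finite (\<Union> (set ` s ` {..<i}))" "\<Union> (set ` s ` {..<i}) \<subseteq> \<Omega>"
      using less rz_tpl unfolding tpl_def by fastforce+
    then have "sm (M \<union> \<Union> (set ` s ` {..<i}))" by (rule sm_Un[OF sm_M])
    from rz_ex[OF this V] have "\<exists>x. x \<in> rz V (M \<union> \<Union> (set ` set (L i))) n"
      unfolding L by (simp add: lessThan_atLeast0)
    from someI_ex[OF this] have "s i \<in> rz V (M \<union> \<Union> (set ` set (L i))) n" unfolding s_def[symmetric] .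
    then show ?case unfolding L by (simp add: lessThan_atLeast0)
  qed
  then show ?thesis by blast
qed

text \<open>A solution a of \<phi>(x, b) violates \<phi> at some c in E, so the value at d differs
  from that at b or from that at c. As d realizes the coheir V over all these parameters, d together
  with c has the type of two successive terms of a Morley sequence of V, and by NIP the value cannot
  change within K pairs of that sequence at once.\<close>

lemma conjugates_consistent_or_dividing:
  assumes cs: "finite E" "E \<subseteq> {c. teq M ny b c}" "\<forall>a\<in>tpl \<Omega> nx. \<exists>c\<in>E. a @ c \<notin> \<Phi>"
  shows "\<exists>d\<in>tpl \<Omega> ny. (\<forall>a\<in>tpl \<Omega> nx. a @ b \<in> \<Phi> \<longrightarrow> (\<exists>c\<in>insert b E. (a @ c \<in> \<Phi>) \<noteq> (a @ d \<in> \<Phi>))) \<and>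
    (\<forall>c\<in>insert b E. \<exists>p q K. (\<forall>i::nat. p i \<in> tpl \<Omega> ny \<and> q i \<in> tpl \<Omega> ny \<and> teq M (ny + ny) (d @ c) (q i @ p i)) \<and>
       (\<forall>I a. finite I \<and> card I = K \<and> a \<in> tpl \<Omega> nx \<longrightarrow> (\<exists>i\<in>I. (a @ p i \<in> \<Phi>) = (a @ q i \<in> \<Phi>))))"
proof -
  have \<Phi>O: "\<Phi> \<in> D \<Omega> (nx + ny)" by (rule D_mono[OF MO \<Phi>])
  obtain K where K: "vc_free K (\<lambda>e a. a @ e \<in> \<Phi>) (tpl \<Omega> ny) (tpl \<Omega> nx)" using nip_right[OF \<Phi>O] ..
  obtain V where V: "coh M ny V" "b \<in> rz V M ny" using coh_ex[OF closed_M MO b] by blast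
  have iu: "iu M ny V" by (rule coh_iu[OF V(1) MO])
  then have Vu: "ultra V" "eventually (\<lambda>m. m \<in> tpl \<Omega> ny) V" unfolding iu_def by auto
  let ?E = "insert b E"
  have ET: "c \<in> rz V M ny" if "c \<in> ?E" for c using that cs(2) rz_of_teq[OF V(2)] V(2) by blast
  have "finite (\<Union> (set ` ?E))" "\<Union> (set ` ?E) \<subseteq> \<Omega>" using cs(1) ET rz_tpl unfolding tpl_def by fastforce+
  then have "sm (M \<union> \<Union> (set ` ?E))" by (rule sm_Un[OF sm_M])
  from rz_ex[OF this Vu] obtain d where d: "d \<in> rz V (M \<union> \<Union> (set ` ?E)) ny" ..
  obtain s where s: "\<forall>i::nat. s i \<in> rz V (M \<union> \<Union> (set ` s ` {..<i})) ny" using morley_sequence[OF iu] by blast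
  have st: "s i \<in> tpl \<Omega> ny" for i using s rz_tpl by blast
  have teq: "teq M (ny + ny) (d @ c) (s (Suc (2 * i)) @ s (2 * i))" if c: "c \<in> ?E" for c i
  proof (rule rz_teq_append[OF iu])
    show "d \<in> rz V (M \<union> set c) ny" by (rule subsetD[OF rz_mono d]) (use c in blast)
    show "s (Suc (2 * i)) \<in> rz V (M \<union> set (s (2 * i))) ny"
      by (rule subsetD[OF rz_mono s[THEN spec]]) auto
    have "s (2 * i) \<in> rz V M ny" by (rule subsetD[OF rz_mono s[THEN spec]]) auto
    then show "teq M ny c (s (2 * i))" by (rule rz_teq[OF Vu ET[OF c]])
  qed
  have inc: "\<exists>i\<in>I. (a @ s (2 * i) \<in> \<Phi>) = (a @ s (Suc (2 * i)) \<in> \<Phi>)"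
    if I: "finite I" "card I = K" and a: "a \<in> tpl \<Omega> nx" for I a
  proof -
    define il where "il = sorted_list_of_set I"
    have il: "sorted_wrt (<) il" "set il = I" "length il = K" unfolding il_def using I by auto
    \<comment> \<open>The pairs numbered by I, taken in increasing order, form a Morley sequence of
      length 2K: j div 2 selects the element of I, and j mod 2 the member of its pair.\<close>
    define idx where "idx j = 2 * (il ! (j div 2)) + j mod 2" for j
    have idx: "idx j < idx l" if "j < l" "l < 2 * K" for j l
    proof (cases "j div 2 = l div 2")
      case True
      then have "j mod 2 < l mod 2" using that(1) by presburger
      then show ?thesis unfolding idx_def True by simp
    next
      case False
      then have "j div 2 < l div 2" "l div 2 < length il" using that il(3) by auto
      from sorted_wrt_nth_less[OF il(1) this] have "il ! (j div 2) < il ! (l div 2)" .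
      then have "Suc (il ! (j div 2)) \<le> il ! (l div 2)" by simp
      moreover have "j mod 2 < 2" by simp
      ultimately show ?thesis unfolding idx_def by linarith
    qed
    let ?us = "map (\<lambda>j. s (idx j)) [0..<2 * K]"
    have "?us ! i \<in> rz V (M \<union> set [] \<union> \<Union> (set ` set (take i ?us))) ny" if i: "i < 2 * K" for i
    proof -
      have t: "take i ?us = map (\<lambda>j. s (idx j)) [0..<i]" using i by (simp add: take_map)
      have "s (idx i) \<in> rz V (M \<union> set [] \<union> \<Union> (set ` set (take i ?us))) ny"
        by (rule subsetD[OF rz_mono s[THEN spec]]) (use idx[OF _ i] in \<open>fastforce simp: t\<close>)
      then show ?thesis using i by simp
    qed
    then have "morl M [] (replicate (2 * K) (ny, V)) ?us" unfolding morl_replicate_iff by simp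
    from alternation[OF sm_M iu this equi_mem[OF \<Phi>] points_tpl K a]
    obtain j where j: "j < K" "(a @ ?us ! (2 * j) \<in> \<Phi>) = (a @ ?us ! (2 * j + 1) \<in> \<Phi>)" by (elim exE conjE)
    have "?us ! (2 * j) = s (2 * il ! j)" "?us ! (2 * j + 1) = s (Suc (2 * il ! j))"
      using j(1) by (simp_all add: idx_def)
    moreover have "il ! j \<in> I" using il(2,3) j(1) nth_mem by blast
    ultimately show ?thesis using j(2) by (intro bexI[of _ "il ! j"]) simp_all
  qed
  show ?thesis
  proof (rule bexI[of _ d], intro conjI ballI impI)
    show "d \<in> tpl \<Omega> ny" by (rule rz_tpl[OF d])
    show "\<exists>c\<in>?E. (a @ c \<in> \<Phi>) \<noteq> (a @ d \<in> \<Phi>)" if a: "a \<in> tpl \<Omega> nx" "a @ b \<in> \<Phi>" for a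
    proof -
      obtain c where c: "c \<in> E" "a @ c \<notin> \<Phi>" using bspec[OF cs(3) a(1)] by blast
      show ?thesis
      proof (cases "a @ d \<in> \<Phi>")
        case True
        then show ?thesis using c by (intro bexI[of _ c]) simp_all
      next
        case False
        then show ?thesis using a(2) by (intro bexI[of _ b]) simp_all
      qed
    qed
    fix c assume c: "c \<in> ?E"
    show "\<exists>p q K. (\<forall>i::nat. p i \<in> tpl \<Omega> ny \<and> q i \<in> tpl \<Omega> ny \<and> teq M (ny + ny) (d @ c) (q i @ p i)) \<and>
       (\<forall>I a. finite I \<and> card I = K \<and> a \<in> tpl \<Omega> nx \<longrightarrow> (\<exists>i\<in>I. (a @ p i \<in> \<Phi>) = (a @ q i \<in> \<Phi>)))"
    proof (rule exI[of _ "\<lambda>i. s (2 * i)"], rule exI[of _ "\<lambda>i. s (Suc (2 * i))"], rule exI[of _ K],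
        intro conjI allI impI st teq[OF c])
      fix I :: "nat set" and a assume "finite I \<and> card I = K \<and> a \<in> tpl \<Omega> nx"
      then show "\<exists>i\<in>I. (a @ s (2 * i) \<in> \<Phi>) = (a @ s (Suc (2 * i)) \<in> \<Phi>)" using inc by simp
    qed
  qed
qed

end

section \<open>Renaming, parameters and satisfaction\<close>

lemma expand_simps [simp]:
  "carrier (expand N) = carrier N" "fint (expand N) (Inl f) = fint N f" "fint (expand N) (Inr a) as = a"
  "rint (expand N) = rint N"
  unfolding expand_def by simp_all

lemma eval_cong: "(\<And>v. v \<in> fv_tm t \<Longrightarrow> e v = e' v) \<Longrightarrow> eval N e t = eval N e' t"
proof (induction t)
  case (Fn f ts)
  have "map (eval N e) ts = map (eval N e') ts"
    by (rule map_cong[OF refl], rule Fn.IH) (use Fn.prems in auto)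
  then show ?case by (simp only: eval.simps)
qed simp

lemma sat_cong: "(\<And>v. v \<in> fv \<psi> \<Longrightarrow> e v = e' v) \<Longrightarrow> sat N e \<psi> \<longleftrightarrow> sat N e' \<psi>"
proof (induction \<psi> arbitrary: e e')
  case (Eq s t)
  have "eval N e s = eval N e' s" "eval N e t = eval N e' t" by (rule eval_cong, use Eq in simp)+
  then show ?case by simp
next
  case (Rel r ts)
  have "map (eval N e) ts = map (eval N e') ts"
    by (rule map_cong[OF refl], rule eval_cong) (use Rel in auto)
  then show ?case by (simp only: sat.simps)
next
  case (And \<psi>1 \<psi>2)
  have "sat N e \<psi>1 \<longleftrightarrow> sat N e' \<psi>1" "sat N e \<psi>2 \<longleftrightarrow> sat N e' \<psi>2"
    by (rule And.IH, use And.prems in simp)+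
  then show ?case by simp
next
  case (Ex v \<psi>)
  have "sat N (e(v := a)) \<psi> \<longleftrightarrow> sat N (e'(v := a)) \<psi>" for a
    by (rule Ex.IH) (use Ex.prems in auto)
  then show ?case by (simp only: sat.simps)
next
  case (Neg \<psi>)
  have "sat N e \<psi> \<longleftrightarrow> sat N e' \<psi>" by (rule Neg.IH) (use Neg.prems in simp)
  then show ?case by simp
qed

lemma finite_fv_tm: "finite (fv_tm t)"
  by (induction t) auto

lemma finite_fv: "finite (fv \<psi>)"
  by (induction \<psi>) (auto simp: finite_fv_tm)

section \<open>Replacing parameters by variables, and back\<close>

fun consts_tm :: "('f + 'a) tm \<Rightarrow> 'a set" where
  "consts_tm (Var v) = {}"
| "consts_tm (Fn f ts) = (case f of Inl _ \<Rightarrow> {} | Inr a \<Rightarrow> {a}) \<union> (\<Union>t\<in>set ts. consts_tm t)"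

fun consts_fm :: "('f + 'a, 'r) fm \<Rightarrow> 'a set" where
  "consts_fm (Eq s t) = consts_tm s \<union> consts_tm t"
| "consts_fm (Rel r ts) = (\<Union>t\<in>set ts. consts_tm t)"
| "consts_fm (Neg \<phi>) = consts_fm \<phi>"
| "consts_fm (And \<phi> \<psi>) = consts_fm \<phi> \<union> consts_fm \<psi>"
| "consts_fm (Ex v \<phi>) = consts_fm \<phi>"

lemma finite_consts_tm: "finite (consts_tm t)"
  by (induction t) (auto split: sum.split)

lemma finite_consts_fm: "finite (consts_fm \<psi>)"
  by (induction \<psi>) (auto simp: finite_consts_tm)

lemma consts_tm_subset: "wf_tm (lang_over L A) t \<Longrightarrow> consts_tm t \<subseteq> A"
proof (induction t)
  case (Fn f ts)
  then show ?case by (cases f) (fastforce simp: lang_over_def)+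
qed simp

lemma consts_fm_subset: "wf_fm (lang_over L A) \<psi> \<Longrightarrow> consts_fm \<psi> \<subseteq> A"
proof (induction \<psi>)
  case (Rel r ts)
  then show ?case using consts_tm_subset[of L A] by fastforce
qed (use consts_tm_subset[of L A] in auto)

fun untm :: "('a \<Rightarrow> nat) \<Rightarrow> (nat \<Rightarrow> nat) \<Rightarrow> ('f + 'a) tm \<Rightarrow> 'f tm" where
  "untm p \<rho> (Var v) = Var (\<rho> v)"
| "untm p \<rho> (Fn f ts) = (case f of Inl f' \<Rightarrow> Fn f' (map (untm p \<rho>) ts) | Inr a \<Rightarrow> Var (p a))"

lemma wf_untm: "wf_tm (lang_over L A) t \<Longrightarrow> wf_tm L (untm p \<rho> t)"
proof (induction t)
  case (Fn f ts)
  then show ?case by (cases f) (auto simp: lang_over_def)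
qed simp

lemma fv_untm: "fv_tm (untm p \<rho> t) \<subseteq> \<rho> ` fv_tm t \<union> p ` consts_tm t"
proof (induction t)
  case (Fn f ts)
  show ?case
  proof (cases f)
    case (Inl f')
    show ?thesis
    proof
      fix v assume "v \<in> fv_tm (untm p \<rho> (Fn f ts))"
      then obtain t where t: "t \<in> set ts" "v \<in> fv_tm (untm p \<rho> t)" unfolding Inl by auto
      have "v \<in> \<rho> ` fv_tm t \<union> p ` consts_tm t" by (rule subsetD[OF Fn.IH[OF t(1)] t(2)])
      then show "v \<in> \<rho> ` fv_tm (Fn f ts) \<union> p ` consts_tm (Fn f ts)" using t(1) by auto
    qed
  next
    case (Inr a)
    then show ?thesis by simp
  qed
qed simp

lemma eval_untm:
  "wf_tm (lang_over L A) t \<Longrightarrow> (\<And>a. a \<in> consts_tm t \<Longrightarrow> e (p a) = a) \<Longrightarrow>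
    eval N e (untm p \<rho> t) = eval (expand N) (\<lambda>v. e (\<rho> v)) t"
proof (induction t)
  case (Fn f ts)
  show ?case
  proof (cases f)
    case (Inl f')
    have "map (\<lambda>t. eval N e (untm p \<rho> t)) ts = map (eval (expand N) (\<lambda>v. e (\<rho> v))) ts"
      by (rule map_cong[OF refl], rule Fn.IH) (use Fn.prems Inl in auto)
    then have "fint N f' (map (\<lambda>t. eval N e (untm p \<rho> t)) ts) = fint N f' (map (eval (expand N) (\<lambda>v. e (\<rho> v))) ts)"
      by (rule arg_cong)
    then show ?thesis using Inl by (simp add: comp_def)
  next
    case (Inr a)
    then show ?thesis using Fn.prems by simp
  qed
qed simp

text \<open>The translation is stated as an existence result because each quantifier receives a new
  bound variable that avoids the images of \<rho> and p; under an arbitrary renaming, the original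
  bound variable could capture one of them.\<close>

lemma ex_unparam:
  fixes \<psi> :: "('f + 'a, 'r) fm"
  assumes "wf_fm (lang_over L A) \<psi>"
  shows "\<exists>\<psi>'. wf_fm L \<psi>' \<and> fv \<psi>' \<subseteq> \<rho> ` fv \<psi> \<union> p ` consts_fm \<psi> \<and>
    (\<forall>(N :: ('a, 'f, 'r) struct) e. (\<forall>a\<in>consts_fm \<psi>. e (p a) = a) \<longrightarrow>
       sat N e \<psi>' = sat (expand N) (\<lambda>v. e (\<rho> v)) \<psi>)"
  using assms
proof (induction \<psi> arbitrary: \<rho>)
  case (Eq s t)
  have wf: "wf_tm (lang_over L A) s" "wf_tm (lang_over L A) t" using Eq by simp_all
  have "wf_fm L (Eq (untm p \<rho> s) (untm p \<rho> t))" using wf wf_untm[of L A] by simp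
  moreover have "fv (Eq (untm p \<rho> s) (untm p \<rho> t)) \<subseteq> \<rho> ` fv (Eq s t) \<union> p ` consts_fm (Eq s t)"
    using fv_untm[of p \<rho> s] fv_untm[of p \<rho> t] unfolding fv.simps consts_fm.simps image_Un by blast
  moreover have "sat N e (Eq (untm p \<rho> s) (untm p \<rho> t)) = sat (expand N) (\<lambda>v. e (\<rho> v)) (Eq s t)"
    if "\<forall>a\<in>consts_fm (Eq s t). e (p a) = a" for N :: "('a, 'f, 'r) struct" and e
    using that eval_untm[OF wf(1), of e p N \<rho>] eval_untm[OF wf(2), of e p N \<rho>] by simp
  ultimately show ?case by blast
next
  case (Rel r ts)
  have wf: "\<And>t. t \<in> set ts \<Longrightarrow> wf_tm (lang_over L A) t" using Rel by simp
  have "map (\<lambda>t. eval N e (untm p \<rho> t)) ts = map (eval (expand N) (\<lambda>v. e (\<rho> v))) ts"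
    if "\<forall>a\<in>consts_fm (Rel r ts). e (p a) = a" for N :: "('a, 'f, 'r) struct" and e
    by (rule map_cong[OF refl], rule eval_untm[OF wf]) (use that in auto)
  then have "sat N e (Rel r (map (untm p \<rho>) ts)) = sat (expand N) (\<lambda>v. e (\<rho> v)) (Rel r ts)"
    if "\<forall>a\<in>consts_fm (Rel r ts). e (p a) = a" for N :: "('a, 'f, 'r) struct" and e
    using that by (simp only: sat.simps expand_simps map_map comp_def)
  moreover have "wf_fm L (Rel r (map (untm p \<rho>) ts))"
    using Rel wf_untm[of L A] by (auto simp: lang_over_def)
  moreover have "fv (Rel r (map (untm p \<rho>) ts)) \<subseteq> \<rho> ` fv (Rel r ts) \<union> p ` consts_fm (Rel r ts)"
  proof
    fix v assume "v \<in> fv (Rel r (map (untm p \<rho>) ts))"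
    then obtain t where t: "t \<in> set ts" "v \<in> fv_tm (untm p \<rho> t)" by auto
    have "v \<in> \<rho> ` fv_tm t \<union> p ` consts_tm t" by (rule subsetD[OF fv_untm t(2)])
    then show "v \<in> \<rho> ` fv (Rel r ts) \<union> p ` consts_fm (Rel r ts)" using t(1) by auto
  qed
  ultimately show ?case by blast
next
  case (Neg \<psi>)
  then have wf: "wf_fm (lang_over L A) \<psi>" by simp
  from Neg.IH[OF wf, of \<rho>] obtain \<psi>' where "wf_fm L \<psi>'" "fv \<psi>' \<subseteq> \<rho> ` fv \<psi> \<union> p ` consts_fm \<psi>"
    "\<forall>(N :: ('a, 'f, 'r) struct) e. (\<forall>a\<in>consts_fm \<psi>. e (p a) = a) \<longrightarrow>
       sat N e \<psi>' = sat (expand N) (\<lambda>v. e (\<rho> v)) \<psi>" by (elim exE conjE)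
  then show ?case by (intro exI[of _ "Neg \<psi>'"]) simp
next
  case (And \<psi>1 \<psi>2)
  have wf: "wf_fm (lang_over L A) \<psi>1" "wf_fm (lang_over L A) \<psi>2" using And.prems by simp_all
  from And.IH(1)[OF wf(1), of \<rho>] obtain \<psi>1' where 1: "wf_fm L \<psi>1'" "fv \<psi>1' \<subseteq> \<rho> ` fv \<psi>1 \<union> p ` consts_fm \<psi>1"
    "\<forall>(N :: ('a, 'f, 'r) struct) e. (\<forall>a\<in>consts_fm \<psi>1. e (p a) = a) \<longrightarrow>
       sat N e \<psi>1' = sat (expand N) (\<lambda>v. e (\<rho> v)) \<psi>1" by (elim exE conjE)
  from And.IH(2)[OF wf(2), of \<rho>] obtain \<psi>2' where 2: "wf_fm L \<psi>2'" "fv \<psi>2' \<subseteq> \<rho> ` fv \<psi>2 \<union> p ` consts_fm \<psi>2"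
    "\<forall>(N :: ('a, 'f, 'r) struct) e. (\<forall>a\<in>consts_fm \<psi>2. e (p a) = a) \<longrightarrow>
       sat N e \<psi>2' = sat (expand N) (\<lambda>v. e (\<rho> v)) \<psi>2" by (elim exE conjE)
  have "fv (And \<psi>1' \<psi>2') \<subseteq> \<rho> ` fv (And \<psi>1 \<psi>2) \<union> p ` consts_fm (And \<psi>1 \<psi>2)"
    using 1(2) 2(2) unfolding fv.simps consts_fm.simps image_Un by blast
  then show ?case using 1(1,3) 2(1,3) by (intro exI[of _ "And \<psi>1' \<psi>2'"]) simp
next
  case (Ex v \<psi>)
  have fin: "finite (\<rho> ` fv (Ex v \<psi>) \<union> p ` consts_fm \<psi>)" by (simp add: finite_fv finite_consts_fm)
  obtain w where w: "w \<notin> \<rho> ` fv (Ex v \<psi>) \<union> p ` consts_fm \<psi>" using ex_new_if_finite[OF infinite_UNIV_nat fin] ..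
  have wf: "wf_fm (lang_over L A) \<psi>" using Ex.prems by simp
  from Ex.IH[OF wf, of "\<rho>(v := w)"] obtain \<psi>' where \<psi>': "wf_fm L \<psi>'" "fv \<psi>' \<subseteq> \<rho>(v := w) ` fv \<psi> \<union> p ` consts_fm \<psi>"
    "\<forall>(N :: ('a, 'f, 'r) struct) e. (\<forall>a\<in>consts_fm \<psi>. e (p a) = a) \<longrightarrow>
       sat N e \<psi>' = sat (expand N) (\<lambda>u. e ((\<rho>(v := w)) u)) \<psi>" by (elim exE conjE)
  have "sat N e (Ex w \<psi>') = sat (expand N) (\<lambda>u. e (\<rho> u)) (Ex v \<psi>)"
    if e: "\<forall>a\<in>consts_fm (Ex v \<psi>). e (p a) = a" for N :: "('a, 'f, 'r) struct" and e
  proof -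
    have "sat N (e(w := a)) \<psi>' = sat (expand N) ((\<lambda>u. e (\<rho> u))(v := a)) \<psi>" for a
    proof -
      have "(e(w := a)) (p c) = c" if "c \<in> consts_fm \<psi>" for c
      proof -
        have "p c \<noteq> w" using w that by auto
        then show ?thesis using e that by simp
      qed
      then have "sat N (e(w := a)) \<psi>' = sat (expand N) (\<lambda>u. (e(w := a)) ((\<rho>(v := w)) u)) \<psi>"
        using \<psi>'(3) by blast
      also have "\<dots> = sat (expand N) ((\<lambda>u. e (\<rho> u))(v := a)) \<psi>"
      proof (rule sat_cong)
        fix u assume "u \<in> fv \<psi>"
        then have "u \<noteq> v \<Longrightarrow> \<rho> u \<noteq> w" using w by auto
        then show "(e(w := a)) ((\<rho>(v := w)) u) = ((\<lambda>u. e (\<rho> u))(v := a)) u" by simp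
      qed
      finally show ?thesis .
    qed
    then show ?thesis by simp
  qed
  moreover have "fv (Ex w \<psi>') \<subseteq> \<rho> ` fv (Ex v \<psi>) \<union> p ` consts_fm (Ex v \<psi>)"
  proof
    fix u assume "u \<in> fv (Ex w \<psi>')"
    then have u: "u \<in> fv \<psi>'" "u \<noteq> w" by auto
    then consider x where "x \<in> fv \<psi>" "u = (\<rho>(v := w)) x" | "u \<in> p ` consts_fm \<psi>" using \<psi>'(2) by blast
    then show "u \<in> \<rho> ` fv (Ex v \<psi>) \<union> p ` consts_fm (Ex v \<psi>)"
    proof cases
      case 1
      then have "x \<noteq> v" using u(2) by auto
      then show ?thesis using 1 by simp
    qed simp
  qed
  moreover have "wf_fm L (Ex w \<psi>')" using \<psi>'(1) by simp
  ultimately show ?case by blast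
qed

abbreviation emb :: "('f, 'r) fm \<Rightarrow> ('f + 'a, 'r) fm" where
  "emb \<equiv> map_fm Inl (\<lambda>r. r)"

lemma eval_emb: "eval (expand N) e (map_tm Inl t) = eval N e t"
  by (induction t) (simp_all add: comp_def cong: map_cong)

lemma sat_emb: "sat (expand N) e (emb \<psi>) = sat N e \<psi>"
proof (induction \<psi> arbitrary: e)
  case (Rel r ts)
  then show ?case by (simp add: eval_emb comp_def)
next
  case (Ex v \<psi>)
  show ?case by (simp only: fm.map sat.simps expand_simps Ex.IH)
qed (simp_all add: eval_emb)

lemma wf_emb_tm: "wf_tm L t \<Longrightarrow> wf_tm (lang_over L A) (map_tm Inl t)"
  by (induction t) (auto simp: lang_over_def)

lemma wf_emb: "wf_fm L \<psi> \<Longrightarrow> wf_fm (lang_over L A) (emb \<psi>)"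
  by (induction \<psi>) (auto simp: wf_emb_tm, auto simp: lang_over_def)

lemma fv_emb_tm: "fv_tm (map_tm f t) = fv_tm t"
  by (induction t) auto

lemma fv_emb: "fv (map_fm f g \<psi>) = fv \<psi>"
  by (induction \<psi>) (auto simp: fv_emb_tm)

lemma consts_emb_tm: "consts_tm (map_tm Inl t) = {}"
  by (induction t) auto

lemma consts_emb: "consts_fm (emb \<psi>) = {}"
  by (induction \<psi>) (auto simp: consts_emb_tm)

text \<open>The case without parameters: \<open>emb\<close> produces no constants, so the condition
  on p is void. The renaming may identify variables.\<close>

lemma ex_rename:
  fixes \<psi> :: "('f, 'r) fm"
  assumes "wf_fm L \<psi>"
  shows "\<exists>\<psi>'. wf_fm L \<psi>' \<and> fv \<psi>' \<subseteq> \<rho> ` fv \<psi> \<and>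
    (\<forall>(N :: ('a, 'f, 'r) struct) e. sat N e \<psi>' = sat N (\<lambda>v. e (\<rho> v)) \<psi>)"
proof -
  let ?\<psi> = "emb \<psi> :: ('f + 'a, 'r) fm"
  obtain \<psi>' where "wf_fm L \<psi>'" "fv \<psi>' \<subseteq> \<rho> ` fv ?\<psi> \<union> undefined ` consts_fm ?\<psi>"
    "\<forall>(N :: ('a, 'f, 'r) struct) e. (\<forall>a\<in>consts_fm ?\<psi>. e (undefined a) = a) \<longrightarrow>
       sat N e \<psi>' = sat (expand N) (\<lambda>v. e (\<rho> v)) ?\<psi>"
    using ex_unparam[OF wf_emb[OF assms, of "{} :: 'a set"], of \<rho> undefined] by blast
  then show ?thesis by (auto simp: consts_emb sat_emb fv_emb)
qed

lemma eval_subst: "eval (expand N) e (subst_tm \<sigma> t) = eval (expand N) (\<lambda>v. case \<sigma> v of None \<Rightarrow> e v | Some a \<Rightarrow> a) t"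
proof (induction t)
  case (Var v)
  then show ?case by (simp split: option.split)
next
  case (Fn f ts)
  then have "map (\<lambda>t. eval (expand N) e (subst_tm \<sigma> t)) ts =
      map (eval (expand N) (\<lambda>v. case \<sigma> v of None \<Rightarrow> e v | Some a \<Rightarrow> a)) ts" by simp
  then show ?case by (simp only: subst_tm.simps eval.simps map_map comp_def)
qed

lemma sat_subst: "sat (expand N) e (subst \<sigma> \<psi>) = sat (expand N) (\<lambda>v. case \<sigma> v of None \<Rightarrow> e v | Some a \<Rightarrow> a) \<psi>"
proof (induction \<psi> arbitrary: \<sigma> e)
  case (Rel r ts)
  show ?case by (simp add: comp_def eval_subst)
next
  case (Ex v \<psi>)
  have "(\<lambda>u. case (\<sigma>(v := None)) u of None \<Rightarrow> (e(v := a)) u | Some b \<Rightarrow> b) =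
      (\<lambda>u. case \<sigma> u of None \<Rightarrow> e u | Some b \<Rightarrow> b)(v := a)" for a by (rule ext) (simp split: option.split)
  then show ?case by (simp only: subst.simps sat.simps Ex.IH)
qed (simp_all add: eval_subst)

lemma wf_subst_tm:
  "wf_tm (lang_over L A) t \<Longrightarrow> ran \<sigma> \<subseteq> A \<Longrightarrow> wf_tm (lang_over L A) (subst_tm \<sigma> t)"
proof (induction t)
  case (Var v)
  then show ?case by (auto simp: lang_over_def ran_def split: option.split)
qed auto

lemma wf_subst: "wf_fm (lang_over L A) \<psi> \<Longrightarrow> ran \<sigma> \<subseteq> A \<Longrightarrow> wf_fm (lang_over L A) (subst \<sigma> \<psi>)"
proof (induction \<psi> arbitrary: \<sigma>)
  case (Ex v \<psi>)
  have "ran (\<sigma>(v := None)) \<subseteq> A" using Ex.prems(2) by (auto simp: ran_def)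
  then show ?case using Ex by simp
qed (auto simp: wf_subst_tm)

lemma fv_subst_tm: "fv_tm (subst_tm \<sigma> t) = fv_tm t - dom \<sigma>"
  by (induction t) (auto split: option.split)

lemma fv_subst: "fv (subst \<sigma> \<psi>) = fv \<psi> - dom \<sigma>"
  by (induction \<psi> arbitrary: \<sigma>) (auto simp: fv_subst_tm)

section \<open>Automorphisms preserve satisfaction\<close>

lemma eval_automorphism:
  assumes "automorphism L C h" "is_struct L C" "wf_tm L t" "\<And>v. v \<in> fv_tm t \<Longrightarrow> e v \<in> carrier C"
  shows "eval C (\<lambda>v. h (e v)) t = h (eval C e t) \<and> eval C e t \<in> carrier C"
  using assms(3,4)
proof (induction t)
  case (Fn f ts)
  have IH: "eval C (\<lambda>v. h (e v)) t = h (eval C e t) \<and> eval C e t \<in> carrier C" if "t \<in> set ts" for t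
    by (rule Fn.IH) (use that Fn.prems in auto)
  have s: "set (map (eval C e) ts) \<subseteq> carrier C" "length (map (eval C e) ts) = farity L f" "f \<in> funs L"
    using IH Fn.prems(1) by auto
  have "map (eval C (\<lambda>v. h (e v))) ts = map h (map (eval C e) ts)" using IH by simp
  then have "eval C (\<lambda>v. h (e v)) (Fn f ts) = fint C f (map h (map (eval C e) ts))"
    by (simp only: eval.simps)
  also have "\<dots> = h (fint C f (map (eval C e) ts))"
    using s assms(1) unfolding automorphism_def by metis
  moreover have "fint C f (map (eval C e) ts) \<in> carrier C" using s assms(2) unfolding is_struct_def by blast
  ultimately show ?case by (simp only: eval.simps)
qed simp

lemma sat_automorphism:
  assumes "automorphism L C h" "is_struct L C" "wf_fm L \<psi>" "\<And>v. v \<in> fv \<psi> \<Longrightarrow> e v \<in> carrier C"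
  shows "sat C (\<lambda>v. h (e v)) \<psi> = sat C e \<psi>"
  using assms(3,4)
proof (induction \<psi> arbitrary: e)
  case (Eq s t)
  have 1: "eval C (\<lambda>v. h (e v)) s = h (eval C e s) \<and> eval C e s \<in> carrier C"
    by (rule eval_automorphism[OF assms(1,2)]) (use Eq in auto)
  have 2: "eval C (\<lambda>v. h (e v)) t = h (eval C e t) \<and> eval C e t \<in> carrier C"
    by (rule eval_automorphism[OF assms(1,2)]) (use Eq in auto)
  have "inj_on h (carrier C)" using assms(1) unfolding automorphism_def bij_betw_def by simp
  then show ?case using 1 2 by (simp add: inj_on_eq_iff)
next
  case (Rel r ts)
  have IH: "eval C (\<lambda>v. h (e v)) t = h (eval C e t) \<and> eval C e t \<in> carrier C" if "t \<in> set ts" for t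
    by (rule eval_automorphism[OF assms(1,2)]) (use that Rel in auto)
  have s: "set (map (eval C e) ts) \<subseteq> carrier C" "length (map (eval C e) ts) = rarity L r" "r \<in> rels L"
    using IH Rel.prems(1) by auto
  have "map (eval C (\<lambda>v. h (e v))) ts = map h (map (eval C e) ts)" using IH by simp
  then have "sat C (\<lambda>v. h (e v)) (Rel r ts) = rint C r (map h (map (eval C e) ts))"
    by (simp only: sat.simps)
  also have "\<dots> = rint C r (map (eval C e) ts)"
    using s assms(1) unfolding automorphism_def by metis
  finally show ?case by (simp only: sat.simps)
next
  case (Ex v \<psi>)
  have im: "h ` carrier C = carrier C" using assms(1) unfolding automorphism_def bij_betw_def by simp
  have "sat C ((\<lambda>u. h (e u))(v := h a)) \<psi> = sat C (e(v := a)) \<psi>" if "a \<in> carrier C" for a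
  proof -
    have "(\<lambda>u. h (e u))(v := h a) = (\<lambda>u. h ((e(v := a)) u))" by auto
    moreover have "sat C (\<lambda>u. h ((e(v := a)) u)) \<psi> = sat C (e(v := a)) \<psi>"
      by (rule Ex.IH) (use Ex.prems that in auto)
    ultimately show ?thesis by simp
  qed
  then have "(\<exists>a\<in>h ` carrier C. sat C ((\<lambda>u. h (e u))(v := a)) \<psi>) = (\<exists>a\<in>carrier C. sat C (e(v := a)) \<psi>)"
    by auto
  then show ?case unfolding im by simp
next
  case (Neg \<psi>)
  have "sat C (\<lambda>v. h (e v)) \<psi> = sat C e \<psi>" by (rule Neg.IH) (use Neg.prems in simp_all)
  then show ?case by simp
next
  case (And \<psi>1 \<psi>2)
  have "sat C (\<lambda>v. h (e v)) \<psi>1 = sat C e \<psi>1" "sat C (\<lambda>v. h (e v)) \<psi>2 = sat C e \<psi>2"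
    by (rule And.IH, use And.prems in simp_all)+
  then show ?case by simp
qed

lemma automorphism_inv:
  assumes "automorphism L C h" "is_struct L C"
  shows "automorphism L C (inv_into (carrier C) h)"
proof -
  let ?\<Omega> = "carrier C"
  let ?k = "inv_into (carrier C) h"
  have bij: "bij_betw h ?\<Omega> ?\<Omega>" using assms(1) unfolding automorphism_def by simp
  have bk: "bij_betw ?k ?\<Omega> ?\<Omega>" by (rule bij_betw_inv_into[OF bij])
  have hk: "h (?k a) = a" "?k a \<in> ?\<Omega>" if "a \<in> ?\<Omega>" for a
    using bij_betw_inv_into_right[OF bij that] bij_betwE[OF bk] that by auto
  have kh: "?k (h a) = a" if "a \<in> ?\<Omega>" for a by (rule bij_betw_inv_into_left[OF bij that])
  have mhk: "map h (map ?k as) = as" "set (map ?k as) \<subseteq> ?\<Omega>" if "set as \<subseteq> ?\<Omega>" for as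
    using that hk by (induction as) auto
  have "?k (fint C f as) = fint C f (map ?k as)"
    if f: "f \<in> funs L" "set as \<subseteq> ?\<Omega>" "length as = farity L f" for f as
  proof -
    have "h (fint C f (map ?k as)) = fint C f (map h (map ?k as))" "fint C f (map ?k as) \<in> ?\<Omega>"
      using assms f mhk(2)[OF f(2)] unfolding automorphism_def is_struct_def by auto
    then show ?thesis using kh mhk(1)[OF f(2)] by metis
  qed
  moreover have "rint C r as = rint C r (map ?k as)"
    if r: "r \<in> rels L" "set as \<subseteq> ?\<Omega>" "length as = rarity L r" for r as
  proof -
    have "rint C r (map ?k as) = rint C r (map h (map ?k as))"
      using assms(1) r mhk(2)[OF r(2)] unfolding automorphism_def by auto
    then show ?thesis using mhk(1)[OF r(2)] by simp
  qed
  ultimately show ?thesis using bk unfolding automorphism_def by blast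
qed

section \<open>Definable sets of a first-order structure\<close>

definition env :: "nat list \<Rightarrow> 'a list \<Rightarrow> nat \<Rightarrow> 'a" where
  "env xs as v = the (map_of (zip xs as) v)"

lemma holds_env: "holds N \<psi> xs as = sat N (env xs as) \<psi>"
  unfolding holds_def env_def[abs_def] ..

lemma env_nth: "distinct xs \<Longrightarrow> length as = length xs \<Longrightarrow> i < length xs \<Longrightarrow> env xs as (xs ! i) = as ! i"
  unfolding env_def by (simp add: map_of_zip_nth)

lemma env_upt: "length as = n \<Longrightarrow> i < n \<Longrightarrow> env [0..<n] as i = as ! i"
  using env_nth[of "[0..<n]" as i] by simp

definition pos :: "'b list \<Rightarrow> 'b \<Rightarrow> nat" where
  "pos xs v = (SOME i. i < length xs \<and> xs ! i = v)"

lemma pos: "v \<in> set xs \<Longrightarrow> pos xs v < length xs \<and> xs ! pos xs v = v"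
  unfolding pos_def by (rule someI_ex) (simp add: in_set_conv_nth)

lemma env_pos: "distinct xs \<Longrightarrow> length as = length xs \<Longrightarrow> v \<in> set xs \<Longrightarrow> env xs as v = as ! pos xs v"
  using env_nth[of xs as "pos xs v"] pos[of v xs] by simp

locale fo_structure =
  fixes L :: "('f, 'r) lang" and C :: "('a, 'f, 'r) struct"
  assumes struct: "is_struct L C"
begin

abbreviation "\<Omega> \<equiv> carrier C"

text \<open>Formulas of L in the variables 0, 1, ... are used, the first n standing for the tuple
  and the others for the parameters; closure properties then amount to renamings of variables,
  without constants. The intersection with \<Omega> permits B to be any set.\<close>

definition D :: "'a set \<Rightarrow> nat \<Rightarrow> 'a list set set" where
  "D B n = {R. \<exists>k m \<psi>. m \<in> tpl (B \<inter> \<Omega>) k \<and> wf_fm L \<psi> \<and> fv \<psi> \<subseteq> {..<n + k} \<and>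
     R = {g \<in> tpl \<Omega> n. sat C (\<lambda>v. (g @ m) ! v) \<psi>}}"

lemma D_I:
  assumes "m \<in> tpl (B \<inter> \<Omega>) k" "wf_fm L \<psi>" "\<And>v. v \<in> fv \<psi> \<Longrightarrow> \<rho> v < n + k"
    and "R = {g \<in> tpl \<Omega> n. sat C (\<lambda>v. (g @ m) ! \<rho> v) \<psi>}"
  shows "R \<in> D B n"
proof -
  obtain \<psi>' where \<psi>': "wf_fm L \<psi>'" "fv \<psi>' \<subseteq> \<rho> ` fv \<psi>"
    "\<forall>(N :: ('a, 'f, 'r) struct) e. sat N e \<psi>' = sat N (\<lambda>v. e (\<rho> v)) \<psi>"
    using ex_rename[OF assms(2), of \<rho>] by blast
  have "fv \<psi>' \<subseteq> {..<n + k}" using \<psi>'(2) assms(3) by auto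
  moreover have "R = {g \<in> tpl \<Omega> n. sat C (\<lambda>v. (g @ m) ! v) \<psi>'}" unfolding assms(4) \<psi>'(3)[THEN spec, THEN spec] ..
  ultimately show ?thesis unfolding D_def using assms(1) \<psi>'(1) by blast
qed

lemma D_E:
  assumes "R \<in> D B n"
  obtains k m \<psi> where "m \<in> tpl (B \<inter> \<Omega>) k" "wf_fm L \<psi>" "fv \<psi> \<subseteq> {..<n + k}"
    "R = {g \<in> tpl \<Omega> n. sat C (\<lambda>v. (g @ m) ! v) \<psi>}"
  using assms unfolding D_def by blast

lemma D_sub: "R \<in> D B n \<Longrightarrow> R \<subseteq> tpl \<Omega> n"
  unfolding D_def by blast

lemma D_full: "tpl \<Omega> n \<in> D B n"
\<comment> \<open>For n = 0 no free variable is allowed, so a closed valid formula is taken; it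
  holds because the carrier is nonempty.\<close>
proof (rule D_I[where m="[]" and k=0 and \<psi>="Ex 0 (Eq (Var 0) (Var 0))" and \<rho>=id])
  show "tpl \<Omega> n = {g \<in> tpl \<Omega> n. sat C (\<lambda>v. (g @ []) ! id v) (Ex 0 (Eq (Var 0) (Var 0)))}"
    using struct unfolding is_struct_def by auto
qed (auto simp: tpl_def)

lemma D_compl: "R \<in> D B n \<Longrightarrow> tpl \<Omega> n - R \<in> D B n"
proof (erule D_E)
  fix k m \<psi> assume *: "m \<in> tpl (B \<inter> \<Omega>) k" "wf_fm L \<psi>" "fv \<psi> \<subseteq> {..<n + k}"
    "R = {g \<in> tpl \<Omega> n. sat C (\<lambda>v. (g @ m) ! v) \<psi>}"
  show "tpl \<Omega> n - R \<in> D B n"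
    by (rule D_I[OF *(1), of "Neg \<psi>" "\<lambda>v. v"]) (use * in auto)
qed

lemma D_Int:
  assumes "R \<in> D B n" "S \<in> D B n"
  shows "R \<inter> S \<in> D B n"
proof -
  obtain k m \<psi> where R: "m \<in> tpl (B \<inter> \<Omega>) k" "wf_fm L \<psi>" "fv \<psi> \<subseteq> {..<n + k}"
    "R = {g \<in> tpl \<Omega> n. sat C (\<lambda>v. (g @ m) ! v) \<psi>}" using assms(1) by (rule D_E)
  obtain k' m' \<psi>' where S: "m' \<in> tpl (B \<inter> \<Omega>) k'" "wf_fm L \<psi>'" "fv \<psi>' \<subseteq> {..<n + k'}"
    "S = {g \<in> tpl \<Omega> n. sat C (\<lambda>v. (g @ m') ! v) \<psi>'}" using assms(2) by (rule D_E)
  \<comment> \<open>The parameters of S are listed behind the k parameters of R, which shifts its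
    parameter variables by k.\<close>
  let ?\<rho> = "\<lambda>v. if v < n then v else v + k"
  obtain \<chi> where \<chi>: "wf_fm L \<chi>" "fv \<chi> \<subseteq> ?\<rho> ` fv \<psi>'"
    "\<forall>(N :: ('a, 'f, 'r) struct) e. sat N e \<chi> = sat N (\<lambda>v. e (?\<rho> v)) \<psi>'"
    using ex_rename[OF S(2), of ?\<rho>] by blast
  have lm: "length m = k" using R(1) unfolding tpl_def by simp
  show ?thesis
  proof (rule D_I[of "m @ m'" B "k + k'" "And \<psi> \<chi>" "\<lambda>v. v"])
    show "m @ m' \<in> tpl (B \<inter> \<Omega>) (k + k')" by (rule tpl_append[OF R(1) S(1)])
    show "wf_fm L (And \<psi> \<chi>)" using R(2) \<chi>(1) by simp
    show "v < n + (k + k')" if "v \<in> fv (And \<psi> \<chi>)" for v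
      using that R(3) S(3) \<chi>(2) by (fastforce split: if_splits)
    have "sat C (\<lambda>v. (g @ m @ m') ! v) \<psi> = sat C (\<lambda>v. (g @ m) ! v) \<psi>"
      "sat C (\<lambda>v. (g @ m @ m') ! v) \<chi> = sat C (\<lambda>v. (g @ m') ! v) \<psi>'" if g: "g \<in> tpl \<Omega> n" for g
    proof -
      have lg: "length g = n" using g unfolding tpl_def by simp
      show "sat C (\<lambda>v. (g @ m @ m') ! v) \<psi> = sat C (\<lambda>v. (g @ m) ! v) \<psi>"
        by (rule sat_cong) (use R(3) lg lm in \<open>auto simp: nth_append\<close>)
      show "sat C (\<lambda>v. (g @ m @ m') ! v) \<chi> = sat C (\<lambda>v. (g @ m') ! v) \<psi>'"
        unfolding \<chi>(3)[THEN spec, THEN spec] by (rule sat_cong) (use lg lm in \<open>auto simp: nth_append\<close>)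
    qed
    then show "R \<inter> S = {g \<in> tpl \<Omega> n. sat C (\<lambda>v. (g @ m @ m') ! v) (And \<psi> \<chi>)}" unfolding R(4) S(4) by auto
  qed
qed

lemma D_reindex:
  assumes "R \<in> D B k" "length I = k" "set I \<subseteq> {..<n}"
  shows "{g \<in> tpl \<Omega> n. sub g I \<in> R} \<in> D B n"
proof -
  obtain l m \<psi> where R: "m \<in> tpl (B \<inter> \<Omega>) l" "wf_fm L \<psi>" "fv \<psi> \<subseteq> {..<k + l}"
    "R = {g \<in> tpl \<Omega> k. sat C (\<lambda>v. (g @ m) ! v) \<psi>}" using assms(1) by (rule D_E)
  have In: "I ! v < n" if "v < k" for v using assms(2,3) that nth_mem by blast
  let ?\<rho> = "\<lambda>v. if v < k then I ! v else n + (v - k)"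
  show ?thesis
  proof (rule D_I[OF R(1,2), of ?\<rho>])
    show "?\<rho> v < n + l" if "v \<in> fv \<psi>" for v using that R(3) In[of v] by (auto simp: subset_iff)
    have "sub g I \<in> R \<longleftrightarrow> sat C (\<lambda>v. (g @ m) ! ?\<rho> v) \<psi>" if g: "g \<in> tpl \<Omega> n" for g
    proof -
      have "sub g I \<in> tpl \<Omega> k" by (rule sub_tpl[OF g assms(3,2)])
      moreover have "sat C (\<lambda>v. (sub g I @ m) ! v) \<psi> = sat C (\<lambda>v. (g @ m) ! ?\<rho> v) \<psi>"
      proof (rule sat_cong)
        fix v
        have "length g = n" using g unfolding tpl_def by simp
        then show "(sub g I @ m) ! v = (g @ m) ! ?\<rho> v"
        proof (cases "v < k")
          case True
          then show ?thesis using In[of v] assms(2) \<open>length g = n\<close> by (simp add: nth_append sub_def)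
        next
          case False
          then obtain w where "v = k + w" using le_Suc_ex not_less by blast
          then show ?thesis using assms(2) \<open>length g = n\<close> by (simp add: nth_append sub_def)
        qed
      qed
      ultimately show ?thesis unfolding R(4) by simp
    qed
    then show "{g \<in> tpl \<Omega> n. sub g I \<in> R} = {g \<in> tpl \<Omega> n. sat C (\<lambda>v. (g @ m) ! ?\<rho> v) \<psi>}" by blast
  qed
qed

lemma D_eq: "i < n \<Longrightarrow> j < n \<Longrightarrow> {g \<in> tpl \<Omega> n. g ! i = g ! j} \<in> D B n"
  by (rule D_I[of "[]" B 0 "Eq (Var i) (Var j)" "\<lambda>v. v"]) (auto simp: tpl_def)

lemma D_proj1:
  assumes "R \<in> D B (Suc n)"
  shows "{g \<in> tpl \<Omega> n. \<exists>a\<in>\<Omega>. g @ [a] \<in> R} \<in> D B n"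
proof -
  obtain k m \<psi> where R: "m \<in> tpl (B \<inter> \<Omega>) k" "wf_fm L \<psi>" "fv \<psi> \<subseteq> {..<Suc n + k}"
    "R = {g \<in> tpl \<Omega> (Suc n). sat C (\<lambda>v. (g @ m) ! v) \<psi>}" using assms by (rule D_E)
  \<comment> \<open>The entry to be quantified moves from position n to the position n + k behind
    the parameters, which close the gap.\<close>
  let ?\<rho> = "\<lambda>v. if v < n then v else if v = n then n + k else v - 1"
  obtain \<chi> where \<chi>: "wf_fm L \<chi>" "fv \<chi> \<subseteq> ?\<rho> ` fv \<psi>"
    "\<forall>(N :: ('a, 'f, 'r) struct) e. sat N e \<chi> = sat N (\<lambda>v. e (?\<rho> v)) \<psi>"
    using ex_rename[OF R(2), of ?\<rho>] by blast
  show ?thesis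
  proof (rule D_I[OF R(1), of "Ex (n + k) \<chi>" "\<lambda>v. v"])
    show "wf_fm L (Ex (n + k) \<chi>)" using \<chi>(1) by simp
    show "v < n + k" if "v \<in> fv (Ex (n + k) \<chi>)" for v
      using that R(3) \<chi>(2) by (fastforce split: if_splits)
    have "g @ [a] \<in> R \<longleftrightarrow> sat C ((\<lambda>v. (g @ m) ! v)(n + k := a)) \<chi>" if g: "g \<in> tpl \<Omega> n" and a: "a \<in> \<Omega>" for g a
    proof -
      have lg: "length g = n" "length m = k" using g R(1) unfolding tpl_def by auto
      have "g @ [a] \<in> tpl \<Omega> (Suc n)" using g a unfolding tpl_def by simp
      moreover have "sat C (\<lambda>v. ((g @ [a]) @ m) ! v) \<psi> = sat C (\<lambda>v. ((\<lambda>v. (g @ m) ! v)(n + k := a)) (?\<rho> v)) \<psi>"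
      proof (rule sat_cong)
        fix v assume "v \<in> fv \<psi>"
        then have "v < Suc n + k" using R(3) by blast
        then show "((g @ [a]) @ m) ! v = ((\<lambda>v. (g @ m) ! v)(n + k := a)) (?\<rho> v)"
          using lg by (auto simp: nth_append nth_Cons' split: if_splits)
      qed
      ultimately show ?thesis unfolding R(4) \<chi>(3)[THEN spec, THEN spec] by simp
    qed
    then show "{g \<in> tpl \<Omega> n. \<exists>a\<in>\<Omega>. g @ [a] \<in> R} = {g \<in> tpl \<Omega> n. sat C (\<lambda>v. (g @ m) ! v) (Ex (n + k) \<chi>)}"
      by (simp del: fun_upd_apply) blast
  qed
qed

lemma D_proj: "R \<in> D B (n + k) \<Longrightarrow> {g \<in> tpl \<Omega> n. \<exists>h\<in>tpl \<Omega> k. g @ h \<in> R} \<in> D B n"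
proof (induction k arbitrary: n)
  case 0
  have "{g \<in> tpl \<Omega> n. \<exists>h\<in>tpl \<Omega> 0. g @ h \<in> R} = R" using D_sub[OF 0] by (auto simp: tpl_def)
  then show ?case using 0 by simp
next
  case (Suc k)
  then have "R \<in> D B (Suc n + k)" by simp
  from D_proj1[OF Suc.IH[OF this]]
  have "{g \<in> tpl \<Omega> n. \<exists>a\<in>\<Omega>. g @ [a] \<in> {g \<in> tpl \<Omega> (Suc n). \<exists>h\<in>tpl \<Omega> k. g @ h \<in> R}} \<in> D B n" .
  moreover have "(\<exists>a\<in>\<Omega>. g @ [a] \<in> {g \<in> tpl \<Omega> (Suc n). \<exists>h\<in>tpl \<Omega> k. g @ h \<in> R}) \<longleftrightarrow> (\<exists>h\<in>tpl \<Omega> (Suc k). g @ h \<in> R)"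
    if g: "g \<in> tpl \<Omega> n" for g
  proof
    assume "\<exists>a\<in>\<Omega>. g @ [a] \<in> {g \<in> tpl \<Omega> (Suc n). \<exists>h\<in>tpl \<Omega> k. g @ h \<in> R}"
    then obtain a h where "a \<in> \<Omega>" "h \<in> tpl \<Omega> k" "(g @ [a]) @ h \<in> R" by blast
    then show "\<exists>h\<in>tpl \<Omega> (Suc k). g @ h \<in> R" by (intro bexI[of _ "a # h"]) (auto simp: tpl_def)
  next
    assume "\<exists>h\<in>tpl \<Omega> (Suc k). g @ h \<in> R"
    then obtain h where h: "h \<in> tpl \<Omega> (Suc k)" "g @ h \<in> R" by blast
    then obtain a h' where "h = a # h'" unfolding tpl_def by (cases h) auto
    then have "a \<in> \<Omega>" "h' \<in> tpl \<Omega> k" "g @ [a] \<in> tpl \<Omega> (Suc n)" "(g @ [a]) @ h' \<in> R"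
      using h g unfolding tpl_def by auto
    then show "\<exists>a\<in>\<Omega>. g @ [a] \<in> {g \<in> tpl \<Omega> (Suc n). \<exists>h\<in>tpl \<Omega> k. g @ h \<in> R}" by blast
  qed
  then have "{g \<in> tpl \<Omega> n. \<exists>a\<in>\<Omega>. g @ [a] \<in> {g \<in> tpl \<Omega> (Suc n). \<exists>h\<in>tpl \<Omega> k. g @ h \<in> R}} =
      {g \<in> tpl \<Omega> n. \<exists>h\<in>tpl \<Omega> (Suc k). g @ h \<in> R}" by (intro Collect_cong conj_cong refl)
  ultimately show ?case by simp
qed

lemma D_mono: "B \<subseteq> B' \<Longrightarrow> R \<in> D B n \<Longrightarrow> R \<in> D B' n"
proof (erule D_E)
  fix k m \<psi> assume B: "B \<subseteq> B'" and *: "m \<in> tpl (B \<inter> \<Omega>) k" "wf_fm L \<psi>" "fv \<psi> \<subseteq> {..<n + k}"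
    "R = {g \<in> tpl \<Omega> n. sat C (\<lambda>v. (g @ m) ! v) \<psi>}"
  have "m \<in> tpl (B' \<inter> \<Omega>) k" using *(1) B unfolding tpl_def by blast
  then show "R \<in> D B' n" using *(2-4) unfolding D_def by blast
qed

lemma D_param:
  assumes "R \<in> D B (n + k)" "m \<in> tpl B k" "m \<in> tpl \<Omega> k"
  shows "{g \<in> tpl \<Omega> n. g @ m \<in> R} \<in> D B n"
proof -
  obtain l p \<psi> where R: "p \<in> tpl (B \<inter> \<Omega>) l" "wf_fm L \<psi>" "fv \<psi> \<subseteq> {..<n + k + l}"
    "R = {g \<in> tpl \<Omega> (n + k). sat C (\<lambda>v. (g @ p) ! v) \<psi>}" using assms(1) by (rule D_E)
  have m: "m \<in> tpl (B \<inter> \<Omega>) k" using assms(2,3) unfolding tpl_def by blast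
  show ?thesis
  proof (rule D_I[OF tpl_append[OF m R(1)] R(2), of "\<lambda>v. v"])
    show "v < n + (k + l)" if "v \<in> fv \<psi>" for v using that R(3) by auto
    show "{g \<in> tpl \<Omega> n. g @ m \<in> R} = {g \<in> tpl \<Omega> n. sat C (\<lambda>v. (g @ m @ p) ! v) \<psi>}"
      unfolding R(4) using tpl_append[OF _ assms(3)] by auto
  qed
qed

lemma D_paramE:
  assumes "R \<in> D (B \<union> A) n"
  shows "\<exists>k m R'. m \<in> tpl A k \<and> m \<in> tpl \<Omega> k \<and> R' \<in> D B (n + k) \<and> R = {g \<in> tpl \<Omega> n. g @ m \<in> R'}"
proof -
  obtain l p \<psi> where R: "p \<in> tpl ((B \<union> A) \<inter> \<Omega>) l" "wf_fm L \<psi>" "fv \<psi> \<subseteq> {..<n + l}"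
    "R = {g \<in> tpl \<Omega> n. sat C (\<lambda>v. (g @ p) ! v) \<psi>}" using assms by (rule D_E)
  define m where "m = filter (\<lambda>a. a \<in> A) p"
  define q where "q = filter (\<lambda>a. a \<notin> A) p"
  have m: "m \<in> tpl A (length m)" "m \<in> tpl \<Omega> (length m)" and q: "q \<in> tpl (B \<inter> \<Omega>) (length q)"
    using R(1) unfolding m_def q_def tpl_def by auto
  have "set p \<subseteq> set (m @ q)" unfolding m_def q_def by auto
  from ex_sub[OF this] obtain I where I: "set I \<subseteq> {..<length (m @ q)}" "length I = length p" "sub (m @ q) I = p" by blast
  have lp: "length p = l" using R(1) unfolding tpl_def by simp
  let ?\<rho> = "\<lambda>v. if v < n then v else n + I ! (v - n)"
  let ?R = "{g \<in> tpl \<Omega> (n + length m). sat C (\<lambda>v. (g @ q) ! ?\<rho> v) \<psi>}"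
  have "?R \<in> D B (n + length m)"
  proof (rule D_I[OF q R(2) _ refl])
    fix v assume "v \<in> fv \<psi>"
    then have v: "v < n + l" using R(3) by blast
    have "I ! (v - n) < length (m @ q)" if "\<not> v < n"
    proof -
      have "v - n < length I" using that v I(2) lp by simp
      from subsetD[OF I(1) nth_mem[OF this]] show ?thesis by simp
    qed
    then show "?\<rho> v < n + length m + length q" by auto
  qed
  moreover have "R = {g \<in> tpl \<Omega> n. g @ m \<in> ?R}"
  proof -
    have "sat C (\<lambda>v. ((g @ m) @ q) ! ?\<rho> v) \<psi> = sat C (\<lambda>v. (g @ p) ! v) \<psi>" if g: "g \<in> tpl \<Omega> n" for g
    proof (rule sat_cong)
      fix v assume "v \<in> fv \<psi>"
      then have v: "v < n + l" using R(3) by blast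
      have lg: "length g = n" using g unfolding tpl_def by simp
      show "((g @ m) @ q) ! ?\<rho> v = (g @ p) ! v"
      proof (cases "v < n")
        case False
        then have "(m @ q) ! (I ! (v - n)) = p ! (v - n)"
          using I(2,3) lp v unfolding sub_def by (metis add.commute add_diff_inverse_nat nat_add_left_cancel_less nth_map)
        then show ?thesis using False lg by (simp add: nth_append)
      qed (use lg in \<open>simp add: nth_append\<close>)
    qed
    then show ?thesis unfolding R(4) using tpl_append[OF _ m(2)] by blast
  qed
  ultimately show ?thesis using m by blast
qed

lemma formula_D:
  assumes "\<psi> \<in> formulas (lang_over L B) xs" "distinct xs" "B \<subseteq> \<Omega>"
  shows "{g \<in> tpl \<Omega> (length xs). holds (expand C) \<psi> xs g} \<in> D B (length xs)"
proof -
  have \<psi>: "wf_fm (lang_over L B) \<psi>" "fv \<psi> \<subseteq> set xs" using assms(1) unfolding formulas_def by auto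
  obtain m where m: "set m = consts_fm \<psi>" using finite_list[OF finite_consts_fm[of \<psi>]] ..
  let ?n = "length xs"
  let ?p = "\<lambda>a. ?n + pos m a"
  have p: "?p a < ?n + length m" "\<And>g. length g = ?n \<Longrightarrow> (g @ m) ! ?p a = a" if "a \<in> consts_fm \<psi>" for a
  proof -
    have "a \<in> set m" using that m by simp
    from pos[OF this] show "?p a < ?n + length m" "\<And>g. length g = ?n \<Longrightarrow> (g @ m) ! ?p a = a"
      by (simp_all add: nth_append)
  qed
  obtain \<psi>' where \<psi>': "wf_fm L \<psi>'" "fv \<psi>' \<subseteq> pos xs ` fv \<psi> \<union> ?p ` consts_fm \<psi>"
    "\<forall>(N :: ('a, 'f, 'r) struct) e. (\<forall>a\<in>consts_fm \<psi>. e (?p a) = a) \<longrightarrow>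
       sat N e \<psi>' = sat (expand N) (\<lambda>v. e (pos xs v)) \<psi>"
    using ex_unparam[OF \<psi>(1), of "pos xs" ?p] by (elim exE conjE)
  have mB: "m \<in> tpl (B \<inter> \<Omega>) (length m)"
    using consts_fm_subset[OF \<psi>(1)] assms(3) m unfolding tpl_def by auto
  show ?thesis
  proof (rule D_I[OF mB \<psi>'(1), of "\<lambda>v. v"])
    show "v < ?n + length m" if v: "v \<in> fv \<psi>'" for v
    proof -
      have "v \<in> pos xs ` fv \<psi> \<union> ?p ` consts_fm \<psi>" using \<psi>'(2) v by blast
      then consider x where "x \<in> fv \<psi>" "v = pos xs x" | a where "a \<in> consts_fm \<psi>" "v = ?p a" by blast
      then show ?thesis
      proof cases
        case 1
        then have "v < ?n" using \<psi>(2) pos[of x xs] by auto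
        then show ?thesis by simp
      qed (use p(1) in simp)
    qed
    have "holds (expand C) \<psi> xs g = sat C (\<lambda>v. (g @ m) ! v) \<psi>'" if g: "g \<in> tpl \<Omega> ?n" for g
    proof -
      have lg: "length g = ?n" using g unfolding tpl_def by simp
      have "sat C (\<lambda>v. (g @ m) ! v) \<psi>' = sat (expand C) (\<lambda>v. (g @ m) ! pos xs v) \<psi>"
        using \<psi>'(3)[THEN spec, THEN spec, of "\<lambda>v. (g @ m) ! v" C] p(2)[OF _ lg] by blast
      also have "\<dots> = sat (expand C) (env xs g) \<psi>"
      proof (rule sat_cong)
        fix v assume "v \<in> fv \<psi>"
        then have "v \<in> set xs" using \<psi>(2) by blast
        then show "(g @ m) ! pos xs v = env xs g v"
          using env_pos[OF assms(2) lg] pos[of v xs] lg by (simp add: nth_append)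
      qed
      finally show ?thesis unfolding holds_env by simp
    qed
    then show "{g \<in> tpl \<Omega> ?n. holds (expand C) \<psi> xs g} = {g \<in> tpl \<Omega> ?n. sat C (\<lambda>v. (g @ m) ! v) \<psi>'}" by blast
  qed
qed

lemma D_formula:
  assumes "R \<in> D B (length xs)" "distinct xs"
  shows "\<exists>\<psi>\<in>formulas (lang_over L B) xs. \<forall>g\<in>tpl \<Omega> (length xs). holds (expand C) \<psi> xs g \<longleftrightarrow> g \<in> R"
proof -
  let ?n = "length xs"
  obtain k m \<psi> where R: "m \<in> tpl (B \<inter> \<Omega>) k" "wf_fm L \<psi>" "fv \<psi> \<subseteq> {..<?n + k}"
    "R = {g \<in> tpl \<Omega> ?n. sat C (\<lambda>v. (g @ m) ! v) \<psi>}" using assms(1) by (rule D_E)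
  \<comment> \<open>Variables from z on do not occur in xs. They hold the places of the parameters
    until \<sigma> replaces them by constants.\<close>
  define z where "z = Suc (Max (insert 0 (set xs)))"
  have z: "v < z" if "v \<in> set xs" for v
    unfolding z_def less_Suc_eq_le by (rule Max_ge) (use that in auto)
  let ?\<rho> = "\<lambda>v. if v < ?n then xs ! v else z + (v - ?n)"
  obtain \<chi> where \<chi>: "wf_fm L \<chi>" "fv \<chi> \<subseteq> ?\<rho> ` fv \<psi>"
    "\<forall>(N :: ('a, 'f, 'r) struct) e. sat N e \<chi> = sat N (\<lambda>v. e (?\<rho> v)) \<psi>"
    using ex_rename[OF R(2), of ?\<rho>] by blast
  define \<sigma> where "\<sigma> v = (if z \<le> v \<and> v < z + k then Some (m ! (v - z)) else None)" for v
  have lm: "length m = k" using R(1) unfolding tpl_def by simp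
  have ran: "ran \<sigma> \<subseteq> B"
    using R(1) lm unfolding ran_def \<sigma>_def tpl_def by (auto split: if_splits simp: subset_iff)
  have "fv \<chi> \<subseteq> set xs \<union> dom \<sigma>"
  proof
    fix u assume "u \<in> fv \<chi>"
    then obtain v where v: "v \<in> fv \<psi>" "u = ?\<rho> v" using \<chi>(2) by blast
    then have "v < ?n + k" using R(3) by blast
    then show "u \<in> set xs \<union> dom \<sigma>" using v(2) by (auto simp: \<sigma>_def dom_def)
  qed
  then have "subst \<sigma> (emb \<chi>) \<in> formulas (lang_over L B) xs"
    unfolding formulas_def using wf_subst[OF wf_emb[OF \<chi>(1)] ran] by (auto simp: fv_subst fv_emb)
  moreover have "holds (expand C) (subst \<sigma> (emb \<chi>)) xs g \<longleftrightarrow> g \<in> R" if g: "g \<in> tpl \<Omega> ?n" for g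
  proof -
    have lg: "length g = ?n" using g unfolding tpl_def by simp
    let ?e = "\<lambda>v. case \<sigma> v of None \<Rightarrow> env xs g v | Some a \<Rightarrow> a"
    have "holds (expand C) (subst \<sigma> (emb \<chi>)) xs g = sat C (\<lambda>v. ?e (?\<rho> v)) \<psi>"
      unfolding holds_env sat_subst sat_emb \<chi>(3)[THEN spec, THEN spec] ..
    also have "\<dots> = sat C (\<lambda>v. (g @ m) ! v) \<psi>"
    proof (rule sat_cong)
      fix v assume "v \<in> fv \<psi>"
      then have v: "v < ?n + k" using R(3) by blast
      show "?e (?\<rho> v) = (g @ m) ! v"
      proof (cases "v < ?n")
        case True
        then have "\<sigma> (xs ! v) = None" using z[of "xs ! v"] unfolding \<sigma>_def by simp
        then show ?thesis using True env_nth[OF assms(2) lg True] lg by (simp add: nth_append)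
      next
        case False
        then obtain w where "v = ?n + w" using le_Suc_ex not_less by blast
        then show ?thesis using v lg by (simp add: \<sigma>_def nth_append)
      qed
    qed
    finally show ?thesis unfolding R(4) using g by simp
  qed
  ultimately show ?thesis by blast
qed

lemma tuples_tpl: "tuples C xs = tpl \<Omega> (length xs)"
  unfolding tuples_def tpl_def by simp

lemma holds_inst:
  assumes "distinct (xs @ ys)" "fv \<psi> \<subseteq> set (xs @ ys)" "length a = length xs" "length c = length ys"
  shows "holds (expand C) (inst ys c \<psi>) xs a = holds (expand C) \<psi> (xs @ ys) (a @ c)"
  unfolding holds_env inst_def sat_subst
proof (rule sat_cong)
  fix v assume "v \<in> fv \<psi>"
  then have v: "v \<in> set xs \<union> set ys" using assms(2) by auto
  have "map_of (zip (xs @ ys) (a @ c)) = map_of (zip ys c) ++ map_of (zip xs a)"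
    using assms(3) by (simp add: map_of_append)
  moreover have "dom (map_of (zip ys c)) = set ys" "dom (map_of (zip xs a)) = set xs"
    using assms(3,4) by (simp_all add: dom_map_of_zip)
  ultimately show "(case map_of (zip ys c) v of None \<Rightarrow> env xs a v | Some a \<Rightarrow> a) = env (xs @ ys) (a @ c) v"
    using v assms(1) unfolding env_def map_add_def
    by (cases "v \<in> set xs"; cases "map_of (zip ys c) v"; cases "map_of (zip xs a) v") (auto simp: domIff)
qed

end

section \<open>Skolem hulls\<close>

lemma card_of_tpl:
  assumes "\<not> finite \<Lambda>" "|X| \<le>o |\<Lambda>|"
  shows "|tpl X k| \<le>o |\<Lambda>|"
proof (induction k)
  case 0
  have "tpl X 0 = {[]}" unfolding tpl_def by auto
  moreover have "\<Lambda> \<noteq> {}" using assms(1) by auto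
  ultimately show ?case using card_of_singl_ordLeq by metis
next
  case (Suc k)
  have "tpl X (Suc k) = (\<lambda>(a, g). a # g) ` (X \<times> tpl X k)"
    unfolding tpl_def by (force simp: length_Suc_conv image_iff)
  then have "|tpl X (Suc k)| \<le>o |X \<times> tpl X k|" using card_of_image by metis
  also have "|X \<times> tpl X k| \<le>o |\<Lambda>|"
    by (rule card_of_Sigma_ordLeq_infinite[OF assms(1,2)]) (use Suc in simp)
  finally show ?case .
qed

lemma card_of_lists_ordLeq:
  assumes "\<not> finite \<Lambda>" "|X| \<le>o |\<Lambda>|"
  shows "|lists X| \<le>o |\<Lambda>|"
proof -
  have "lists X = (\<Union>k. tpl X k)" unfolding tpl_def lists_eq_set by auto
  moreover have "|\<Union>k::nat. tpl X k| \<le>o |\<Lambda>|"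
    by (rule card_of_UNION_ordLeq_infinite[OF assms(1)])
      (use assms(1) infinite_iff_card_of_nat card_of_tpl[OF assms] in auto)
  ultimately show ?thesis by simp
qed

text \<open>Closing off countably often suffices: a finite list from the union already lies in some
  stage. Each stage adds the entries of at most |\<Lambda>| finite lists, so the cardinality does
  not grow.\<close>

lemma ex_hull:
  fixes W :: "'i \<Rightarrow> 'a list \<Rightarrow> 'a list"
  assumes inf: "\<not> finite \<Lambda>" and I: "|I| \<le>o |\<Lambda>|" and B: "|B| \<le>o |\<Lambda>|"
    and B\<Omega>: "B \<subseteq> \<Omega>" and W\<Omega>: "\<And>i m. i \<in> I \<Longrightarrow> set (W i m) \<subseteq> \<Omega>"
  shows "\<exists>H. B \<subseteq> H \<and> H \<subseteq> \<Omega> \<and> |H| \<le>o |\<Lambda>| \<and> (\<forall>i\<in>I. \<forall>m. set m \<subseteq> H \<longrightarrow> set (W i m) \<subseteq> H)"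
proof -
  define F where "F X = X \<union> (\<Union>(i, m)\<in>I \<times> lists X. set (W i m))" for X
  define X where "X k = (F ^^ k) B" for k
  have Suc: "X (Suc k) = F (X k)" for k unfolding X_def by simp
  have card_set: "|set (l :: 'a list)| \<le>o |\<Lambda>|" for l
    by (rule ordLess_imp_ordLeq, rule finite_ordLess_infinite)
      (use inf in \<open>auto simp: card_of_well_order_on Field_card_of\<close>)
  have "|X k| \<le>o |\<Lambda>|" for k
  proof (induction k)
    case 0
    show ?case unfolding X_def using B by simp
  next
    case (Suc k)
    have "|I \<times> lists (X k)| \<le>o |\<Lambda>|"
      by (rule card_of_Sigma_ordLeq_infinite[OF inf I]) (use card_of_lists_ordLeq[OF inf Suc] in simp)
    then have "|\<Union>(i, m)\<in>I \<times> lists (X k). set (W i m)| \<le>o |\<Lambda>|"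
      by (rule card_of_UNION_ordLeq_infinite[OF inf]) (use card_set in auto)
    then have "|X k \<union> (\<Union>(i, m)\<in>I \<times> lists (X k). set (W i m))| \<le>o |\<Lambda>|"
      by (intro card_of_Un_ordLeq_infinite_Field[OF _ Suc _ card_of_Card_order]) (use inf in \<open>simp_all add: Field_card_of\<close>)
    then show ?case unfolding \<open>X (Suc k) = F (X k)\<close> F_def .
  qed
  then have card: "|\<Union>k. X k| \<le>o |\<Lambda>|"
    using inf infinite_iff_card_of_nat by (intro card_of_UNION_ordLeq_infinite) auto
  have X\<Omega>: "X k \<subseteq> \<Omega>" for k
  proof (induction k)
    case 0
    show ?case unfolding X_def using B\<Omega> by simp
  next
    case (Suc k)
    then show ?case unfolding \<open>X (Suc k) = F (X k)\<close> F_def using W\<Omega> by blast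
  qed
  have mono: "X k \<subseteq> X l" if "k \<le> l" for k l
    using that by (induction l rule: dec_induct) (auto simp: Suc F_def)
  have "set (W i m) \<subseteq> (\<Union>k. X k)" if i: "i \<in> I" and m: "set m \<subseteq> (\<Union>k. X k)" for i m
  proof -
    have "\<exists>k. set m \<subseteq> X k"
      using m
    proof (induction m)
      case (Cons a m)
      then obtain k l where "set m \<subseteq> X k" "a \<in> X l" by auto
      then have "set (a # m) \<subseteq> X (max k l)" using mono[of k "max k l"] mono[of l "max k l"] by auto
      then show ?case ..
    qed simp
    then obtain k where "set m \<subseteq> X k" ..
    then have "set (W i m) \<subseteq> X (Suc k)" unfolding Suc F_def using i by auto
    then show ?thesis by blast
  qed
  moreover have "B \<subseteq> (\<Union>k. X k)" using UN_upper[of 0 UNIV X] unfolding X_def by simp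
  ultimately show ?thesis using card X\<Omega> by (intro exI[of _ "\<Union>k. X k"]) blast
qed

section \<open>The monster model\<close>

locale monster = fo_structure L C for L :: "('f, 'r) lang" and C :: "('a, 'f, 'r) struct" +
  fixes T :: "('f, 'r) fm set" and \<kappa> :: "'k rel"
  assumes NIP: "NIP_theory TYPE('a) L T" and mm: "monster_model L T \<kappa> C"
begin

definition sm :: "'a set \<Rightarrow> bool" where
  "sm B \<longleftrightarrow> B \<subseteq> \<Omega> \<and> |B| <o \<kappa>"

lemma Card_\<kappa>: "Card_order \<kappa>" and fm_\<kappa>: "|{\<phi>. wf_fm L \<phi>}| <o \<kappa>"
  using mm unfolding monster_model_def by auto

lemma infinite_fm: "\<not> finite {\<phi> :: ('f, 'r) fm. wf_fm L \<phi>}"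
proof
  assume fin: "finite {\<phi> :: ('f, 'r) fm. wf_fm L \<phi>}"
  have "range (\<lambda>i. Eq (Var i) (Var i)) \<subseteq> {\<phi> :: ('f, 'r) fm. wf_fm L \<phi>}" by auto
  from finite_subset[OF this fin] have "finite (range (\<lambda>i. Eq (Var i) (Var i) :: ('f, 'r) fm))" .
  moreover have "inj (\<lambda>i. Eq (Var i) (Var i) :: ('f, 'r) fm)" by (rule injI) simp
  ultimately have "finite (UNIV :: nat set)" by (rule finite_imageD)
  then show False by simp
qed

lemma infinite_\<kappa>: "\<not> finite (Field \<kappa>)"
proof
  assume fin: "finite (Field \<kappa>)"
  have "|{\<phi>. wf_fm L \<phi>}| \<le>o |Field \<kappa>|"
    using ordLess_imp_ordLeq[OF fm_\<kappa>] card_of_Field_ordIso[OF Card_\<kappa>] ordIso_symmetric ordLeq_ordIso_trans by blast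
  then show False using card_of_ordLeq_finite fin infinite_fm by blast
qed

lemma sm_sub: "sm B \<Longrightarrow> B \<subseteq> \<Omega>"
  unfolding sm_def by simp

lemma sm_Un:
  assumes "sm B" "finite A" "A \<subseteq> \<Omega>"
  shows "sm (B \<union> A)"
proof -
  have "|A| <o \<kappa>"
    by (rule finite_ordLess_infinite)
      (use assms(2) infinite_\<kappa> Card_\<kappa> in \<open>auto simp: card_of_well_order_on Field_card_of card_order_on_def\<close>)
  then show ?thesis
    using assms card_of_Un_ordLess_infinite_Field[OF infinite_\<kappa> Card_\<kappa>] unfolding sm_def by blast
qed

lemma sm_closed:
  assumes "sm B"
  shows "\<exists>B'. B \<subseteq> B' \<and> sm B' \<and> (\<forall>n. \<forall>R\<in>D B' n. R \<noteq> {} \<longrightarrow> R \<inter> tpl B' n \<noteq> {})"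
proof -
  let ?Fm = "{\<psi> :: ('f, 'r) fm. wf_fm L \<psi>}"
  \<comment> \<open>The hull has at most as many elements as there are formulas and elements of B
    together, and \<kappa> is larger than both numbers.\<close>
  let ?\<Lambda> = "?Fm <+> B"
  have le: "|?Fm| \<le>o |?\<Lambda>|" "|B| \<le>o |?\<Lambda>|" by (rule card_of_Plus1, rule card_of_Plus2)
  have inf: "\<not> finite ?\<Lambda>" by (rule card_of_ordLeq_infinite[OF le(1) infinite_fm])
  have less: "|?\<Lambda>| <o \<kappa>"
    by (rule card_of_Plus_ordLess_infinite_Field[OF infinite_\<kappa> Card_\<kappa> fm_\<kappa>]) (use assms in \<open>simp add: sm_def\<close>)
  \<comment> \<open>The Skolem functions return whole witness tuples, so the criterion is obtained
    for all arities at once. The arity n is part of the index, since it is not determined by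
    \<psi>.\<close>
  define P where "P = (\<lambda>(\<psi> :: ('f, 'r) fm, n) m g. g \<in> tpl \<Omega> n \<and> sat C (\<lambda>v. (g @ m) ! v) \<psi>)"
  define W where "W i m = (if \<exists>g. P i m g then SOME g. P i m g else [])" for i m
  have W: "P i m (W i m)" if "P i m g" for i m g
    using someI[of "P i m" g] that unfolding W_def by auto
  have I: "|?Fm \<times> (UNIV :: nat set)| \<le>o |?\<Lambda>|"
    by (intro card_of_Sigma_ordLeq_infinite[OF inf] le(1) ballI iffD1[OF infinite_iff_card_of_nat] inf)
  have W\<Omega>: "set (W i m) \<subseteq> \<Omega>" for i m
  proof (cases "\<exists>g. P i m g")
    case True
    then have "P i m (W i m)" using W by blast
    then show ?thesis unfolding P_def tpl_def by (auto split: prod.splits)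
  qed (simp add: W_def)
  obtain H where H: "B \<subseteq> H" "H \<subseteq> \<Omega>" "|H| \<le>o |?\<Lambda>|"
      "\<forall>i\<in>?Fm \<times> UNIV. \<forall>m. set m \<subseteq> H \<longrightarrow> set (W i m) \<subseteq> H"
    using ex_hull[where W=W, OF inf I le(2) sm_sub[OF assms] W\<Omega>] by (elim exE conjE)
  have "R \<inter> tpl H n \<noteq> {}" if R: "R \<in> D H n" "R \<noteq> {}" for R n
  proof -
    obtain k m \<psi> where r: "m \<in> tpl (H \<inter> \<Omega>) k" "wf_fm L \<psi>" "fv \<psi> \<subseteq> {..<n + k}"
      "R = {g \<in> tpl \<Omega> n. sat C (\<lambda>v. (g @ m) ! v) \<psi>}" using R(1) by (rule D_E)
    obtain g where "g \<in> R" using R(2) by blast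
    then have "P (\<psi>, n) m g" unfolding P_def r(4) by simp
    then have Wm: "P (\<psi>, n) m (W (\<psi>, n) m)" by (rule W)
    have "set m \<subseteq> H" using r(1) unfolding tpl_def by blast
    then have "set (W (\<psi>, n) m) \<subseteq> H" using H(4) r(2) by blast
    then have "W (\<psi>, n) m \<in> R \<inter> tpl H n" using Wm unfolding P_def r(4) tpl_def by simp
    then show ?thesis by blast
  qed
  moreover have "sm H" unfolding sm_def using H(2) ordLeq_ordLess_trans[OF H(3) less] by simp
  ultimately show ?thesis using H(1) by blast
qed

lemma saturation:
  assumes "sm B" "F \<subseteq> D B n"
    and fs: "\<And>F0. finite F0 \<Longrightarrow> F0 \<subseteq> F \<Longrightarrow> \<exists>g\<in>tpl \<Omega> n. \<forall>R\<in>F0. g \<in> R"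
  shows "\<exists>g\<in>tpl \<Omega> n. \<forall>R\<in>F. g \<in> R"
proof -
  let ?xs = "[0..<n]"
  have tup: "tuples C ?xs = tpl \<Omega> n" using tuples_tpl[of ?xs] by simp
  have "\<forall>R\<in>F. \<exists>\<psi>. \<psi> \<in> formulas (lang_over L B) ?xs \<and> (\<forall>g\<in>tpl \<Omega> n. holds (expand C) \<psi> ?xs g \<longleftrightarrow> g \<in> R)"
  proof
    fix R assume "R \<in> F"
    then have "R \<in> D B (length ?xs)" using assms(2) by auto
    from D_formula[OF this] show "\<exists>\<psi>. \<psi> \<in> formulas (lang_over L B) ?xs \<and>
        (\<forall>g\<in>tpl \<Omega> n. holds (expand C) \<psi> ?xs g \<longleftrightarrow> g \<in> R)" by auto
  qed
  from bchoice[OF this] obtain f where f: "\<forall>R\<in>F. f R \<in> formulas (lang_over L B) ?xs \<and>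
      (\<forall>g\<in>tpl \<Omega> n. holds (expand C) (f R) ?xs g \<longleftrightarrow> g \<in> R)" ..
  have cons: "consistent C ?xs (f ` F)"
    unfolding consistent_def tup
  proof (intro allI impI)
    fix F' assume "F' \<subseteq> f ` F" "finite F'"
    then obtain F0 where F0: "F0 \<subseteq> F" "finite F0" "F' = f ` F0" using finite_subset_image[of F' f F] by blast
    obtain g where "g \<in> tpl \<Omega> n" "\<forall>R\<in>F0. g \<in> R" using fs[OF F0(2,1)] by blast
    then show "\<exists>a\<in>tpl \<Omega> n. \<forall>\<theta>\<in>F'. holds (expand C) \<theta> ?xs a" using F0 f by (intro bexI[of _ g]) blast+
  qed
  have "B \<subseteq> \<Omega>" "|B| <o \<kappa>" using assms(1) unfolding sm_def by auto
  moreover have "saturated L \<kappa> C" using mm unfolding monster_model_def by simp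
  moreover have "f ` F \<subseteq> formulas (lang_over L B) ?xs" using f by blast
  ultimately obtain a where "a \<in> tuples C ?xs" "\<forall>\<theta>\<in>f ` F. holds (expand C) \<theta> ?xs a"
    using cons distinct_upt[of 0 n] unfolding saturated_def by metis
  then show ?thesis using f unfolding tup by (intro bexI[of _ a]) blast+
qed

lemma homogeneity:
  assumes "sm B" "g \<in> tpl \<Omega> n" "g' \<in> tpl \<Omega> n" "\<forall>R\<in>D B n. g \<in> R \<longrightarrow> g' \<in> R"
  shows "\<exists>h\<in>{h. automorphism L C h}. (\<forall>a\<in>B. h a = a) \<and> map h g = g'"
proof -
  have B\<Omega>: "B \<subseteq> \<Omega>" by (rule sm_sub[OF assms(1)])
  have lg: "length g = n" "length g' = n" using assms(2,3) unfolding tpl_def by auto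
  have iff: "g \<in> R \<longleftrightarrow> g' \<in> R" if "R \<in> D B n" for R
    using assms(2-4) that D_compl[OF that] by blast
  \<comment> \<open>The candidate fixes B and takes g to g'. The choice of a position in g does not
    matter, nor does an overlap of g with B, because coincidences among entries and with elements of
    B are definable over B.\<close>
  define h where "h a = (if a \<in> B then a else g' ! pos g a)" for a
  have g_eq: "g' ! i = g' ! j" if ij: "i < n" "j < n" "g ! i = g ! j" for i j
  proof -
    have "g \<in> {x \<in> tpl \<Omega> n. x ! i = x ! j}" using ij assms(2) by simp
    from iffD1[OF iff[OF D_eq[OF ij(1,2)]] this] show ?thesis by simp
  qed
  have g_B: "g' ! i = g ! i" if i: "i < n" "g ! i \<in> B" for i
  proof -
    have R: "{x \<in> tpl \<Omega> n. x @ [g ! i] \<in> {y \<in> tpl \<Omega> (n + 1). y ! i = y ! n}} \<in> D B n"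
      by (rule D_param, rule D_eq) (use i B\<Omega> in \<open>auto simp: tpl_def\<close>)
    have "g \<in> {x \<in> tpl \<Omega> n. x @ [g ! i] \<in> {y \<in> tpl \<Omega> (n + 1). y ! i = y ! n}}"
      using assms(2) i B\<Omega> lg by (auto simp: tpl_def nth_append)
    from iffD1[OF iff[OF R] this] show ?thesis using lg i by (simp add: nth_append)
  qed
  have hg: "map h g = g'"
  proof (rule nth_equalityI)
    fix i assume "i < length (map h g)"
    then have i: "i < n" using lg by simp
    have p: "pos g (g ! i) < n" "g ! pos g (g ! i) = g ! i" using pos[of "g ! i" g] i lg by auto
    show "map h g ! i = g' ! i"
      using g_B[OF i] g_eq[OF p(1) i p(2)] i lg unfolding h_def by simp
  qed (use lg in simp)
  have "partial_elementary L C (B \<union> set g) h"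
    unfolding partial_elementary_def
  proof (intro conjI allI ballI impI)
    show "B \<union> set g \<subseteq> \<Omega>" using B\<Omega> assms(2) unfolding tpl_def by blast
    have "h ` set g = set g'" using hg by (metis list.set_map)
    moreover have "h ` B = B" unfolding h_def by simp
    ultimately show "h ` (B \<union> set g) \<subseteq> \<Omega>" using B\<Omega> assms(3) unfolding image_Un tpl_def by simp
    fix xs \<phi> as assume xs: "distinct xs" "\<phi> \<in> formulas L xs" and as: "set as \<subseteq> B \<union> set g \<and> length as = length xs"
    define m where "m = filter (\<lambda>a. a \<in> B) as"
    have m: "m \<in> tpl (B \<inter> \<Omega>) (length m)" using B\<Omega> unfolding m_def tpl_def by auto
    have "set as \<subseteq> set (g @ m)" using as unfolding m_def by auto
    from ex_sub[OF this] obtain I where I: "set I \<subseteq> {..<length (g @ m)}" "length I = length as" "sub (g @ m) I = as" by blast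
    have "map h m = m" unfolding m_def by (rule map_idI) (simp add: h_def)
    then have has: "map h as = sub (g' @ m) I" using map_sub[OF I(1), of h] I(3) hg by simp
    have vI: "pos xs v < length I" if "v \<in> fv \<phi>" for v
      using that xs(2) pos[of v xs] I(2) as unfolding formulas_def by auto
    have holds: "holds C \<phi> xs (sub (z @ m) I) \<longleftrightarrow> sat C (\<lambda>v. (z @ m) ! (I ! pos xs v)) \<phi>" for z
      unfolding holds_env
    proof (rule sat_cong)
      fix v assume v: "v \<in> fv \<phi>"
      then have "v \<in> set xs" using xs(2) unfolding formulas_def by auto
      then have "env xs (sub (z @ m) I) v = sub (z @ m) I ! pos xs v" using env_pos[OF xs(1), of "sub (z @ m) I"] I(2) as by simp
      then show "env xs (sub (z @ m) I) v = (z @ m) ! (I ! pos xs v)" using vI[OF v] unfolding sub_def by simp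
    qed
    have "{z \<in> tpl \<Omega> n. sat C (\<lambda>v. (z @ m) ! (I ! pos xs v)) \<phi>} \<in> D B n"
    proof (rule D_I[OF m _ _ refl])
      show "wf_fm L \<phi>" using xs(2) unfolding formulas_def by simp
      show "I ! pos xs v < n + length m" if "v \<in> fv \<phi>" for v
        using subsetD[OF I(1) nth_mem[OF vI[OF that]]] lg by simp
    qed
    from iff[OF this] show "holds C \<phi> xs as = holds C \<phi> xs (map h as)"
      using holds[of g] holds[of g'] assms(2,3) unfolding has I(3) by simp
  qed
  moreover have "|B \<union> set g| <o \<kappa>"
    using sm_Un[OF assms(1), of "set g"] assms(2) unfolding sm_def tpl_def by simp
  moreover have "strongly_homogeneous L \<kappa> C" using mm unfolding monster_model_def by simp
  ultimately obtain f where f: "automorphism L C f" "\<forall>a\<in>B \<union> set g. f a = h a"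
    unfolding strongly_homogeneous_def by blast
  have "map f g = map h g" using f(2) by simp
  moreover have "f a = a" if "a \<in> B" for a using f(2) that unfolding h_def by simp
  ultimately show ?thesis using f(1) hg by blast
qed

lemma aut_into: "h \<in> {h. automorphism L C h} \<Longrightarrow> a \<in> \<Omega> \<Longrightarrow> h a \<in> \<Omega>"
  unfolding automorphism_def using bij_betwE by blast

lemma aut_inv:
  assumes "h \<in> {h. automorphism L C h}"
  shows "\<exists>k\<in>{h. automorphism L C h}. \<forall>a\<in>\<Omega>. k (h a) = a \<and> h (k a) = a"
proof -
  have h: "automorphism L C h" using assms by simp
  then have "bij_betw h \<Omega> \<Omega>" unfolding automorphism_def by simp
  then show ?thesis
    using automorphism_inv[OF h struct] bij_betw_inv_into_left bij_betw_inv_into_right by fastforce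
qed

lemma aut_D:
  assumes "h \<in> {h. automorphism L C h}" "\<forall>a\<in>B. h a = a" "R \<in> D B n" "g \<in> tpl \<Omega> n"
  shows "map h g \<in> R \<longleftrightarrow> g \<in> R"
proof -
  obtain k m \<psi> where R: "m \<in> tpl (B \<inter> \<Omega>) k" "wf_fm L \<psi>" "fv \<psi> \<subseteq> {..<n + k}"
    "R = {g \<in> tpl \<Omega> n. sat C (\<lambda>v. (g @ m) ! v) \<psi>}" using assms(3) by (rule D_E)
  have h: "automorphism L C h" using assms(1) by simp
  have hm: "map h m = m" using R(1) assms(2) unfolding tpl_def by (intro map_idI) auto
  have len: "length g = n" "length m = k" using assms(4) R(1) unfolding tpl_def by auto
  have "sat C (\<lambda>v. (map h g @ m) ! v) \<psi> = sat C (\<lambda>v. h ((g @ m) ! v)) \<psi>"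
  proof (rule sat_cong)
    fix v assume "v \<in> fv \<psi>"
    then have "v < length (g @ m)" using R(3) len by auto
    then have "map h (g @ m) ! v = h ((g @ m) ! v)" by (rule nth_map)
    then show "(map h g @ m) ! v = h ((g @ m) ! v)" using hm by simp
  qed
  also have "\<dots> = sat C (\<lambda>v. (g @ m) ! v) \<psi>"
  proof (rule sat_automorphism[OF h struct R(2)])
    fix v assume "v \<in> fv \<psi>"
    then have "v < length (g @ m)" using R(3) len by auto
    from nth_mem[OF this] show "(g @ m) ! v \<in> \<Omega>" using assms(4) R(1) unfolding tpl_def by auto
  qed
  moreover have "map h g \<in> tpl \<Omega> n" using assms(1,4) aut_into unfolding tpl_def by auto
  ultimately show ?thesis unfolding R(4) using assms(4) by simp
qed

lemma nip_D:
  assumes "R \<in> D \<Omega> (n + k)"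
  shows "\<exists>d. vc_free d (\<lambda>u a. u @ a \<in> R) (tpl \<Omega> n) (tpl \<Omega> k)"
proof -
  obtain l p \<psi> where R: "p \<in> tpl (\<Omega> \<inter> \<Omega>) l" "wf_fm L \<psi>" "fv \<psi> \<subseteq> {..<n + k + l}"
    "R = {g \<in> tpl \<Omega> (n + k). sat C (\<lambda>v. (g @ p) ! v) \<psi>}" using assms by (rule D_E)
  \<comment> \<open>NIP is assumed for formulas without parameters, so the parameters p of R become
    part of the second group of variables.\<close>
  let ?xs = "[0..<n]" and ?ys = "[n..<n + (k + l)]"
  have app: "?xs @ ?ys = [0..<n + (k + l)]" by (rule upt_add_eq_append[symmetric]) simp
  have "distinct (?xs @ ?ys)" "\<psi> \<in> formulas L (?xs @ ?ys)" unfolding app formulas_def using R(2,3) by auto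
  moreover have "models L C T" using mm unfolding monster_model_def by simp
  ultimately have "NIP_formula C ?xs ?ys \<psi>" using NIP unfolding NIP_theory_def by blast
  then obtain d where d: "\<forall>A\<subseteq>tuples C ?xs. finite A \<and> card A = d \<longrightarrow>
      \<not> shattered ((\<lambda>a. {c \<in> tuples C ?xs. holds C \<psi> (?xs @ ?ys) (c @ a)}) ` tuples C ?ys) A"
    unfolding NIP_formula_def by (elim exE)
  have tx: "tuples C ?xs = tpl \<Omega> n" using tuples_tpl[of ?xs] by simp
  have ty: "tuples C ?ys = tpl \<Omega> (k + l)" using tuples_tpl[of ?ys] by simp
  have holds: "holds C \<psi> (?xs @ ?ys) (u @ a @ p) \<longleftrightarrow> u @ a \<in> R" if "u \<in> tpl \<Omega> n" "a \<in> tpl \<Omega> k" for u a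
  proof -
    have "u @ a \<in> tpl \<Omega> (n + k)" by (rule tpl_append[OF that])
    moreover have "sat C (env [0..<n + (k + l)] (u @ a @ p)) \<psi> = sat C (\<lambda>v. ((u @ a) @ p) ! v) \<psi>"
    proof (rule sat_cong)
      fix v assume "v \<in> fv \<psi>"
      then have "v < n + (k + l)" using R(3) by auto
      moreover have "length (u @ a @ p) = n + (k + l)" using that R(1) unfolding tpl_def by simp
      ultimately show "env [0..<n + (k + l)] (u @ a @ p) v = ((u @ a) @ p) ! v" by (simp add: env_upt)
    qed
    ultimately show ?thesis unfolding holds_env app R(4) by simp
  qed
  have "vc_free d (\<lambda>u a. u @ a \<in> R) (tpl \<Omega> n) (tpl \<Omega> k)"
    unfolding vc_free_def
  proof
    assume "\<exists>u. (\<forall>j<d. u j \<in> tpl \<Omega> n) \<and> (\<forall>S. \<exists>a\<in>tpl \<Omega> k. \<forall>j<d. (u j @ a \<in> R) = (j \<in> S))"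
    then obtain u where u: "\<forall>j<d. u j \<in> tpl \<Omega> n" "\<forall>S. \<exists>a\<in>tpl \<Omega> k. \<forall>j<d. (u j @ a \<in> R) = (j \<in> S)"
      by (elim exE conjE)
    let ?A = "u ` {..<d}"
    \<comment> \<open>The NIP hypothesis speaks of a set of d points. The pattern {i} separates
      \<open>u i\<close> from the other points, so no point is repeated.\<close>
    have "inj_on u {..<d}"
    proof (rule inj_onI)
      fix i j assume ij: "i \<in> {..<d}" "j \<in> {..<d}" "u i = u j"
      from u(2)[THEN spec, of "{i}"] obtain a where a: "\<forall>l<d. (u l @ a \<in> R) = (l \<in> {i})" by (elim bexE)
      have d: "i < d" "j < d" using ij(1,2) by simp_all
      note a[THEN spec, THEN mp, OF d(1)] a[THEN spec, THEN mp, OF d(2)]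
      then have "j \<in> {i}" unfolding ij(3) by blast
      then show "i = j" by simp
    qed
    then have "card ?A = d" by (simp add: card_image)
    moreover have "?A \<subseteq> tuples C ?xs" unfolding tx using u(1) by auto
    moreover have "shattered ((\<lambda>a. {c \<in> tuples C ?xs. holds C \<psi> (?xs @ ?ys) (c @ a)}) ` tuples C ?ys) ?A"
      unfolding shattered_def
    proof (intro allI impI)
      fix S assume S: "S \<subseteq> ?A"
      from u(2)[THEN spec, of "{j. u j \<in> S}"]
      obtain a where a: "a \<in> tpl \<Omega> k" "\<forall>j<d. (u j @ a \<in> R) = (j \<in> {j. u j \<in> S})" by (elim bexE)
      have "a @ p \<in> tuples C ?ys" unfolding ty using tpl_append[OF a(1)] R(1) by simp
      moreover have "S = {c \<in> tuples C ?xs. holds C \<psi> (?xs @ ?ys) (c @ (a @ p))} \<inter> ?A"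
      proof (rule set_eqI)
        fix c
        show "c \<in> S \<longleftrightarrow> c \<in> {c \<in> tuples C ?xs. holds C \<psi> (?xs @ ?ys) (c @ (a @ p))} \<inter> ?A"
        proof (cases "c \<in> ?A")
          case True
          then obtain j where j: "j < d" "c = u j" by blast
          have ut: "u j \<in> tpl \<Omega> n" using u(1) j(1) by simp
          have "u j @ a \<in> R \<longleftrightarrow> u j \<in> S" using a(2) j(1) by simp
          then show ?thesis using True ut holds[OF ut a(1)] unfolding tx j(2) by simp
        next
          case False
          then show ?thesis using S by blast
        qed
      qed
      ultimately show "\<exists>F\<in>(\<lambda>a. {c \<in> tuples C ?xs. holds C \<psi> (?xs @ ?ys) (c @ a)}) ` tuples C ?ys. S = F \<inter> ?A"
        by blast
    qed
    ultimately show False using d by blast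
  qed
  then show ?thesis ..
qed

sublocale ms: monster_structure \<Omega> D "{h. automorphism L C h}" sm
  by (rule monster_structure.intro)
    (fact D_sub D_full D_compl D_Int D_reindex D_eq D_proj D_mono D_param D_paramE sm_sub sm_Un sm_closed
      saturation homogeneity aut_into aut_inv aut_D nip_D)+

text \<open>Elementarity is applied to one existential quantifier at a time: the last entry of a
  point of R is found in M first and then serves as a parameter for the remaining entries.\<close>

lemma closed_elementary:
  assumes "elementary_substructure L M C"
  shows "ms.closed (carrier M)"
  unfolding ms.closed_def
proof (intro allI ballI impI)
  let ?M = "carrier M"
  have M\<Omega>: "?M \<subseteq> \<Omega>" and el: "\<And>xs \<phi> as. distinct xs \<Longrightarrow> \<phi> \<in> formulas L xs \<Longrightarrow> as \<in> tuples M xs \<Longrightarrow>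
      holds M \<phi> xs as \<longleftrightarrow> holds C \<phi> xs as"
    using assms unfolding elementary_substructure_def by blast+
  have single: "\<exists>a\<in>?M. [a] \<in> R" if R1: "R \<in> D ?M 1" "c \<in> R" for R c
  proof -
    obtain k m \<psi> where R: "m \<in> tpl (?M \<inter> \<Omega>) k" "wf_fm L \<psi>" "fv \<psi> \<subseteq> {..<1 + k}"
      "R = {g \<in> tpl \<Omega> 1. sat C (\<lambda>v. (g @ m) ! v) \<psi>}" using R1(1) by (rule D_E)
    have lm: "length m = k" "set m \<subseteq> ?M" using R(1) unfolding tpl_def by auto
    let ?xs = "[1..<1 + k]" and ?zs = "[0..<1 + k]"
    have env: "sat N ((env ?xs m)(0 := a)) \<psi> = sat N (\<lambda>v. (a # m) ! v) \<psi>" for N :: "('a, 'f, 'r) struct" and a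
    proof (rule sat_cong)
      fix v assume "v \<in> fv \<psi>"
      then have v: "v < 1 + k" using R(3) by blast
      show "((env ?xs m)(0 := a)) v = (a # m) ! v"
      proof (cases v)
        case (Suc w)
        then have "env ?xs m (?xs ! w) = m ! w" using lm v by (intro env_nth) auto
        moreover have "?xs ! w = Suc w" using Suc v by (subst nth_upt) auto
        ultimately show ?thesis using Suc by (simp del: upt_Suc)
      qed simp
    qed
    have env': "holds N \<psi> ?zs (a # m) = sat N (\<lambda>v. (a # m) ! v) \<psi>" for N :: "('a, 'f, 'r) struct" and a
      unfolding holds_env
    proof (rule sat_cong)
      fix v assume "v \<in> fv \<psi>"
      then have "v < 1 + k" using R(3) by blast
      then show "env ?zs (a # m) v = (a # m) ! v" using lm by (intro env_upt) auto
    qed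
    obtain a where a: "c = [a]" "a \<in> \<Omega>" using R1(2) unfolding R(4) tpl_def by (auto simp: length_Suc_conv)
    then have "sat C (\<lambda>v. (a # m) ! v) \<psi>" using R1(2) unfolding R(4) by simp
    then have "holds C (Ex 0 \<psi>) ?xs m" using a(2) unfolding holds_env sat.simps env by blast
    moreover have "Ex 0 \<psi> \<in> formulas L ?xs" unfolding formulas_def using R(2,3) by fastforce
    moreover have "m \<in> tuples M ?xs" unfolding tuples_def using lm by simp
    ultimately have "holds M (Ex 0 \<psi>) ?xs m" using el[of ?xs] by simp
    then obtain a' where a': "a' \<in> ?M" "sat M (\<lambda>v. (a' # m) ! v) \<psi>" unfolding holds_env sat.simps env by blast
    have "\<psi> \<in> formulas L ?zs" unfolding formulas_def using R(2,3) by auto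
    moreover have "a' # m \<in> tuples M ?zs" unfolding tuples_def using lm a'(1) by simp
    ultimately have "holds M \<psi> ?zs (a' # m) \<longleftrightarrow> holds C \<psi> ?zs (a' # m)" by (rule el[OF distinct_upt])
    then have "sat C (\<lambda>v. (a' # m) ! v) \<psi>" using a'(2) unfolding env' by blast
    then have "[a'] \<in> R" unfolding R(4) tpl_def using a'(1) M\<Omega> by auto
    then show ?thesis using a'(1) by blast
  qed
  show "R \<inter> tpl ?M n \<noteq> {}" if "R \<in> D ?M n" "R \<noteq> {}" for R n
    using that
  proof (induction n arbitrary: R)
    case 0
    then obtain c where "c \<in> R" "c \<in> tpl \<Omega> 0" using D_sub by blast
    then have "c \<in> R \<inter> tpl ?M 0" unfolding tpl_def by auto
    then show ?case by blast
  next
    case (Suc n)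
    then have R: "R \<in> D ?M (n + 1)" by simp
    obtain c where c: "c \<in> R" "c \<in> tpl \<Omega> (n + 1)" using Suc.prems D_sub[OF R] by blast
    have "take n c \<in> tpl \<Omega> n" "drop n c \<in> tpl \<Omega> 1" "take n c @ drop n c \<in> R"
      using c unfolding tpl_def by (auto dest: in_set_takeD in_set_dropD)
    then have "drop n c \<in> {z \<in> tpl \<Omega> 1. \<exists>h\<in>tpl \<Omega> n. h @ z \<in> R}" by blast
    from single[OF ms.D_proj_front[OF R] this] obtain a h where a: "a \<in> ?M" "h \<in> tpl \<Omega> n" "h @ [a] \<in> R" by blast
    have "[a] \<in> tpl ?M 1" "[a] \<in> tpl \<Omega> 1" using a(1) M\<Omega> unfolding tpl_def by auto
    from Suc.IH[OF D_param[OF R this]] a(2,3)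
    obtain h' where h': "h' @ [a] \<in> R" "h' \<in> tpl ?M n" by blast
    then have "h' @ [a] \<in> R \<inter> tpl ?M (Suc n)" using tpl_append[OF h'(2) \<open>[a] \<in> tpl ?M 1\<close>] by simp
    then show ?case by blast
  qed
qed

lemma tp_eq:
  assumes "ms.teq B (length ys) c c'" "distinct ys" "B \<subseteq> \<Omega>"
  shows "tp L C B ys c = tp L C B ys c'"
proof -
  have "holds (expand C) \<psi> ys c \<longleftrightarrow> holds (expand C) \<psi> ys c'" if "\<psi> \<in> formulas (lang_over L B) ys" for \<psi>
  proof -
    have c: "c \<in> tpl \<Omega> (length ys)" "c' \<in> tpl \<Omega> (length ys)"
      and eq: "\<forall>R\<in>D B (length ys). c \<in> R \<longleftrightarrow> c' \<in> R" using assms(1) unfolding ms.teq_def by simp_all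
    from bspec[OF eq formula_D[OF that assms(2,3)]] show ?thesis using c by simp
  qed
  then show ?thesis unfolding tp_def by (intro Collect_cong conj_cong refl)
qed

lemma nonforking_consistent:
  assumes M: "elementary_substructure L M C" "small \<kappa> (carrier M)"
    and dist: "distinct (xs @ ys)" and \<phi>: "\<phi> \<in> formulas (lang_over L (carrier M)) (xs @ ys)"
    and b: "b \<in> tuples C ys" and nf: "\<not> forks L C (carrier M) xs (inst ys b \<phi>)"
  shows "\<exists>\<psi> \<in> tp L C (carrier M) ys b.
           consistent C xs {inst ys c \<phi> | c. c \<in> tuples C ys \<and> holds (expand C) \<psi> ys c}"
proof -
  let ?M = "carrier M" and ?nx = "length xs" and ?ny = "length ys"
  define \<Phi> where "\<Phi> = {g \<in> tpl \<Omega> (?nx + ?ny). holds (expand C) \<phi> (xs @ ys) g}"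
  have M\<Omega>: "?M \<subseteq> \<Omega>" using M(1) unfolding elementary_substructure_def by simp
  have sm_M: "sm ?M" using M(2) M\<Omega> unfolding sm_def small_def by simp
  have \<Phi>: "\<Phi> \<in> D ?M (?nx + ?ny)" using formula_D[OF \<phi> dist M\<Omega>] unfolding \<Phi>_def by simp
  have bt: "b \<in> tpl \<Omega> ?ny" using b unfolding tuples_tpl .
  interpret pq: pq_setup \<Omega> D "{h. automorphism L C h}" sm ?M ?nx ?ny \<Phi> b
    by unfold_locales (fact sm_M closed_elementary[OF M(1)] \<Phi> bt)+
  have inst: "holds (expand C) (inst ys c \<phi>) xs a \<longleftrightarrow> a @ c \<in> \<Phi>" if "a \<in> tpl \<Omega> ?nx" "c \<in> tpl \<Omega> ?ny" for a c
    using holds_inst[OF dist, of \<phi> a c] \<phi> that tpl_append[OF that] unfolding \<Phi>_def formulas_def tpl_def by simp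
  have "\<exists>a\<in>tpl \<Omega> ?nx. \<forall>e\<in>E. a @ e \<in> \<Phi>" if E: "finite E" "E \<subseteq> {c. ms.teq ?M ?ny b c}" for E
  proof (rule ccontr)
    assume "\<not> ?thesis"
    then have "\<forall>a\<in>tpl \<Omega> ?nx. \<exists>c\<in>E. a @ c \<notin> \<Phi>" by blast
    from pq.conjugates_consistent_or_dividing[OF E this]
    obtain d where d: "d \<in> tpl \<Omega> ?ny"
      "\<forall>a\<in>tpl \<Omega> ?nx. a @ b \<in> \<Phi> \<longrightarrow> (\<exists>c\<in>insert b E. (a @ c \<in> \<Phi>) \<noteq> (a @ d \<in> \<Phi>))"
      "\<forall>c\<in>insert b E. \<exists>p q K. (\<forall>i::nat. p i \<in> tpl \<Omega> ?ny \<and> q i \<in> tpl \<Omega> ?ny \<and> ms.teq ?M (?ny + ?ny) (d @ c) (q i @ p i)) \<and>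
       (\<forall>I a. finite I \<and> card I = K \<and> a \<in> tpl \<Omega> ?nx \<longrightarrow> (\<exists>i\<in>I. (a @ p i \<in> \<Phi>) = (a @ q i \<in> \<Phi>)))"
      by (elim bexE conjE)
    \<comment> \<open>The dividing formulas have the pair of d and c as their parameter, so a tuple
      of twice the length of ys, disjoint from xs, is needed.\<close>
    define z where "z = Suc (Max (insert 0 (set xs)))"
    have z: "v < z" if "v \<in> set xs" for v
      unfolding z_def less_Suc_eq_le by (rule Max_ge) (use that in auto)
    define zs where "zs = [z..<z + (?ny + ?ny)]"
    have zs: "distinct (xs @ zs)" "length zs = ?ny + ?ny" using dist z unfolding zs_def by fastforce+
    \<comment> \<open>The condition says that \<phi> takes different values at the two halves of the
      parameter tuple; the equivalence inside is split into implications to match the rules for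
      \<open>dfp\<close>.\<close>
    let ?P = "\<lambda>g. \<not> ((take ?nx g @ drop ?ny (drop ?nx g) \<in> \<Phi> \<longrightarrow> take ?nx g @ take ?ny (drop ?nx g) \<in> \<Phi>) \<and>
        (take ?nx g @ take ?ny (drop ?nx g) \<in> \<Phi> \<longrightarrow> take ?nx g @ drop ?ny (drop ?nx g) \<in> \<Phi>))"
    have "ms.dfp ?M (?nx + (?ny + ?ny)) ?P"
      by (intro ms.dfp_not ms.dfp_conj ms.dfp_imp ms.dfp_mem[OF \<Phi>] tm_append tm_take[OF tm_id]
          tm_take[OF tm_drop[OF tm_id]] tm_drop[OF tm_drop[OF tm_id]])
    then have "{g \<in> tpl \<Omega> (?nx + (?ny + ?ny)). ?P g} \<in> D ?M (length (xs @ zs))"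
      unfolding ms.dfp_def using zs(2) by simp
    from D_formula[OF this zs(1)] obtain \<chi> where \<chi>: "\<chi> \<in> formulas (lang_over L ?M) (xs @ zs)"
      "\<forall>g\<in>tpl \<Omega> (length (xs @ zs)). holds (expand C) \<chi> (xs @ zs) g \<longleftrightarrow> g \<in> {g \<in> tpl \<Omega> (?nx + (?ny + ?ny)). ?P g}"
      by (elim bexE)
    have hold_\<chi>: "holds (expand C) (inst zs (d' @ c) \<chi>) xs a \<longleftrightarrow> (a @ c \<in> \<Phi>) \<noteq> (a @ d' \<in> \<Phi>)"
      if t: "a \<in> tpl \<Omega> ?nx" "d' \<in> tpl \<Omega> ?ny" "c \<in> tpl \<Omega> ?ny" for a d' c
    proof -
      have l: "length a = ?nx" "length d' = ?ny" "length c = ?ny" using t unfolding tpl_def by auto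
      have "a @ (d' @ c) \<in> tpl \<Omega> (?nx + (?ny + ?ny))" by (intro tpl_append t)
      moreover have "fv \<chi> \<subseteq> set (xs @ zs)" using \<chi>(1) unfolding formulas_def by simp
      ultimately have "holds (expand C) (inst zs (d' @ c) \<chi>) xs a \<longleftrightarrow> ?P (a @ (d' @ c))"
        using holds_inst[OF zs(1), of \<chi> a "d' @ c"] \<chi>(2) l zs(2) by simp
      then show ?thesis using l by auto
    qed
    let ?\<Theta> = "(\<lambda>c. inst zs (d @ c) \<chi>) ` insert b E"
    have Et: "c \<in> tpl \<Omega> ?ny" if "c \<in> insert b E" for c using that E(2) bt unfolding ms.teq_def by blast
    have "divides L C ?M xs (inst zs (d @ c) \<chi>)" if c: "c \<in> insert b E" for c
    proof -
      obtain p q K where pq: "\<forall>i::nat. p i \<in> tpl \<Omega> ?ny \<and> q i \<in> tpl \<Omega> ?ny \<and> ms.teq ?M (?ny + ?ny) (d @ c) (q i @ p i)"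
        "\<forall>I a. finite I \<and> card I = K \<and> a \<in> tpl \<Omega> ?nx \<longrightarrow> (\<exists>i\<in>I. (a @ p i \<in> \<Phi>) = (a @ q i \<in> \<Phi>))"
        using bspec[OF d(3) c] by (elim exE conjE)
      have tz: "tuples C zs = tpl \<Omega> (?ny + ?ny)" unfolding tuples_tpl zs(2) ..
      have dz: "distinct zs" using zs(1) by simp
      have "q i @ p i \<in> tuples C zs" "tp L C ?M zs (q i @ p i) = tp L C ?M zs (d @ c)" for i
      proof -
        have i: "p i \<in> tpl \<Omega> ?ny" "q i \<in> tpl \<Omega> ?ny" "ms.teq ?M (?ny + ?ny) (d @ c) (q i @ p i)"
          using pq(1) by blast+
        show "q i @ p i \<in> tuples C zs" unfolding tz by (rule tpl_append[OF i(2,1)])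
        show "tp L C ?M zs (q i @ p i) = tp L C ?M zs (d @ c)"
          by (rule tp_eq[OF _ dz M\<Omega>, symmetric]) (use i(3) zs(2) in simp)
      qed
      moreover have "k_inconsistent C xs K (\<lambda>i. inst zs (q i @ p i) \<chi>)"
        unfolding k_inconsistent_def
      proof (intro allI impI notI)
        fix I :: "nat set"
        assume I: "finite I \<and> card I = K" and cons: "consistent C xs ((\<lambda>i. inst zs (q i @ p i) \<chi>) ` I)"
        then obtain a where a: "a \<in> tpl \<Omega> ?nx" "\<forall>i\<in>I. holds (expand C) (inst zs (q i @ p i) \<chi>) xs a"
          unfolding consistent_def tuples_tpl by auto
        obtain i where i: "i \<in> I" "(a @ p i \<in> \<Phi>) = (a @ q i \<in> \<Phi>)" using pq(2) I a(1) by blast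
        have pt: "q i \<in> tpl \<Omega> ?ny" "p i \<in> tpl \<Omega> ?ny" using pq(1) by auto
        from hold_\<chi>[OF a(1) pt] show False using a(2) i by blast
      qed
      moreover have "d @ c \<in> tuples C zs" unfolding tz by (rule tpl_append[OF d(1) Et[OF c]])
      ultimately show ?thesis
        unfolding divides_def using zs(1) \<chi>(1)
        by (intro exI[of _ zs] exI[of _ \<chi>] exI[of _ "d @ c"] exI[of _ K] exI[of _ "\<lambda>i. q i @ p i"] conjI allI refl) blast+
    qed
    moreover have "\<exists>\<theta>\<in>?\<Theta>. holds (expand C) \<theta> xs a"
      if a: "a \<in> tuples C xs" "holds (expand C) (inst ys b \<phi>) xs a" for a
    proof -
      have at: "a \<in> tpl \<Omega> ?nx" using a(1) unfolding tuples_tpl .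
      then obtain c where c: "c \<in> insert b E" "(a @ c \<in> \<Phi>) \<noteq> (a @ d \<in> \<Phi>)"
        using d(2) a(2) inst[OF at bt] by blast
      then show ?thesis using hold_\<chi>[OF at d(1) Et[OF c(1)]] by blast
    qed
    moreover have "finite ?\<Theta>" using E(1) by simp
    ultimately have "forks L C ?M xs (inst ys b \<phi>)"
      unfolding forks_def by (intro exI[of _ ?\<Theta>] conjI ballI impI) auto
    then show False using nf by contradiction
  qed
  from pq.good_if_conjugates_consistent[OF this]
  obtain \<beta> where \<beta>: "\<beta> \<in> D ?M ?ny" "b \<in> \<beta>" "pq.good \<beta>" by blast
  have dy: "distinct ys" using dist by simp
  from D_formula[OF \<beta>(1) dy] obtain \<psi> where \<psi>: "\<psi> \<in> formulas (lang_over L ?M) ys"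
    "\<forall>g\<in>tpl \<Omega> ?ny. holds (expand C) \<psi> ys g \<longleftrightarrow> g \<in> \<beta>" by (elim bexE)
  have "\<psi> \<in> tp L C ?M ys b" unfolding tp_def using \<psi> \<beta>(2) bt by blast
  moreover have "consistent C xs {inst ys c \<phi> | c. c \<in> tuples C ys \<and> holds (expand C) \<psi> ys c}"
    unfolding consistent_def
  proof (intro allI impI)
    fix F assume F: "F \<subseteq> {inst ys c \<phi> | c. c \<in> tuples C ys \<and> holds (expand C) \<psi> ys c}" "finite F"
    have "F \<subseteq> (\<lambda>c. inst ys c \<phi>) ` \<beta>" using F(1) \<psi>(2) unfolding tuples_tpl by auto
    then obtain E where E: "E \<subseteq> \<beta>" "finite E" "F = (\<lambda>c. inst ys c \<phi>) ` E"
      using finite_subset_image[OF F(2)] by metis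
    obtain a where a: "a \<in> tpl \<Omega> ?nx" "\<forall>c\<in>E. a @ c \<in> \<Phi>" using \<beta>(3) E(1,2) unfolding pq.good_def by blast
    have "holds (expand C) \<theta> xs a" if \<theta>: "\<theta> \<in> F" for \<theta>
    proof -
      obtain c where c: "c \<in> E" "\<theta> = inst ys c \<phi>" using \<theta> E(3) by blast
      then have "c \<in> tpl \<Omega> ?ny" using E(1) D_sub[OF \<beta>(1)] by blast
      then show ?thesis using inst[OF a(1)] a(2) c by blast
    qed
    then show "\<exists>a\<in>tuples C xs. \<forall>\<theta>\<in>F. holds (expand C) \<theta> xs a" using a(1) unfolding tuples_tpl by blast
  qed
  ultimately show ?thesis by blast
qed

end

theorem theorem1p6:
  fixes L :: "('f, 'r) lang"
    and T :: "('f, 'r) fm set"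
    and C M :: "('a, 'f, 'r) struct"
    and \<kappa> :: "'k rel"
    and \<phi> :: "('f + 'a, 'r) fm"
    and xs ys :: "nat list"
    and b :: "'a list"
  assumes "complete_theory L T"
    and "NIP_theory TYPE('a) L T"
    and "monster_model L T \<kappa> C"
    and "models L M T"
    and "elementary_substructure L M C"
    and "small \<kappa> (carrier M)"
    and "distinct (xs @ ys)"
    and "\<phi> \<in> formulas (lang_over L (carrier M)) (xs @ ys)"
    and "b \<in> tuples C ys"
    and "\<not> forks L C (carrier M) xs (inst ys b \<phi>)"
  shows "\<exists>\<psi> \<in> tp L C (carrier M) ys b.
           consistent C xs {inst ys c \<phi> | c. c \<in> tuples C ys \<and> holds (expand C) \<psi> ys c}"
proof -
  have struct: "is_struct L C" using assms(3) unfolding monster_model_def models_def by simp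
  interpret monster L C T \<kappa> by unfold_locales (fact struct assms(2,3))+
  show ?thesis by (rule nonforking_consistent[OF assms(5-10)])
qed

end
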